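(* Let $\Gamma$ and $\Pi$ be finite connected graphs, each with at least two vertices, and let $n \geq 5$. Then the graph braid group $B_n(\Gamma)$ is not isomorphic to the right-angled Artin group $A_\Pi$.
   Context: For a finite graph $\Gamma$ (regarded as a 1-dimensional CW complex) and a positive integer $n$, let $C_n^{\mathrm{top}}(\Gamma)=\{(x_1,\dots,x_n)\in\Gamma^n : x_i\neq x_j \text{ for } i\neq j\}$ and $UC_n^{\mathrm{top}}(\Gamma)=C_n^{\mathrm{top}}(\Gamma)/S_n$, where the symmetric group $S_n$ permutes coordinates. The graph braid group is $B_n(\Gamma,S)=\pi_1(UC_n^{\mathrm{top}}(\Gamma),S)$; when $\Gamma$ is connected it does not depend on the base point $S$ up to isomorphism and is written $B_n(\Gamma)$. The right-angled Artin group $A_\Pi$ with (simplicial) defining graph $\Pi$ is the group with generators the vertices of $\Pi$ and relations $vw=wv$ whenever $v$ and $w$ are adjacent in $\Pi$. *)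

theory Defs
  imports
    "HOL-Analysis.Analysis"
    "HOL-Algebra.Group"
    "HOL-Combinatorics.Permutations"
    "Graph_Theory.Digraph_Component"
begin

section \<open>Finite graphs as 1-dimensional CW complexes\<close>

text \<open>
  A graph, possibly with loops and multiple edges, is given by a \<^typ>\<open>('a, 'b) pre_digraph\<close>.
  The direction of an arc only serves to parametrise the corresponding closed edge by
  the unit interval; each arc is one undirected edge (1-cell). The points of the complex are
  \<open>Inl v\<close> for a vertex \<open>v\<close> and \<open>Inr (e, t)\<close> with \<open>0 < t < 1\<close> for the interior of an edge \<open>e\<close>.
\<close>

definition char_map :: "('a, 'b) pre_digraph \<Rightarrow> 'b \<Rightarrow> real \<Rightarrow> 'a + 'b \<times> real" where
  "char_map G e t =
     (if t \<le> 0 then Inl (tail G e) else if t \<ge> 1 then Inl (head G e) else Inr (e, t))"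

definition realization_points :: "('a, 'b) pre_digraph \<Rightarrow> ('a + 'b \<times> real) set" where
  "realization_points G = Inl ` verts G \<union> Inr ` (arcs G \<times> {0<..<1})"

text \<open>The weak topology: a set is open iff its preimages under all characteristic maps are open.\<close>

definition realization :: "('a, 'b) pre_digraph \<Rightarrow> ('a + 'b \<times> real) topology" where
  "realization G = topology (\<lambda>U. U \<subseteq> realization_points G \<and>
     (\<forall>e\<in>arcs G. openin (top_of_set {0..1}) {t \<in> {0..1}. char_map G e t \<in> U}))"

lemma openin_realization:
  "openin (realization G) U \<longleftrightarrow> U \<subseteq> realization_points G \<and>
     (\<forall>e\<in>arcs G. openin (top_of_set {0..1}) {t \<in> {0..1}. char_map G e t \<in> U})"
proof -
  have int: "{t \<in> {0..1}. char_map G e t \<in> S \<inter> T} =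
      {t \<in> {0..1}. char_map G e t \<in> S} \<inter> {t \<in> {0..1}. char_map G e t \<in> T}" for e S T
    by auto
  have un: "{t \<in> {0..1}. char_map G e t \<in> \<Union>\<K>} =
      (\<Union>K\<in>\<K>. {t \<in> {0..1}. char_map G e t \<in> K})" for e \<K>
    by auto
  have "istopology (\<lambda>U. U \<subseteq> realization_points G \<and>
     (\<forall>e\<in>arcs G. openin (top_of_set {0..1}) {t \<in> {0..1}. char_map G e t \<in> U}))"
    unfolding istopology_def int un
    by (intro conjI allI impI ballI openin_Int openin_Union) blast+
  then show ?thesis
    unfolding realization_def by (simp add: topology_inverse')
qed

lemma topspace_realization:
  assumes "wf_digraph G"
  shows "topspace (realization G) = realization_points G"
proof (rule antisym)
  show "topspace (realization G) \<subseteq> realization_points G"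
    using openin_realization openin_topspace by blast
  have "{t \<in> {0..1}. char_map G e t \<in> realization_points G} = {0..1}" if "e \<in> arcs G" for e
    using that assms
    by (auto simp: char_map_def realization_points_def wf_digraph.tail_in_verts
        wf_digraph.head_in_verts)
  then have "openin (realization G) (realization_points G)"
    by (simp add: openin_realization)
  then show "realization_points G \<subseteq> topspace (realization G)"
    by (rule openin_subset)
qed


section \<open>Configuration spaces\<close>

definition quotient_topology :: "'a topology \<Rightarrow> ('a \<Rightarrow> 'b) \<Rightarrow> 'b topology" where
  "quotient_topology X f =
     topology (\<lambda>U. U \<subseteq> f ` topspace X \<and> openin X {x \<in> topspace X. f x \<in> U})"

lemma openin_quotient_topology:
  "openin (quotient_topology X f) U \<longleftrightarrow>
     U \<subseteq> f ` topspace X \<and> openin X {x \<in> topspace X. f x \<in> U}"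
proof -
  have int: "{x \<in> topspace X. f x \<in> S \<inter> T} =
      {x \<in> topspace X. f x \<in> S} \<inter> {x \<in> topspace X. f x \<in> T}" for S T
    by auto
  have un: "{x \<in> topspace X. f x \<in> \<Union>\<K>} = (\<Union>K\<in>\<K>. {x \<in> topspace X. f x \<in> K})" for \<K>
    by auto
  have "istopology (\<lambda>U. U \<subseteq> f ` topspace X \<and> openin X {x \<in> topspace X. f x \<in> U})"
    unfolding istopology_def int un
    by (intro conjI allI impI openin_Int openin_Union) blast+
  then show ?thesis
    unfolding quotient_topology_def by (simp add: topology_inverse')
qed

lemma topspace_quotient_topology [simp]: "topspace (quotient_topology X f) = f ` topspace X"
proof (rule antisym)
  show "topspace (quotient_topology X f) \<subseteq> f ` topspace X"
    using openin_topspace[of "quotient_topology X f"] unfolding openin_quotient_topology by (rule conjunct1)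
  have "{x \<in> topspace X. f x \<in> f ` topspace X} = topspace X"
    by auto
  then have "openin (quotient_topology X f) (f ` topspace X)"
    by (simp add: openin_quotient_topology)
  then show "f ` topspace X \<subseteq> topspace (quotient_topology X f)"
    by (rule openin_subset)
qed

lemma quotient_map_quotient_topology: "quotient_map X (quotient_topology X f) f"
  by (simp add: quotient_map_def openin_quotient_topology)

definition conf_space :: "nat \<Rightarrow> 'a topology \<Rightarrow> (nat \<Rightarrow> 'a) topology" where
  "conf_space n X = subtopology (product_topology (\<lambda>_. X) {1..n}) {x. inj_on x {1..n}}"

definition perm_orbit :: "nat \<Rightarrow> (nat \<Rightarrow> 'a) \<Rightarrow> (nat \<Rightarrow> 'a) set" where
  "perm_orbit n x = {x \<circ> \<sigma> | \<sigma>. \<sigma> permutes {1..n}}"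

definition uconf_space :: "nat \<Rightarrow> 'a topology \<Rightarrow> (nat \<Rightarrow> 'a) set topology" where
  "uconf_space n X = quotient_topology (conf_space n X) (perm_orbit n)"


section \<open>The fundamental group of a topological space\<close>

text \<open>
  Paths are functions on all of \<^typ>\<open>real\<close>, of which only the values on the unit interval matter:
  two loops that agree there are homotopic in the sense below. The library's join of paths
  is restricted to types of class \<^class>\<open>topological_space\<close>.
\<close>

definition loops :: "'a topology \<Rightarrow> 'a \<Rightarrow> (real \<Rightarrow> 'a) set" where
  "loops X s = {g. pathin X g \<and> g 0 = s \<and> g 1 = s}"

definition loop_homotopy :: "'a topology \<Rightarrow> 'a \<Rightarrow> ((real \<Rightarrow> 'a) \<times> (real \<Rightarrow> 'a)) set" where
  "loop_homotopy X s = {(g, h). g \<in> loops X s \<and> h \<in> loops X s \<and>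
     homotopic_with (\<lambda>k. k 0 = s \<and> k 1 = s) (top_of_set {0..1}) X g h}"

definition loop_concat :: "(real \<Rightarrow> 'a) \<Rightarrow> (real \<Rightarrow> 'a) \<Rightarrow> real \<Rightarrow> 'a" where
  "loop_concat g h t = (if t \<le> 1/2 then g (2 * t) else h (2 * t - 1))"

definition fundamental_group :: "'a topology \<Rightarrow> 'a \<Rightarrow> (real \<Rightarrow> 'a) set monoid" where
  "fundamental_group X s =
     \<lparr>carrier = loops X s // loop_homotopy X s,
      mult = (\<lambda>A B. \<Union>g\<in>A. \<Union>h\<in>B. loop_homotopy X s `` {loop_concat g h}),
      one = loop_homotopy X s `` {\<lambda>_. s}\<rparr>"

lemma equiv_loop_homotopy: "equiv (loops X s) (loop_homotopy X s)"
proof (rule equivI)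
  show "loop_homotopy X s \<subseteq> loops X s \<times> loops X s"
    by (auto simp: loop_homotopy_def)
  show "refl_on (loops X s) (loop_homotopy X s)"
    by (auto simp: refl_on_def loop_homotopy_def loops_def pathin_def)
  show "sym (loop_homotopy X s)"
    by (auto simp: sym_def loop_homotopy_def homotopic_with_sym)
  show "trans (loop_homotopy X s)"
    unfolding trans_def loop_homotopy_def by (blast intro: homotopic_with_trans)
qed

lemma loop_concat_loops:
  assumes "g \<in> loops X s" "h \<in> loops X s"
  shows "loop_concat g h \<in> loops X s"
proof -
  let ?I = "top_of_set {0..1::real}"
  have gh: "continuous_map ?I X g" "continuous_map ?I X h" "g 1 = s" "h 0 = s"
    using assms by (auto simp: loops_def pathin_def)
  have sub: "subtopology ?I {x \<in> topspace ?I. x \<le> 1/2} = top_of_set {0..1/2}"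
    "subtopology ?I {x \<in> topspace ?I. 1/2 \<le> x} = top_of_set {1/2..1}"
    by (auto simp: subtopology_subtopology intro!: arg_cong[where f = top_of_set])
  have "continuous_map ?I X (\<lambda>x. if x \<le> 1/2 then (g \<circ> (\<lambda>t. 2 * t)) x else (h \<circ> (\<lambda>t. 2 * t - 1)) x)"
  proof (rule continuous_map_cases_le)
    show "continuous_map ?I euclideanreal (\<lambda>x. x)" "continuous_map ?I euclideanreal (\<lambda>x. 1/2)"
      by auto
    show "continuous_map (subtopology ?I {x \<in> topspace ?I. x \<le> 1/2}) X (g \<circ> (\<lambda>t. 2 * t))"
      unfolding sub by (rule continuous_map_compose[OF _ gh(1)]) (auto intro!: continuous_intros)
    show "continuous_map (subtopology ?I {x \<in> topspace ?I. 1/2 \<le> x}) X (h \<circ> (\<lambda>t. 2 * t - 1))"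
      unfolding sub by (rule continuous_map_compose[OF _ gh(2)]) (auto intro!: continuous_intros)
    show "(g \<circ> (\<lambda>t. 2 * t)) x = (h \<circ> (\<lambda>t. 2 * t - 1)) x" if "x = 1/2" for x
      using gh by (simp add: that)
  qed
  then have "pathin X (loop_concat g h)"
    by (simp add: pathin_def loop_concat_def[abs_def] o_def cong: if_cong)
  then show ?thesis
    using assms by (auto simp: loops_def loop_concat_def)
qed

lemma loop_homotopy_concat:
  assumes "(g, g') \<in> loop_homotopy X s" "(h, h') \<in> loop_homotopy X s"
  shows "(loop_concat g h, loop_concat g' h') \<in> loop_homotopy X s"
proof -
  let ?I = "top_of_set {0..1::real}"
  let ?J = "prod_topology ?I ?I"
  obtain H where H: "continuous_map ?J X H" "\<And>x. H (0, x) = g x" "\<And>x. H (1, x) = g' x"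
    "\<And>t. t \<in> {0..1} \<Longrightarrow> H (t, 0) = s \<and> H (t, 1) = s"
    using assms(1) unfolding loop_homotopy_def homotopic_with_def by auto
  obtain K where K: "continuous_map ?J X K" "\<And>x. K (0, x) = h x" "\<And>x. K (1, x) = h' x"
    "\<And>t. t \<in> {0..1} \<Longrightarrow> K (t, 0) = s \<and> K (t, 1) = s"
    using assms(2) unfolding loop_homotopy_def homotopic_with_def by auto
  have J: "?J = top_of_set ({0..1} \<times> {0..1})"
    by (simp add: prod_topology_subtopology_eu)
  have sub: "subtopology ?J {x \<in> topspace ?J. snd x \<le> 1/2} = top_of_set ({0..1} \<times> {0..1/2})"
    "subtopology ?J {x \<in> topspace ?J. 1/2 \<le> snd x} = top_of_set ({0..1} \<times> {1/2..1})"
    unfolding J by (auto simp: subtopology_subtopology intro!: arg_cong[where f = top_of_set])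
  define L where "L = (\<lambda>z. if snd z \<le> 1/2 then (H \<circ> (\<lambda>z. (fst z, 2 * snd z))) z
                           else (K \<circ> (\<lambda>z. (fst z, 2 * snd z - 1))) z)"
  have "continuous_map ?J X L"
    unfolding L_def
  proof (rule continuous_map_cases_le)
    show "continuous_map ?J euclideanreal snd" "continuous_map ?J euclideanreal (\<lambda>x. 1/2)"
      unfolding J by (auto intro!: continuous_intros)
    show "continuous_map (subtopology ?J {x \<in> topspace ?J. snd x \<le> 1/2}) X (H \<circ> (\<lambda>z. (fst z, 2 * snd z)))"
      unfolding sub by (rule continuous_map_compose[OF _ H(1)]) (auto simp: J intro!: continuous_intros)
    show "continuous_map (subtopology ?J {x \<in> topspace ?J. 1/2 \<le> snd x}) X (K \<circ> (\<lambda>z. (fst z, 2 * snd z - 1)))"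
      unfolding sub by (rule continuous_map_compose[OF _ K(1)]) (auto simp: J intro!: continuous_intros)
    show "(H \<circ> (\<lambda>z. (fst z, 2 * snd z))) x = (K \<circ> (\<lambda>z. (fst z, 2 * snd z - 1))) x"
      if "x \<in> topspace ?J" "snd x = 1/2" for x
    proof -
      have "fst x \<in> {0..1}"
        using that(1) by (auto simp: J)
      then show ?thesis
        using H(4)[of "fst x"] K(4)[of "fst x"] by (simp add: that(2))
    qed
  qed
  moreover have "\<forall>x. L (0, x) = loop_concat g h x" "\<forall>x. L (1, x) = loop_concat g' h' x"
    by (auto simp: L_def loop_concat_def H K)
  moreover have "\<forall>t\<in>{0..1}. L (t, 0) = s \<and> L (t, 1) = s"
    using H(4) K(4) by (auto simp: L_def)
  ultimately have "homotopic_with (\<lambda>k. k 0 = s \<and> k 1 = s) ?I X (loop_concat g h) (loop_concat g' h')"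
    unfolding homotopic_with_def by (intro exI[of _ L]) simp
  then show ?thesis
    using assms loop_concat_loops by (auto simp: loop_homotopy_def)
qed

lemma loop_homotopy_reparametrize:
  assumes p: "pathin X p"
    and c: "continuous_on {0..1} \<phi>" "continuous_on {0..1} \<psi>"
    and r: "\<phi> ` {0..1} \<subseteq> {0..1}" "\<psi> ` {0..1} \<subseteq> {0..1}"
    and e: "\<phi> 0 = \<psi> 0" "\<phi> 1 = \<psi> 1" "p (\<phi> 0) = s" "p (\<phi> 1) = s"
    and a: "\<And>x. x \<in> {0..1} \<Longrightarrow> a x = p (\<phi> x)"
    and b: "\<And>x. x \<in> {0..1} \<Longrightarrow> b x = p (\<psi> x)"
  shows "(a, b) \<in> loop_homotopy X s"
proof -
  let ?I = "top_of_set {0..1::real}"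
  have J: "prod_topology ?I ?I = top_of_set ({0..1} \<times> {0..1})"
    by (simp add: prod_topology_subtopology_eu)
  define f where "f = (\<lambda>z::real \<times> real. (1 - fst z) * \<phi> (snd z) + fst z * \<psi> (snd z))"
  have rng: "f (t, x) \<in> {0..1}" if "t \<in> {0..1}" "x \<in> {0..1}" for t x
  proof -
    have "\<phi> x \<in> {0..1}" "\<psi> x \<in> {0..1}"
      using r that by blast+
    then show ?thesis
      unfolding f_def using that convexD[of "{0..1::real}" "\<phi> x" "\<psi> x" "1 - t" t] by simp
  qed
  have "continuous_on ({0..1} \<times> {0..1}) f"
    unfolding f_def
    by (intro continuous_intros continuous_on_compose2[OF c(1)] continuous_on_compose2[OF c(2)]) auto
  then have "continuous_map (prod_topology ?I ?I) ?I f"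
    unfolding J using rng by auto
  then have "continuous_map (prod_topology ?I ?I) X (p \<circ> f)"
    using p unfolding pathin_def by (rule continuous_map_compose)
  moreover have "(p \<circ> f) (t, 0) = s \<and> (p \<circ> f) (t, 1) = s" for t
  proof -
    have "f (t, 0) = \<phi> 0" "f (t, 1) = \<phi> 1"
      using e(1,2) by (simp_all add: f_def algebra_simps)
    then show ?thesis
      using e by simp
  qed
  ultimately have hom: "homotopic_with (\<lambda>k. k 0 = s \<and> k 1 = s) ?I X (p \<circ> \<phi>) (p \<circ> \<psi>)"
    unfolding homotopic_with_def by (intro exI[of _ "p \<circ> f"]) (simp add: f_def)
  have loop: "pathin X (p \<circ> \<phi>)" "pathin X (p \<circ> \<psi>)"
    using c r unfolding pathin_def
    by (auto simp: image_subset_iff intro!: continuous_map_compose[OF _ p[unfolded pathin_def]])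
  have "homotopic_with (\<lambda>k. k 0 = s \<and> k 1 = s) ?I X a b"
    by (rule homotopic_with_eq[OF hom]) (auto simp: a b)
  moreover have "pathin X a" "pathin X b"
    using loop a b unfolding pathin_def by (auto intro: continuous_map_eq)
  ultimately show ?thesis
    using e a b by (simp add: loop_homotopy_def loops_def)
qed

lemma mult_fundamental_group:
  assumes "g \<in> loops X s" "h \<in> loops X s"
  shows "loop_homotopy X s `` {g} \<otimes>\<^bsub>fundamental_group X s\<^esub> loop_homotopy X s `` {h} =
           loop_homotopy X s `` {loop_concat g h}"
proof -
  note eq = equiv_loop_homotopy[of X s]
  have "loop_homotopy X s `` {loop_concat g' h'} = loop_homotopy X s `` {loop_concat g h}"
    if "(g, g') \<in> loop_homotopy X s" "(h, h') \<in> loop_homotopy X s" for g' h'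
    using equiv_class_eq[OF eq loop_homotopy_concat[OF that]] by simp
  then have "(\<Union>g'\<in>loop_homotopy X s `` {g}. \<Union>h'\<in>loop_homotopy X s `` {h}.
        loop_homotopy X s `` {loop_concat g' h'}) =
      (\<Union>g'\<in>loop_homotopy X s `` {g}. \<Union>h'\<in>loop_homotopy X s `` {h}.
        loop_homotopy X s `` {loop_concat g h})"
    by (intro SUP_cong refl) (simp_all only: Image_singleton_iff)
  moreover have "g \<in> loop_homotopy X s `` {g}" "h \<in> loop_homotopy X s `` {h}"
    using assms eq by (auto simp: equiv_def refl_on_def)
  ultimately show ?thesis
    unfolding fundamental_group_def monoid.simps by blast
qed

lemma group_fundamental_group:
  assumes s: "s \<in> topspace X"
  shows "group (fundamental_group X s)"
proof (rule groupI)
  let ?G = "fundamental_group X s"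
  let ?c = "\<lambda>g. loop_homotopy X s `` {g}"
  note eq = equiv_loop_homotopy[of X s]
  have car: "A \<in> carrier ?G \<longleftrightarrow> (\<exists>g\<in>loops X s. A = ?c g)" for A
    by (auto simp: fundamental_group_def quotient_def)
  have one: "\<one>\<^bsub>?G\<^esub> = ?c (\<lambda>_. s)" and cl: "(\<lambda>_. s) \<in> loops X s"
    using s by (auto simp: fundamental_group_def loops_def)
  show "\<one>\<^bsub>?G\<^esub> \<in> carrier ?G"
    using one cl car by blast
  fix A assume "A \<in> carrier ?G"
  then obtain g where g: "g \<in> loops X s" "A = ?c g"
    using car by blast
  then have pg: "pathin X g" "g 0 = s" "g 1 = s"
    by (auto simp: loops_def)
  have "(loop_concat (\<lambda>_. s) g, g) \<in> loop_homotopy X s"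
    by (rule loop_homotopy_reparametrize[OF pg(1), where \<phi> = "\<lambda>x. max 0 (2 * x - 1)" and \<psi> = "\<lambda>x. x"])
       (auto simp: loop_concat_def pg max_absorb1 max_absorb2 intro!: continuous_intros)
  then show "\<one>\<^bsub>?G\<^esub> \<otimes>\<^bsub>?G\<^esub> A = A"
    using equiv_class_eq[OF eq] by (simp add: one g mult_fundamental_group cl)
  have rev: "(\<lambda>t. g (1 - t)) \<in> loops X s"
  proof -
    have "continuous_map (top_of_set {0..1}) X (g \<circ> (\<lambda>t. 1 - t))"
      using pg(1) unfolding pathin_def
      by (rule continuous_map_compose[rotated]) (auto intro!: continuous_intros)
    then show ?thesis
      using pg by (simp add: loops_def pathin_def o_def)
  qed
  have "(loop_concat (\<lambda>t. g (1 - t)) g, \<lambda>_. s) \<in> loop_homotopy X s"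
    by (rule loop_homotopy_reparametrize[OF pg(1), where \<phi> = "\<lambda>x. \<bar>2 * x - 1\<bar>" and \<psi> = "\<lambda>x. 1"])
       (auto simp: loop_concat_def pg intro!: continuous_intros)
  then have "?c (\<lambda>t. g (1 - t)) \<otimes>\<^bsub>?G\<^esub> A = \<one>\<^bsub>?G\<^esub>"
    using equiv_class_eq[OF eq] by (simp add: one g mult_fundamental_group rev)
  then show "\<exists>B\<in>carrier ?G. B \<otimes>\<^bsub>?G\<^esub> A = \<one>\<^bsub>?G\<^esub>"
    using rev car by blast
  fix B assume "B \<in> carrier ?G"
  then obtain h where h: "h \<in> loops X s" "B = ?c h"
    using car by blast
  show "A \<otimes>\<^bsub>?G\<^esub> B \<in> carrier ?G"
    using g h car loop_concat_loops by (metis mult_fundamental_group)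
  fix C assume "C \<in> carrier ?G"
  then obtain k where k: "k \<in> loops X s" "C = ?c k"
    using car by blast
  let ?p = "loop_concat (loop_concat g h) k"
  have lp: "?p \<in> loops X s"
    using g h k by (simp add: loop_concat_loops)
  have "(?p, loop_concat g (loop_concat h k)) \<in> loop_homotopy X s"
  proof (rule loop_homotopy_reparametrize[where p = ?p and \<phi> = "\<lambda>x. x"
        and \<psi> = "\<lambda>x. max (x / 2) (max (x - 1/4) (2 * x - 1))"])
    show "loop_concat g (loop_concat h k) x = ?p (max (x / 2) (max (x - 1/4) (2 * x - 1)))"
      if "x \<in> {0..1}" for x
    proof -
      consider "x \<le> 1/2" | "1/2 < x" "x \<le> 3/4" | "3/4 < x"
        by linarith
      then show ?thesis
      proof cases
        case 1
        then have "max (x / 2) (max (x - 1/4) (2 * x - 1)) = x / 2"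
          by simp
        with 1 show ?thesis
          by (simp add: loop_concat_def)
      next
        case 2
        then have "max (x / 2) (max (x - 1/4) (2 * x - 1)) = x - 1/4"
          by simp
        with 2 show ?thesis
          by (simp add: loop_concat_def algebra_simps)
      next
        case 3
        then have "max (x / 2) (max (x - 1/4) (2 * x - 1)) = 2 * x - 1"
          by simp
        with 3 show ?thesis
          by (simp add: loop_concat_def)
      qed
    qed
  qed (use lp in \<open>auto simp: loops_def le_max_iff_disj intro!: continuous_intros\<close>)
  then show "A \<otimes>\<^bsub>?G\<^esub> B \<otimes>\<^bsub>?G\<^esub> C = A \<otimes>\<^bsub>?G\<^esub> (B \<otimes>\<^bsub>?G\<^esub> C)"
    using equiv_class_eq[OF eq] g h k by (simp add: mult_fundamental_group loop_concat_loops)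
qed

definition graph_braid_group ::
    "nat \<Rightarrow> ('a, 'b) pre_digraph \<Rightarrow> (nat \<Rightarrow> 'a + 'b \<times> real) set \<Rightarrow>
     (real \<Rightarrow> (nat \<Rightarrow> 'a + 'b \<times> real) set) set monoid" where
  "graph_braid_group n G S = fundamental_group (uconf_space n (realization G)) S"


section \<open>Group presentations and right-angled Artin groups\<close>

text \<open>
  Words over \<open>X\<close> and its formal inverses: \<open>(x, True)\<close> stands for \<open>x\<close> and \<open>(x, False)\<close> for its
  inverse. A relation \<open>l = r\<close> is given as the pair \<open>(l, r)\<close>.
\<close>

type_synonym 'g word = "('g \<times> bool) list"

abbreviation words :: "'g set \<Rightarrow> 'g word set" where
  "words X \<equiv> lists (X \<times> UNIV)"

inductive_set pres_eq :: "'g set \<Rightarrow> ('g word \<times> 'g word) set \<Rightarrow> ('g word \<times> 'g word) set"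
  for X :: "'g set" and R :: "('g word \<times> 'g word) set" where
  pres_eq_refl: "w \<in> words X \<Longrightarrow> (w, w) \<in> pres_eq X R"
| pres_eq_sym: "(u, v) \<in> pres_eq X R \<Longrightarrow> (v, u) \<in> pres_eq X R"
| pres_eq_trans: "(u, v) \<in> pres_eq X R \<Longrightarrow> (v, w) \<in> pres_eq X R \<Longrightarrow> (u, w) \<in> pres_eq X R"
| pres_eq_cancel: "u \<in> words X \<Longrightarrow> v \<in> words X \<Longrightarrow> x \<in> X \<Longrightarrow>
    (u @ [(x, b), (x, \<not> b)] @ v, u @ v) \<in> pres_eq X R"
| pres_eq_relator: "u \<in> words X \<Longrightarrow> v \<in> words X \<Longrightarrow> l \<in> words X \<Longrightarrow> r \<in> words X \<Longrightarrow> (l, r) \<in> R \<Longrightarrow>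
    (u @ l @ v, u @ r @ v) \<in> pres_eq X R"

definition presented_group :: "'g set \<Rightarrow> ('g word \<times> 'g word) set \<Rightarrow> 'g word set monoid" where
  "presented_group X R =
     \<lparr>carrier = words X // pres_eq X R,
      mult = (\<lambda>A B. \<Union>u\<in>A. \<Union>v\<in>B. pres_eq X R `` {u @ v}),
      one = pres_eq X R `` {[]}\<rparr>"

lemma pres_eq_words: "(u, v) \<in> pres_eq X R \<Longrightarrow> u \<in> words X \<and> v \<in> words X"
  by (induction rule: pres_eq.induct) auto

lemma equiv_pres_eq: "equiv (words X) (pres_eq X R)"
proof (rule equivI)
  show "pres_eq X R \<subseteq> words X \<times> words X"
    using pres_eq_words by (metis mem_Sigma_iff subrelI)
  show "refl_on (words X) (pres_eq X R)"
    by (auto simp: refl_on_def intro: pres_eq_refl)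
  show "sym (pres_eq X R)"
    by (auto simp: sym_def intro: pres_eq_sym)
  show "trans (pres_eq X R)"
    unfolding trans_def by (blast intro: pres_eq_trans)
qed

lemma pres_eq_context:
  assumes "(u, v) \<in> pres_eq X R" "a \<in> words X" "b \<in> words X"
  shows "(a @ u @ b, a @ v @ b) \<in> pres_eq X R"
  using assms(1)
proof (induction rule: pres_eq.induct)
  case (pres_eq_refl w)
  then show ?case
    using assms by (intro pres_eq.pres_eq_refl) simp
next
  case (pres_eq_sym u v)
  then show ?case
    by (blast intro: pres_eq.pres_eq_sym)
next
  case (pres_eq_trans u v w)
  then show ?case
    by (blast intro: pres_eq.pres_eq_trans)
next
  case (pres_eq_cancel u v x c)
  then show ?case
    using assms pres_eq.pres_eq_cancel[of "a @ u" X "v @ b" x c R] by simp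
next
  case (pres_eq_relator u v l r)
  then show ?case
    using assms pres_eq.pres_eq_relator[of "a @ u" X "v @ b" l r R] by simp
qed

lemma pres_eq_append:
  assumes "(u, u') \<in> pres_eq X R" "(v, v') \<in> pres_eq X R"
  shows "(u @ v, u' @ v') \<in> pres_eq X R"
proof -
  have "(u @ v, u' @ v) \<in> pres_eq X R"
    using pres_eq_context[OF assms(1), of "[]" v] pres_eq_words[OF assms(2)] by simp
  moreover have "(u' @ v, u' @ v') \<in> pres_eq X R"
    using pres_eq_context[OF assms(2), of u' "[]"] pres_eq_words[OF assms(1)] by simp
  ultimately show ?thesis
    by (rule pres_eq_trans)
qed

lemma mult_presented_group:
  assumes "u \<in> words X" "v \<in> words X"
  shows "pres_eq X R `` {u} \<otimes>\<^bsub>presented_group X R\<^esub> pres_eq X R `` {v} = pres_eq X R `` {u @ v}"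
proof -
  have "pres_eq X R `` {u' @ v'} = pres_eq X R `` {u @ v}"
    if "(u, u') \<in> pres_eq X R" "(v, v') \<in> pres_eq X R" for u' v'
    using equiv_class_eq[OF equiv_pres_eq pres_eq_append[OF that]] by simp
  then have "(\<Union>u'\<in>pres_eq X R `` {u}. \<Union>v'\<in>pres_eq X R `` {v}. pres_eq X R `` {u' @ v'}) =
      (\<Union>u'\<in>pres_eq X R `` {u}. \<Union>v'\<in>pres_eq X R `` {v}. pres_eq X R `` {u @ v})"
    by (intro SUP_cong refl) (simp_all only: Image_singleton_iff)
  moreover have "u \<in> pres_eq X R `` {u}" "v \<in> pres_eq X R `` {v}"
    using assms by (auto intro: pres_eq_refl)
  ultimately show ?thesis
    unfolding presented_group_def monoid.simps by blast
qed

lemma group_presented_group: "group (presented_group X R)"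
proof (rule groupI)
  let ?G = "presented_group X R"
  let ?c = "\<lambda>w. pres_eq X R `` {w}"
  have car: "A \<in> carrier ?G \<longleftrightarrow> (\<exists>w\<in>words X. A = ?c w)" for A
    by (auto simp: presented_group_def quotient_def)
  have one: "\<one>\<^bsub>?G\<^esub> = ?c []"
    by (simp add: presented_group_def)
  show "\<one>\<^bsub>?G\<^esub> \<in> carrier ?G"
    unfolding one car by (intro bexI[of _ "[]"]) auto
  fix A assume "A \<in> carrier ?G"
  then obtain u where u: "u \<in> words X" "A = ?c u"
    using car by blast
  have one_mult: "?c [] \<otimes>\<^bsub>?G\<^esub> ?c u = ?c ([] @ u)"
    using u by (intro mult_presented_group) auto
  then show "\<one>\<^bsub>?G\<^esub> \<otimes>\<^bsub>?G\<^esub> A = A"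
    by (simp add: one u)
  define i where "i = (\<lambda>w::'a word. rev (map (\<lambda>(x, b). (x, \<not> b)) w))"
  have i: "i w \<in> words X \<and> (i w @ w, []) \<in> pres_eq X R" if "w \<in> words X" for w
    using that
  proof (induction w)
    case Nil
    then show ?case
      by (simp add: i_def pres_eq_refl)
  next
    case (Cons y w)
    obtain x b where y: "y = (x, b)"
      by force
    have i': "i (y # w) = i w @ [(x, \<not> b)]"
      by (simp add: i_def y)
    have "(i w @ [(x, \<not> b), (x, \<not> \<not> b)] @ w, i w @ w) \<in> pres_eq X R"
      using Cons by (intro pres_eq_cancel) (auto simp: y)
    then have "(i w @ [(x, \<not> b), (x, b)] @ w, []) \<in> pres_eq X R"
      using Cons by (auto intro: pres_eq_trans)
    then show ?case
      using Cons unfolding i' by (simp add: y)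
  qed
  then have "?c (i u) \<otimes>\<^bsub>?G\<^esub> A = \<one>\<^bsub>?G\<^esub>"
    using u equiv_class_eq[OF equiv_pres_eq, of "i u @ u" "[]" X R]
    by (simp add: one mult_presented_group)
  moreover have "?c (i u) \<in> carrier ?G"
    unfolding car using i[OF u(1)] by (intro bexI[of _ "i u"]) simp_all
  ultimately show "\<exists>B\<in>carrier ?G. B \<otimes>\<^bsub>?G\<^esub> A = \<one>\<^bsub>?G\<^esub>"
    by (rule bexI)
  fix B assume "B \<in> carrier ?G"
  then obtain v where v: "v \<in> words X" "B = ?c v"
    using car by blast
  have uv: "u @ v \<in> words X"
    using u v by simp
  then show "A \<otimes>\<^bsub>?G\<^esub> B \<in> carrier ?G"
    unfolding car u(2) v(2) mult_presented_group[OF u(1) v(1)] by (intro bexI[of _ "u @ v"] refl)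
  fix C assume "C \<in> carrier ?G"
  then obtain w where w: "w \<in> words X" "C = ?c w"
    using car by blast
  have vw: "v @ w \<in> words X"
    using v w by simp
  show "A \<otimes>\<^bsub>?G\<^esub> B \<otimes>\<^bsub>?G\<^esub> C = A \<otimes>\<^bsub>?G\<^esub> (B \<otimes>\<^bsub>?G\<^esub> C)"
    unfolding u(2) v(2) w(2)
    by (simp only: mult_presented_group[OF u(1) v(1)] mult_presented_group[OF v(1) w(1)]
        mult_presented_group[OF uv w(1)] mult_presented_group[OF u(1) vw] append_assoc)
qed

definition raag :: "('a, 'b) pre_digraph \<Rightarrow> 'a word set monoid" where
  "raag P = presented_group (verts P)
     {([(v, True), (w, True)], [(w, True), (v, True)]) | v w. (v, w) \<in> arcs_ends P}"

end

theory Submission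
  imports Defs "HOL-Library.Function_Algebras"
begin


text \<open>
  Replacing two edges at a vertex of degree 2 by one edge, assume that the graph has as few edges
  as possible. Let \<open>m\<close> denote the class of a loop in the abelianization of the Artin group.

  \<^item> If there is a loop or a leaf edge \<open>e\<close>, ending at a vertex \<open>v\<close>, the configurations with one
    particle at \<open>v\<close> and all others inside \<open>e\<close> form a contractible two-sided wall. Counting signed
    crossings gives a homomorphism \<open>\<chi>\<close> to the integers, and since \<open>m\<close> is trivial near the
    wall, \<open>(\<chi>, m)\<close> lifts to a Heisenberg group. So \<open>\<chi> p * m q = \<chi> q * m p\<close> for commuting \<open>p\<close>
    and \<open>q\<close>; as every generator commutes with another one, \<open>\<chi> = 0\<close>. But some loop crosses the
    wall exactly once. (If the graph is an interval, the group is trivial.)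

  \<^item> Otherwise all degrees are at least 3 and there are no loops, and a longest path yields three
    arcs that meet only in their common end points \<open>v\<close> and \<open>w\<close>. Exchanging two particles near \<open>v\<close>
    and two others near \<open>w\<close> gives commuting loops with opposite classes \<open>m\<close>, whose monodromies are
    the disjoint transpositions (1 2) and (3 4). The lifts of these to the Clifford algebra
    anticommute. On the other hand, the lifts of the generators can be made to commute along the
    edges of the defining graph by twisting the product with a bimultiplicative function of the
    classes \<open>m\<close>, and such a twist does not change the commutator of elements with proportional
    classes. So the two lifts would have to commute.
\<close>
section \<open>Paths, homotopies and path functors\<close>

text \<open>Both obstructions live in degree 2. In a right-angled Artin group every class of degree
  2 is a sum of products of classes of degree 1, and the product of two adjacent generators' dual
  classes is nonzero. A wall yields a nonzero class \<open>chi\<close> whose product with every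
  class of degree 1 vanishes, against the connectedness of the defining graph. The Clifford lifts
  represent Schur's class of the symmetric group. Pulled back to an Artin group it is a sum of
  products, so it dies on a torus whose two generators are proportional in the abelianization; but
  it is nontrivial on (1 2) and (3 4). Hence the insistence on opposite classes. The obstacle is
  that no braid group is computed. Homomorphisms to noncommutative groups (Heisenberg groups,
  symmetric groups, the Artin group itself) are instead defined on paths with arbitrary end points,
  locally over an open cover, and glued. This takes the place of van Kampen's theorem and of
  covering theory; cocycles appear only as explicit group laws or scalar factors.\<close>

definition lin :: "'a::real_vector => 'a => real => 'a" where
  "lin a b t = a + t *\<^sub>R (b - a)"

text \<open>Homotopy relative to the end points, between arbitrary points: unlike
  \<open>loop_homotopy\<close> it names no base point and compares values on the unit interval only.
  The first coordinate of the square is the homotopy parameter. That \<open>q\<close> has the end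
  points of \<open>p\<close> is a consequence.\<close>

definition path_hom :: "'y topology => (real => 'y) => (real => 'y) => bool" where
  "path_hom Y p q \<longleftrightarrow> (\<exists>H. continuous_map (top_of_set ({0..1} \<times> {0..1::real})) Y H \<and>
     (\<forall>t\<in>{0..1}. H (0, t) = p t \<and> H (1, t) = q t) \<and>
     (\<forall>s\<in>{0..1::real}. H (s, 0) = p 0 \<and> H (s, 1) = p 1))"

lemma lin_0 [simp]: "lin a b 0 = a" and lin_1 [simp]: "lin a b 1 = b"
  by (auto simp: lin_def)

lemma lin_same [simp]: "lin a a = (\<lambda>_. a)"
  by (auto simp: lin_def)

lemma lin_in_convex:
  assumes "convex C" "a \<in> C" "b \<in> C" "t \<in> {0..1}"
  shows "lin a b t \<in> C"
proof -
  have "lin a b t = (1 - t) *\<^sub>R a + t *\<^sub>R b"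
    by (simp add: lin_def algebra_simps)
  thus ?thesis
    using assms by (simp add: convexD)
qed

lemma continuous_on_lin: "continuous_on S (lin a (b :: 'a::real_normed_vector))"
  unfolding lin_def by (intro continuous_intros)

lemma square_topology: "prod_topology (top_of_set {0..1::real}) (top_of_set {0..1::real}) =
    top_of_set ({0..1} \<times> {0..1})"
  by (simp add: prod_topology_subtopology_eu)

lemma pathin_cong:
  assumes "pathin Y p" "\<And>t. t \<in> {0..1} ==> p t = q t"
  shows "pathin Y q"
  using assms unfolding pathin_def by (auto intro: continuous_map_eq)

lemma pathin_compose_convex:
  assumes "continuous_map (top_of_set C) Y h" "continuous_on {0..1} \<phi>" "\<phi> ` {0..1} \<subseteq> C"
  shows "pathin Y (\<lambda>t. h (\<phi> t))"
  using continuous_map_compose[of "top_of_set {0..1}" "top_of_set C" \<phi> Y h] assms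
  by (auto simp: pathin_def o_def)

text \<open>The straight-line homotopy inside the convex set, carried to \<open>Y\<close> by
  \<open>h\<close>. Reparametrisations, triangles and squares are all instances.\<close>

lemma path_hom_convex:
  fixes C :: "'a::real_normed_vector set"
  assumes h: "continuous_map (top_of_set C) Y h" and C: "convex C"
    and \<phi>: "continuous_on {0..1} \<phi>" "\<phi> ` {0..1} \<subseteq> C"
    and \<psi>: "continuous_on {0..1} \<psi>" "\<psi> ` {0..1} \<subseteq> C"
    and e: "\<phi> 0 = \<psi> 0" "\<phi> 1 = \<psi> 1"
    and p: "\<And>t. t \<in> {0..1} ==> p t = h (\<phi> t)" and q: "\<And>t. t \<in> {0..1} ==> q t = h (\<psi> t)"
  shows "path_hom Y p q"
proof -
  define f where "f = (\<lambda>z. lin (\<phi> (snd z)) (\<psi> (snd z)) (fst z))"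
  have "continuous_on ({0..1} \<times> {0..1}) f"
    unfolding f_def lin_def
    by (intro continuous_intros continuous_on_compose2[OF \<phi>(1)] continuous_on_compose2[OF \<psi>(1)]) auto
  moreover have "f ` ({0..1} \<times> {0..1}) \<subseteq> C"
    using \<phi>(2) \<psi>(2) by (auto simp: f_def intro!: lin_in_convex[OF C])
  ultimately have "continuous_map (top_of_set ({0..1} \<times> {0..1})) (top_of_set C) f"
    by auto
  hence "continuous_map (top_of_set ({0..1} \<times> {0..1})) Y (h \<circ> f)"
    using h by (rule continuous_map_compose)
  thus ?thesis
    unfolding path_hom_def using e by (intro exI[of _ "h \<circ> f"]) (auto simp: f_def p q)
qed

lemma pathin_const [simp]: "pathin Y (\<lambda>_. y) \<longleftrightarrow> y \<in> topspace Y"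
  by (simp add: pathin_def)

lemma path_hom_cong:
  assumes "pathin Y p" "\<And>t. t \<in> {0..1} ==> p t = q t"
  shows "path_hom Y p q"
  by (rule path_hom_convex[OF assms(1)[unfolded pathin_def], where \<phi> = "\<lambda>t. t" and \<psi> = "\<lambda>t. t"])
     (use assms in \<open>auto intro!: continuous_intros\<close>)

lemma path_hom_pathin:
  assumes "path_hom Y p q"
  shows "pathin Y p" "pathin Y q" "q 0 = p 0" "q 1 = p 1"
proof -
  obtain H where H: "continuous_map (top_of_set ({0..1} \<times> {0..1::real})) Y H"
     "\<And>t. t\<in>{0..1} ==> H (0, t) = p t \<and> H (1, t) = q t"
     "\<And>s. s\<in>{0..1::real} ==> H (s, 0) = p 0 \<and> H (s, 1) = p 1"
    using assms unfolding path_hom_def by blast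
  have "pathin Y (\<lambda>t. H (s, t))" if "s \<in> {0..1}" for s
    by (rule pathin_compose_convex[OF H(1)]) (use that in \<open>auto intro!: continuous_intros\<close>)
  from this[of 0] this[of 1] show "pathin Y p" "pathin Y q"
    using H(2) by (auto intro: pathin_cong)
  show "q 0 = p 0" "q 1 = p 1"
    using H(2)[of 0] H(2)[of 1] H(3)[of 1] by auto
qed

lemma path_hom_refl: "pathin Y p ==> path_hom Y p p"
  by (rule path_hom_cong) auto

lemma path_hom_sym:
  assumes "path_hom Y p q" shows "path_hom Y q p"
proof -
  obtain H where H: "continuous_map (top_of_set ({0..1} \<times> {0..1::real})) Y H"
     "\<And>t. t\<in>{0..1} ==> H (0, t) = p t \<and> H (1, t) = q t"
     "\<And>s. s\<in>{0..1::real} ==> H (s, 0) = p 0 \<and> H (s, 1) = p 1"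
    using assms unfolding path_hom_def by blast
  have "continuous_map (top_of_set ({0..1} \<times> {0..1::real})) Y (H \<circ> (\<lambda>z. (1 - fst z, snd z)))"
    by (rule continuous_map_compose[OF _ H(1)]) (auto intro!: continuous_intros)
  thus ?thesis
    unfolding path_hom_def using H(2,3) path_hom_pathin[OF assms]
    by (intro exI[of _ "H \<circ> (\<lambda>z. (1 - fst z, snd z))"]) auto
qed

lemma continuous_map_paste_square:
  assumes f: "continuous_map (top_of_set ({0..1} \<times> {0..1::real})) Y f"
    and g: "continuous_map (top_of_set ({0..1} \<times> {0..1::real})) Y g"
    and eq: "\<And>s. s \<in> {0..1} ==> f (s, 1) = g (s, 0)"
  shows "continuous_map (top_of_set ({0..1} \<times> {0..1::real})) Y
     (\<lambda>z. if snd z \<le> 1/2 then f (fst z, 2 * snd z) else g (fst z, 2 * snd z - 1))"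
proof -
  let ?J = "top_of_set ({0..1} \<times> {0..1::real})"
  have sub: "subtopology ?J {x \<in> topspace ?J. snd x \<le> 1/2} = top_of_set ({0..1} \<times> {0..1/2})"
    "subtopology ?J {x \<in> topspace ?J. 1/2 \<le> snd x} = top_of_set ({0..1} \<times> {1/2..1})"
    by (auto simp: subtopology_subtopology intro!: arg_cong[where f = top_of_set])
  have "continuous_map ?J Y (\<lambda>z. if snd z \<le> 1/2 then (f \<circ> (\<lambda>z. (fst z, 2 * snd z))) z
      else (g \<circ> (\<lambda>z. (fst z, 2 * snd z - 1))) z)"
  proof (rule continuous_map_cases_le)
    show "continuous_map ?J euclideanreal snd" "continuous_map ?J euclideanreal (\<lambda>x. 1/2)"
      by (auto intro!: continuous_intros)
    show "continuous_map (subtopology ?J {x \<in> topspace ?J. snd x \<le> 1/2}) Y (f \<circ> (\<lambda>z. (fst z, 2 * snd z)))"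
      unfolding sub by (rule continuous_map_compose[OF _ f]) (auto intro!: continuous_intros)
    show "continuous_map (subtopology ?J {x \<in> topspace ?J. 1/2 \<le> snd x}) Y (g \<circ> (\<lambda>z. (fst z, 2 * snd z - 1)))"
      unfolding sub by (rule continuous_map_compose[OF _ g]) (auto intro!: continuous_intros)
    show "(f \<circ> (\<lambda>z. (fst z, 2 * snd z))) x = (g \<circ> (\<lambda>z. (fst z, 2 * snd z - 1))) x"
      if "x \<in> topspace ?J" "snd x = 1/2" for x
    proof -
      have a: "2 * snd x = 1" using that(2) by simp
      have "fst x \<in> {0..1}" using that(1) by auto
      from eq[OF this] show ?thesis by (simp only: o_def a diff_self)
    qed
  qed
  thus ?thesis by (simp add: o_def cong: if_cong)
qed

lemma pathin_loop_concat:
  assumes "pathin Y p" "pathin Y q" "p 1 = q 0"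
  shows "pathin Y (loop_concat p q)"
proof -
  have lift: "continuous_map (top_of_set ({0..1} \<times> {0..1::real})) Y (r \<circ> snd)" if "pathin Y r" for r
    by (rule continuous_map_compose[OF _ that[unfolded pathin_def]]) (auto intro!: continuous_intros)
  from continuous_map_paste_square[OF lift[OF assms(1)] lift[OF assms(2)]] assms(3)
  have "continuous_map (top_of_set ({0..1} \<times> {0..1::real})) Y (\<lambda>z. loop_concat p q (snd z))"
    unfolding loop_concat_def o_def by (simp cong: if_cong)
  hence "pathin Y (\<lambda>t. loop_concat p q (snd (0::real, t)))"
    by (rule pathin_compose_convex) (auto intro!: continuous_intros)
  thus ?thesis by simp
qed

lemma loop_concat_0 [simp]: "loop_concat p q 0 = p 0" and loop_concat_1 [simp]: "loop_concat p q 1 = q 1"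
  by (auto simp: loop_concat_def)

lemma path_hom_concat:
  assumes "path_hom Y p p'" "path_hom Y q q'" "p 1 = q 0"
  shows "path_hom Y (loop_concat p q) (loop_concat p' q')"
proof -
  obtain H where H: "continuous_map (top_of_set ({0..1} \<times> {0..1::real})) Y H"
     "\<And>t. t\<in>{0..1} ==> H (0, t) = p t \<and> H (1, t) = p' t"
     "\<And>s. s\<in>{0..1::real} ==> H (s, 0) = p 0 \<and> H (s, 1) = p 1"
    using assms(1) unfolding path_hom_def by blast
  obtain K where K: "continuous_map (top_of_set ({0..1} \<times> {0..1::real})) Y K"
     "\<And>t. t\<in>{0..1} ==> K (0, t) = q t \<and> K (1, t) = q' t"
     "\<And>s. s\<in>{0..1::real} ==> K (s, 0) = q 0 \<and> K (s, 1) = q 1"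
    using assms(2) unfolding path_hom_def by blast
  show ?thesis
    unfolding path_hom_def
    by (intro exI conjI, rule continuous_map_paste_square[OF H(1) K(1)])
       (use H(2,3) K(2,3) assms(3) in \<open>auto simp: loop_concat_def\<close>)
qed

lemma path_hom_trans:
  assumes "path_hom Y p q" "path_hom Y q r"
  shows "path_hom Y p r"
proof -
  obtain H where H: "continuous_map (top_of_set ({0..1} \<times> {0..1::real})) Y H"
     "\<And>t. t\<in>{0..1} ==> H (0, t) = p t \<and> H (1, t) = q t"
     "\<And>s. s\<in>{0..1::real} ==> H (s, 0) = p 0 \<and> H (s, 1) = p 1"
    using assms(1) unfolding path_hom_def by blast
  obtain K where K: "continuous_map (top_of_set ({0..1} \<times> {0..1::real})) Y K"
     "\<And>t. t\<in>{0..1} ==> K (0, t) = q t \<and> K (1, t) = r t"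
     "\<And>s. s\<in>{0..1::real} ==> K (s, 0) = q 0 \<and> K (s, 1) = q 1"
    using assms(2) unfolding path_hom_def by blast
  \<comment> \<open>Transitivity stacks homotopies in the homotopy direction, whereas
    \<open>continuous_map_paste_square\<close> glues in the path direction; exchanging the
    coordinates before and after turns one into the other.\<close>
  let ?sw = "\<lambda>z::real \<times> real. (snd z, fst z)"
  have sw: "continuous_map (top_of_set ({0..1} \<times> {0..1::real})) (top_of_set ({0..1} \<times> {0..1::real})) ?sw"
    by (auto intro!: continuous_intros)
  have "continuous_map (top_of_set ({0..1} \<times> {0..1::real})) Y
     (\<lambda>z. if snd z \<le> 1/2 then (H \<circ> ?sw) (fst z, 2 * snd z) else (K \<circ> ?sw) (fst z, 2 * snd z - 1))"
    by (rule continuous_map_paste_square[OF continuous_map_compose[OF sw H(1)] continuous_map_compose[OF sw K(1)]])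
       (use H(2) K(2) in auto)
  from continuous_map_compose[OF sw this]
  show ?thesis
    unfolding path_hom_def o_def
    by (intro exI conjI, assumption) (use H(2,3) K(2,3) path_hom_pathin[OF assms(1)] in auto)
qed

lemma path_hom_reparam:
  assumes "pathin Y p" "continuous_on {0..1} \<phi>" "\<phi> ` {0..1} \<subseteq> {0..1}"
    "continuous_on {0..1} \<psi>" "\<psi> ` {0..1} \<subseteq> {0..1}" "\<phi> 0 = \<psi> 0" "\<phi> 1 = \<psi> 1"
    "\<And>t. t \<in> {0..1} ==> a t = p (\<phi> t)" "\<And>t. t \<in> {0..1} ==> b t = p (\<psi> t)"
  shows "path_hom Y a b"
  by (rule path_hom_convex[OF assms(1)[unfolded pathin_def] _ assms(2-9)]) auto

text \<open>The reparametrisation has slopes 1/2, 1 and 2, with breaks at 1/2 and 3/4. As the slopes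
  increase it is convex, hence the maximum of its three affine pieces, which makes its continuity
  immediate.\<close>

lemma path_hom_assoc:
  assumes "pathin Y p" "pathin Y q" "pathin Y r" "p 1 = q 0" "q 1 = r 0"
  shows "path_hom Y (loop_concat (loop_concat p q) r) (loop_concat p (loop_concat q r))"
proof (rule path_hom_reparam[where p = "loop_concat (loop_concat p q) r" and \<phi> = "\<lambda>x. x"
        and \<psi> = "\<lambda>x. max (x / 2) (max (x - 1/4) (2 * x - 1))"])
  show "pathin Y (loop_concat (loop_concat p q) r)"
    using assms by (simp add: pathin_loop_concat)
  show "loop_concat p (loop_concat q r) x =
      loop_concat (loop_concat p q) r (max (x / 2) (max (x - 1/4) (2 * x - 1)))" for x
  proof -
    consider "x \<le> 1/2" | "1/2 < x" "x \<le> 3/4" | "3/4 < x"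
      by linarith
    thus ?thesis
    proof cases
      case 1
      hence "max (x / 2) (max (x - 1/4) (2 * x - 1)) = x / 2" by simp
      with 1 show ?thesis by (simp add: loop_concat_def)
    next
      case 2
      hence "max (x / 2) (max (x - 1/4) (2 * x - 1)) = x - 1/4" by simp
      with 2 show ?thesis by (simp add: loop_concat_def algebra_simps)
    next
      case 3
      hence "max (x / 2) (max (x - 1/4) (2 * x - 1)) = 2 * x - 1" by simp
      with 3 show ?thesis by (simp add: loop_concat_def)
    qed
  qed
qed (auto simp: le_max_iff_disj intro!: continuous_intros)

lemma path_hom_const_left:
  assumes "pathin Y p" "p 0 = y" shows "path_hom Y (loop_concat (\<lambda>_. y) p) p"
  by (rule path_hom_reparam[OF assms(1), where \<phi> = "\<lambda>x. max 0 (2 * x - 1)" and \<psi> = "\<lambda>x. x"])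
     (use assms in \<open>auto simp: loop_concat_def max_absorb1 max_absorb2 intro!: continuous_intros\<close>)

lemma path_hom_const_right:
  assumes "pathin Y p" "p 1 = y" shows "path_hom Y (loop_concat p (\<lambda>_. y)) p"
  by (rule path_hom_reparam[OF assms(1), where \<phi> = "\<lambda>x. min 1 (2 * x)" and \<psi> = "\<lambda>x. x"])
     (use assms in \<open>auto simp: loop_concat_def min_absorb1 min_absorb2 intro!: continuous_intros\<close>)

definition rev_path :: "(real => 'y) => real => 'y" where
  "rev_path p t = p (1 - t)"

lemma rev_path_0 [simp]: "rev_path p 0 = p 1" and rev_path_1 [simp]: "rev_path p 1 = p 0"
  by (auto simp: rev_path_def)

lemma pathin_rev_path: assumes "pathin Y p" shows "pathin Y (rev_path p)"
proof -
  have "pathin Y (\<lambda>t. p (1 - t))"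
    by (rule pathin_compose_convex[OF assms[unfolded pathin_def]]) (auto intro!: continuous_intros)
  thus ?thesis by (simp add: rev_path_def[abs_def])
qed

lemma path_hom_rev_left:
  assumes "pathin Y p" shows "path_hom Y (loop_concat (rev_path p) p) (\<lambda>_. p 1)"
  by (rule path_hom_reparam[OF assms, where \<phi> = "\<lambda>x. \<bar>2 * x - 1\<bar>" and \<psi> = "\<lambda>x. 1"])
     (auto simp: loop_concat_def rev_path_def intro!: continuous_intros)

lemma path_hom_rev_right:
  assumes "pathin Y p" shows "path_hom Y (loop_concat p (rev_path p)) (\<lambda>_. p 0)"
  by (rule path_hom_reparam[OF assms, where \<phi> = "\<lambda>x. min (2 * x) (2 - 2 * x)" and \<psi> = "\<lambda>x. 0"])
     (auto simp: loop_concat_def rev_path_def min_absorb1 min_absorb2 min_le_iff_disj intro!: continuous_intros)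

text \<open>The bridge to the group: the classes of loops that make up
  \<open>fundamental_group\<close> are unfolded only in \<open>raag_words_exist\<close>, everything
  else speaks of paths.\<close>

lemma loop_homotopy_iff:
  "(g, h) \<in> loop_homotopy Y s \<longleftrightarrow> path_hom Y g h \<and> g 0 = s \<and> g 1 = s"
proof
  assume "(g, h) \<in> loop_homotopy Y s"
  hence *: "g 0 = s" "g 1 = s" and
    "homotopic_with (\<lambda>k. k 0 = s \<and> k 1 = s) (top_of_set {0..1}) Y g h"
    by (auto simp: loop_homotopy_def loops_def)
  thus "path_hom Y g h \<and> g 0 = s \<and> g 1 = s"
    unfolding homotopic_with_def path_hom_def square_topology by auto
next
  assume A: "path_hom Y g h \<and> g 0 = s \<and> g 1 = s"
  then obtain H where H: "continuous_map (top_of_set ({0..1} \<times> {0..1::real})) Y H"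
     "\<And>t. t\<in>{0..1} ==> H (0, t) = g t \<and> H (1, t) = h t"
     "\<And>s. s\<in>{0..1::real} ==> H (s, 0) = g 0 \<and> H (s, 1) = g 1"
    unfolding path_hom_def by blast
  have "homotopic_with (\<lambda>k. k 0 = s \<and> k 1 = s) (top_of_set {0..1}) Y (\<lambda>t. H (0, t)) (\<lambda>t. H (1, t))"
    unfolding homotopic_with_def square_topology using H A by (intro exI[of _ H]) auto
  hence "homotopic_with (\<lambda>k. k 0 = s \<and> k 1 = s) (top_of_set {0..1}) Y g h"
    by (rule homotopic_with_eq) (use H(2) in auto)
  thus "(g, h) \<in> loop_homotopy Y s"
    using A path_hom_pathin[of Y g h] by (auto simp: loop_homotopy_def loops_def)
qed

text \<open>A homomorphism from the fundamental groupoid to a group. It is written additively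
  because \<open>group_add\<close> does not demand commutativity, so one type class serves the
  integers, Heisenberg groups and groups of bijections. Allowing all paths, not only loops, is what
  permits local definitions.\<close>

definition path_functor :: "'y topology => ((real => 'y) => 'k::group_add) => bool" where
  "path_functor Y F \<longleftrightarrow> (\<forall>p q. pathin Y p \<longrightarrow> pathin Y q \<longrightarrow> p 1 = q 0 \<longrightarrow> F (loop_concat p q) = F p + F q) \<and>
     (\<forall>p q. path_hom Y p q \<longrightarrow> F p = F q)"

lemma path_functor_concat:
  "path_functor Y F ==> pathin Y p ==> pathin Y q ==> p 1 = q 0 ==> F (loop_concat p q) = F p + F q"
  by (simp add: path_functor_def)

lemma path_functor_hom: "path_functor Y F ==> path_hom Y p q ==> F p = F q"
  by (simp add: path_functor_def)

lemma path_functor_cong: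
  "path_functor Y F ==> pathin Y p ==> (\<And>t. t \<in> {0..1} ==> p t = q t) ==> F p = F q"
  using path_functor_hom path_hom_cong by blast

lemma path_functor_const:
  assumes "path_functor Y F" "y \<in> topspace Y" shows "F (\<lambda>_. y) = 0"
proof -
  have "loop_concat (\<lambda>_. y) (\<lambda>_. y) = (\<lambda>_. y)"
    by (auto simp: loop_concat_def)
  hence "F (\<lambda>_. y) + F (\<lambda>_. y) = F (\<lambda>_. y) + 0"
    using path_functor_concat[OF assms(1), of "\<lambda>_. y" "\<lambda>_. y"] assms(2) by simp
  thus ?thesis
    by (simp only: add_left_cancel)
qed

lemma path_functor_rev:
  assumes "path_functor Y F" "pathin Y p" shows "F (rev_path p) = - F p"
proof -
  have "F (loop_concat p (rev_path p)) = F (\<lambda>_. p 0)"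
    by (rule path_functor_hom[OF assms(1) path_hom_rev_right[OF assms(2)]])
  moreover have "p 0 \<in> topspace Y"
    using assms(2) by (auto simp: pathin_def continuous_map_def)
  ultimately have "F p + F (rev_path p) = 0"
    using path_functor_const[OF assms(1)] path_functor_concat[OF assms(1,2) pathin_rev_path[OF assms(2)]]
    by simp
  thus ?thesis by (simp add: minus_unique)
qed

text \<open>A convex domain has no monodromy: two sides of a triangle can be pushed onto the third.
  Sums over subdivisions become independent of the subdivision for this reason.\<close>

lemma path_functor_triangle:
  fixes C :: "'a::real_normed_vector set"
  assumes F: "path_functor Y F" and h: "continuous_map (top_of_set C) Y h" and C: "convex C"
    and abc: "a \<in> C" "b \<in> C" "c \<in> C"
  shows "F (\<lambda>t. h (lin a b t)) + F (\<lambda>t. h (lin b c t)) = F (\<lambda>t. h (lin a c t))"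
proof -
  have im: "lin x y ` {0..1} \<subseteq> C" if "x \<in> C" "y \<in> C" for x y
    using lin_in_convex[OF C that] by auto
  have p: "pathin Y (\<lambda>t. h (lin x y t))" if "x \<in> C" "y \<in> C" for x y
    by (rule pathin_compose_convex[OF h continuous_on_lin im[OF that]])
  have c: "continuous_on {0..1} (loop_concat (lin a b) (lin b c))"
  proof -
    have "pathin euclidean (loop_concat (lin a b) (lin b c))"
      by (rule pathin_loop_concat) (auto simp: pathin_def intro!: continuous_on_lin)
    thus ?thesis by (simp add: pathin_def)
  qed
  have i: "loop_concat (lin a b) (lin b c) ` {0..1} \<subseteq> C"
    using im[of a b] im[of b c] abc by (auto simp: loop_concat_def image_subset_iff)
  have "path_hom Y (loop_concat (\<lambda>t. h (lin a b t)) (\<lambda>t. h (lin b c t))) (\<lambda>t. h (lin a c t))"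
    by (rule path_hom_convex[OF h C c i continuous_on_lin im[OF abc(1,3)]]) (auto simp: loop_concat_def)
  from path_functor_hom[OF F this] show ?thesis
    using path_functor_concat[OF F p p, of a b b c] abc by simp
qed

lemma path_functor_square:
  fixes C :: "'a::real_normed_vector set"
  assumes F: "path_functor Y F" and h: "continuous_map (top_of_set C) Y h" and C: "convex C"
    and "a \<in> C" "b \<in> C" "c \<in> C" "d \<in> C"
  shows "F (\<lambda>t. h (lin a b t)) + F (\<lambda>t. h (lin b d t)) = F (\<lambda>t. h (lin a c t)) + F (\<lambda>t. h (lin c d t))"
  unfolding path_functor_triangle[OF F h C \<open>a \<in> C\<close> \<open>b \<in> C\<close> \<open>d \<in> C\<close>]
    path_functor_triangle[OF F h C \<open>a \<in> C\<close> \<open>c \<in> C\<close> \<open>d \<in> C\<close>] ..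

text \<open>The two ways along the boundary from one corner to the opposite one are paths in a
  convex set. Every commuting square of motions of particles becomes a relation between functor
  values through this.\<close>

lemma path_hom_square:
  assumes h: "continuous_map (top_of_set ({0..1} \<times> {0..1::real})) Y h"
  shows "path_hom Y (loop_concat (\<lambda>t. h (t, 0)) (\<lambda>t. h (1, t))) (loop_concat (\<lambda>t. h (0, t)) (\<lambda>t. h (t, 1)))"
proof (rule path_hom_convex[OF h, where \<phi> = "loop_concat (\<lambda>t. (t, 0)) (\<lambda>t. (1, t))" and
      \<psi> = "loop_concat (\<lambda>t. (0, t)) (\<lambda>t. (t, 1))"])
  have "pathin euclidean (loop_concat (\<lambda>t. (t, 0::real)) (\<lambda>t. (1::real, t)))"
    "pathin euclidean (loop_concat (\<lambda>t. (0::real, t)) (\<lambda>t. (t, 1::real)))"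
    by (rule pathin_loop_concat; auto simp: pathin_def intro!: continuous_intros)+
  thus "continuous_on {0..1} (loop_concat (\<lambda>t. (t, 0::real)) (\<lambda>t. (1::real, t)))"
    "continuous_on {0..1} (loop_concat (\<lambda>t. (0::real, t)) (\<lambda>t. (t, 1::real)))"
    by (simp_all add: pathin_def)
  show "loop_concat (\<lambda>t. (t, 0)) (\<lambda>t. (1, t)) ` {0..1} \<subseteq> {0..1::real} \<times> {0..1::real}"
    "loop_concat (\<lambda>t. (0, t)) (\<lambda>t. (t, 1)) ` {0..1} \<subseteq> {0..1::real} \<times> {0..1::real}"
    unfolding loop_concat_def image_subset_iff by simp_all
  show "convex ({0..1::real} \<times> {0..1::real})"
    by (intro convex_Times convex_real_interval)
  show "loop_concat (\<lambda>t. h (t, 0)) (\<lambda>t. h (1, t)) t = h (loop_concat (\<lambda>t. (t, 0)) (\<lambda>t. (1, t)) t)"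
    "loop_concat (\<lambda>t. h (0, t)) (\<lambda>t. h (t, 1)) t = h (loop_concat (\<lambda>t. (0, t)) (\<lambda>t. (t, 1)) t)" for t
    by (cases "t \<le> 1/2"; simp add: loop_concat_def)+
qed (simp_all only: loop_concat_0 loop_concat_1)

section \<open>Gluing path functors\<close>

text \<open>The order of the terms matters, as the group need not be commutative.\<close>

primrec psum :: "(nat => 'k::group_add) => nat => 'k" where
  "psum f 0 = 0"
| "psum f (Suc k) = psum f k + f k"

lemma psum_cong: "(\<And>i. i < k ==> f i = g i) ==> psum f k = psum g k"
  by (induction k) auto

lemma psum_add: "psum f (a + b) = psum f a + psum (\<lambda>i. f (a + i)) b"
  by (induction b) (auto simp: add.assoc)

text \<open>With \<open>f\<close> and \<open>g\<close> as the rails of a ladder and \<open>v\<close>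
  as its rungs, commuting cells add up to a commuting rectangle.\<close>

lemma psum_ladder:
  assumes "\<And>i. i < k ==> f i + v (Suc i) = v i + g i"
  shows "psum f k + v k = v 0 + psum g k"
  using assms
proof (induction k)
  case (Suc k)
  have "psum f (Suc k) + v (Suc k) = psum f k + (f k + v (Suc k))"
    by (simp add: add.assoc)
  also have "\<dots> = psum f k + v k + g k"
    using Suc.prems by (simp add: add.assoc)
  also have "\<dots> = v 0 + psum g (Suc k)"
    using Suc by (simp add: add.assoc)
  finally show ?case .
qed simp

definition seg :: "(real => 'y) => nat => nat => real => 'y" where
  "seg p N i = (\<lambda>t. p (lin (i / N) (Suc i / N) t))"

definition small_on :: "'y set set => (real => 'y) => nat => bool" where
  "small_on \<U> p N \<longleftrightarrow> N > 0 \<and> (\<forall>i<N. \<exists>U\<in>\<U>. p ` {i / N..Suc i / N} \<subseteq> U)"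

lemma interval_sub_unit: "i < N ==> {real i / real N..real (Suc i) / real N} \<subseteq> {0..1}"
  by (auto simp: field_simps intro: order_trans)

lemma loop_concat_left: "t \<le> 1/2 ==> loop_concat p q t = p (2 * t)"
  by (simp add: loop_concat_def)

lemma loop_concat_right:
  assumes "1/2 \<le> t" "p 1 = q 0" shows "loop_concat p q t = q (2 * t - 1)"
proof (cases "t = 1/2")
  case True
  hence "2 * t = 1" by simp
  moreover have "loop_concat p q t = p (2 * t)" using True by (simp only: loop_concat_left order_refl)
  ultimately show ?thesis using assms(2) by (simp only: diff_self)
qed (use assms in \<open>auto simp: loop_concat_def\<close>)

lemma lin_half: "lin (a / 2) (b / 2) t = lin a b t / (2::real)"
  by (simp add: lin_def algebra_simps diff_divide_distrib add_divide_distrib)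

lemma lin_seg_mem: "t \<in> {0..1} ==> lin (real i / real N) (real (Suc i) / real N) t \<in> {real i / real N..real (Suc i) / real N}"
  by (rule lin_in_convex) (auto simp: divide_right_mono)

lemma lin_seg_unit: "i < N ==> t \<in> {0..1} ==> lin (real i / real N) (real (Suc i) / real N) t \<in> {0..1}"
  using lin_seg_mem interval_sub_unit by blast

lemma psum_seg_functor:
  assumes F: "path_functor Y F" and p: "pathin Y p" and N: "N > 0"
  shows "psum (\<lambda>i. F (seg p N i)) N = F p"
proof -
  have "psum (\<lambda>i. F (seg p N i)) k = F (\<lambda>t. p (lin 0 (k / N) t))" if "k \<le> N" for k
    using that
  proof (induction k)
    case 0
    have "p 0 \<in> topspace Y"
      using p by (auto simp: pathin_def continuous_map_def)
    thus ?case
      using path_functor_const[OF F] by simp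
  next
    case (Suc k)
    have "k / N \<in> {0..1}" "Suc k / N \<in> {0..1}"
      using Suc.prems N by (auto simp: field_simps)
    thus ?case
      using Suc path_functor_triangle[OF F p[unfolded pathin_def], of 0 "k / N" "Suc k / N"]
      by (simp add: seg_def)
  qed
  from this[of N] have "psum (\<lambda>i. F (seg p N i)) N = F (\<lambda>t. p (lin 0 1 t))"
    using N by simp
  thus ?thesis by (simp add: lin_def)
qed

lemma grid_subdivision:
  assumes H: "continuous_map (top_of_set ({0..1} \<times> {0..1::real})) Y H"
    and op: "\<And>U. U \<in> \<U> ==> openin Y U" and cov: "topspace Y \<subseteq> \<Union>\<U>"
  obtains N :: nat where "N > 0"
    "\<forall>i<N. \<forall>j<N. \<exists>U\<in>\<U>. H ` ({i / N..Suc i / N} \<times> {j / N..Suc j / N}) \<subseteq> U"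
proof -
  let ?Q = "{0..1::real} \<times> {0..1::real}"
  define \<C> where "\<C> = {T. open T \<and> (\<exists>U\<in>\<U>. H ` (T \<inter> ?Q) \<subseteq> U)}"
  have "z \<in> \<Union>\<C>" if z: "z \<in> ?Q" for z
  proof -
    have "H z \<in> topspace Y"
      using H z by (auto simp: continuous_map_def)
    then obtain U where U: "U \<in> \<U>" "H z \<in> U"
      using cov by blast
    have "openin (top_of_set ?Q) {x \<in> topspace (top_of_set ?Q). H x \<in> U}"
      using openin_continuous_map_preimage[OF H op[OF U(1)]] .
    then obtain T where T: "open T" "{x \<in> ?Q. H x \<in> U} = ?Q \<inter> T"
      by (auto simp: openin_open)
    hence "T \<in> \<C>" "z \<in> T"
      using U z by (auto simp: \<C>_def intro!: bexI[of _ U])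
    thus ?thesis by blast
  qed
  hence sub: "?Q \<subseteq> \<Union>\<C>" by blast
  hence ne: "\<C> \<noteq> {}" by auto
  have comp: "compact ?Q" by (intro compact_Times compact_Icc)
  have opC: "\<And>B. B \<in> \<C> ==> open B" by (simp add: \<C>_def)
  obtain \<delta> where \<delta>: "\<delta> > 0" "\<And>T. T \<subseteq> ?Q ==> diameter T < \<delta> ==> \<exists>B\<in>\<C>. T \<subseteq> B"
    using Lebesgue_number_lemma[OF comp ne sub opC] by blast
  \<comment> \<open>A cell of side 1/N has diameter at most 2/N, so 1/N below a quarter of the
    Lebesgue number gives the strict inequality that is required.\<close>
  obtain N0 where "inverse (of_nat (Suc N0)) < \<delta> / 4"
    using reals_Archimedean[of "\<delta> / 4"] \<delta>(1) by auto
  then obtain N :: nat where N: "N > 0" "1 / N < \<delta> / 4"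
    by (metis inverse_eq_divide zero_less_Suc)
  have cell: "\<exists>U\<in>\<U>. H ` ({i / N..Suc i / N} \<times> {j / N..Suc j / N}) \<subseteq> U" if ij: "i < N" "j < N" for i j
  proof -
    let ?T = "{i / N..Suc i / N} \<times> {j / N..Suc j / N}"
    have TQ: "?T \<subseteq> ?Q"
      using interval_sub_unit[OF ij(1)] interval_sub_unit[OF ij(2)] by blast
    have "dist x y \<le> 2 / N" if "x \<in> ?T" "y \<in> ?T" for x y
    proof -
      have "dist (fst x) (fst y) \<le> 1 / N" "dist (snd x) (snd y) \<le> 1 / N"
        using that by (auto simp: dist_real_def add_divide_distrib abs_le_iff)
      moreover have "dist x y \<le> dist (fst x) (fst y) + dist (snd x) (snd y)"
        by (cases x; cases y) (simp add: dist_Pair_Pair sqrt_sum_squares_le_sum)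
      ultimately show ?thesis by simp
    qed
    hence "diameter ?T \<le> 2 / N"
      by (intro diameter_le) (auto simp: dist_norm)
    also have "\<dots> < \<delta>"
      using N \<delta>(1) by (simp add: field_simps)
    finally obtain B where "B \<in> \<C>" "?T \<subseteq> B"
      using \<delta>(2)[OF TQ] by blast
    then obtain U where "U \<in> \<U>" "H ` (B \<inter> ?Q) \<subseteq> U"
      by (auto simp: \<C>_def)
    with \<open>?T \<subseteq> B\<close> TQ show ?thesis by blast
  qed
  show thesis by (rule that[OF N(1)]) (intro allI impI cell)
qed

text \<open>The grid is applied to \<open>p\<close> regarded as a homotopy that does not depend on
  its first parameter.\<close>

lemma small_on_exists:
  assumes p: "pathin Y p" and op: "\<And>U. U \<in> \<U> ==> openin Y U" and cov: "topspace Y \<subseteq> \<Union>\<U>"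
  shows "\<exists>N. small_on \<U> p N"
proof -
  have "continuous_map (top_of_set ({0..1} \<times> {0..1::real})) Y (p \<circ> snd)"
    by (rule continuous_map_compose[OF _ p[unfolded pathin_def]]) (auto intro!: continuous_intros)
  then obtain N :: nat where N: "N > 0"
    "\<forall>i<N. \<forall>j<N. \<exists>U\<in>\<U>. (p \<circ> snd) ` ({i / N..Suc i / N} \<times> {j / N..Suc j / N}) \<subseteq> U"
    by (rule grid_subdivision[OF _ op cov])
  have "\<exists>U\<in>\<U>. p ` {j / N..Suc j / N} \<subseteq> U" if j: "j < N" for j
  proof -
    obtain U where U: "U \<in> \<U>" "(p \<circ> snd) ` ({real 0 / N..Suc 0 / N} \<times> {j / N..Suc j / N}) \<subseteq> U"
      using N(2)[rule_format, OF N(1) j] by auto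
    have "p t \<in> U" if "t \<in> {j / N..Suc j / N}" for t
      using U(2) that N(1) by (auto simp: image_subset_iff)
    with U(1) show ?thesis by blast
  qed
  with N(1) show ?thesis unfolding small_on_def by blast
qed

text \<open>Since \<open>P\<close> is one function of the path and does not see \<open>U\<close>,
  the local functors agree on overlaps by construction. The value on a long path is the ordered sum
  over a subdivision finer than the cover. Refining does not change this sum, and a homotopy is
  crossed one row of small cells at a time.\<close>

theorem glue_path_functor:
  fixes P :: "(real => 'y) => 'k::group_add"
  assumes op: "\<And>U. U \<in> \<U> ==> openin Y U" and cov: "topspace Y \<subseteq> \<Union>\<U>"
    and P: "\<And>U. U \<in> \<U> ==> path_functor (subtopology Y U) P"
  obtains F where "path_functor Y F" "\<And>U p. U \<in> \<U> ==> pathin (subtopology Y U) p ==> F p = P p"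
proof -
  define S where "S p N = psum (\<lambda>i. P (seg p N i)) N" for p N
  have ex: "\<exists>N. small_on \<U> p N" if "pathin Y p" for p
    by (rule small_on_exists[OF that op cov])
  have cont: "continuous_map (top_of_set C) (subtopology Y U) p"
    if "pathin Y p" "C \<subseteq> {0..1}" "p ` C \<subseteq> U" for C U p
    using that continuous_map_from_subtopology_mono[of "euclideanreal" "{0..1}" Y p C]
    by (auto simp: pathin_def continuous_map_in_subtopology)
  have refine: "S p (N * M) = S p N" if p: "pathin Y p" and s: "small_on \<U> p N" and M: "M > 0" for p N M
  proof -
    have N: "N > 0" using s by (simp add: small_on_def)
    \<comment> \<open>Each of the \<open>N\<close> coarse pieces lies in a single \<open>U\<close>;
      inside it the \<open>M\<close> fine pieces are added up by triangles, in the inner induction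
      over \<open>j\<close>.\<close>
    have "psum (\<lambda>i. P (seg p (N * M) i)) (i * M) = psum (\<lambda>i. P (seg p N i)) i" if "i \<le> N" for i
      using that
    proof (induction i)
      case (Suc i)
      hence i: "i < N" by simp
      let ?C = "{i / N..Suc i / N}"
      obtain U where U: "U \<in> \<U>" "p ` ?C \<subseteq> U"
        using s i unfolding small_on_def by blast
      note c = cont[OF p interval_sub_unit[OF i] U(2)]
      have pt: "(i * M + j) / (N * M) \<in> ?C" if "j \<le> M" for j
        using that N M by (auto simp: field_simps)
      have "psum (\<lambda>k. P (seg p (N * M) (i * M + k))) j = P (\<lambda>t. p (lin (i / N) ((i * M + j) / (N * M)) t))"
        if "j \<le> M" for j
        using that
      proof (induction j)
        case 0
        have e: "(i * M) / (N * M) = i / N"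
          using M by simp
        have "p (i / N) \<in> topspace (subtopology Y U)"
          using c pt[of 0] M by (auto simp: continuous_map_def e)
        thus ?case
          using path_functor_const[OF P[OF U(1)]] M by (simp)
      next
        case (Suc j)
        have "i / N \<in> ?C" using N by (auto simp: field_simps)
        from path_functor_triangle[OF P[OF U(1)] c _ this pt pt, of j "Suc j"] Suc
        show ?case by (simp add: seg_def add_ac)
      qed
      from this[of M] have "psum (\<lambda>k. P (seg p (N * M) (i * M + k))) M = P (\<lambda>t. p (lin (i / N) ((i * M + M) / (N * M)) t))"
        by simp
      have "psum (\<lambda>k. P (seg p (N * M) (i * M + k))) M = P (seg p N i)"
      proof -
        have "real (i * M + M) / real (N * M) = real (Suc i) / real N"
        proof -
          have "i * M + M = Suc i * M" by simp
          thus ?thesis using M by (simp only: of_nat_mult) simp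
        qed
        with \<open>psum (\<lambda>k. P (seg p (N * M) (i * M + k))) M = P (\<lambda>t. p (lin (i / N) ((i * M + M) / (N * M)) t))\<close>
        show ?thesis by (simp add: seg_def)
      qed
      thus ?case
        using Suc by (simp add: psum_add add.commute[of M])
    qed simp
    from this[of N] show ?thesis by (simp add: S_def)
  qed
  \<comment> \<open>The choice of the subdivision is harmless, since any two have the common
    refinement into \<open>N * M\<close> pieces.\<close>
  define F where "F p = S p (SOME N. small_on \<U> p N)" for p
  have F: "F p = S p N" if p: "pathin Y p" and s: "small_on \<U> p N" for p N
  proof -
    let ?M = "SOME N. small_on \<U> p N"
    have M: "small_on \<U> p ?M"
      using s by (rule someI)
    have "S p ?M = S p (?M * N)"
      using refine[OF p M] s by (simp add: small_on_def)
    also have "\<dots> = S p N"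
      using refine[OF p s, of ?M] M by (simp add: small_on_def mult.commute)
    finally show ?thesis by (simp add: F_def)
  qed
  have mult: "small_on \<U> p (N * M)" if s: "small_on \<U> p N" and M: "M > 0" for p N M
    unfolding small_on_def
  proof (intro conjI allI impI)
    show "0 < N * M" using s M by (simp add: small_on_def)
    fix i assume i: "i < N * M"
    define k where "k = i div M"
    have N: "N > 0" using s by (simp add: small_on_def)
    have k: "k < N" using i M by (simp add: k_def less_mult_imp_div_less)
    then obtain U where U: "U \<in> \<U>" "p ` {k / N..Suc k / N} \<subseteq> U"
      using s unfolding small_on_def by blast
    have "k * M \<le> i" "Suc i \<le> Suc k * M"
      using M by (auto simp: k_def dividend_less_div_times Suc_leI div_times_less_eq_dividend)
    hence "real k * real M \<le> real i" "real (Suc i) \<le> real (Suc k) * real M"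
      by (simp_all only: of_nat_mult[symmetric] of_nat_le_iff)
    hence "(real k * real M) / (real N * real M) \<le> real i / (real N * real M)"
      "real (Suc i) / (real N * real M) \<le> (real (Suc k) * real M) / (real N * real M)"
      by (simp_all only: divide_right_mono of_nat_0_le_iff mult_nonneg_nonneg)
    moreover have "real j / real N = (real j * real M) / (real N * real M)" for j
      using M by simp
    ultimately have "k / N \<le> i / (N * M)" "Suc i / (N * M) \<le> Suc k / N"
      by (simp_all only: of_nat_mult)
    hence "{i / (N * M)..Suc i / (N * M)} \<subseteq> {k / N..Suc k / N}"
      by auto
    hence "p ` {i / (N * M)..Suc i / (N * M)} \<subseteq> U"
      using U(2) by blast
    with U(1) show "\<exists>U\<in>\<U>. p ` {real i / real (N * M)..real (Suc i) / real (N * M)} \<subseteq> U"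
      by auto
  qed
  have segP: "\<exists>U\<in>\<U>. pathin (subtopology Y U) (seg p N i)" if "pathin Y p" "small_on \<U> p N" "i < N" for p N i
  proof -
    obtain U where U: "U \<in> \<U>" "p ` {i / N..Suc i / N} \<subseteq> U"
      using \<open>small_on \<U> p N\<close> \<open>i < N\<close> unfolding small_on_def by blast
    have "pathin (subtopology Y U) (\<lambda>t. p (lin (i / N) (Suc i / N) t))"
      by (rule pathin_compose_convex[OF cont[OF that(1) interval_sub_unit[OF that(3)] U(2)] continuous_on_lin])
         (rule image_subsetI, rule lin_seg_mem)
    with U(1) show ?thesis by (auto simp: seg_def)
  qed
  have Pcong: "P a = P b" if "\<exists>U\<in>\<U>. pathin (subtopology Y U) a" "\<And>t. t \<in> {0..1} ==> a t = b t" for a b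
    using that path_functor_cong[OF P] by blast
  have pf: "path_functor Y F"
    unfolding path_functor_def
  proof (intro conjI allI impI)
    fix p q assume p: "pathin Y p" and q: "pathin Y q" and pq: "p 1 = q 0"
    let ?r = "loop_concat p q"
    obtain N1 N2 where "small_on \<U> p N1" "small_on \<U> q N2"
      using ex p q by blast
    hence s12: "small_on \<U> p N1" "small_on \<U> q N2" and pos: "N1 > 0" "N2 > 0"
      by (simp_all add: small_on_def)
    define N where "N = N1 * N2"
    have N: "small_on \<U> p N" "small_on \<U> q N" "N > 0"
      using mult[OF s12(1) pos(2)] mult[OF s12(2) pos(1)] pos
      by (simp_all only: N_def mult.commute[of N2 N1] nat_0_less_mult_iff)
    have half: "real N / real (2 * N) = 1/2" using N(3) by simp
    have dh: "real k / real (2 * N) = real k / real N / 2" for k by simp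
    have r1: "?r ` {i / (2 * N)..Suc i / (2 * N)} \<subseteq> p ` {i / N..Suc i / N}" if i: "i < N" for i
    proof
      fix y assume "y \<in> ?r ` {i / (2 * N)..Suc i / (2 * N)}"
      then obtain t where t: "y = ?r t" "i / (2 * N) \<le> t" "t \<le> Suc i / (2 * N)" by auto
      have "t \<le> 1/2"
      proof -
        have "real (Suc i) / real (2 * N) \<le> real N / real (2 * N)"
          by (rule divide_right_mono) (use i in auto)
        from order_trans[OF t(3) this] show ?thesis unfolding half .
      qed
      hence "y = p (2 * t)" by (simp add: t loop_concat_left)
      moreover have "2 * t \<in> {i / N..Suc i / N}"
        using t N(3) by (auto simp: field_simps)
      ultimately show "y \<in> p ` {i / N..Suc i / N}" by blast
    qed
    have r2: "?r ` {(N + i) / (2 * N)..Suc (N + i) / (2 * N)} \<subseteq> q ` {i / N..Suc i / N}" if i: "i < N" for i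
    proof
      fix y assume "y \<in> ?r ` {(N + i) / (2 * N)..Suc (N + i) / (2 * N)}"
      then obtain t where t: "y = ?r t" "(N + i) / (2 * N) \<le> t" "t \<le> Suc (N + i) / (2 * N)" by auto
      have "1/2 \<le> t"
      proof -
        have "real N / real (2 * N) \<le> real (N + i) / real (2 * N)"
          by (rule divide_right_mono) auto
        also have "\<dots> \<le> t" using t(2) by simp
        finally show ?thesis unfolding half .
      qed
      hence "y = q (2 * t - 1)"
        using pq by (simp only: t loop_concat_right)
      moreover have "2 * t - 1 \<in> {i / N..Suc i / N}"
        using t N(3) by (auto simp: field_simps)
      ultimately show "y \<in> q ` {i / N..Suc i / N}" by blast
    qed
    have s2: "small_on \<U> ?r (2 * N)"
      unfolding small_on_def
    proof (intro conjI allI impI)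
      fix i assume i: "i < 2 * N"
      show "\<exists>U\<in>\<U>. ?r ` {real i / real (2 * N)..real (Suc i) / real (2 * N)} \<subseteq> U"
      proof (cases "i < N")
        case True
        obtain U where "U \<in> \<U>" "p ` {i / N..Suc i / N} \<subseteq> U"
          using N(1) True unfolding small_on_def by blast
        with r1[OF True] have "?r ` {i / (2 * N)..Suc i / (2 * N)} \<subseteq> U" by (rule_tac subset_trans)
        with \<open>U \<in> \<U>\<close> show ?thesis by auto
      next
        case False
        define j where "j = i - N"
        have j: "i = N + j" "j < N" using False i by (auto simp: j_def)
        obtain U where "U \<in> \<U>" "q ` {j / N..Suc j / N} \<subseteq> U"
          using N(2) j(2) unfolding small_on_def by blast
        with r2[OF j(2)] have "?r ` {(N + j) / (2 * N)..Suc (N + j) / (2 * N)} \<subseteq> U" by (rule_tac subset_trans)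
        with \<open>U \<in> \<U>\<close> show ?thesis by (auto simp: j(1))
      qed
    qed (use N in simp)
    have pr: "pathin Y ?r" by (rule pathin_loop_concat[OF p q pq])
    have e1: "P (seg ?r (2 * N) i) = P (seg p N i)" if i: "i < N" for i
    proof (rule Pcong)
      show "\<exists>U\<in>\<U>. pathin (subtopology Y U) (seg ?r (2 * N) i)"
        using segP[OF pr s2] i by simp
      fix t :: real assume t: "t \<in> {0..1}"
      have l: "lin (i / (2 * N)) (Suc i / (2 * N)) t = lin (i / N) (Suc i / N) t / 2"
        unfolding dh lin_half ..
      have "lin (i / N) (Suc i / N) t \<le> 1"
        using lin_seg_unit[OF i t] by simp
      hence le: "lin (i / (2 * N)) (Suc i / (2 * N)) t \<le> 1/2" unfolding l by simp
      have "2 * lin (i / (2 * N)) (Suc i / (2 * N)) t = lin (i / N) (Suc i / N) t" unfolding l by simp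
      with loop_concat_left[OF le, of p q] have "?r (lin (i / (2 * N)) (Suc i / (2 * N)) t) = p (lin (i / N) (Suc i / N) t)"
        by (simp only:)
      thus "seg ?r (2 * N) i t = seg p N i t"
        unfolding seg_def by simp
    qed
    have e2: "P (seg ?r (2 * N) (N + i)) = P (seg q N i)" if i: "i < N" for i
    proof (rule Pcong)
      show "\<exists>U\<in>\<U>. pathin (subtopology Y U) (seg ?r (2 * N) (N + i))"
        using segP[OF pr s2] i by simp
      fix t :: real assume t: "t \<in> {0..1}"
      have l: "2 * lin ((N + i) / (2 * N)) (Suc (N + i) / (2 * N)) t - 1 = lin (i / N) (Suc i / N) t"
        using N(3) by (simp add: lin_def field_simps)
      have "lin (i / N) (Suc i / N) t \<ge> 0"
        using lin_seg_unit[OF i t] by simp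
      hence "lin ((N + i) / (2 * N)) (Suc (N + i) / (2 * N)) t \<ge> 1/2"
        using l by simp
      hence "?r (lin ((N + i) / (2 * N)) (Suc (N + i) / (2 * N)) t) = q (lin (i / N) (Suc i / N) t)"
        unfolding l[symmetric] using pq by (simp only: loop_concat_right)
      thus "seg ?r (2 * N) (N + i) t = seg q N i t"
        unfolding seg_def by simp
    qed
    have "F ?r = psum (\<lambda>i. P (seg ?r (2 * N) i)) (N + N)"
      using F[OF pr s2] by (simp add: S_def mult_2)
    also have "\<dots> = S p N + S q N"
      unfolding psum_add S_def using e1 e2 by (simp cong: psum_cong)
    finally show "F ?r = F p + F q"
      using F[OF p N(1)] F[OF q N(2)] by simp
  next
    fix p q assume pq: "path_hom Y p q"
    then obtain H where H: "continuous_map (top_of_set ({0..1} \<times> {0..1::real})) Y H"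
       "\<And>t. t\<in>{0..1} ==> H (0, t) = p t \<and> H (1, t) = q t"
       "\<And>s. s\<in>{0..1::real} ==> H (s, 0) = p 0 \<and> H (s, 1) = p 1"
      unfolding path_hom_def by blast
    obtain N :: nat where N: "N > 0"
      "\<forall>i<N. \<forall>j<N. \<exists>U\<in>\<U>. H ` ({i / N..Suc i / N} \<times> {j / N..Suc j / N}) \<subseteq> U"
      by (rule grid_subdivision[OF H(1) op cov])
    \<comment> \<open>\<open>P\<close> summed along the line of the square with homotopy parameter
      j/N. Consecutive rows differ by the two outermost rungs, and these are constant paths because
      the homotopy fixes the end points.\<close>
    define row where "row j = psum (\<lambda>i. P (\<lambda>t. H (lin (j / N, i / N) (j / N, Suc i / N) t))) N" for j :: nat
    have step: "row j = row (Suc j)" if j: "j < N" for j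
    proof -
      define v where "v i = P (\<lambda>t. H (lin (j / N, i / N) (Suc j / N, i / N) t))" for i :: nat
      have "psum (\<lambda>i. P (\<lambda>t. H (lin (j / N, i / N) (j / N, Suc i / N) t))) N + v N =
        v 0 + psum (\<lambda>i. P (\<lambda>t. H (lin (Suc j / N, i / N) (Suc j / N, Suc i / N) t))) N"
      proof (rule psum_ladder)
        fix i assume i: "i < N"
        let ?C = "{j / N..Suc j / N} \<times> {i / N..Suc i / N}"
        obtain U where U: "U \<in> \<U>" "H ` ?C \<subseteq> U"
          using N(2)[rule_format, OF j i] by blast
        have C: "?C \<subseteq> {0..1} \<times> {0..1}"
          using interval_sub_unit[OF i] interval_sub_unit[OF j] by blast
        have c: "continuous_map (top_of_set ?C) (subtopology Y U) H"
          using continuous_map_from_subtopology_mono[OF H(1) C] U(2)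
          by (auto simp: continuous_map_in_subtopology)
        have le: "real j / N \<le> Suc j / N" "real i / N \<le> Suc i / N"
          by (auto simp: divide_right_mono)
        show "P (\<lambda>t. H (lin (j / N, i / N) (j / N, Suc i / N) t)) + v (Suc i) =
          v i + P (\<lambda>t. H (lin (Suc j / N, i / N) (Suc j / N, Suc i / N) t))"
          unfolding v_def
          by (rule path_functor_square[OF P[OF U(1)] c]) (use le in \<open>auto simp: convex_Times\<close>)
      qed
      moreover have "v i = 0" if i: "i = 0 \<or> i = N" for i
      proof -
        define y where "y = H (j / N, i / N)"
        have y: "H (lin (j / N, i / N) (Suc j / N, i / N) t) = y" if t: "t \<in> {0..1}" for t
        proof -
          have "lin (j / N, i / N) (Suc j / N, i / N) t = (lin (j / N) (Suc j / N) t, i / N)"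
            by (simp add: lin_def)
          moreover have "lin (j / N) (Suc j / N) t \<in> {0..1}"
            by (rule lin_seg_unit[OF j t])
          moreover have "j / N \<in> {0..1}" using j by auto
          ultimately show ?thesis
            using i H(3) N(1) unfolding y_def by auto
        qed
        have yt: "y \<in> topspace Y"
          using H(1) j i by (auto simp: y_def continuous_map_def Pi_iff)
        then obtain U where U: "U \<in> \<U>" "y \<in> U" using cov by blast
        have "v i = P (\<lambda>_. y)"
          unfolding v_def
          by (rule Pcong[symmetric]) (use U y yt in \<open>auto intro!: bexI[of _ U] simp: topspace_subtopology\<close>)
        also have "\<dots> = 0"
          by (rule path_functor_const[OF P[OF U(1)]]) (use U yt in \<open>simp add: topspace_subtopology\<close>)
        finally show ?thesis .
      qed
      ultimately show ?thesis by (simp add: row_def)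
    qed
    have "row 0 = row j" if "j \<le> N" for j
      using that by (induction j) (auto simp: step)
    hence r: "row 0 = row N" by blast
    have end_row: "F a = row j" if j: "j = 0 \<or> j = N" and a: "pathin Y a"
      "\<And>t. t \<in> {0..1} ==> H (j / N, t) = a t" for a j
    proof -
      have s: "small_on \<U> a N"
        unfolding small_on_def
      proof (intro conjI allI impI N(1))
        fix i assume i: "i < N"
        define k where "k = (if j = 0 then 0 else N - 1)"
        have k: "k < N" using N(1) by (simp add: k_def)
        obtain U where U: "U \<in> \<U>" "H ` ({k / N..Suc k / N} \<times> {i / N..Suc i / N}) \<subseteq> U"
          using N(2)[rule_format, OF k i] by blast
        have jk: "j / N \<in> {k / N..Suc k / N}"
          using j N(1) by (auto simp: k_def field_simps)
        have "a ` {i / N..Suc i / N} \<subseteq> U"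
        proof
          fix y assume "y \<in> a ` {i / N..Suc i / N}"
          then obtain t where t: "t \<in> {i / N..Suc i / N}" "y = a t" by blast
          have "y = H (j / N, t)"
            using a(2)[of t] t interval_sub_unit[OF i] by (metis subsetD)
          with U(2) t(1) jk show "y \<in> U" by blast
        qed
        with U(1) show "\<exists>U\<in>\<U>. a ` {real i / real N..real (Suc i) / real N} \<subseteq> U" by blast
      qed
      have "P (seg a N i) = P (\<lambda>t. H (lin (j / N, i / N) (j / N, Suc i / N) t))" if i: "i < N" for i
      proof (rule Pcong[OF segP[OF a(1) s i]])
        fix t :: real assume t: "t \<in> {0..1}"
        have "lin (i / N) (Suc i / N) t \<in> {0..1}"
          by (rule lin_seg_unit[OF i t])
        moreover have "lin (j / N, i / N) (j / N, Suc i / N) t = (j / N, lin (i / N) (Suc i / N) t)"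
          by (simp add: lin_def)
        ultimately show "seg a N i t = H (lin (j / N, i / N) (j / N, Suc i / N) t)"
          using a(2) by (simp add: seg_def)
      qed
      thus ?thesis
        unfolding F[OF a(1) s] S_def row_def by (rule psum_cong)
    qed
    show "F p = F q"
      using end_row[of 0 p] end_row[of N q] r H(2) path_hom_pathin[OF pq] N(1) by simp
  qed
  moreover have "F p = P p" if U: "U \<in> \<U>" and p: "pathin (subtopology Y U) p" for U p
  proof -
    have pY: "pathin Y p" and pU: "p ` {0..1} \<subseteq> U"
      using p by (auto simp: pathin_def continuous_map_in_subtopology)
    hence s: "small_on \<U> p 1"
      using U by (auto simp: small_on_def)
    show ?thesis
      unfolding F[OF pY s] S_def using psum_seg_functor[OF P[OF U] p, of 1] by simp
  qed
  ultimately show thesis using that by blast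
qed

text \<open>A path is a concatenation of small pieces, so agreement on small pieces suffices. It
  serves to recognise a glued functor, or one of its components, as a known one.\<close>

lemma path_functor_unique:
  assumes op: "\<And>U. U \<in> \<U> ==> openin Y U" and cov: "topspace Y \<subseteq> \<Union>\<U>"
    and F: "path_functor Y F" and G: "path_functor Y G"
    and eq: "\<And>U p. U \<in> \<U> ==> pathin (subtopology Y U) p ==> F p = G p"
    and p: "pathin Y p"
  shows "F p = G p"
proof -
  obtain N where N: "small_on \<U> p N"
    using small_on_exists[OF p op cov] by blast
  have "F (seg p N i) = G (seg p N i)" if i: "i < N" for i
  proof -
    obtain U where U: "U \<in> \<U>" "p ` {i / N..Suc i / N} \<subseteq> U"
      using N i unfolding small_on_def by blast
    have "continuous_map (top_of_set {i / N..Suc i / N}) (subtopology Y U) p"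
      using p U(2) continuous_map_from_subtopology_mono[OF _ interval_sub_unit[OF i], of euclideanreal Y p]
      by (auto simp: pathin_def continuous_map_in_subtopology)
    hence "pathin (subtopology Y U) (seg p N i)"
      unfolding seg_def
      by (rule pathin_compose_convex[OF _ continuous_on_lin])
         (rule image_subsetI, rule lin_seg_mem)
    thus ?thesis using eq[OF U(1)] by blast
  qed
  hence "psum (\<lambda>i. F (seg p N i)) N = psum (\<lambda>i. G (seg p N i)) N"
    by (rule psum_cong)
  thus ?thesis
    using psum_seg_functor[OF F p] psum_seg_functor[OF G p] N by (auto simp: small_on_def)
qed

section \<open>Words of loops in a right-angled Artin fundamental group\<close>

text \<open>The connecting path to \<open>s\<close> is prescribed to be constant, so that closing up
  a loop at \<open>s\<close> does not change its class.\<close>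

definition base_paths :: "'y topology => 'y => ('y => real => 'y) => bool" where
  "base_paths Y s c \<longleftrightarrow> (\<forall>y\<in>topspace Y. pathin Y (c y) \<and> c y 0 = s \<and> c y 1 = y) \<and> c s = (\<lambda>_. s)"

definition conj_loop :: "('y => real => 'y) => (real => 'y) => real => 'y" where
  "conj_loop c p = loop_concat (c (p 0)) (loop_concat p (rev_path (c (p 1))))"

lemma base_paths_exist:
  assumes "path_connected_space Y" "s \<in> topspace Y"
  obtains c where "base_paths Y s c"
proof -
  have "\<forall>y\<in>topspace Y. \<exists>g. pathin Y g \<and> g 0 = s \<and> g 1 = y"
    using assms by (auto simp: path_connected_space_def)
  then obtain c where c: "\<forall>y\<in>topspace Y. pathin Y (c y) \<and> c y 0 = s \<and> c y 1 = y"
    by metis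
  have "base_paths Y s (c(s := (\<lambda>_. s)))"
    using c assms(2) by (auto simp: base_paths_def)
  thus thesis by (rule that)
qed

lemma pathin_topspace: "pathin Y p ==> t \<in> {0..1} ==> p t \<in> topspace Y"
  by (auto simp: pathin_def continuous_map_def)

context
  fixes Y :: "'y topology" and s :: 'y and c
  assumes c: "base_paths Y s c"
begin

lemma base_path:
  assumes "pathin Y p" "t \<in> {0..1}"
  shows "pathin Y (c (p t))" "c (p t) 0 = s" "c (p t) 1 = p t"
  using c pathin_topspace[OF assms] by (auto simp: base_paths_def)

lemma conj_loop_loop:
  assumes "pathin Y p"
  shows "pathin Y (conj_loop c p)" "conj_loop c p 0 = s" "conj_loop c p 1 = s"
  using assms base_path[OF assms, of 0] base_path[OF assms, of 1]
  by (auto simp: conj_loop_def intro!: pathin_loop_concat pathin_rev_path)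

lemma conj_loop_hom:
  assumes "path_hom Y p q"
  shows "path_hom Y (conj_loop c p) (conj_loop c q)"
proof -
  note pq = path_hom_pathin[OF assms]
  note b = base_path[OF pq(1), of 0] base_path[OF pq(1), of 1]
  show ?thesis
    unfolding conj_loop_def pq(3,4) using b
    by (intro path_hom_concat path_hom_refl assms pathin_rev_path) auto
qed

text \<open>The connecting path to the middle point is run backwards and then forwards, and cancels;
  the rest is reassociation.\<close>

lemma conj_loop_concat:
  assumes p: "pathin Y p" and q: "pathin Y q" and pq: "p 1 = q 0"
  shows "path_hom Y (conj_loop c (loop_concat p q)) (loop_concat (conj_loop c p) (conj_loop c q))"
proof -
  let ?a = "c (p 0)" and ?b = "c (q 0)" and ?d = "rev_path (c (q 1))"
  let ?x = "loop_concat q ?d"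
  have a: "pathin Y ?a" "?a 1 = p 0"
    using base_path[OF p, of 0] by auto
  have b: "pathin Y ?b" "?b 0 = s" "?b 1 = q 0"
    using base_path[OF q, of 0] by auto
  have b': "pathin Y (rev_path ?b)" "rev_path ?b 0 = q 0" "rev_path ?b 1 = s"
    using b pathin_rev_path[OF b(1)] by auto
  have d: "pathin Y ?d" "?d 0 = q 1"
    using base_path[OF q, of 1] by (auto intro: pathin_rev_path)
  have x: "pathin Y ?x" "?x 0 = q 0"
    using q d by (auto intro: pathin_loop_concat)
  have bx: "pathin Y (loop_concat ?b ?x)"
    using b x by (auto intro: pathin_loop_concat)
  have pb: "pathin Y (loop_concat p (rev_path ?b))"
    using p b' pq by (auto intro: pathin_loop_concat)
  have cancel: "path_hom Y (loop_concat (rev_path ?b) (loop_concat ?b ?x)) ?x"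
  proof -
    have "path_hom Y (loop_concat (rev_path ?b) (loop_concat ?b ?x)) (loop_concat (loop_concat (rev_path ?b) ?b) ?x)"
      by (rule path_hom_sym[OF path_hom_assoc]) (use b b' x in auto)
    moreover have "path_hom Y (loop_concat (loop_concat (rev_path ?b) ?b) ?x) (loop_concat (\<lambda>_. q 0) ?x)"
      using path_hom_rev_left[OF b(1)] b x by (intro path_hom_concat path_hom_refl) auto
    moreover have "path_hom Y (loop_concat (\<lambda>_. q 0) ?x) ?x"
      using x by (intro path_hom_const_left) auto
    ultimately show ?thesis by (blast intro: path_hom_trans)
  qed
  have "path_hom Y (loop_concat (loop_concat p (rev_path ?b)) (loop_concat ?b ?x))
      (loop_concat p (loop_concat (rev_path ?b) (loop_concat ?b ?x)))"
    by (rule path_hom_assoc) (use p pq b b' bx in auto)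
  moreover have "path_hom Y (loop_concat p (loop_concat (rev_path ?b) (loop_concat ?b ?x))) (loop_concat p ?x)"
    by (rule path_hom_concat[OF path_hom_refl[OF p] cancel]) (use pq b' in simp)
  moreover have "path_hom Y (loop_concat p ?x) (loop_concat (loop_concat p q) ?d)"
    by (rule path_hom_sym[OF path_hom_assoc]) (use p q pq d in auto)
  ultimately have *: "path_hom Y (loop_concat (loop_concat p (rev_path ?b)) (loop_concat ?b ?x)) (loop_concat (loop_concat p q) ?d)"
    by (blast intro: path_hom_trans)
  have "path_hom Y (loop_concat (loop_concat ?a (loop_concat p (rev_path ?b))) (loop_concat ?b ?x))
     (loop_concat ?a (loop_concat (loop_concat p (rev_path ?b)) (loop_concat ?b ?x)))"
    by (rule path_hom_assoc) (use a b b' pb bx in auto)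
  moreover have "path_hom Y (loop_concat ?a (loop_concat (loop_concat p (rev_path ?b)) (loop_concat ?b ?x)))
     (loop_concat ?a (loop_concat (loop_concat p q) ?d))"
    by (rule path_hom_concat[OF path_hom_refl[OF a(1)] *]) (use a in auto)
  ultimately show ?thesis
    unfolding conj_loop_def using pq by (auto intro: path_hom_sym path_hom_trans)
qed

lemma conj_loop_of_loop:
  assumes p: "pathin Y p" and e: "p 0 = s" "p 1 = s"
  shows "path_hom Y (conj_loop c p) p"
proof -
  have s: "s \<in> topspace Y" using pathin_topspace[OF p, of 0] e by simp
  have r: "rev_path (\<lambda>_. s) = (\<lambda>_. s)" by (auto simp: rev_path_def)
  have "path_hom Y (loop_concat (\<lambda>_. s) (loop_concat p (\<lambda>_. s))) (loop_concat p (\<lambda>_. s))"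
    by (rule path_hom_const_left) (use p e s in \<open>auto intro: pathin_loop_concat\<close>)
  moreover have "path_hom Y (loop_concat p (\<lambda>_. s)) p"
    by (rule path_hom_const_right) (use p e in auto)
  ultimately show ?thesis
    using c e unfolding conj_loop_def base_paths_def by (auto simp: r intro: path_hom_trans)
qed

lemma path_functor_conj_loop:
  assumes F: "path_functor Y F" and p: "pathin Y p"
  shows "F (conj_loop c p) = F (c (p 0)) + F p - F (c (p 1))"
proof -
  note b = base_path[OF p, of 0] base_path[OF p, of 1]
  have pr: "pathin Y (loop_concat p (rev_path (c (p 1))))"
    using b p by (auto intro: pathin_loop_concat pathin_rev_path)
  have "F (conj_loop c p) = F (c (p 0)) + F (loop_concat p (rev_path (c (p 1))))"
    unfolding conj_loop_def using b p pr by (intro path_functor_concat[OF F]) auto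
  also have "F (loop_concat p (rev_path (c (p 1)))) = F p + F (rev_path (c (p 1)))"
    using b p pathin_rev_path by (intro path_functor_concat[OF F]) auto
  also have "F (rev_path (c (p 1))) = - F (c (p 1))"
    using b by (intro path_functor_rev[OF F]) auto
  finally show ?thesis by (simp only: diff_conv_add_uminus add.assoc)
qed

end

section \<open>Words in the generators and the loops they describe\<close>

primrec word_loop :: "'y => ('c => real => 'y) => 'c word => real => 'y" where
  "word_loop s l [] = (\<lambda>_. s)"
| "word_loop s l (a # w) = loop_concat (if snd a then l (fst a) else rev_path (l (fst a))) (word_loop s l w)"

definition ev :: "('c => 'k::group_add) => 'c word => 'k" where
  "ev g w = sum_list (map (\<lambda>(x, b). if b then g x else - g x) w)"

lemma ev_simps [simp]: "ev g [] = 0" "ev g ((x, b) # w) = (if b then g x else - g x) + ev g w"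
  "ev g (u @ v) = ev g u + ev g v"
  by (auto simp: ev_def)

lemma ev_pres_eq:
  assumes "(u, v) \<in> pres_eq X R" and R: "\<And>l r. (l, r) \<in> R ==> ev g l = ev g r"
  shows "ev g u = ev g v"
  using assms(1) by (induction rule: pres_eq.induct) (auto simp: R add.assoc[symmetric])

lemma word_loop_loop:
  assumes "\<And>x. x \<in> V ==> l x \<in> loops Y s" "w \<in> words V" "s \<in> topspace Y"
  shows "word_loop s l w \<in> loops Y s"
  using assms(2)
proof (induction w)
  case Nil
  thus ?case using assms(3) by (auto simp: loops_def)
next
  case (Cons a w)
  have "l (fst a) \<in> loops Y s" "rev_path (l (fst a)) \<in> loops Y s"
    using Cons assms(1)[of "fst a"] by (auto simp: loops_def pathin_rev_path)
  thus ?case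
    using Cons loop_concat_loops[of _ Y s "word_loop s l w"] by auto
qed

lemma path_functor_word_loop:
  assumes F: "path_functor Y F" and l: "\<And>x. x \<in> V ==> l x \<in> loops Y s" and w: "w \<in> words V"
    and s: "s \<in> topspace Y"
  shows "F (word_loop s l w) = ev (\<lambda>x. F (l x)) w"
  using w
proof (induction w)
  case Nil
  thus ?case using path_functor_const[OF F s] by simp
next
  case (Cons a w)
  have w: "word_loop s l w \<in> loops Y s"
  proof (rule word_loop_loop[where V = V])
    show "w \<in> words V" using Cons by simp
  qed (use l s in auto)
  have la: "l (fst a) \<in> loops Y s"
    using Cons l[of "fst a"] by auto
  obtain x b where a: "a = (x, b)" by force
  have "F (loop_concat q (word_loop s l w)) = F q + F (word_loop s l w)" if "q \<in> loops Y s" for q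
    using path_functor_concat[OF F, of q "word_loop s l w"] that w by (auto simp: loops_def)
  moreover have "rev_path (l (fst a)) \<in> loops Y s"
    using la by (auto simp: loops_def pathin_rev_path)
  moreover have "F (rev_path (l (fst a))) = - F (l (fst a))"
    using path_functor_rev[OF F, of "l (fst a)"] la by (auto simp: loops_def)
  ultimately show ?case
    using Cons la by (auto simp: a)
qed

definition raag_rel :: "('c, 'd) pre_digraph => ('c word \<times> 'c word) set" where
  "raag_rel P = {([(v, True), (w, True)], [(w, True), (v, True)]) | v w. (v, w) \<in> arcs_ends P}"

lemma raag_presented: "raag P = presented_group (verts P) (raag_rel P)"
  by (simp add: raag_def raag_rel_def)

text \<open>What is kept of an isomorphism: a word for every path (closed up through the base
  point), a loop for every generator, and compatibility with homotopy, concatenation and the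
  commutation relations. Later arguments then need neither the isomorphism nor classes of
  loops.\<close>

definition raag_words :: "'y topology => 'y => ('c, 'd) pre_digraph => ('c => real => 'y) =>
    ((real => 'y) => 'c word) => bool" where
  "raag_words Y s P l w \<longleftrightarrow>
     (\<forall>p. pathin Y p \<longrightarrow> w p \<in> words (verts P)) \<and>
     (\<forall>p q. path_hom Y p q \<longrightarrow> (w p, w q) \<in> pres_eq (verts P) (raag_rel P)) \<and>
     (\<forall>p q. pathin Y p \<longrightarrow> pathin Y q \<longrightarrow> p 1 = q 0 \<longrightarrow>
        (w (loop_concat p q), w p @ w q) \<in> pres_eq (verts P) (raag_rel P)) \<and>
     (\<forall>x\<in>verts P. l x \<in> loops Y s \<and> (w (l x), [(x, True)]) \<in> pres_eq (verts P) (raag_rel P)) \<and>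
     (\<forall>p\<in>loops Y s. path_hom Y p (word_loop s l (w p))) \<and>
     (\<forall>x y. (x, y) \<in> arcs_ends P \<longrightarrow> path_hom Y (loop_concat (l x) (l y)) (loop_concat (l y) (l x)))"

lemma raag_words_exist:
  assumes iso: "fundamental_group Y s \<cong> raag P" and s: "s \<in> topspace Y" and c: "base_paths Y s c"
    and wf: "wf_digraph P"
  obtains l w where "raag_words Y s P l w"
proof -
  let ?G = "fundamental_group Y s" and ?V = "verts P" and ?R = "raag_rel P"
  let ?A = "presented_group ?V ?R"
  let ?c = "\<lambda>g. loop_homotopy Y s `` {g}" and ?k = "\<lambda>u. pres_eq ?V ?R `` {u}"
  note eq = equiv_loop_homotopy[of Y s]
  interpret A: group ?A by (rule group_presented_group)
  obtain h where h: "h \<in> iso ?G ?A"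
    using iso by (auto simp: is_iso_def raag_presented)
  have hm: "h (x \<otimes>\<^bsub>?G\<^esub> y) = h x \<otimes>\<^bsub>?A\<^esub> h y" if "x \<in> carrier ?G" "y \<in> carrier ?G" for x y
    using h that by (auto simp: iso_def hom_def)
  have bij: "bij_betw h (carrier ?G) (carrier ?A)"
    using h by (auto simp: iso_def)
  have carG: "?c g \<in> carrier ?G" if "g \<in> loops Y s" for g
    using that by (auto simp: fundamental_group_def quotient_def)
  have carG': "\<exists>g\<in>loops Y s. A = ?c g" if "A \<in> carrier ?G" for A
    using that by (auto simp: fundamental_group_def quotient_def)
  have carA: "?k u \<in> carrier ?A" if "u \<in> words ?V" for u
    using that by (auto simp: presented_group_def quotient_def)
  have carA': "\<exists>u\<in>words ?V. A = ?k u" if "A \<in> carrier ?A" for A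
    using that by (auto simp: presented_group_def quotient_def)
  have hc: "h (?c (loop_concat a b)) = h (?c a) \<otimes>\<^bsub>?A\<^esub> h (?c b)" if "a \<in> loops Y s" "b \<in> loops Y s" for a b
    using hm[OF carG carG, OF that] mult_fundamental_group[OF that] by simp
  have heq: "?c a = ?c b" if "path_hom Y a b" "a \<in> loops Y s" for a b
    by (rule equiv_class_eq[OF eq]) (use that in \<open>auto simp: loop_homotopy_iff loops_def\<close>)
  have hinj: "path_hom Y a b" if "h (?c a) = h (?c b)" "a \<in> loops Y s" "b \<in> loops Y s" for a b
  proof -
    have "?c a = ?c b"
      using bij that carG by (auto simp: bij_betw_def inj_on_def)
    hence "(a, b) \<in> loop_homotopy Y s"
      using eq_equiv_class[OF _ eq that(3)] by blast
    thus ?thesis by (simp add: loop_homotopy_iff)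
  qed
  have kinj: "(u, v) \<in> pres_eq ?V ?R" if "?k u = ?k v" "v \<in> words ?V" for u v
    using eq_equiv_class[OF that(1) equiv_pres_eq that(2)] .
  have one: "h (?c (\<lambda>_. s)) = ?k []"
  proof -
    have "(\<lambda>_. s) \<in> loops Y s" using s by (auto simp: loops_def)
    moreover have "loop_concat (\<lambda>_. s) (\<lambda>_. s) = (\<lambda>_. s)" by (auto simp: loop_concat_def)
    ultimately have "h (?c (\<lambda>_. s)) \<otimes>\<^bsub>?A\<^esub> h (?c (\<lambda>_. s)) = h (?c (\<lambda>_. s))" and
      "h (?c (\<lambda>_. s)) \<in> carrier ?A"
      using hc[of "\<lambda>_. s" "\<lambda>_. s"] bij carG by (auto simp: bij_betw_def)
    hence "h (?c (\<lambda>_. s)) = \<one>\<^bsub>?A\<^esub>"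
      using A.l_cancel_one by blast
    thus ?thesis by (simp add: presented_group_def)
  qed
  have "\<exists>g\<in>loops Y s. h (?c g) = ?k u" if "u \<in> words ?V" for u
  proof -
    have "?k u \<in> h ` carrier ?G" using bij carA[OF that] by (auto simp: bij_betw_def)
    then obtain A where "A \<in> carrier ?G" "?k u = h A" by blast
    with carG'[of A] show ?thesis by auto
  qed
  hence "\<exists>g\<in>loops Y s. h (?c g) = ?k [(x, True)]" if "x \<in> ?V" for x
    using that by simp
  hence "\<forall>x\<in>?V. \<exists>g. g \<in> loops Y s \<and> h (?c g) = ?k [(x, True)]"
    by blast
  then obtain l where l: "\<And>x. x \<in> ?V ==> l x \<in> loops Y s" "\<And>x. x \<in> ?V ==> h (?c (l x)) = ?k [(x, True)]"
    by metis
  \<comment> \<open>The loops \<open>l x\<close> are chosen for positive letters only; for an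
    inverse letter the image is forced by cancellation in the Artin group.\<close>
  have rl: "rev_path (l x) \<in> loops Y s" "h (?c (rev_path (l x))) = ?k [(x, False)]" if x: "x \<in> ?V" for x
  proof -
    show r: "rev_path (l x) \<in> loops Y s"
      using l(1)[OF x] by (auto simp: loops_def pathin_rev_path)
    have "path_hom Y (loop_concat (rev_path (l x)) (l x)) (\<lambda>_. s)"
      using path_hom_rev_left[of Y "l x"] l(1)[OF x] by (auto simp: loops_def)
    hence "h (?c (rev_path (l x))) \<otimes>\<^bsub>?A\<^esub> ?k [(x, True)] = ?k []"
      using hc[OF r l(1)[OF x]] heq[of "loop_concat (rev_path (l x)) (l x)"] one l[OF x]
        loop_concat_loops[OF r l(1)[OF x]] by simp
    moreover have "?k [(x, False)] \<otimes>\<^bsub>?A\<^esub> ?k [(x, True)] = ?k []"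
    proof -
      have w: "[(x, False)] \<in> words ?V" "[(x, True)] \<in> words ?V" "[] \<in> words ?V"
        using x by auto
      have "([] @ [(x, False), (x, \<not> False)] @ [], [] @ []) \<in> pres_eq ?V ?R"
        by (rule pres_eq_cancel) (use x in auto)
      hence "?k [(x, False), (x, True)] = ?k []"
        using equiv_class_eq[OF equiv_pres_eq] by fastforce
      thus ?thesis using mult_presented_group[OF w(1,2)] by simp
    qed
    moreover have "h (?c (rev_path (l x))) \<in> carrier ?A"
      using bij carG[OF r] by (auto simp: bij_betw_def)
    moreover have "?k [(x, False)] \<in> carrier ?A" "?k [(x, True)] \<in> carrier ?A"
      using x by (auto intro!: carA)
    ultimately show "h (?c (rev_path (l x))) = ?k [(x, False)]"
      by (metis A.right_cancel)
  qed
  have hw: "h (?c (word_loop s l u)) = ?k u" if "u \<in> words ?V" for u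
    using that
  proof (induction u)
    case Nil
    thus ?case using one by simp
  next
    case (Cons a u)
    obtain x b where a: "a = (x, b)" by force
    have x: "x \<in> ?V" and u: "u \<in> words ?V" using Cons by (auto simp: a)
    have wl: "word_loop s l u \<in> loops Y s"
      by (rule word_loop_loop[where V = ?V]) (use l(1) u s in auto)
    have xb: "[(x, b)] \<in> words ?V" using x by auto
    have "h (?c (loop_concat q (word_loop s l u))) = ?k ((x, b) # u)"
      if "q \<in> loops Y s" "h (?c q) = ?k [(x, b)]" for q
      using hc[OF that(1) wl] that(2) Cons.IH mult_presented_group[OF xb u] by simp
    thus ?case
      using l[OF x] rl[OF x] by (auto simp: a)
  qed
  have "\<exists>u. u \<in> words ?V \<and> h (?c g) = ?k u" if "g \<in> loops Y s" for g
  proof -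
    have "h (?c g) \<in> carrier ?A"
      using bij_betw_apply[OF bij carG[OF that]] .
    from carA'[OF this] show ?thesis by blast
  qed
  hence "\<forall>g\<in>loops Y s. \<exists>u. u \<in> words ?V \<and> h (?c g) = ?k u"
    by blast
  then obtain W where W: "\<And>g. g \<in> loops Y s ==> W g \<in> words ?V" "\<And>g. g \<in> loops Y s ==> h (?c g) = ?k (W g)"
    by metis
  have cl: "conj_loop c p \<in> loops Y s" if "pathin Y p" for p
    using conj_loop_loop[OF c that] by (auto simp: loops_def)
  \<comment> \<open>Paths that are not loops at \<open>s\<close> receive a word through their
    closure \<open>conj_loop c p\<close>.\<close>
  define w where "w p = W (conj_loop c p)" for p
  have lw: "h (?c p) = ?k (w p)" if p: "p \<in> loops Y s" for p
  proof -
    have "path_hom Y (conj_loop c p) p"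
      using conj_loop_of_loop[OF c] p by (auto simp: loops_def)
    moreover have "pathin Y p" using p by (auto simp: loops_def)
    ultimately show ?thesis
      using W(2)[OF cl] heq[OF _ cl] by (metis w_def)
  qed
  have "raag_words Y s P l w"
    unfolding raag_words_def
  proof (intro conjI allI impI ballI)
    show "w p \<in> words ?V" if "pathin Y p" for p
      unfolding w_def by (rule W(1)[OF cl[OF that]])
    show "(w p, w q) \<in> pres_eq ?V ?R" if "path_hom Y p q" for p q
    proof (rule kinj)
      have "pathin Y p" "pathin Y q" using path_hom_pathin[OF that] by auto
      thus "w q \<in> words ?V" "?k (w p) = ?k (w q)"
        using W cl heq[OF conj_loop_hom[OF c that]] by (metis w_def)+
    qed
    show "(w (loop_concat p q), w p @ w q) \<in> pres_eq ?V ?R" if "pathin Y p" "pathin Y q" "p 1 = q 0" for p q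
    proof (rule kinj)
      note cp = cl[OF that(1)] and cq = cl[OF that(2)] and cpq = cl[OF pathin_loop_concat[OF that]]
      have wpq: "w p \<in> words ?V" "w q \<in> words ?V" by (simp_all only: w_def W(1) cp cq)
      thus "w p @ w q \<in> words ?V" by simp
      have "?k (w (loop_concat p q)) = h (?c (conj_loop c (loop_concat p q)))"
        unfolding w_def using W(2)[OF cpq] by simp
      also have "\<dots> = h (?c (loop_concat (conj_loop c p) (conj_loop c q)))"
        using heq[OF conj_loop_concat[OF c that] cpq] by simp
      also have "\<dots> = ?k (w p) \<otimes>\<^bsub>?A\<^esub> ?k (w q)"
        unfolding hc[OF cp cq] w_def using W(2)[OF cp] W(2)[OF cq] by simp
      also have "\<dots> = ?k (w p @ w q)"
        by (rule mult_presented_group[OF wpq])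
      finally show "?k (w (loop_concat p q)) = ?k (w p @ w q)" .
    qed
    show "l x \<in> loops Y s" if "x \<in> ?V" for x by (rule l(1)[OF that])
    show "(w (l x), [(x, True)]) \<in> pres_eq ?V ?R" if "x \<in> ?V" for x
      by (rule kinj) (use lw[OF l(1)[OF that]] l(2)[OF that] that in auto)
    show "path_hom Y p (word_loop s l (w p))" if "p \<in> loops Y s" for p
    proof (rule hinj[OF _ that])
      have "w p \<in> words ?V" unfolding w_def using W(1) cl that by (auto simp: loops_def)
      thus "h (?c p) = h (?c (word_loop s l (w p)))" "word_loop s l (w p) \<in> loops Y s"
        using hw lw[OF that] word_loop_loop[of ?V l Y s "w p", OF l(1) _ s] by simp_all
    qed
    show "path_hom Y (loop_concat (l x) (l y)) (loop_concat (l y) (l x))" if xy: "(x, y) \<in> arcs_ends P" for x y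
    proof (rule hinj)
      have x: "x \<in> ?V" and y: "y \<in> ?V"
        using xy wf by (auto simp: arcs_ends_def arc_to_ends_def wf_digraph.tail_in_verts wf_digraph.head_in_verts)
      thus "loop_concat (l x) (l y) \<in> loops Y s" "loop_concat (l y) (l x) \<in> loops Y s"
        using l(1) by (auto intro: loop_concat_loops)
      have w: "[(x, True)] \<in> words ?V" "[(y, True)] \<in> words ?V" using x y by auto
      have "([(x, True), (y, True)], [(y, True), (x, True)]) \<in> ?R"
        using xy by (auto simp: raag_rel_def)
      hence "([] @ [(x, True), (y, True)] @ [], [] @ [(y, True), (x, True)] @ []) \<in> pres_eq ?V ?R"
        by (intro pres_eq_relator) (use x y in auto)
      hence "?k [(x, True), (y, True)] = ?k [(y, True), (x, True)]"
        using equiv_class_eq[OF equiv_pres_eq] by fastforce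
      thus "h (?c (loop_concat (l x) (l y))) = h (?c (loop_concat (l y) (l x)))"
        using hc[OF l(1)[OF x] l(1)[OF y]] hc[OF l(1)[OF y] l(1)[OF x]] l(2)[OF x] l(2)[OF y]
          mult_presented_group[OF w] mult_presented_group[OF w(2,1)] by simp
    qed
  qed
  thus thesis by (rule that)
qed

text \<open>The vector of exponent sums of a word, that is, its class in the abelianization; this is
  the class \<open>m\<close> of the overview before normalisation near a wall.\<close>

definition ab :: "'c word => 'c => int" where
  "ab = ev (\<lambda>x v. if v = x then 1 else 0)"

lemma ab_pres_eq:
  assumes "(u, v) \<in> pres_eq (verts P) (raag_rel P)" shows "ab u = ab v"
  unfolding ab_def by (rule ev_pres_eq[OF assms]) (auto simp: raag_rel_def add.commute)

lemma path_functor_ab: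
  assumes w: "raag_words Y s P l w"
  shows "path_functor Y (\<lambda>p. ab (w p))"
proof -
  show ?thesis
    unfolding path_functor_def
  proof (intro conjI allI impI)
    fix p q assume "pathin Y p" "pathin Y q" "p 1 = q 0"
    hence "(w (loop_concat p q), w p @ w q) \<in> pres_eq (verts P) (raag_rel P)"
      using w unfolding raag_words_def by blast
    from ab_pres_eq[OF this] show "ab (w (loop_concat p q)) = ab (w p) + ab (w q)"
      by (simp add: ab_def)
  next
    fix p q assume "path_hom Y p q"
    thus "ab (w p) = ab (w q)"
      using w unfolding raag_words_def by (blast intro: ab_pres_eq)
  qed
qed

lemma ab_generator:
  assumes w: "raag_words Y s P l w" and x: "x \<in> verts P"
  shows "ab (w (l x)) = (\<lambda>v. if v = x then 1 else 0)"
proof -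
  have "(w (l x), [(x, True)]) \<in> pres_eq (verts P) (raag_rel P)"
    using w x unfolding raag_words_def by blast
  from ab_pres_eq[OF this] show ?thesis by (simp add: ab_def)
qed

lemma path_functor_eq:
  assumes "path_functor Y G" "\<And>p. pathin Y p ==> F p = G p"
  shows "path_functor Y F"
  unfolding path_functor_def
proof (intro conjI allI impI)
  fix p q assume "pathin Y p" "pathin Y q" "p 1 = q 0"
  thus "F (loop_concat p q) = F p + F q"
    using assms(2) pathin_loop_concat[of Y p q] path_functor_concat[OF assms(1)] by simp
next
  fix p q assume "path_hom Y p q"
  thus "F p = F q"
    using assms(2) path_hom_pathin[of Y p q] path_functor_hom[OF assms(1)] by metis
qed

lemma path_functor_subtopology:
  assumes "path_functor Y F" shows "path_functor (subtopology Y U) F"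
proof -
  have "path_hom Y p q" if "path_hom (subtopology Y U) p q" for p q
    using that unfolding path_hom_def by (auto simp: continuous_map_in_subtopology)
  thus ?thesis
    using assms unfolding path_functor_def by (auto simp: pathin_def continuous_map_in_subtopology)
qed

lemma path_functor_compose:
  assumes "path_functor Y F" "\<And>a b. h (a + b) = h a + h b"
  shows "path_functor Y (\<lambda>p. h (F p))"
  using assms unfolding path_functor_def by auto

lemma path_functor_coboundary: "path_functor Y (\<lambda>p. - g (p 0) + g (p 1))"
  unfolding path_functor_def
proof (intro conjI allI impI)
  show "- g (p 0) + g (p 1) = - g (q 0) + g (q 1)" if "path_hom Y p q" for p q
    using path_hom_pathin(3,4)[OF that] by simp
qed (simp add: add.assoc[symmetric])

text \<open>Adding differences of a potential leaves the values on loops unchanged. The freedom is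
  used to make the abelianization vanish identically near a wall.\<close>

lemma path_functor_gauge:
  fixes g :: "'y => 'k::ab_group_add"
  assumes "path_functor Y F"
  shows "path_functor Y (\<lambda>p. F p + (- g (p 0) + g (p 1)))"
  using assms path_functor_coboundary[of Y g] unfolding path_functor_def
  by (simp add: algebra_simps)

section \<open>Walls: an isolated degree one class\<close>

text \<open>A Heisenberg group: the central extension by \<open>hz\<close> with cocycle
  \<open>chi a * hm b\<close>. The components \<open>hm\<close> and \<open>hz\<close> are functions
  so that all coordinates of the abelianization are treated at once.\<close>

datatype 'c heis = Heis (chi: int) (hm: "'c => int") (hz: "'c => int")

instantiation heis :: (type) group_add
begin

definition "0 = Heis 0 0 0"
definition "a + b = Heis (chi a + chi b) (hm a + hm b) (\<lambda>v. hz a v + hz b v + chi a * hm b v)"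
definition "- (a :: 'a heis) = Heis (- chi a) (- hm a) (\<lambda>v. - hz a v + chi a * hm a v)"
definition "(a :: 'a heis) - b = a + - b"

instance
  by standard
    (auto simp: zero_heis_def plus_heis_def uminus_heis_def minus_heis_def algebra_simps
      intro!: heis.expand)

end

lemma heis_simps [simp]: "chi (a + b) = chi a + chi b" "hm (a + b) = hm a + hm b"
  "hz (a + b) v = hz a v + hz b v + chi a * hm b v"
  by (auto simp: plus_heis_def)

text \<open>The last step of a walk that reaches \<open>x\<close> from another vertex supplies the
  neighbour. Thus every generator commutes with a different generator.\<close>

lemma connected_neighbour:
  assumes P: "graph P" "Digraph_Component.connected P" "card (verts P) \<ge> 2" and x: "x \<in> verts P"
  shows "\<exists>y\<in>verts P. y \<noteq> x \<and> ((x, y) \<in> arcs_ends P \<or> (y, x) \<in> arcs_ends P)"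
proof -
  interpret graph P by fact
  have "card {x} < card (verts P)" using P(3) by simp
  hence "\<not> verts P \<subseteq> {x}"
    by (meson card_mono finite.emptyI finite_insert not_less)
  then obtain z where z: "z \<in> verts P" "z \<noteq> x" by blast
  have "z \<rightarrow>\<^sup>*\<^bsub>mk_symmetric P\<^esub> x"
    using P(2) x z by (auto simp: Digraph_Component.connected_def strongly_connected_def)
  hence "(z, x) \<in> rtrancl_on (verts P) (parcs (mk_symmetric P))"
    by (simp add: reachable_def)
  thus ?thesis
  proof (cases rule: rtrancl_on.cases)
    case rtrancl_on_refl
    thus ?thesis using z by simp
  next
    case (rtrancl_on_into_rtrancl_on y)
    then obtain e where e: "e \<in> arcs P" "(y, x) = (tail P e, head P e) \<or> (y, x) = (head P e, tail P e)"
      by (auto simp: parcs_mk_symmetric)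
    hence "(x, y) \<in> arcs_ends P \<or> (y, x) \<in> arcs_ends P"
      by (auto simp: arcs_ends_def arc_to_ends_def)
    moreover have "y \<noteq> x" "y \<in> verts P"
      using e no_loops[OF e(1)] by auto
    ultimately show ?thesis by blast
  qed
qed

text \<open>\<open>U\<close> is a neighbourhood of the wall in which functors are differences of a
  potential, and \<open>W\<close> is the complement of the wall. The function \<open>f\<close> tells
  the two sides apart: it is constant along paths in \<open>U\<close> that avoid the wall. The path
  \<open>a\<close> crosses the wall and \<open>b\<close> returns without crossing.\<close>

theorem wall_not_raag:
  fixes P :: "('c, 'd) pre_digraph" and f :: "'y => int"
  assumes P: "graph P" "Digraph_Component.connected P" "card (verts P) \<ge> 2"
    and Y: "path_connected_space Y" "s \<in> topspace Y"
    and U: "openin Y U" "openin Y W" "topspace Y \<subseteq> U \<union> W"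
    and pot: "\<And>F :: (real => 'y) => 'c => int. path_functor Y F ==>
        \<exists>g. \<forall>p. pathin (subtopology Y U) p \<longrightarrow> F p = g (p 0) - g (p 1)"
    and f: "\<And>p. pathin (subtopology Y (U \<inter> W)) p ==> f (p 0) = f (p 1)"
    and a: "pathin (subtopology Y U) a" and b: "pathin (subtopology Y W) b"
    and ab: "a 1 = b 0" "b 1 = a 0" "f (a 0) \<noteq> f (a 1)"
  shows "\<not> fundamental_group Y s \<cong> raag P"
proof
  assume iso: "fundamental_group Y s \<cong> raag P"
  interpret P: graph P by fact
  obtain c where c: "base_paths Y s c" using base_paths_exist[OF Y] .
  obtain l w where w: "raag_words Y s P l w"
    using raag_words_exist[OF iso Y(2) c P.wf_digraph_axioms] .
  define F where "F = (\<lambda>p. ab (w p))"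
  have F: "path_functor Y F" unfolding F_def by (rule path_functor_ab[OF w])
  obtain g where g: "\<And>p. pathin (subtopology Y U) p ==> F p = g (p 0) - g (p 1)"
    using pot[OF F] by blast
  define m where "m p = F p + (- g (p 0) + g (p 1))" for p
  have m: "path_functor Y m" unfolding m_def[abs_def] by (rule path_functor_gauge[OF F])
  have m0: "m p = 0" if "pathin (subtopology Y U) p" for p
    using g[OF that] by (simp add: m_def)
  have sub: "pathin (subtopology Y A) p \<longleftrightarrow> pathin Y p \<and> p ` {0..1} \<subseteq> A" for A p
    by (auto simp: pathin_def continuous_map_in_subtopology)
  \<comment> \<open>On \<open>U\<close> the normalised class \<open>m\<close> is zero, and on
    \<open>W\<close> nothing crosses the wall. So in either set one factor of the cocycle vanishes
    and the Heisenberg law is plain addition; on the overlap both values are trivial, so the two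
    definitions agree there.\<close>
  define Q where "Q p = (if p ` {0..1} \<subseteq> U then Heis (- f (p 0) + f (p 1)) 0 0 else Heis 0 (m p) 0)" for p
  have QU: "path_functor (subtopology Y U) Q"
  proof (rule path_functor_eq)
    show "path_functor (subtopology Y U) (\<lambda>p. Heis (- f (p 0) + f (p 1)) 0 0 :: 'c heis)"
      using path_functor_compose[OF path_functor_coboundary[of "subtopology Y U" f], of "\<lambda>i. Heis i 0 0"]
      by (simp add: plus_heis_def fun_eq_iff)
  qed (auto simp: Q_def sub)
  have QW: "Q p = Heis 0 (m p) 0" if p: "pathin (subtopology Y W) p" for p
  proof (cases "p ` {0..1} \<subseteq> U")
    case True
    with p have "pathin (subtopology Y (U \<inter> W)) p" "pathin (subtopology Y U) p"
      by (auto simp: sub)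
    with f m0 True show ?thesis by (auto simp: Q_def)
  qed (simp add: Q_def)
  have "path_functor (subtopology Y W) Q"
  proof (rule path_functor_eq[OF _ QW])
    show "path_functor (subtopology Y W) (\<lambda>p. Heis 0 (m p) 0)"
      using path_functor_compose[OF path_functor_subtopology[OF m, of W], of "\<lambda>i. Heis 0 i 0"]
      by (simp add: plus_heis_def fun_eq_iff)
  qed
  hence Q: "path_functor (subtopology Y T) Q" if "T \<in> {U, W}" for T
    using QU that by blast
  have op: "openin Y T" if "T \<in> {U, W}" for T using U that by blast
  have cov: "topspace Y \<subseteq> \<Union>{U, W}" using U by auto
  obtain \<Phi> where \<Phi>: "path_functor Y \<Phi>" "\<And>T p. T \<in> {U, W} ==> pathin (subtopology Y T) p ==> \<Phi> p = Q p"
    by (rule glue_path_functor[OF op cov Q]) blast+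
  have hm: "hm (\<Phi> p) = m p" if "pathin Y p" for p
  proof (rule path_functor_unique[OF op cov _ m _ that])
    show "path_functor Y (\<lambda>p. hm (\<Phi> p))"
      by (rule path_functor_compose[OF \<Phi>(1), where h = hm]) simp
    fix T q assume T: "T \<in> {U, W}" and q: "pathin (subtopology Y T) q"
    show "hm (\<Phi> q) = m q"
    proof (cases "T = W")
      case True
      thus ?thesis using \<Phi>(2)[OF T q] QW q by simp
    next
      case False
      hence "pathin (subtopology Y U) q" using T q by auto
      thus ?thesis using \<Phi>(2)[OF T q] m0 by (auto simp: Q_def sub)
    qed
  qed
  have X: "path_functor Y (\<lambda>p. chi (\<Phi> p))"
    by (rule path_functor_compose[OF \<Phi>(1)]) simp
  have l: "l x \<in> loops Y s" if "x \<in> verts P" for x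
    using w that by (auto simp: raag_words_def)
  have lm: "m (l x) = (\<lambda>v. if v = x then 1 else 0)" if "x \<in> verts P" for x
    using ab_generator[OF w that] l[OF that] by (simp add: m_def F_def loops_def)
  have zero: "chi (\<Phi> (l x)) = 0" if x: "x \<in> verts P" for x
  proof -
    obtain y where y: "y \<in> verts P" "y \<noteq> x" "(x, y) \<in> arcs_ends P \<or> (y, x) \<in> arcs_ends P"
      using connected_neighbour[OF P x] by blast
    hence "path_hom Y (loop_concat (l x) (l y)) (loop_concat (l y) (l x)) \<or>
       path_hom Y (loop_concat (l y) (l x)) (loop_concat (l x) (l y))"
      using w by (auto simp: raag_words_def)
    hence "\<Phi> (loop_concat (l x) (l y)) = \<Phi> (loop_concat (l y) (l x))"
      using path_functor_hom[OF \<Phi>(1)] by metis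
    hence "\<Phi> (l x) + \<Phi> (l y) = \<Phi> (l y) + \<Phi> (l x)"
      using path_functor_concat[OF \<Phi>(1)] l[OF x] l[OF y(1)] by (simp add: loops_def)
    \<comment> \<open>In the central coordinate \<open>y\<close> the two orders contribute the
      products \<open>chi (\<Phi> (l x)) * 1\<close> and \<open>chi (\<Phi> (l y)) * 0\<close>,
      because \<open>m (l x)\<close> has no component at \<open>y\<close>, which differs from
      \<open>x\<close>.\<close>
    hence "hz (\<Phi> (l x) + \<Phi> (l y)) y = hz (\<Phi> (l y) + \<Phi> (l x)) y" by simp
    thus ?thesis
      using hm[of "l x"] hm[of "l y"] lm[OF x] lm[OF y(1)] l[OF x] l[OF y(1)] y(2)
      by (simp add: loops_def)
  qed
  have pa: "pathin Y a" "pathin Y b" using a b by (auto simp: sub)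
  \<comment> \<open>The loop that crosses the wall once. Written as a word in the generators it must
    have \<open>chi\<close> equal to 0, while counting the crossing gives a nonzero value.\<close>
  define q where "q = conj_loop c (loop_concat a b)"
  have pab: "pathin Y (loop_concat a b)" by (rule pathin_loop_concat[OF pa ab(1)])
  have q: "q \<in> loops Y s"
    unfolding q_def using conj_loop_loop[OF c pab] by (auto simp: loops_def)
  have "chi (\<Phi> q) = chi (\<Phi> (word_loop s l (w q)))"
    using path_functor_hom[OF X] w q by (auto simp: raag_words_def)
  also have "\<dots> = ev (\<lambda>x. chi (\<Phi> (l x))) (w q)"
    by (rule path_functor_word_loop[OF X l _ Y(2)]) (use w q in \<open>auto simp: raag_words_def loops_def\<close>)
  also have "\<dots> = 0"
  proof -
    have "w q \<in> words (verts P)" using w q by (auto simp: raag_words_def loops_def)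
    moreover have "ev (\<lambda>x. chi (\<Phi> (l x))) v = 0" if "v \<in> words (verts P)" for v
      using that by (induction v) (auto simp: zero)
    ultimately show ?thesis by blast
  qed
  finally have "chi (\<Phi> q) = 0" .
  moreover have "chi (\<Phi> q) = chi (\<Phi> (loop_concat a b))"
    unfolding q_def using path_functor_conj_loop[OF c X pab] ab by simp
  moreover have "chi (\<Phi> (loop_concat a b)) = chi (\<Phi> a) + chi (\<Phi> b)"
    by (rule path_functor_concat[OF X pa ab(1)])
  moreover have "chi (\<Phi> a) = f (a 1) - f (a 0)"
    using \<Phi>(2)[of U a] a by (auto simp: Q_def sub)
  moreover have "chi (\<Phi> b) = 0"
    using \<Phi>(2)[of W b] QW[OF b] b by auto
  ultimately show False using ab(3) by simp
qed

text \<open>If functors are differences of a potential, every loop has class zero in the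
  abelianization, whereas a generator has coefficient 1 at itself.\<close>

theorem contractible_not_raag:
  fixes P :: "('c, 'd) pre_digraph"
  assumes P: "graph P" "card (verts P) \<ge> 2"
    and Y: "path_connected_space Y" "s \<in> topspace Y"
    and pot: "\<And>F :: (real => 'y) => 'c => int. path_functor Y F ==>
        \<exists>g. \<forall>p. pathin Y p \<longrightarrow> F p = g (p 0) - g (p 1)"
  shows "\<not> fundamental_group Y s \<cong> raag P"
proof
  assume iso: "fundamental_group Y s \<cong> raag P"
  interpret P: graph P by fact
  obtain c where c: "base_paths Y s c" using base_paths_exist[OF Y] .
  obtain l w where w: "raag_words Y s P l w"
    using raag_words_exist[OF iso Y(2) c P.wf_digraph_axioms] .
  obtain x where x: "x \<in> verts P" using P(2) by fastforce
  hence l: "pathin Y (l x)" "l x 0 = l x 1"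
    using w by (auto simp: raag_words_def loops_def)
  obtain g where "\<And>p. pathin Y p ==> ab (w p) = g (p 0) - g (p 1)"
    using pot[OF path_functor_ab[OF w]] by blast
  from this[OF l(1)] l(2) have "ab (w (l x)) = 0" by simp
  hence "ab (w (l x)) x = 0" by simp
  with ab_generator[OF w x] show False by simp
qed


section \<open>A Clifford algebra and lifts of permutations\<close>

definition sc :: "real => (nat set => real) => nat set => real" where
  "sc c f = (\<lambda>A. c * f A)"

definition flip :: "nat => nat set => nat set" where
  "flip k A = (if k \<in> A then A - {k} else insert k A)"

text \<open>Clifford generators in Jordan-Wigner form: toggle \<open>k\<close> in the set, with a
  sign that counts the smaller elements. They act on functions of arbitrary sets of naturals, so the
  operators are the same for every \<open>n\<close>.\<close>

definition cl :: "nat => (nat set => real) => nat set => real" where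
  "cl k f = (\<lambda>A. (-1) ^ card {j \<in> A. j < k} * f (flip k A))"

lemma sc_simps [simp]: "sc 1 f = f" "sc a (sc b f) = sc (a * b) f" "sc 0 f = 0" "sc c 0 = 0"
  "sc c (f + g) = sc c f + sc c g" "sc c (- f) = - sc c f"
  by (auto simp: sc_def fun_eq_iff algebra_simps)

lemma sc_minus: "sc (- c) f = - sc c f" and sc_add: "sc (a + b) f = sc a f + sc b f"
  by (auto simp: sc_def fun_eq_iff algebra_simps)

lemma cl_add [simp]: "cl k (f + g) = cl k f + cl k g" and cl_sc [simp]: "cl k (sc c f) = sc c (cl k f)"
  and cl_0 [simp]: "cl k 0 = 0" and cl_minus [simp]: "cl k (- f) = - cl k f"
  by (auto simp: cl_def sc_def fun_eq_iff algebra_simps)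

lemma cl_diff [simp]: "cl k (f - g) = cl k f - cl k g"
  by (auto simp: cl_def fun_eq_iff algebra_simps)

lemma cl_sq [simp]: "cl k (cl k f) = f"
proof -
  have "{j \<in> flip k A. j < k} = {j \<in> A. j < k}" "flip k (flip k A) = A" for A
    by (auto simp: flip_def)
  thus ?thesis
    by (auto simp: cl_def fun_eq_iff mult.assoc[symmetric] power_add[symmetric])
qed

lemma cl_anti:
  assumes "k \<noteq> l" shows "cl k (cl l f) = - cl l (cl k f)"
proof -
  have lt: "cl k (cl l f) = - cl l (cl k f)" if kl: "k < l" for k l f
  proof
    fix A
    have 1: "{j \<in> flip l A. j < k} = {j \<in> A. j < k}" using kl by (auto simp: flip_def)
    have 2: "flip k (flip l A) = flip l (flip k A)" using kl by (auto simp: flip_def)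
    have fin: "finite {j \<in> A. j < l}" by (rule finite_subset[of _ "{..<l}"]) auto
    have 3: "(-1::real) ^ card {j \<in> flip k A. j < l} = - ((-1) ^ card {j \<in> A. j < l})"
    proof (cases "k \<in> A")
      case True
      hence "{j \<in> A. j < l} = insert k {j \<in> flip k A. j < l}" "k \<notin> {j \<in> flip k A. j < l}"
        using kl by (auto simp: flip_def)
      moreover have "finite {j \<in> flip k A. j < l}" by (rule finite_subset[of _ "{..<l}"]) auto
      ultimately show ?thesis by simp
    next
      case False
      hence "{j \<in> flip k A. j < l} = insert k {j \<in> A. j < l}" "k \<notin> {j \<in> A. j < l}"
        using kl by (auto simp: flip_def)
      with fin show ?thesis by simp
    qed
    show "cl k (cl l f) A = (- cl l (cl k f)) A"
      by (simp add: cl_def 1 2 3)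
  qed
  show ?thesis
  proof (cases "k < l")
    case True
    thus ?thesis by (rule lt)
  next
    case False
    with assms have "l < k" by simp
    from lt[OF this, of f] show ?thesis by simp
  qed
qed

text \<open>The homogeneous elements of the algebra generated by the \<open>cl k\<close> with
  \<open>k \<in> J\<close>, as operators. The real parameter is the parity, 1 for even and -1 for
  odd. Zero has every parity, so that a component of a decomposition may vanish.\<close>

inductive Alg :: "nat set => real => ((nat set => real) => nat set => real) => bool" for J where
  Alg_zero: "Alg J s (\<lambda>f. 0)"
| Alg_unit: "Alg J 1 (\<lambda>f. f)"
| Alg_gen: "Alg J s T ==> k \<in> J ==> Alg J (- s) (\<lambda>f. cl k (T f))"
| Alg_add: "Alg J s T ==> Alg J s T' ==> Alg J s (\<lambda>f. T f + T' f)"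
| Alg_scale: "Alg J s T ==> Alg J s (\<lambda>f. sc c (T f))"

lemma Alg_linear:
  assumes "Alg J s T" shows "T (f + g) = T f + T g" "T (sc c f) = sc c (T f)"
  using assms by (induction) (auto simp: mult.commute)

lemma Alg_comp:
  assumes "Alg J s T" "Alg J s' T'" shows "Alg J (s * s') (\<lambda>f. T (T' f))"
  using assms
proof (induction)
  case (Alg_gen s T k)
  hence "Alg J (- (s * s')) (\<lambda>f. cl k (T (T' f)))"
    by (intro Alg.Alg_gen) auto
  thus ?case by simp
qed (auto intro: Alg.intros)

text \<open>A generator outside \<open>J\<close> anticommutes with every factor, so moving it past
  \<open>T\<close> costs the parity of \<open>T\<close>.\<close>

lemma Alg_anticomm:
  assumes "Alg J s T" "k \<notin> J" shows "cl k (T f) = sc s (T (cl k f))"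
  using assms
proof (induction)
  case (Alg_gen s T j)
  hence "cl k (cl j (T f)) = - cl j (cl k (T f))"
    by (intro cl_anti) auto
  thus ?case using Alg_gen by (simp add: sc_minus)
qed (auto simp: mult.commute)

text \<open>The generator \<open>cl k\<close> can be moved to the left of every product, where its
  square disappears; what remains is linear in it with coefficients over \<open>J\<close>.\<close>

lemma Alg_split:
  assumes "Alg (insert k J) s T" "k \<notin> J"
  shows "\<exists>T0 T1. Alg J s T0 \<and> Alg J (- s) T1 \<and> (\<forall>f. T f = T0 f + cl k (T1 f))"
  using assms
proof (induction)
  case (Alg_zero s)
  have "Alg J s (\<lambda>f. 0) \<and> Alg J (- s) (\<lambda>f. 0) \<and> (\<forall>f::nat set => real. 0 = 0 + cl k 0)"
    by (simp add: Alg.Alg_zero)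
  thus ?case
    by (rule_tac exI[of _ "\<lambda>f. 0"], rule_tac exI[of _ "\<lambda>f. 0"])
next
  case Alg_unit
  have "Alg J 1 (\<lambda>f. f) \<and> Alg J (- 1) (\<lambda>f. 0) \<and> (\<forall>f. f = f + cl k 0)"
    by (simp add: Alg.Alg_zero Alg.Alg_unit)
  thus ?case
    by (rule_tac exI[of _ "\<lambda>f. f"], rule_tac exI[of _ "\<lambda>f. 0"])
next
  case (Alg_gen s T j)
  then obtain T0 T1 where T: "Alg J s T0" "Alg J (- s) T1" "\<And>f. T f = T0 f + cl k (T1 f)"
    by blast
  show ?case
  proof (cases "j = k")
    case True
    show ?thesis
      by (rule exI[of _ T1], rule exI[of _ T0]) (use T True in \<open>auto simp: add.commute\<close>)
  next
    case False
    hence j: "j \<in> J" using Alg_gen by simp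
    have "Alg J (- (- s)) (\<lambda>f. sc (-1) (cl j (T1 f)))"
      by (intro Alg.Alg_scale Alg.Alg_gen T j)
    moreover have "cl j (T f) = cl j (T0 f) + cl k (sc (-1) (cl j (T1 f)))" for f
      using cl_anti[OF False, of "T1 f"] by (simp add: T(3) sc_minus)
    ultimately show ?thesis
      using Alg.Alg_gen[OF T(1) j] by blast
  qed
next
  case (Alg_add s T T')
  then obtain T0 T1 T0' T1' where T: "Alg J s T0" "Alg J (- s) T1" "\<And>f. T f = T0 f + cl k (T1 f)"
    "Alg J s T0'" "Alg J (- s) T1'" "\<And>f. T' f = T0' f + cl k (T1' f)"
    by blast
  show ?case
    by (rule exI[of _ "\<lambda>f. T0 f + T0' f"], rule exI[of _ "\<lambda>f. T1 f + T1' f"])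
       (intro conjI allI Alg.Alg_add T, simp only: T(3,6) cl_add ac_simps)
next
  case (Alg_scale s T c)
  then obtain T0 T1 where T: "Alg J s T0" "Alg J (- s) T1" "\<And>f. T f = T0 f + cl k (T1 f)"
    by blast
  show ?case
    by (rule exI[of _ "\<lambda>f. sc c (T0 f)"], rule exI[of _ "\<lambda>f. sc c (T1 f)"])
       (use T in \<open>auto intro: Alg.Alg_scale\<close>)
qed

text \<open>Split off one generator: the even part \<open>T0\<close> commutes with
  \<open>cl k\<close> while the odd part \<open>T1\<close> anticommutes with it. Commuting with
  \<open>cl k\<close> thus forces \<open>T1\<close> to equal its negative, and induction continues
  with \<open>T0\<close>.\<close>

lemma Alg_center:
  assumes "finite J" "Alg J 1 T" "\<And>k f. k \<in> J ==> T (cl k f) = cl k (T f)"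
  shows "\<exists>c. \<forall>f. T f = sc c f"
  using assms
proof (induction J arbitrary: T rule: finite_induct)
  case empty
  have "\<exists>c. \<forall>f. T f = sc c f" if "Alg {} s T" for s T
    using that
  proof (induction)
    case (Alg_zero s)
    show ?case by (intro exI[of _ 0]) simp
  next
    case Alg_unit
    show ?case by (intro exI[of _ 1]) simp
  next
    case (Alg_add s T T')
    thus ?case by (metis sc_add)
  next
    case (Alg_scale s T c)
    thus ?case by (metis sc_simps(2))
  qed auto
  with empty show ?case by blast
next
  case (insert k J)
  obtain T0 T1 where T: "Alg J 1 T0" "Alg J (-1) T1" "\<And>f. T f = T0 f + cl k (T1 f)"
    using Alg_split[OF insert.prems(1) insert.hyps(2)] by auto
  have T1: "T1 f = 0" for f
  proof -
    have a: "cl k (T0 f) = T0 (cl k f)"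
      using Alg_anticomm[OF T(1) insert.hyps(2)] by simp
    have "cl k (T1 f) = - T1 (cl k f)"
      using Alg_anticomm[OF T(2) insert.hyps(2)] by (simp add: sc_minus)
    hence b: "cl k (T1 (cl k f)) = - T1 f"
      using cl_sq[of k "T1 f"] by (metis cl_minus minus_minus)
    have "T0 (cl k f) + cl k (T1 (cl k f)) = cl k (T0 f) + T1 f"
      using insert.prems(2)[OF insertI1, of f] unfolding T(3) by (simp only: cl_add cl_sq)
    hence "- T1 f = T1 f" by (simp add: a b)
    thus ?thesis by (auto simp: fun_eq_iff)
  qed
  hence "T = T0" using T(3) by auto
  thus ?case using insert T(1) by simp
qed

text \<open>The twisted action of a pin group. Conjugation by \<open>cl i - cl j\<close> sends every
  generator to minus the generator with transposed index; building this sign and the parity into the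
  definition makes lifts closed under composition.\<close>

definition lift :: "nat => (nat => nat) => ((nat set => real) => nat set => real) => bool" where
  "lift n \<pi> T \<longleftrightarrow> Alg {1..n} (sign \<pi>) T \<and> (\<forall>k\<in>{1..n}. \<forall>f. T (cl k f) = sc (sign \<pi>) (cl (\<pi> k) (T f)))"

lemma lift_id: "lift n id (\<lambda>f. f)"
  by (simp add: lift_def Alg_unit)

lemma lift_scale: "lift n \<pi> T ==> lift n \<pi> (\<lambda>f. sc c (T f))"
  by (simp add: lift_def Alg_scale mult.commute)

lemma lift_comp:
  assumes p: "\<pi> permutes {1..n}" "\<pi>' permutes {1..n}" and T: "lift n \<pi> T" "lift n \<pi>' T'"
  shows "lift n (\<pi> \<circ> \<pi>') (\<lambda>f. T (T' f))"
proof -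
  have s: "sign (\<pi> \<circ> \<pi>') = sign \<pi> * sign \<pi>'"
    using p by (intro sign_compose permutes_imp_permutation[of "{1..n}"]) auto
  have "T (T' (cl k f)) = sc (sign \<pi> * sign \<pi>') (cl (\<pi> (\<pi>' k)) (T (T' f)))" if k: "k \<in> {1..n}" for k f
  proof -
    have "\<pi>' k \<in> {1..n}" using permutes_in_image[OF p(2)] k by simp
    thus ?thesis
      using T k Alg_linear(2)[of "{1..n}" "sign \<pi>" T] by (simp add: lift_def mult.commute)
  qed
  moreover have "Alg {1..n} (sign \<pi> * sign \<pi>') (\<lambda>f. T (T' f))"
    using T Alg_comp[of "{1..n}" "sign \<pi>" T "sign \<pi>'" T'] by (simp add: lift_def)
  ultimately show ?thesis by (simp add: lift_def s)
qed

text \<open>A lift of the identity is even and commutes with all generators. So lifts form a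
  projective representation of the symmetric group.\<close>

lemma lift_id_scalar: "lift n id T ==> \<exists>c. \<forall>f. T f = sc c f"
  by (rule Alg_center[of "{1..n}"]) (auto simp: lift_def)

definition tr :: "nat => nat => (nat set => real) => nat set => real" where
  "tr i j f = cl i f + sc (-1) (cl j f)"

lemma tr_sq: "i \<noteq> j ==> tr i j (tr i j f) = sc 2 f"
  using cl_anti[of i j f] sc_add[of 1 1 f] by (simp add: tr_def sc_minus del: add_uminus_conv_diff)

lemma tr_sc: "tr i j (sc c f) = sc c (tr i j f)"
  by (simp add: tr_def mult.commute)

lemma lift_tr:
  assumes "i \<in> {1..n}" "j \<in> {1..n}" "i \<noteq> j"
  shows "lift n (Transposition.transpose i j) (tr i j)"
proof -
  have s: "sign (Transposition.transpose i j) = -1" using assms by (simp add: sign_swap_id)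
  have "Alg {1..n} (- 1) (\<lambda>f. cl i f)" "Alg {1..n} (- 1) (\<lambda>f. cl j f)"
    using Alg_gen[OF Alg_unit] assms by blast+
  hence "Alg {1..n} (- 1) (\<lambda>f. cl i f + sc (-1) (cl j f))"
    by (intro Alg_add Alg_scale)
  moreover have "tr i j (cl k f) = - cl (Transposition.transpose i j k) (tr i j f)" for k f
    using assms cl_anti[of i j f] cl_anti[of k i f] cl_anti[of k j f]
    by (cases "k = i"; cases "k = j") (auto simp: tr_def sc_minus)
  ultimately show ?thesis
    by (simp add: lift_def s tr_def[abs_def] sc_minus)
qed

text \<open>Schur's phenomenon: disjoint transpositions commute, but each of the four pairs of
  generators involved anticommutes, and so do the lifts.\<close>

lemma tr_disjoint:
  assumes "a \<noteq> c" "a \<noteq> d" "b \<noteq> c" "b \<noteq> d"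
  shows "tr a b (tr c d f) = - tr c d (tr a b f)"
  using cl_anti[of a c f] cl_anti[of a d f] cl_anti[of b c f] cl_anti[of b d f] assms
  by (simp add: tr_def sc_minus del: add_uminus_conv_diff)

text \<open>A lift of the inverse is carried along in the induction over transpositions; the factor
  1/2 compensates for \<open>tr_sq\<close>.\<close>

lemma lift_exists:
  assumes "\<pi> permutes {1..n}"
  shows "\<exists>T T'. lift n \<pi> T \<and> lift n (inv_into UNIV \<pi>) T' \<and> (\<forall>f. T (T' f) = f) \<and> (\<forall>f. T' (T f) = f)"
  using assms finite_atLeastAtMost[of 1 n]
proof (induction rule: permutes_induct)
  case id
  show ?case using lift_id by (intro exI[of _ "\<lambda>f. f"]) (simp add: id_def)
next
  case (swap a b p)
  have ab: "a \<in> {1..n}" "b \<in> {1..n}" "a \<noteq> b" and p: "p permutes {1..n}"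
    using swap by auto
  obtain T T' where T: "lift n p T" "lift n (inv_into UNIV p) T'" "\<And>f. T (T' f) = f" "\<And>f. T' (T f) = f"
    using swap by blast
  note t = lift_tr[OF ab]
  have tp: "Transposition.transpose a b permutes {1..n}" using ab by (intro permutes_swap_id)
  have "lift n (Transposition.transpose a b \<circ> p) (\<lambda>f. tr a b (T f))"
    by (rule lift_comp[OF tp p t T(1)])
  moreover have "lift n (inv_into UNIV p \<circ> Transposition.transpose a b) (\<lambda>f. T' (sc (1/2) (tr a b f)))"
    by (rule lift_comp[OF permutes_inv[OF p] tp T(2) lift_scale[OF t]])
  moreover have "inv_into UNIV (Transposition.transpose a b \<circ> p) = inv_into UNIV p \<circ> Transposition.transpose a b"
    using p tp by (simp add: o_inv_distrib permutes_bij)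
  moreover have "tr a b (T (T' (sc (1/2) (tr a b f)))) = f" for f
    by (simp add: T(3) tr_sc tr_sq[OF ab(3)])
  moreover have "T' (sc (1/2) (tr a b (tr a b (T f)))) = f" for f
    by (simp add: tr_sq[OF ab(3)] T(4))
  ultimately show ?case
    by (rule_tac exI[of _ "\<lambda>f. tr a b (T f)"], rule_tac exI[of _ "\<lambda>f. T' (sc (1/2) (tr a b f))"]) (simp only: simp_thms)
qed


section \<open>Symmetric groups and the spin obstruction\<close>

text \<open>All bijections of a type, made an instance of \<open>group_add\<close> so that path
  functors can take values there. Addition is composition.\<close>

typedef 'z sym = "{f :: 'z => 'z. bij f}"
  by (rule exI[of _ id]) simp

setup_lifting type_definition_sym

instantiation sym :: (type) group_add
begin

lift_definition zero_sym :: "'a sym" is id by simp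
lift_definition plus_sym :: "'a sym => 'a sym => 'a sym" is "(\<circ>)" by (rule bij_comp)
lift_definition uminus_sym :: "'a sym => 'a sym" is "inv_into UNIV" by (rule bij_imp_bij_inv)
definition "(a :: 'a sym) - b = a + - b"

instance
proof
  fix a b c :: "'a sym"
  show "a + b + c = a + (b + c)" by transfer (simp add: o_assoc)
  show "0 + a = a" "a + 0 = a" by (transfer, simp)+
  show "- a + a = 0" by transfer (simp add: bij_is_inj)
  show "a + - b = a - b" by (simp add: minus_sym_def)
qed

end

lemma Rep_sym_simps: "Rep_sym 0 = id" "Rep_sym (a + b) = Rep_sym a \<circ> Rep_sym b"
    "Rep_sym (- a) = inv_into UNIV (Rep_sym a)"
  by (transfer, simp)+

text \<open>The data of a homomorphism from the Artin group to the permutations of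
  \<open>{1..n}\<close>, given on generators. The aim is to lift it to operators without losing the
  commutation relations.\<close>

locale spin =
  fixes P :: "('c, 'd) pre_digraph" and n :: nat and \<rho> :: "'c => nat sym"
  assumes fin: "finite (verts P)"
    and perm: "x \<in> verts P ==> Rep_sym (\<rho> x) permutes {1..n}"
    and comm: "(x, y) \<in> arcs_ends P ==> x \<in> verts P ==> y \<in> verts P ==> x \<noteq> y \<and> \<rho> x + \<rho> y = \<rho> y + \<rho> x"
begin

definition good_lift :: "'c => (bool => (nat set => real) => nat set => real) => bool" where
  "good_lift x T \<longleftrightarrow> (\<forall>b. lift n (Rep_sym (if b then \<rho> x else - \<rho> x)) (T b)) \<and>
     (\<forall>b f. T b (T (\<not> b) f) = f)"

definition T :: "'c => bool => (nat set => real) => nat set => real" where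
  "T x = (SOME T. good_lift x T)"

lemma good_lift_T: assumes "x \<in> verts P" shows "good_lift x (T x)"
proof -
  obtain S S' where S: "lift n (Rep_sym (\<rho> x)) S" "lift n (inv_into UNIV (Rep_sym (\<rho> x))) S'"
    "\<And>f. S (S' f) = f" "\<And>f. S' (S f) = f"
    using lift_exists[OF perm[OF assms]] by blast
  hence "good_lift x (\<lambda>b. if b then S else S')"
    by (simp add: good_lift_def Rep_sym_simps)
  thus ?thesis unfolding T_def by (rule someI[of "good_lift x"])
qed

lemma T_lift: "x \<in> verts P ==> lift n (Rep_sym (if b then \<rho> x else - \<rho> x)) (T x b)"
  and T_cancel: "x \<in> verts P ==> T x b (T x (\<not> b) f) = f"
  using good_lift_T[of x] unfolding good_lift_def by blast+

lemma T_sc: "x \<in> verts P ==> T x b (sc c f) = sc c (T x b f)"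
  using T_lift[of x b] by (auto simp: lift_def intro: Alg_linear(2))

text \<open>The commutator of the two lifts is a lift of the identity, hence a scalar.\<close>

lemma commute_scalar:
  assumes xy: "(x, y) \<in> arcs_ends P" "x \<in> verts P" "y \<in> verts P"
  shows "\<exists>c. c \<noteq> 0 \<and> (\<forall>f. T x True (T y True f) = sc c (T y True (T x True f)))"
proof -
  note p = perm[OF xy(2)] perm[OF xy(3)]
  note p' = permutes_inv[OF p(1)] permutes_inv[OF p(2)]
  have l: "lift n (Rep_sym (\<rho> x)) (T x True)" "lift n (Rep_sym (\<rho> y)) (T y True)"
    "lift n (inv_into UNIV (Rep_sym (\<rho> x))) (T x False)" "lift n (inv_into UNIV (Rep_sym (\<rho> y))) (T y False)"
    using T_lift[OF xy(2), of True] T_lift[OF xy(2), of False] T_lift[OF xy(3), of True] T_lift[OF xy(3), of False]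
    by (simp_all add: Rep_sym_simps)
  have L: "lift n ((Rep_sym (\<rho> x) \<circ> Rep_sym (\<rho> y)) \<circ> (inv_into UNIV (Rep_sym (\<rho> x)) \<circ> inv_into UNIV (Rep_sym (\<rho> y))))
     (\<lambda>f. T x True (T y True (T x False (T y False f))))"
    by (rule lift_comp[OF _ _ lift_comp[OF p l(1,2)] lift_comp[OF p' l(3,4)]])
       (intro permutes_compose p p')+
  have "(Rep_sym (\<rho> x) \<circ> Rep_sym (\<rho> y)) \<circ> (inv_into UNIV (Rep_sym (\<rho> x)) \<circ> inv_into UNIV (Rep_sym (\<rho> y))) =
    Rep_sym (\<rho> x + \<rho> y + (- \<rho> x + - \<rho> y))"
    by (simp only: Rep_sym_simps)
  also have "\<rho> x + \<rho> y + (- \<rho> x + - \<rho> y) = 0"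
  proof -
    have "\<rho> x + \<rho> y + (- \<rho> x + - \<rho> y) = \<rho> y + (\<rho> x + - \<rho> x) + - \<rho> y"
      using comm[OF xy] by (simp only: add.assoc)
    thus ?thesis by simp
  qed
  finally have "lift n id (\<lambda>f. T x True (T y True (T x False (T y False f))))"
    using L by (simp only: Rep_sym_simps)
  from lift_id_scalar[OF this] obtain c where c: "\<And>f. T x True (T y True (T x False (T y False f))) = sc c f"
    by blast
  have "T x True (T y True f) = sc c (T y True (T x True f))" for f
    using c[of "T y True (T x True f)"] T_cancel[OF xy(2), of False] T_cancel[OF xy(3), of False] by simp
  moreover have "c \<noteq> 0"
  proof
    assume "c = 0"
    hence "T x True (T y True (T x False (T y False (\<lambda>_. 1)))) = 0" using c by simp
    \<comment> \<open>If the scalar were 0, undoing the four invertible operators would make the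
      constant function 1 vanish.\<close>
    hence "T y True (T x True (T y False (T x False (T x True (T y True (T x False (T y False (\<lambda>_. 1)))))))) =
       T y True (T x True (T y False (T x False (sc 0 (\<lambda>_. 1)))))" by simp
    hence "(\<lambda>_. 1) = sc 0 (\<lambda>_::nat set. 1::real)"
      unfolding T_sc[OF xy(2)] T_sc[OF xy(3)]
      using T_cancel[OF xy(2), of False] T_cancel[OF xy(3), of False]
        T_cancel[OF xy(2), of True] T_cancel[OF xy(3), of True] by simp
    thus False by (simp add: fun_eq_iff)
  qed
  ultimately show ?thesis by blast
qed

definition K :: "'c => 'c => real" where
  "K x y = (SOME c. c \<noteq> 0 \<and> (\<forall>f. T x True (T y True f) = sc c (T y True (T x True f))))"

text \<open>An arbitrary numbering; for each edge it selects the one ordered pair of end points on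
  which the twist \<open>B\<close> places its correction.\<close>

definition idx :: "'c => nat" where
  "idx = (SOME h. inj_on h (verts P))"

text \<open>A bimultiplicative twist that makes the chosen lifts of adjacent generators commute.\<close>

definition B :: "'c => 'c => real" where
  "B x y = (if (x, y) \<in> arcs_ends P \<and> idx x < idx y then inverse (K x y)
            else if (y, x) \<in> arcs_ends P \<and> (x, y) \<notin> arcs_ends P \<and> idx x < idx y then K y x else 1)"

definition bt :: "'c => ('c => int) => real" where
  "bt x m = (\<Prod>y\<in>verts P. B x y powi m y)"

text \<open>The bimultiplicative extension of \<open>B\<close> to exponent vectors, a bilinear form
  written multiplicatively: each \<open>B x y\<close> occurs with exponent
  \<open>m x * m' y\<close>.\<close>

definition \<beta> :: "('c => int) => ('c => int) => real" where
  "\<beta> m m' = (\<Prod>x\<in>verts P. bt x m' powi m x)"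

lemma idx_inj: "inj_on idx (verts P)"
proof -
  have "\<exists>h :: 'c => nat. inj_on h (verts P)"
    using finite_imp_inj_to_nat_seg[OF fin] by blast
  thus ?thesis unfolding idx_def by (rule someI_ex)
qed

lemma K: assumes "(x, y) \<in> arcs_ends P" "x \<in> verts P" "y \<in> verts P"
  shows "K x y \<noteq> 0" "T x True (T y True f) = sc (K x y) (T y True (T x True f))"
  using someI_ex[OF commute_scalar[OF assms]] unfolding K_def by blast+

lemma B_nz: "x \<in> verts P ==> y \<in> verts P ==> B x y \<noteq> 0"
  using K(1) by (auto simp: B_def)

lemma bt_nz: "x \<in> verts P ==> bt x m \<noteq> 0"
  using fin B_nz by (auto simp: bt_def prod_zero_iff power_int_eq_0_iff)

lemma \<beta>_nz: "\<beta> m m' \<noteq> 0"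
  using fin bt_nz by (auto simp: \<beta>_def prod_zero_iff power_int_eq_0_iff)

lemma bt_add: "x \<in> verts P ==> bt x (m + m') = bt x m * bt x m'"
  unfolding bt_def prod.distrib[symmetric] using B_nz by (intro prod.cong) (auto simp: power_int_add)

lemma bt_uminus: "bt x (- m) = inverse (bt x m)"
  unfolding bt_def by (simp add: power_int_minus prod_inversef[symmetric] o_def)

lemma \<beta>_add: "\<beta> (m + m') k = \<beta> m k * \<beta> m' k"
  unfolding \<beta>_def prod.distrib[symmetric] using bt_nz by (intro prod.cong) (auto simp: power_int_add)

lemma \<beta>_uminus: "\<beta> (- m) k = inverse (\<beta> m k)" "\<beta> m (- k) = inverse (\<beta> m k)"
  unfolding \<beta>_def by (simp_all add: bt_uminus power_int_minus power_int_inverse prod_inversef[symmetric] o_def)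

lemma \<beta>_single:
  assumes "x \<in> verts P"
  shows "\<beta> (\<lambda>v. if v = x then 1 else 0) m = bt x m" "\<beta> (- (\<lambda>v. if v = x then 1 else 0)) m = inverse (bt x m)"
proof -
  have "(\<Prod>y\<in>verts P. bt y m powi (if y = x then 1 else 0)) = (\<Prod>y\<in>verts P. if y = x then bt y m else 1)"
    by (intro prod.cong) auto
  also have "\<dots> = bt x m" using fin assms by simp
  finally show "\<beta> (\<lambda>v. if v = x then 1 else 0) m = bt x m" by (simp add: \<beta>_def)
  thus "\<beta> (- (\<lambda>v. if v = x then 1 else 0)) m = inverse (bt x m)" by (simp only: \<beta>_uminus)
qed

text \<open>The product of the lifts along a word, where every letter is twisted by \<beta> against
  the class of the rest of the word. The result is not multiplicative, its defect being exactly
  \<beta> by \<open>N_append\<close>, but it depends only on the element of the Artin group.\<close>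

primrec N :: "'c word => (nat set => real) => nat set => real" where
  "N [] = (\<lambda>f. f)"
| "N (a # w) = (\<lambda>f. sc (if snd a then bt (fst a) (ab w) else inverse (bt (fst a) (ab w))) (T (fst a) (snd a) (N w f)))"

lemma ab_Cons: "ab ((x, b) # w) = (if b then (\<lambda>v. if v = x then 1 else 0) else - (\<lambda>v. if v = x then 1 else 0)) + ab w"
  by (simp add: ab_def)

lemma ab_append: "ab (u @ v) = ab u + ab v"
  by (simp add: ab_def)

lemma N_append:
  assumes "u \<in> words (verts P)" "v \<in> words (verts P)"
  shows "N (u @ v) f = sc (\<beta> (ab u) (ab v)) (N u (N v f))"
  using assms(1)
proof (induction u)
  case Nil
  show ?case by (simp add: ab_def \<beta>_def)
next
  case (Cons a u)
  obtain x b where a: "a = (x, b)" by force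
  have x: "x \<in> verts P" using Cons by (auto simp: a)
  have "\<beta> (ab (a # u)) (ab v) = (if b then bt x (ab v) else inverse (bt x (ab v))) * \<beta> (ab u) (ab v)"
    using \<beta>_single[OF x] unfolding a ab_Cons \<beta>_add by (cases b) (simp_all only: if_True if_False)
  thus ?case
    using Cons x by (auto simp: a ab_append bt_add T_sc mult_ac)
qed

text \<open>Both sides of a relation have the same class, so the twists against the surrounding
  words agree and only the relation itself needs to be checked.\<close>

lemma N_pres_eq:
  assumes "(u, v) \<in> pres_eq (verts P) (raag_rel P)"
  shows "N u = N v"
  using assms
proof (induction rule: pres_eq.induct)
  case (pres_eq_cancel u v x b)
  have w: "[(x, b), (x, \<not> b)] \<in> words (verts P)" using pres_eq_cancel by auto
  \<comment> \<open>\<open>B x x\<close> is 1, so a letter next to its inverse picks up no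
    factor.\<close>
  have "bt x (\<lambda>v. if v = x then 1 else 0) = 1"
  proof -
    have "(\<Prod>y\<in>verts P. B x y powi (if y = x then 1 else 0)) = (\<Prod>y\<in>verts P. 1)"
      by (intro prod.cong) (auto simp: B_def)
    thus ?thesis by (simp add: bt_def)
  qed
  hence one: "N [(x, b), (x, \<not> b)] f = f" for f
    using pres_eq_cancel T_cancel[of x b f] bt_uminus[of x "\<lambda>v. if v = x then 1 else 0"] by (cases b) (simp_all add: ab_def bt_def)
  have ab0: "ab ([(x, b), (x, \<not> b)] @ v) = ab v"
    by (cases b) (simp_all add: ab_def)
  have b0: "\<beta> (ab [(x, b), (x, \<not> b)]) (ab v) = 1"
    by (cases b) (simp_all add: ab_def \<beta>_def)
  have wv: "[(x, b), (x, \<not> b)] @ v \<in> words (verts P)" using w pres_eq_cancel by auto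
  show ?case
  proof
    fix f
    have "N (u @ [(x, b), (x, \<not> b)] @ v) f = sc (\<beta> (ab u) (ab v)) (N u (N ([(x, b), (x, \<not> b)] @ v) f))"
      using N_append[OF _ wv] pres_eq_cancel unfolding ab0 by blast
    also have "N ([(x, b), (x, \<not> b)] @ v) f = N v f"
      using N_append[OF w pres_eq_cancel(2), of f] by (simp only: b0 one sc_simps)
    finally show "N (u @ [(x, b), (x, \<not> b)] @ v) f = N (u @ v) f"
      using N_append pres_eq_cancel by simp
  qed
next
  case (pres_eq_relator u v l r)
  then obtain x y where xy: "(x, y) \<in> arcs_ends P" "l = [(x, True), (y, True)]" "r = [(y, True), (x, True)]"
    by (auto simp: raag_rel_def)
  have V: "x \<in> verts P" "y \<in> verts P" using pres_eq_relator xy by auto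
  have "x \<noteq> y" using comm[OF xy(1)] V by blast
  hence "idx x \<noteq> idx y" using idx_inj V by (auto simp: inj_on_def)
  have bts: "bt z (\<lambda>v. if v = x' then 1 else 0) = B z x'" if "x' \<in> verts P" for z x'
  proof -
    have "(\<Prod>y\<in>verts P. B z y powi (if y = x' then 1 else 0)) = (\<Prod>y\<in>verts P. if y = x' then B z y else 1)"
      by (intro prod.cong) auto
    thus ?thesis using fin that by (simp add: bt_def)
  qed
  have bt0: "bt z 0 = 1" for z by (simp add: bt_def)
  have Nl: "N l f = sc (B x y) (T x True (T y True f))" "N r f = sc (B y x) (T y True (T x True f))" for f
    using V bts by (simp_all add: xy ab_def bt0 T_sc)
  \<comment> \<open>Whichever of the two ordered pairs carries the correction, it makes up for the
    scalar \<open>K\<close> by which the two orders of the lifts differ.\<close>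
  have lr: "N l f = N r f" for f
  proof (cases "idx x < idx y")
    case True
    have "B x y = inverse (K x y)" "B y x = 1" using True xy by (auto simp: B_def)
    thus ?thesis using Nl K[OF xy(1) V] by simp
  next
    case False
    hence lt: "idx y < idx x" using \<open>idx x \<noteq> idx y\<close> by simp
    have B1: "B x y = 1" using lt by (simp add: B_def)
    show ?thesis
    proof (cases "(y, x) \<in> arcs_ends P")
      case True
      hence "B y x = inverse (K y x)" using lt by (simp add: B_def)
      thus ?thesis using Nl B1 K[OF True V(2,1)] by simp
    next
      case False
      hence "B y x = K x y" using lt xy by (simp add: B_def)
      thus ?thesis using Nl B1 K[OF xy(1) V] by simp
    qed
  qed
  have ablr: "ab l = ab r" by (simp add: xy ab_def add.commute)
  show ?case
  proof
    fix f
    have "N (u @ l @ v) f = sc (\<beta> (ab u) (ab (l @ v))) (N u (sc (\<beta> (ab l) (ab v)) (N l (N v f))))"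
      using N_append pres_eq_relator by simp
    moreover have "N (u @ r @ v) f = sc (\<beta> (ab u) (ab (r @ v))) (N u (sc (\<beta> (ab r) (ab v)) (N r (N v f))))"
      using N_append pres_eq_relator by simp
    ultimately show "N (u @ l @ v) f = N (u @ r @ v) f"
      by (simp add: lr ablr ab_append)
  qed
qed auto

lemma permutes_ev: "w \<in> words (verts P) ==> Rep_sym (ev \<rho> w) permutes {1..n}"
proof (induction w)
  case Nil
  show ?case by (simp only: ev_simps Rep_sym_simps permutes_id)
next
  case (Cons a w)
  obtain x b where a: "a = (x, b)" by force
  have x: "x \<in> verts P" and w: "w \<in> words (verts P)" using Cons by (auto simp: a)
  have "Rep_sym (if b then \<rho> x else - \<rho> x) permutes {1..n}"
    using perm[OF x] by (auto simp: Rep_sym_simps permutes_inv)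
  thus ?case
    unfolding a ev_simps Rep_sym_simps(2) by (rule permutes_compose[OF Cons.IH[OF w]])
qed

lemma lift_N: "w \<in> words (verts P) ==> lift n (Rep_sym (ev \<rho> w)) (N w)"
proof (induction w)
  case Nil
  show ?case by (simp only: ev_simps Rep_sym_simps N.simps lift_id)
next
  case (Cons a w)
  obtain x b where a: "a = (x, b)" by force
  have x: "x \<in> verts P" and w: "w \<in> words (verts P)" using Cons by (auto simp: a)
  have "Rep_sym (if b then \<rho> x else - \<rho> x) permutes {1..n}"
    using perm[OF x] by (auto simp: Rep_sym_simps permutes_inv)
  from lift_comp[OF this permutes_ev[OF w] T_lift[OF x] Cons.IH[OF w]]
  show ?case unfolding a N.simps ev_simps Rep_sym_simps(2) fst_conv snd_conv by (rule lift_scale)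
qed

lemma N_zero: "w \<in> words (verts P) ==> N w f = 0 ==> f = 0"
proof (induction w)
  case (Cons a w)
  obtain x b where a: "a = (x, b)" by force
  have x: "x \<in> verts P" and w: "w \<in> words (verts P)" using Cons by (auto simp: a)
  define c where "c = (if b then bt x (ab w) else inverse (bt x (ab w)))"
  have c: "c \<noteq> 0" using bt_nz[OF x] by (simp add: c_def)
  have "sc c (T x b (N w f)) = 0" using Cons.prems(2) by (simp only: a c_def N.simps fst_conv snd_conv)
  hence "sc (inverse c) (sc c (T x b (N w f))) = 0" by simp
  hence "T x b (N w f) = sc 0 0" using c by simp
  hence "T x (\<not> b) (T x b (N w f)) = 0" by (simp only: T_sc[OF x]) simp
  hence "N w f = 0" using T_cancel[OF x, of "\<not> b"] by simp
  thus ?case using Cons.IH[OF w] by simp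
qed simp

text \<open>\<open>tr a b\<close> composed with \<open>N w\<close> lifts the square of a
  transposition, hence is a scalar; multiplying once more by \<open>tr a b\<close>, whose square is
  2, recovers \<open>N w\<close>.\<close>

lemma N_transposition:
  assumes w: "w \<in> words (verts P)" and e: "Rep_sym (ev \<rho> w) = Transposition.transpose a b"
    and ab: "a \<in> {1..n}" "b \<in> {1..n}" "a \<noteq> b"
  shows "\<exists>c. c \<noteq> 0 \<and> (\<forall>f. N w f = sc c (tr a b f))"
proof -
  have p: "Transposition.transpose a b permutes {1..n}" using ab by (intro permutes_swap_id)
  have l: "lift n (Transposition.transpose a b) (N w)" using lift_N[OF w] e by simp
  obtain c where c: "\<And>f. tr a b (N w f) = sc c f"
    using lift_id_scalar[of n "\<lambda>f. tr a b (N w f)"] lift_comp[OF p p lift_tr[OF ab] l] by auto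
  have "tr a b (tr a b (N w f)) = sc c (tr a b f)" for f
    unfolding c tr_sc ..
  hence "sc (1/2) (sc 2 (N w f)) = sc (1/2) (sc c (tr a b f))" for f
    by (simp only: tr_sq[OF ab(3)])
  hence *: "N w f = sc (c / 2) (tr a b f)" for f by simp
  moreover have "c \<noteq> 0"
  proof
    assume "c = 0"
    hence "N w (\<lambda>_. 1) = 0" using * by simp
    hence "(\<lambda>_::nat set. 1::real) = 0" by (rule N_zero[OF w])
    thus False by (simp add: fun_eq_iff)
  qed
  ultimately show ?thesis by (intro exI[of _ "c / 2"]) simp
qed

text \<open>For opposite classes both orders carry the same twist, since \<beta>(m, -m) and
  \<beta>(-m, m) are both the inverse of \<beta>(m, m). So the operators commute; as multiples of
  lifts of disjoint transpositions they also anticommute. Their product would be 0, although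
  \<open>tr a b\<close> and \<open>tr c d\<close> square to 2.\<close>

theorem no_opposite_commuting_transpositions:
  assumes u: "u \<in> words (verts P)" "Rep_sym (ev \<rho> u) = Transposition.transpose a b"
    and v: "v \<in> words (verts P)" "Rep_sym (ev \<rho> v) = Transposition.transpose c d"
    and d: "distinct [a, b, c, d]" "{a, b, c, d} \<subseteq> {1..n}"
    and uv: "(u @ v, v @ u) \<in> pres_eq (verts P) (raag_rel P)" and opp: "ab v = - ab u"
  shows False
proof -
  obtain k where k: "k \<noteq> 0" "\<And>f. N u f = sc k (tr a b f)"
    using N_transposition[OF u] d by auto
  obtain k' where k': "k' \<noteq> 0" "\<And>f. N v f = sc k' (tr c d f)"
    using N_transposition[OF v] d by auto
  let ?b = "inverse (\<beta> (ab u) (ab u))"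
  have "sc ?b (N u (N v f)) = sc ?b (N v (N u f))" for f
    using fun_cong[OF N_pres_eq[OF uv], of f] N_append[OF u(1) v(1), of f] N_append[OF v(1) u(1), of f]
    by (simp add: opp \<beta>_uminus)
  hence "sc (\<beta> (ab u) (ab u)) (sc ?b (N u (N v f))) = sc (\<beta> (ab u) (ab u)) (sc ?b (N v (N u f)))" for f
    by simp
  hence "N u (N v f) = N v (N u f)" for f
    using \<beta>_nz[of "ab u" "ab u"] by simp
  hence "sc (k * k') (tr a b (tr c d f)) = sc (k * k') (tr c d (tr a b f))" for f
    by (simp add: k k' tr_sc mult.commute)
  hence "sc (inverse (k * k')) (sc (k * k') (tr a b (tr c d f))) = sc (inverse (k * k')) (sc (k * k') (tr c d (tr a b f)))" for f
    by simp
  moreover have "inverse (k * k') * (k * k') = 1" using k(1) k'(1) by (intro left_inverse) simp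
  ultimately have "tr a b (tr c d f) = tr c d (tr a b f)" for f
    by (simp only: sc_simps)
  moreover have "tr a b (tr c d f) = - tr c d (tr a b f)" for f
    by (rule tr_disjoint) (use d in auto)
  ultimately have z: "tr a b (tr c d f) = - tr a b (tr c d f)" for f
    by metis
  have "tr a b (tr c d f) = 0" for f
  proof
    fix A show "tr a b (tr c d f) A = 0 A" using fun_cong[OF z[of f], of A] by simp
  qed
  hence "tr c d (tr a b (tr a b (tr c d f))) = 0" for f
    using tr_sc[of _ _ 0] by (metis sc_simps(3))
  hence "sc 4 f = 0" for f
    using tr_sq[of a b] tr_sq[of c d] d by (simp add: tr_sc)
  hence "sc 4 (\<lambda>_. 1) {} = (0::real)" by simp
  thus False by (simp add: sc_def)
qed

end

section \<open>Configuration spaces\<close>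

lemma topspace_conf_space:
  "topspace (conf_space n X) = {x \<in> {1..n} \<rightarrow>\<^sub>E topspace X. inj_on x {1..n}}"
  by (auto simp: conf_space_def)

lemma topspace_uconf_space: "topspace (uconf_space n X) = perm_orbit n ` topspace (conf_space n X)"
  by (simp add: uconf_space_def)

lemma continuous_map_conf_space:
  "continuous_map Z (conf_space n X) f \<longleftrightarrow>
     (\<forall>z\<in>topspace Z. f z \<in> extensional {1..n} \<and> inj_on (f z) {1..n}) \<and>
     (\<forall>i\<in>{1..n}. continuous_map Z X (\<lambda>z. f z i))"
  unfolding conf_space_def continuous_map_in_subtopology continuous_map_componentwise
  by auto

lemma continuous_map_perm_orbit: "continuous_map (conf_space n X) (uconf_space n X) (perm_orbit n)"
  unfolding uconf_space_def by (rule quotient_imp_continuous_map[OF quotient_map_quotient_topology])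

lemma perm_orbit_self: "x \<in> perm_orbit n x"
  unfolding perm_orbit_def by (auto intro!: exI[of _ id] permutes_id)

lemma perm_orbit_compose:
  assumes "\<sigma> permutes {1..n}" shows "perm_orbit n (x \<circ> \<sigma>) = perm_orbit n x"
proof -
  have "x \<circ> \<sigma> \<circ> \<tau> \<in> perm_orbit n x" if "\<tau> permutes {1..n}" for \<tau>
    unfolding perm_orbit_def using permutes_compose[OF that assms] by (auto simp: o_assoc[symmetric])
  moreover have "x \<circ> \<tau> \<in> perm_orbit n (x \<circ> \<sigma>)" if "\<tau> permutes {1..n}" for \<tau>
  proof -
    have "x \<circ> \<tau> = x \<circ> \<sigma> \<circ> (inv_into UNIV \<sigma> \<circ> \<tau>)"
      using permutes_inv_o(1)[OF assms] by (simp add: fun_eq_iff)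
    thus ?thesis
      unfolding perm_orbit_def using permutes_compose[OF that permutes_inv[OF assms]] by blast
  qed
  ultimately show ?thesis
    unfolding perm_orbit_def[of n "x \<circ> \<sigma>"] perm_orbit_def[of n x] by (auto simp: perm_orbit_def)
qed

lemma perm_orbit_eqE:
  assumes "perm_orbit n x = perm_orbit n y"
  obtains \<sigma> where "\<sigma> permutes {1..n}" "y = x \<circ> \<sigma>"
  using perm_orbit_self[of y n] assms unfolding perm_orbit_def by auto

lemma conf_compose:
  assumes "\<sigma> permutes {1..n}" shows "continuous_map (conf_space n X) (conf_space n X) (\<lambda>x. x \<circ> \<sigma>)"
  unfolding continuous_map_conf_space
proof (intro conjI ballI)
  fix x assume x: "x \<in> topspace (conf_space n X)"
  show "x \<circ> \<sigma> \<in> extensional {1..n}"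
    using x assms unfolding topspace_conf_space by (auto simp: extensional_def PiE_iff permutes_not_in)
  show "inj_on (x \<circ> \<sigma>) {1..n}"
    using x permutes_inj_on[OF assms] permutes_image[OF assms] unfolding topspace_conf_space
    by (auto intro!: comp_inj_on)
next
  fix i assume "i \<in> {1..n}"
  hence i: "\<sigma> i \<in> {1..n}" using permutes_in_image[OF assms] by blast
  have "continuous_map (conf_space n X) (conf_space n X) id" by simp
  thus "continuous_map (conf_space n X) X (\<lambda>x. (x \<circ> \<sigma>) i)"
    using i unfolding continuous_map_conf_space by auto
qed

lemma conf_compose_mem:
  "\<sigma> permutes {1..n} ==> x \<in> topspace (conf_space n X) ==> x \<circ> \<sigma> \<in> topspace (conf_space n X)"
  using conf_compose[of \<sigma> n X] by (auto simp: continuous_map_def)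

lemma perm_orbit_eq_iff_image:
  assumes x: "x \<in> topspace (conf_space n X)" and y: "y \<in> topspace (conf_space n X)" and e: "x ` {1..n} = y ` {1..n}"
  shows "perm_orbit n x = perm_orbit n y"
proof -
  have bx: "bij_betw x {1..n} (y ` {1..n})" and bY: "bij_betw y {1..n} (y ` {1..n})"
    using x y e by (auto simp: topspace_conf_space bij_betw_def)
  define \<sigma> where "\<sigma> i = (if i \<in> {1..n} then inv_into {1..n} x (y i) else i)" for i
  have "bij_betw (inv_into {1..n} x \<circ> y) {1..n} {1..n}"
    by (rule bij_betw_trans[OF bY bij_betw_inv_into[OF bx]])
  hence "bij_betw \<sigma> {1..n} {1..n}"
    by (rule bij_betw_cong[THEN iffD1, rotated]) (simp add: \<sigma>_def)
  hence p: "\<sigma> permutes {1..n}"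
    by (rule bij_imp_permutes) (simp only: \<sigma>_def if_False)
  have "y i = x (\<sigma> i)" for i
  proof (cases "i \<in> {1..n}")
    case True
    hence "x (inv_into {1..n} x (y i)) = y i"
      using bx by (intro f_inv_into_f) (auto simp: bij_betw_def)
    thus ?thesis using True by (simp add: \<sigma>_def)
  next
    case False
    thus ?thesis using x y by (auto simp: topspace_conf_space PiE_iff extensional_def \<sigma>_def)
  qed
  hence y': "y = x \<circ> \<sigma>" by (simp add: fun_eq_iff)
  show ?thesis unfolding y' by (rule perm_orbit_compose[OF p, symmetric])
qed

text \<open>The preimage of the image of \<open>U\<close> is the union of the translates of
  \<open>U\<close> under permutations of the coordinates.\<close>

lemma open_perm_orbit:
  assumes "openin (conf_space n X) U" shows "openin (uconf_space n X) (perm_orbit n ` U)"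
  unfolding uconf_space_def openin_quotient_topology
proof
  have U: "U \<subseteq> topspace (conf_space n X)" by (rule openin_subset[OF assms])
  thus "perm_orbit n ` U \<subseteq> perm_orbit n ` topspace (conf_space n X)" by blast
  have "{x \<in> topspace (conf_space n X). perm_orbit n x \<in> perm_orbit n ` U} =
     (\<Union>\<sigma>\<in>{\<sigma>. \<sigma> permutes {1..n}}. {x \<in> topspace (conf_space n X). x \<circ> \<sigma> \<in> U})"
  proof (intro equalityI subsetI)
    fix x assume "x \<in> {x \<in> topspace (conf_space n X). perm_orbit n x \<in> perm_orbit n ` U}"
    then obtain u where u: "x \<in> topspace (conf_space n X)" "u \<in> U" "perm_orbit n x = perm_orbit n u" by blast
    obtain \<sigma> where "\<sigma> permutes {1..n}" "u = x \<circ> \<sigma>" using perm_orbit_eqE[OF u(3)] .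
    with u show "x \<in> (\<Union>\<sigma>\<in>{\<sigma>. \<sigma> permutes {1..n}}. {x \<in> topspace (conf_space n X). x \<circ> \<sigma> \<in> U})" by blast
  next
    fix x assume "x \<in> (\<Union>\<sigma>\<in>{\<sigma>. \<sigma> permutes {1..n}}. {x \<in> topspace (conf_space n X). x \<circ> \<sigma> \<in> U})"
    then obtain \<sigma> where s: "\<sigma> permutes {1..n}" "x \<in> topspace (conf_space n X)" "x \<circ> \<sigma> \<in> U" by blast
    from imageI[OF s(3), of "perm_orbit n"] s(1,2)
    show "x \<in> {x \<in> topspace (conf_space n X). perm_orbit n x \<in> perm_orbit n ` U}"
      by (simp only: perm_orbit_compose mem_Collect_eq)
  qed
  moreover have "openin (conf_space n X) {x \<in> topspace (conf_space n X). x \<circ> \<sigma> \<in> U}" if "\<sigma> permutes {1..n}" for \<sigma>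
    by (rule openin_continuous_map_preimage[OF conf_compose[OF that] assms])
  ultimately show "openin (conf_space n X) {x \<in> topspace (conf_space n X). perm_orbit n x \<in> perm_orbit n ` U}"
    by (auto intro!: openin_Union)
qed

text \<open>The orbit map is open, so its inverse on an injectivity set is continuous. These
  sections play the part of evenly covered neighbourhoods.\<close>

lemma perm_orbit_section:
  assumes G: "openin (conf_space n X) G" and inj: "inj_on (perm_orbit n) G"
  shows "\<exists>r. continuous_map (subtopology (uconf_space n X) (perm_orbit n ` G)) (conf_space n X) r \<and>
    (\<forall>x\<in>G. r (perm_orbit n x) = x)"
proof -
  define r where "r = inv_into G (perm_orbit n)"
  have r: "r (perm_orbit n x) = x" if "x \<in> G" for x
    unfolding r_def using inj that by (rule inv_into_f_f)
  have Gs: "G \<subseteq> topspace (conf_space n X)" by (rule openin_subset[OF G])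
  have "continuous_map (subtopology (uconf_space n X) (perm_orbit n ` G)) (conf_space n X) r"
    unfolding continuous_map_def
  proof (intro conjI allI impI)
    show "r \<in> topspace (subtopology (uconf_space n X) (perm_orbit n ` G)) \<rightarrow> topspace (conf_space n X)"
      using r Gs by (auto simp: topspace_subtopology)
    fix U assume U: "openin (conf_space n X) U"
    have "{y \<in> topspace (subtopology (uconf_space n X) (perm_orbit n ` G)). r y \<in> U} = perm_orbit n ` (G \<inter> U)"
      using r Gs by (auto simp: topspace_subtopology topspace_uconf_space)
    moreover have "openin (uconf_space n X) (perm_orbit n ` (G \<inter> U))"
      by (intro open_perm_orbit openin_Int G U)
    ultimately show "openin (subtopology (uconf_space n X) (perm_orbit n ` G))
        {y \<in> topspace (subtopology (uconf_space n X) (perm_orbit n ` G)). r y \<in> U}"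
      by (auto simp: openin_subtopology intro!: exI[of _ "perm_orbit n ` (G \<inter> U)"])
  qed
  with r show ?thesis by (intro exI[of _ r] conjI ballI)
qed

lemma open_box:
  assumes "\<And>i. i \<in> {1..n} ==> openin X (U i)"
  shows "openin (conf_space n X) {x \<in> topspace (conf_space n X). \<forall>i\<in>{1..n}. x i \<in> U i}"
proof -
  have id: "continuous_map (conf_space n X) (conf_space n X) id" by simp
  have "openin (conf_space n X) {x \<in> topspace (conf_space n X). x i \<in> U i}" if "i \<in> {1..n}" for i
    using id that assms[OF that] unfolding continuous_map_conf_space by (auto intro!: openin_continuous_map_preimage)
  hence "openin (conf_space n X) ((\<Inter>i\<in>{1..n}. {x \<in> topspace (conf_space n X). x i \<in> U i}) \<inter> topspace (conf_space n X))"
    by (intro openin_INT) auto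
  moreover have "(\<Inter>i\<in>{1..n}. {x \<in> topspace (conf_space n X). x i \<in> U i}) \<inter> topspace (conf_space n X) =
    {x \<in> topspace (conf_space n X). \<forall>i\<in>{1..n}. x i \<in> U i}" by auto
  ultimately show ?thesis by simp
qed

lemma Hausdorff_disjoint_nbhds:
  assumes H: "Hausdorff_space X" and x: "inj_on x {1..n}" "x ` {1..n} \<subseteq> topspace X"
  shows "\<exists>U. (\<forall>i::nat\<in>{1..n}. openin X (U i) \<and> x i \<in> U i) \<and>
    (\<forall>i\<in>{1..n}. \<forall>j\<in>{1..n}. i \<noteq> j \<longrightarrow> U i \<inter> U j = {})"
proof -
  define Q where "Q i j p \<longleftrightarrow> openin X (fst p) \<and> openin X (snd p) \<and> x i \<in> fst p \<and> x j \<in> snd p \<and> fst p \<inter> snd p = {}" for i j p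
  define V where "V i j = fst (SOME p. Q i j p)" for i j
  define W where "W i j = snd (SOME p. Q i j p)" for i j
  have VW: "openin X (V i j) \<and> openin X (W i j) \<and> x i \<in> V i j \<and> x j \<in> W i j \<and> V i j \<inter> W i j = {}"
    if "i \<in> {1..n}" "j \<in> {1..n}" "i \<noteq> j" for i j
  proof -
    have "x i \<in> topspace X" "x j \<in> topspace X"
      using x(2) that by blast+
    moreover have "x i \<noteq> x j" using inj_on_eq_iff[OF x(1) that(1,2)] that(3) by simp
    ultimately obtain A B where "openin X A" "openin X B" "x i \<in> A" "x j \<in> B" "A \<inter> B = {}"
      using H unfolding Hausdorff_space_def disjnt_def by meson
    hence "Q i j (A, B)" by (simp add: Q_def)
    hence "Q i j (SOME p. Q i j p)" by (rule someI)
    thus ?thesis unfolding V_def W_def Q_def .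
  qed
  define U where "U i = (\<Inter>j\<in>{1..n} - {i}. V i j \<inter> W j i) \<inter> topspace X" for i
  show ?thesis
  proof (intro exI[of _ U] conjI ballI impI)
    fix i assume i: "i \<in> {1..n}"
    have *: "openin X (V i j \<inter> W j i)" "x i \<in> V i j \<inter> W j i" if "j \<in> {1..n} - {i}" for j
      using VW[of i j] VW[of j i] i that by (simp_all add: openin_Int)
    have "openin X (U i)" unfolding U_def by (rule openin_INT) (simp, rule *(1))
    moreover have "x i \<in> U i" unfolding U_def using *(2) x(2) i by (intro IntI INT_I) auto
    ultimately show "openin X (U i)" "x i \<in> U i" .
  next
    fix i j assume ij: "i \<in> {1..n}" "j \<in> {1..n}" "i \<noteq> j"
    have "j \<in> {1..n} - {i}" "i \<in> {1..n} - {j}" using ij by simp_all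
    hence "U i \<subseteq> V i j" "U j \<subseteq> W i j" unfolding U_def by blast+
    thus "U i \<inter> U j = {}" using VW[OF ij] by blast
  qed
qed

text \<open>Surround the particles by pairwise disjoint open sets. A permutation that keeps a
  configuration inside the resulting box must fix every index.\<close>

lemma local_section:
  assumes H: "Hausdorff_space X" and y: "y \<in> topspace (uconf_space n X)"
  obtains G where "openin (conf_space n X) G" "inj_on (perm_orbit n) G" "y \<in> perm_orbit n ` G"
proof -
  obtain x where x: "x \<in> topspace (conf_space n X)" "y = perm_orbit n x"
    using y by (auto simp: topspace_uconf_space)
  hence xi: "inj_on x {1..n}" "x ` {1..n} \<subseteq> topspace X" by (auto simp: topspace_conf_space)
  obtain U where U: "\<And>i. i \<in> {1..n} ==> openin X (U i) \<and> x i \<in> U i"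
    "\<And>i j. i \<in> {1..n} ==> j \<in> {1..n} ==> i \<noteq> j ==> U i \<inter> U j = {}"
    using Hausdorff_disjoint_nbhds[OF H xi] by (elim exE conjE) blast
  define G where "G = {x \<in> topspace (conf_space n X). \<forall>i\<in>{1..n}. x i \<in> U i}"
  have "openin (conf_space n X) G" unfolding G_def by (rule open_box) (use U in blast)
  moreover have "inj_on (perm_orbit n) G"
  proof (rule inj_onI)
    fix a b assume ab: "a \<in> G" "b \<in> G" "perm_orbit n a = perm_orbit n b"
    obtain \<sigma> where s: "\<sigma> permutes {1..n}" "b = a \<circ> \<sigma>" using perm_orbit_eqE[OF ab(3)] .
    have "\<sigma> i = i" for i
    proof (cases "i \<in> {1..n}")
      case True
      hence si: "\<sigma> i \<in> {1..n}" using permutes_in_image[OF s(1)] by blast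
      have "a (\<sigma> i) \<in> U (\<sigma> i)" "a (\<sigma> i) \<in> U i"
        using ab True si s(2) by (auto simp: G_def)
      thus ?thesis using U(2)[OF si True] by blast
    next
      case False
      thus ?thesis using permutes_not_in[OF s(1)] by blast
    qed
    thus "a = b" using s(2) by (simp add: fun_eq_iff)
  qed
  moreover have "y \<in> perm_orbit n ` G" using x U by (auto simp: G_def)
  ultimately show thesis by (rule that)
qed

section \<open>Monodromy\<close>

text \<open>The value on a path is a sum of values on small pieces. Applied to the monodromy, it
  confines the bijections of all naturals to those supported in \<open>{1..n}\<close>.\<close>

lemma path_functor_values:
  assumes op: "\<And>U. U \<in> \<U> ==> openin Y U" and cov: "topspace Y \<subseteq> \<Union>\<U>"
    and F: "path_functor Y F" and p: "pathin Y p"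
    and H: "0 \<in> H" "\<And>a b. a \<in> H ==> b \<in> H ==> a + b \<in> H"
    and loc: "\<And>U q. U \<in> \<U> ==> pathin (subtopology Y U) q ==> F q \<in> H"
  shows "F p \<in> H"
proof -
  obtain N where N: "small_on \<U> p N"
    using small_on_exists[OF p op cov] by blast
  have "F (seg p N i) \<in> H" if i: "i < N" for i
  proof -
    obtain U where U: "U \<in> \<U>" "p ` {i / N..Suc i / N} \<subseteq> U"
      using N i unfolding small_on_def by blast
    have "continuous_map (top_of_set {i / N..Suc i / N}) (subtopology Y U) p"
      using p U(2) continuous_map_from_subtopology_mono[OF _ interval_sub_unit[OF i], of euclideanreal Y p]
      by (auto simp: pathin_def continuous_map_in_subtopology)
    hence "pathin (subtopology Y U) (seg p N i)"
      unfolding seg_def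
      by (rule pathin_compose_convex[OF _ continuous_on_lin])
         (rule image_subsetI, rule lin_seg_mem)
    thus ?thesis using loc[OF U(1)] by blast
  qed
  hence "psum (\<lambda>i. F (seg p N i)) k \<in> H" if "k \<le> N" for k
    using that by (induction k) (auto intro: H)
  from this[of N] show ?thesis
    using psum_seg_functor[OF F p] N by (auto simp: small_on_def)
qed

lemma path_functor_pullback:
  assumes F: "path_functor Y F" and f: "continuous_map Z Y f"
  shows "path_functor Z (\<lambda>p. F (f \<circ> p))"
  unfolding path_functor_def
proof (intro conjI allI impI)
  fix p q assume "pathin Z p" "pathin Z q" "p 1 = q 0"
  hence "pathin Y (f \<circ> p)" "pathin Y (f \<circ> q)" "(f \<circ> p) 1 = (f \<circ> q) 0"
    using f by (auto simp: pathin_def intro: continuous_map_compose)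
  from path_functor_concat[OF F this]
  show "F (f \<circ> loop_concat p q) = F (f \<circ> p) + F (f \<circ> q)"
    by (simp add: loop_concat_def[abs_def] o_def if_distrib)
next
  fix p q assume "path_hom Z p q"
  then obtain H where H: "continuous_map (top_of_set ({0..1} \<times> {0..1::real})) Z H"
     "\<And>t. t\<in>{0..1} ==> H (0, t) = p t \<and> H (1, t) = q t"
     "\<And>s. s\<in>{0..1::real} ==> H (s, 0) = p 0 \<and> H (s, 1) = p 1"
    unfolding path_hom_def by blast
  have "path_hom Y (f \<circ> p) (f \<circ> q)"
    unfolding path_hom_def
    by (intro exI[of _ "f \<circ> H"] conjI continuous_map_compose[OF H(1) f]) (simp_all add: H(2,3))
  thus "F (f \<circ> p) = F (f \<circ> q)" by (rule path_functor_hom[OF F])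
qed

text \<open>The position of a configuration relative to a representative of its orbit chosen once
  and for all. The monodromy of a path with a lift is then a difference of the labels of the end
  points of the lift.\<close>

definition label :: "nat => (nat => 'a) => nat => nat" where
  "label n x = (SOME \<sigma>. \<sigma> permutes {1..n} \<and> x = (SOME z. z \<in> perm_orbit n x) \<circ> \<sigma>)"

lemma label:
  "label n x permutes {1..n}" "x = (SOME z. z \<in> perm_orbit n x) \<circ> label n x"
proof -
  define z where "z = (SOME z. z \<in> perm_orbit n x)"
  have "z \<in> perm_orbit n x"
    unfolding z_def by (rule someI[where P = "\<lambda>z. z \<in> perm_orbit n x"]) (rule perm_orbit_self)
  then obtain \<tau> where t: "\<tau> permutes {1..n}" "z = x \<circ> \<tau>" by (auto simp: perm_orbit_def)
  have "x = z \<circ> inv_into UNIV \<tau>" using permutes_inv_o(1)[OF t(1)] t(2) by (simp add: fun_eq_iff)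
  hence "\<exists>\<sigma>. \<sigma> permutes {1..n} \<and> x = z \<circ> \<sigma>" using permutes_inv[OF t(1)] by blast
  from someI_ex[OF this]
  show "label n x permutes {1..n}" "x = (SOME z. z \<in> perm_orbit n x) \<circ> label n x"
    unfolding label_def z_def by blast+
qed

text \<open>\<open>x\<close> and \<open>x \<circ> \<sigma>\<close> have the same orbit, hence the
  same representative \<open>z\<close>; injectivity of \<open>z\<close> makes labels unique.\<close>

lemma label_compose:
  assumes x: "x \<in> topspace (conf_space n X)" and s: "\<sigma> permutes {1..n}"
  shows "label n (x \<circ> \<sigma>) = label n x \<circ> \<sigma>"
proof -
  define z where "z = (SOME z. z \<in> perm_orbit n x)"
  have 1: "x = z \<circ> label n x" unfolding z_def by (rule label(2))
  have 2: "x \<circ> \<sigma> = z \<circ> label n (x \<circ> \<sigma>)"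
    using label(2)[of "x \<circ> \<sigma>" n] unfolding perm_orbit_compose[OF s] z_def .
  have zi: "inj_on z {1..n}"
  proof (rule inj_onI)
    fix i j assume ij: "i \<in> {1..n}" "j \<in> {1..n}" "z i = z j"
    let ?L = "inv_into UNIV (label n x)"
    have *: "z k = x (?L k)" for k
    proof -
      have "x (?L k) = z (label n x (?L k))" by (subst 1) (rule o_apply)
      thus ?thesis unfolding permutes_inverses(1)[OF label(1)[of n x]] ..
    qed
    have "?L i \<in> {1..n}" "?L j \<in> {1..n}"
      using permutes_in_image[OF permutes_inv[OF label(1)[of n x]]] ij by blast+
    moreover have "inj_on x {1..n}" using x by (simp add: topspace_conf_space)
    moreover have "x (?L i) = x (?L j)" using ij(3) unfolding * .
    ultimately have "?L i = ?L j" by (auto dest: inj_onD)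
    hence "label n x (?L i) = label n x (?L j)" by (rule arg_cong)
    thus "i = j" unfolding permutes_inverses(1)[OF label(1)[of n x]] .
  qed
  show ?thesis
  proof
    fix i
    show "label n (x \<circ> \<sigma>) i = (label n x \<circ> \<sigma>) i"
    proof (cases "i \<in> {1..n}")
      case True
      have "z (label n (x \<circ> \<sigma>) i) = z (label n x (\<sigma> i))"
      proof -
        have "x (\<sigma> i) = z (label n x (\<sigma> i))" by (subst 1) (rule o_apply)
        moreover have "x (\<sigma> i) = z (label n (x \<circ> \<sigma>) i)" using fun_cong[OF 2, of i] unfolding o_apply .
        ultimately show ?thesis by (simp only:)
      qed
      moreover have "label n (x \<circ> \<sigma>) i \<in> {1..n}" "label n x (\<sigma> i) \<in> {1..n}"
        using True permutes_in_image[OF label(1)[of n "x \<circ> \<sigma>"]] permutes_in_image[OF label(1)[of n x]]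
          permutes_in_image[OF s] by blast+
      ultimately show ?thesis unfolding o_apply[of _ \<sigma> i] by (rule_tac inj_onD[OF zi])
    next
      case False
      thus ?thesis
        using permutes_not_in[OF label(1)[of n "x \<circ> \<sigma>"]] permutes_not_in[OF label(1)[of n x]]
          permutes_not_in[OF s] unfolding o_apply[of _ \<sigma> i] by metis
    qed
  qed
qed

definition slabel :: "nat => (nat => 'a) => nat sym" where
  "slabel n x = Abs_sym (label n x)"

lemma Rep_slabel: "Rep_sym (slabel n x) = label n x"
  unfolding slabel_def using permutes_bij[OF label(1)[of n x]] by (intro Abs_sym_inverse) simp

lemma slabel_compose:
  assumes "x \<in> topspace (conf_space n X)" "Rep_sym s permutes {1..n}"
  shows "slabel n (x \<circ> Rep_sym s) = slabel n x + s"
  unfolding Rep_sym_inject[symmetric] Rep_slabel Rep_sym_simps label_compose[OF assms] ..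

text \<open>For each permutation the set of times at which \<open>y\<close> is that rearrangement of
  \<open>x\<close> is closed. These finitely many sets are disjoint and cover a connected interval,
  so a single one is everything.\<close>

lemma lifts_differ_by_permutation:
  assumes H: "Hausdorff_space X" and x: "pathin (conf_space n X) x" and y: "pathin (conf_space n X) y"
    and e: "\<And>t. t \<in> {0..1} ==> perm_orbit n (x t) = perm_orbit n (y t)"
  shows "\<exists>\<sigma>. \<sigma> permutes {1..n} \<and> y 0 = x 0 \<circ> \<sigma> \<and> y 1 = x 1 \<circ> \<sigma>"
proof -
  let ?I = "top_of_set {0..1::real}"
  define C where "C \<sigma> = {t \<in> topspace ?I. y t = x t \<circ> \<sigma>}" for \<sigma>
  have HC: "Hausdorff_space (conf_space n X)"
    unfolding conf_space_def using H by (intro Hausdorff_space_subtopology) (simp add: Hausdorff_space_product_topology)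
  have cl: "closedin ?I (C \<sigma>)" if "\<sigma> permutes {1..n}" for \<sigma>
  proof -
    have "continuous_map ?I (conf_space n X) ((\<lambda>x. x \<circ> \<sigma>) \<circ> x)"
      using x conf_compose[OF that] by (auto simp: pathin_def intro: continuous_map_compose)
    from closedin_continuous_maps_eq[OF HC y[unfolded pathin_def] this] show ?thesis by (simp add: C_def)
  qed
  obtain \<sigma> where s: "\<sigma> permutes {1..n}" "y 0 = x 0 \<circ> \<sigma>"
    using perm_orbit_eqE[OF e[of 0]] by auto
  define D where "D = (\<Union>\<tau>\<in>{\<tau>. \<tau> permutes {1..n}} - {\<sigma>}. C \<tau>)"
  have cD: "closedin ?I D"
  proof -
    have "finite (C ` ({\<tau>. \<tau> permutes {1..n}} - {\<sigma>}))" using finite_permutations[of "{1..n}"] by simp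
    thus ?thesis unfolding D_def by (rule closedin_Union) (use cl in blast)
  qed
  have "\<exists>\<tau>. \<tau> permutes {1..n} \<and> t \<in> C \<tau>" if "t \<in> {0..1}" for t
    using perm_orbit_eqE[OF e[OF that]] that by (auto simp: C_def)
  hence cov: "topspace ?I \<subseteq> C \<sigma> \<union> D" unfolding D_def by fastforce
  have "C \<sigma> \<inter> C \<tau> = {}" if "\<tau> permutes {1..n}" "\<tau> \<noteq> \<sigma>" for \<tau>
  proof (rule ccontr)
    assume "C \<sigma> \<inter> C \<tau> \<noteq> {}"
    then obtain t where t0: "t \<in> C \<sigma>" "t \<in> C \<tau>" by blast
    have t: "t \<in> {0..1}" "x t \<circ> \<sigma> = x t \<circ> \<tau>" using t0 unfolding C_def by simp_all
    have xt: "inj_on (x t) {1..n}"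
      using pathin_topspace[OF x t(1)] by (auto simp: topspace_conf_space)
    have "\<sigma> i = \<tau> i" for i
    proof (cases "i \<in> {1..n}")
      case True
      hence "\<sigma> i \<in> {1..n}" "\<tau> i \<in> {1..n}"
        using permutes_in_image[OF s(1)] permutes_in_image[OF that(1)] by blast+
      moreover have "x t (\<sigma> i) = x t (\<tau> i)" using fun_cong[OF t(2), of i] by simp
      ultimately show ?thesis by (rule_tac inj_onD[OF xt])
    next
      case False
      thus ?thesis using permutes_not_in[OF s(1)] permutes_not_in[OF that(1)] by metis
    qed
    with that(2) show False by auto
  qed
  hence dis: "C \<sigma> \<inter> D = {}" unfolding D_def by blast
  have "connected_space ?I" by (simp add: connected_space_subtopology)
  moreover have "0 \<in> C \<sigma>" unfolding C_def using s by simp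
  ultimately have "D = {}"
    using cl[OF s(1)] cD cov dis unfolding connected_space_closedin by blast
  hence "1 \<in> C \<sigma>" using cov by auto
  hence "y 1 = x 1 \<circ> \<sigma>" unfolding C_def by simp
  with s show ?thesis by blast
qed

text \<open>Small paths are lifted by local sections. Another lift multiplies both end labels on the
  right by the same permutation, which cancels in the difference. Gluing then stands in for unique
  path lifting.\<close>

theorem monodromy:
  assumes H: "Hausdorff_space (X :: 'a topology)"
  obtains \<Phi> :: "(real => (nat => 'a) set) => nat sym" where "path_functor (uconf_space n X) \<Phi>"
    "\<And>x. pathin (conf_space n X) x ==> \<Phi> (perm_orbit n \<circ> x) = slabel n (x 0) - slabel n (x 1)"
    "\<And>p. pathin (uconf_space n X) p ==> Rep_sym (\<Phi> p) permutes {1..n}"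
proof -
  let ?Y = "uconf_space n X" and ?C = "conf_space n X"
  define Q where "Q p x \<longleftrightarrow> pathin ?C x \<and> (\<forall>t\<in>{0..1}. perm_orbit n (x t) = p t)" for p x
  define P where "P p = (let x = (SOME x. Q p x) in slabel n (x 0) - slabel n (x 1))" for p
  have P: "P p = slabel n (x 0) - slabel n (x 1)" if x: "Q p x" for p x
  proof -
    define y where "y = (SOME x. Q p x)"
    have y: "Q p y" unfolding y_def by (rule someI[where P = "Q p"]) (rule x)
    obtain \<sigma> where s: "\<sigma> permutes {1..n}" "y 0 = x 0 \<circ> \<sigma>" "y 1 = x 1 \<circ> \<sigma>"
      using lifts_differ_by_permutation[OF H, of n x y] x y by (auto simp: Q_def)
    define s' where "s' = Abs_sym \<sigma>"
    have s': "Rep_sym s' = \<sigma>"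
      unfolding s'_def using permutes_bij[OF s(1)] by (intro Abs_sym_inverse) simp
    have xt: "x 0 \<in> topspace ?C" "x 1 \<in> topspace ?C"
      using x by (auto simp: Q_def intro: pathin_topspace)
    have "slabel n (y 0) = slabel n (x 0) + s'" "slabel n (y 1) = slabel n (x 1) + s'"
      using slabel_compose[OF xt(1), of s'] slabel_compose[OF xt(2), of s'] s s' by simp_all
    hence "slabel n (y 0) - slabel n (y 1) = slabel n (x 0) - slabel n (x 1)"
      by (simp only: diff_conv_add_uminus minus_add add.assoc minus_add_cancel add_minus_cancel)
    thus ?thesis by (simp add: P_def y_def[symmetric] Let_def)
  qed
  define \<U> where "\<U> = {perm_orbit n ` G | G. openin ?C G \<and> inj_on (perm_orbit n) G}"
  have op: "openin ?Y U" if "U \<in> \<U>" for U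
    using that open_perm_orbit unfolding \<U>_def by blast
  have cov: "topspace ?Y \<subseteq> \<Union>\<U>"
  proof
    fix y assume "y \<in> topspace ?Y"
    from local_section[OF H this] show "y \<in> \<Union>\<U>" unfolding \<U>_def by blast
  qed
  have loc: "\<exists>r :: (nat => 'a) set => nat => 'a. \<forall>p. pathin (subtopology ?Y U) p \<longrightarrow> P p = slabel n (r (p 0)) - slabel n (r (p 1))"
    if UU: "U \<in> \<U>" for U
  proof -
    obtain G where G: "U = perm_orbit n ` G" "openin ?C G" "inj_on (perm_orbit n) G"
      using UU unfolding \<U>_def by blast
    obtain r where r: "continuous_map (subtopology ?Y U) ?C r" "\<forall>x\<in>G. r (perm_orbit n x) = x"
      using perm_orbit_section[OF G(2,3)] unfolding G(1) by (elim exE conjE)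
    have "P p = slabel n (r (p 0)) - slabel n (r (p 1))" if p: "pathin (subtopology ?Y U) p" for p
    proof -
      have "Q p (r \<circ> p)"
        unfolding Q_def
      proof
        show "pathin ?C (r \<circ> p)" using p r(1) unfolding pathin_def by (rule continuous_map_compose)
        show "\<forall>t\<in>{0..1}. perm_orbit n ((r \<circ> p) t) = p t"
        proof
          fix t :: real assume "t \<in> {0..1}"
          from pathin_topspace[OF p this] have "p t \<in> perm_orbit n ` G"
            unfolding topspace_subtopology G(1) by (rule IntD2)
          then obtain x where "x \<in> G" "p t = perm_orbit n x" by blast
          with r(2) show "perm_orbit n ((r \<circ> p) t) = p t" by simp
        qed
      qed
      from P[OF this] show ?thesis by simp
    qed
    thus ?thesis by (intro exI[of _ r] allI impI)
  qed
  have PU: "path_functor (subtopology ?Y U) P" if UU: "U \<in> \<U>" for U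
  proof -
    obtain r :: "(nat => 'a) set => nat => 'a" where r: "\<forall>p. pathin (subtopology ?Y U) p \<longrightarrow> P p = slabel n (r (p 0)) - slabel n (r (p 1))"
      using loc[OF UU] by (elim exE)
    show ?thesis
      by (rule path_functor_eq[OF path_functor_coboundary[of _ "\<lambda>y. - slabel n (r y)"]])
         (simp add: r)
  qed
  obtain \<Phi> where \<Phi>: "path_functor ?Y \<Phi>" "\<And>U p. U \<in> \<U> ==> pathin (subtopology ?Y U) p ==> \<Phi> p = P p"
    using glue_path_functor[OF op cov PU] by blast
  have "\<Phi> (perm_orbit n \<circ> x) = slabel n (x 0) - slabel n (x 1)" if x: "pathin ?C x" for x
  proof -
    \<comment> \<open>The cover is pulled back to ordered configurations. There both sides of the
      formula are functors that agree on small paths, which settles paths of any length.\<close>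
    define \<V> where "\<V> = {{x \<in> topspace ?C. perm_orbit n x \<in> U} | U. U \<in> \<U>}"
    have "\<Phi> (perm_orbit n \<circ> x) = - (- slabel n (x 0)) + - slabel n (x 1)"
    proof (rule path_functor_unique[where Y = ?C and \<U> = \<V> and F = "\<lambda>x. \<Phi> (perm_orbit n \<circ> x)"
          and G = "\<lambda>x. - (- slabel n (x 0)) + - slabel n (x 1)"])
      show "openin ?C V" if V: "V \<in> \<V>" for V
      proof -
        obtain U where "U \<in> \<U>" "V = {x \<in> topspace ?C. perm_orbit n x \<in> U}" using V unfolding \<V>_def by blast
        thus ?thesis using openin_continuous_map_preimage[OF continuous_map_perm_orbit op] by blast
      qed
      show "topspace ?C \<subseteq> \<Union>\<V>"
      proof
        fix x assume x: "x \<in> topspace ?C"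
        hence "perm_orbit n x \<in> topspace ?Y" unfolding topspace_uconf_space by (rule imageI)
        then obtain U where "U \<in> \<U>" "perm_orbit n x \<in> U" using cov by blast
        with x show "x \<in> \<Union>\<V>" unfolding \<V>_def by blast
      qed
      show "path_functor ?C (\<lambda>x. \<Phi> (perm_orbit n \<circ> x))"
        by (rule path_functor_pullback[OF \<Phi>(1) continuous_map_perm_orbit])
      show "path_functor ?C (\<lambda>x. - (- slabel n (x 0)) + - slabel n (x 1))"
        by (rule path_functor_coboundary)
      fix V p assume V: "V \<in> \<V>" and p: "pathin (subtopology ?C V) p"
      obtain U where U: "U \<in> \<U>" "V = {x \<in> topspace ?C. perm_orbit n x \<in> U}" using V unfolding \<V>_def by blast
      have pC: "pathin ?C p" "p ` {0..1} \<subseteq> V"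
        using p by (auto simp: pathin_def continuous_map_in_subtopology)
      have "pathin ?Y (perm_orbit n \<circ> p)"
        using pC(1) continuous_map_perm_orbit unfolding pathin_def by (rule continuous_map_compose)
      hence "pathin (subtopology ?Y U) (perm_orbit n \<circ> p)"
        using pC(2) unfolding U(2) pathin_def continuous_map_in_subtopology by auto
      hence "\<Phi> (perm_orbit n \<circ> p) = P (perm_orbit n \<circ> p)" by (rule \<Phi>(2)[OF U(1)])
      also have "\<dots> = slabel n (p 0) - slabel n (p 1)"
        by (rule P) (simp add: Q_def pC)
      finally show "\<Phi> (perm_orbit n \<circ> p) = - (- slabel n (p 0)) + - slabel n (p 1)" by simp
    qed (rule x)
    thus ?thesis by simp
  qed
  moreover have "Rep_sym (\<Phi> p) permutes {1..n}" if p: "pathin ?Y p" for p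
  proof -
    have "\<Phi> p \<in> {g. Rep_sym g permutes {1..n}}"
    proof (rule path_functor_values[OF op cov \<Phi>(1) p])
      show "0 \<in> {g. Rep_sym g permutes {1..n}}" by (simp only: mem_Collect_eq Rep_sym_simps permutes_id)
      show "a + b \<in> {g. Rep_sym g permutes {1..n}}"
        if "a \<in> {g. Rep_sym g permutes {1..n}}" "b \<in> {g. Rep_sym g permutes {1..n}}" for a b
        using that unfolding mem_Collect_eq Rep_sym_simps by (intro permutes_compose)
      fix U q assume U: "U \<in> \<U>" and q: "pathin (subtopology ?Y U) q"
      obtain r :: "(nat => 'a) set => nat => 'a" where r: "\<forall>p. pathin (subtopology ?Y U) p \<longrightarrow> P p = slabel n (r (p 0)) - slabel n (r (p 1))"
        using loc[OF U] by (elim exE)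
      hence "P q = slabel n (r (q 0)) - slabel n (r (q 1))" using q by simp
      hence e: "Rep_sym (\<Phi> q) = label n (r (q 0)) \<circ> inv_into UNIV (label n (r (q 1)))"
        using \<Phi>(2)[OF U q] by (simp only: minus_sym_def Rep_sym_simps Rep_slabel)
      show "\<Phi> q \<in> {g. Rep_sym g permutes {1..n}}"
        unfolding mem_Collect_eq e by (rule permutes_compose[OF permutes_inv[OF label(1)] label(1)])
    qed
    thus ?thesis by simp
  qed
  ultimately show thesis using that[OF \<Phi>(1)] by blast
qed

section \<open>Three arcs with common end points\<close>

definition ix :: "'i list => 'i => nat" where
  "ix xs l = length (takeWhile (\<lambda>y. y \<noteq> l) xs)"

lemma ix_nth: "distinct xs ==> r < length xs ==> ix xs (xs ! r) = r"
proof (induction xs arbitrary: r)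
  case (Cons x xs)
  show ?case
  proof (cases r)
    case 0
    thus ?thesis by (simp add: ix_def)
  next
    case (Suc k)
    hence "x \<noteq> xs ! k" "k < length xs" using Cons.prems by auto
    thus ?thesis using Cons Suc by (simp add: ix_def)
  qed
qed simp

definition tri :: "'b => 'b => 'b => nat => 'b" where
  "tri x y z i = (if i = 0 then x else if i = 1 then y else z)"

lemma tri_simps [simp]: "tri x y z 0 = x" "tri x y z (Suc 0) = y" "tri x y z 2 = z"
  by (simp_all add: tri_def)

section \<open>States: labels listed in order along three arcs\<close>

definition snoc :: "nat => 'i => (nat => 'i list) => nat => 'i list" where
  "snoc j b m = (\<lambda>i. if i = j then m i @ [b] else m i)"

text \<open>A new particle enters the arc at its initial end, the vertex with parameter 0; with
  \<open>snoc\<close> it enters at the vertex with parameter 1. Acting on opposite ends of the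
  lists, the two operations commute, even on the same arc.\<close>

definition push :: "nat => 'i => (nat => 'i list) => nat => 'i list" where
  "push j a m = (\<lambda>i. if i = j then a # m i else m i)"

lemma push_snoc: "push j a (snoc c b m) = snoc c b (push j a m)"
  by (auto simp: push_def snoc_def fun_eq_iff)

definition arc_of :: "(nat => 'i list) => 'i => nat" where
  "arc_of m l = (if l \<in> set (m 0) then 0 else if l \<in> set (m 1) then 1 else 2)"

definition pos :: "(nat => 'i list) => 'i => real" where
  "pos m l = real (ix (m (arc_of m l)) l + 1) / real (length (m (arc_of m l)) + 1)"

definition state :: "'i set => (nat => 'i list) => bool" where
  "state M m \<longleftrightarrow> distinct (m 0 @ m 1 @ m 2) \<and> set (m 0 @ m 1 @ m 2) = M"

lemma less3: "i < 3 \<longleftrightarrow> i = 0 \<or> i = 1 \<or> i = (2::nat)"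
  by auto

lemma state_distinct: "state M m ==> i < 3 ==> distinct (m i)"
  by (auto simp: state_def less3)

lemma state_sub: "state M m ==> i < 3 ==> set (m i) \<subseteq> M"
  by (auto simp: state_def less3)

lemma arc_eq: "state M m ==> i < 3 ==> l \<in> set (m i) ==> arc_of m l = i"
  by (auto simp: state_def less3 arc_of_def)

lemma arc_mem: "state M m ==> l \<in> M ==> l \<in> set (m (arc_of m l)) \<and> arc_of m l < 3"
  by (auto simp: state_def arc_of_def)

lemma pos_nth:
  assumes "state M m" "i < 3" "r < length (m i)"
  shows "pos m (m i ! r) = real (r + 1) / real (length (m i) + 1)"
  using assms arc_eq[OF assms(1,2), of "m i ! r"] ix_nth[OF state_distinct[OF assms(1,2)] assms(3)]
  by (simp add: pos_def)

lemma state_push: "state M m ==> a \<notin> M ==> j < 3 ==> state (insert a M) (push j a m)"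
  by (auto simp: state_def push_def less3)

lemma state_snoc: "state M m ==> a \<notin> M ==> j < 3 ==> state (insert a M) (snoc j a m)"
  by (auto simp: state_def snoc_def less3)

lemma arc_push:
  assumes "state M m" "a \<notin> M" "j < 3"
  shows "l \<in> M ==> arc_of (push j a m) l = arc_of m l" "arc_of (push j a m) a = j"
  using assms by (auto simp: state_def push_def less3 arc_of_def)

lemma arc_snoc:
  assumes "state M m" "a \<notin> M" "j < 3"
  shows "l \<in> M ==> arc_of (snoc j a m) l = arc_of m l" "arc_of (snoc j a m) a = j"
  using assms by (auto simp: state_def snoc_def less3 arc_of_def)

definition evenly :: "nat => real list" where
  "evenly m = map (\<lambda>r. real (r + 1) / real (m + 1)) [0..<m]"

lemma evenly_sorted: "sorted_wrt (<) (evenly m)"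
  unfolding evenly_def sorted_wrt_iff_nth_less by (auto intro!: divide_strict_right_mono)

lemma evenly_in: "x \<in> set (evenly m) ==> 0 < x \<and> x < 1"
  unfolding evenly_def by auto

lemma map_pos: "state M m ==> i < 3 ==> map (pos m) (m i) = evenly (length (m i))"
  by (rule nth_equalityI) (auto simp: evenly_def pos_nth)

text \<open>Admissible positions for a state: the order on each arc is kept, only \<open>a\<close>
  may sit at the vertex 0 and only \<open>b\<close> at the vertex 1. The condition is convex, so
  straight motions between admissible positions are free of collisions.\<close>

definition okl :: "(nat => 'i list) => 'i => 'i => ('i => real) => bool" where
  "okl m a b q \<longleftrightarrow> (\<forall>i<3. sorted_wrt (<) (map q (m i)) \<and>
     (\<forall>l\<in>set (m i). 0 \<le> q l \<and> q l \<le> 1 \<and> (l \<noteq> a \<longrightarrow> 0 < q l) \<and> (l \<noteq> b \<longrightarrow> q l < 1)))"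

lemma okl_lin:
  assumes q: "okl m a b q" "okl m a b q'" and t: "t \<in> {0..1}"
  shows "okl m a b (\<lambda>l. lin (q l) (q' l) t)"
proof -
  have mono: "lin x x' t < lin y y' t" if "x < y" "x' < y'" for x x' y y' :: real
  proof -
    have "(1 - t) * x + t * x' < (1 - t) * y + t * y'"
    proof (cases "t = 1")
      case False
      hence "(1 - t) * x < (1 - t) * y" "t * x' \<le> t * y'"
        using that t by (auto intro!: mult_left_mono)
      thus ?thesis by linarith
    qed (use that in simp)
    thus ?thesis by (simp add: lin_def algebra_simps)
  qed
  have cvx: "0 \<le> lin x y t" "lin x y t \<le> 1" if "0 \<le> x" "x \<le> 1" "0 \<le> y" "y \<le> 1" for x y :: real
    using lin_in_convex[of "{0..1}" x y t] that t by auto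
  have c0: "0 < lin x y t" if "0 < x" "0 < y" for x y :: real
    using mono[of 0 x 0 y] that by simp
  have c1: "lin x y t < 1" if "x < 1" "y < 1" for x y :: real
    using mono[of x 1 y 1] that by simp
  show ?thesis
    unfolding okl_def
  proof (intro allI impI conjI ballI)
    fix i :: nat assume i: "i < 3"
    show "sorted_wrt (<) (map (\<lambda>l. lin (q l) (q' l) t) (m i))"
      using q i unfolding okl_def sorted_wrt_iff_nth_less by (auto intro!: mono)
    fix l assume l: "l \<in> set (m i)"
    hence "0 \<le> q l" "q l \<le> 1" "0 \<le> q' l" "q' l \<le> 1" using q i unfolding okl_def by blast+
    thus "0 \<le> lin (q l) (q' l) t" "lin (q l) (q' l) t \<le> 1" by (rule cvx)+
    show "0 < lin (q l) (q' l) t" if "l \<noteq> a"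
      using q i l that unfolding okl_def by (intro c0) blast+
    show "lin (q l) (q' l) t < 1" if "l \<noteq> b"
      using q i l that unfolding okl_def by (intro c1) blast+
  qed
qed

text \<open>All positions in use are evenly spaced inside an arc, possibly with a 0 in front for
  \<open>a\<close> and a 1 at the end for \<open>b\<close>.\<close>

lemma okl_intro:
  assumes ex: "\<And>i. i < 3 ==> \<exists>e u v. map q (k i) = u @ evenly e @ v \<and>
      (u = [] \<or> u = [0] \<and> hd (k i) = a) \<and> (v = [] \<or> v = [1] \<and> last (k i) = b)"
  shows "okl k a b q"
  unfolding okl_def
proof (intro allI impI)
  fix i :: nat assume "i < 3"
  then obtain e u v where e: "map q (k i) = u @ evenly e @ v"
    "u = [] \<or> u = [0] \<and> hd (k i) = a" "v = [] \<or> v = [1] \<and> last (k i) = b"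
    using ex by meson
  have s: "sorted_wrt (<) (map q (k i))"
    unfolding e(1) using e(2,3) evenly_in evenly_sorted by (auto simp: sorted_wrt_append)
  have mn: "q (k i ! x) < q (k i ! y)" if "x < y" "y < length (k i)" for x y
      using s that unfolding sorted_wrt_iff_nth_less by simp
    have "0 \<le> q l \<and> q l \<le> 1 \<and> (l \<noteq> a \<longrightarrow> 0 < q l) \<and> (l \<noteq> b \<longrightarrow> q l < 1)" if l: "l \<in> set (k i)" for l
  proof -
    have "q l \<in> set (u @ evenly e @ v)" unfolding e(1)[symmetric] using l by simp
    hence r: "0 \<le> q l" "q l \<le> 1" using e(2,3) evenly_in by fastforce+
    have ne: "k i \<noteq> []" using l by auto
    have "l = hd (k i)" if "q l = 0"
    proof (rule ccontr)
      assume c: "l \<noteq> hd (k i)"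
      obtain r where r: "r < length (k i)" "k i ! r = l" using l by (metis in_set_conv_nth)
      hence "r \<noteq> 0" using c ne by (metis hd_conv_nth)
      hence lt: "q (hd (k i)) < 0" using mn[of 0 r] r ne that by (simp add: hd_conv_nth)
      have "q (hd (k i)) \<in> set (u @ evenly e @ v)" unfolding e(1)[symmetric] using ne by simp
      thus False using lt e(2,3) evenly_in by fastforce
    qed
    moreover have "u = [0]" if "q l = 0"
    proof (rule ccontr)
      assume "u \<noteq> [0]"
      hence "u = []" using e(2) by blast
      hence "q l \<in> set (evenly e @ v)" using \<open>q l \<in> set (u @ evenly e @ v)\<close> by simp
      thus False using that e(3) evenly_in by fastforce
    qed
    moreover have "l = last (k i)" if "q l = 1"
    proof (rule ccontr)
      assume c: "l \<noteq> last (k i)"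
      obtain r where r: "r < length (k i)" "k i ! r = l" using l by (metis in_set_conv_nth)
      hence "r < length (k i) - 1" using c ne by (metis last_conv_nth Suc_pred length_greater_0_conv less_Suc_eq diff_Suc_1)
      hence lt: "q (last (k i)) > 1" using mn[of r "length (k i) - 1"] r ne that by (simp add: last_conv_nth)
      have "q (last (k i)) \<in> set (u @ evenly e @ v)" unfolding e(1)[symmetric] using ne by simp
      thus False using lt e(2,3) evenly_in by fastforce
    qed
    moreover have "v = [1]" if "q l = 1"
    proof (rule ccontr)
      assume "v \<noteq> [1]"
      hence "v = []" using e(3) by blast
      hence "q l \<in> set (u @ evenly e)" using \<open>q l \<in> set (u @ evenly e @ v)\<close> by simp
      thus False using that e(2) evenly_in by fastforce
    qed
    ultimately show ?thesis using r e(2,3) by fastforce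
  qed
  with s show "sorted_wrt (<) (map q (k i)) \<and>
     (\<forall>l\<in>set (k i). 0 \<le> q l \<and> q l \<le> 1 \<and> (l \<noteq> a \<longrightarrow> 0 < q l) \<and> (l \<noteq> b \<longrightarrow> q l < 1))" by blast
qed

lemma okl_push:
  assumes m: "state M m" and a: "a \<notin> M" and j: "j < 3"
  shows "okl (push j a m) a b ((pos m)(a := 0))" "okl (push j a m) a b (pos (push j a m))"
proof -
  have m1: "state (insert a M) (push j a m)" using state_push[OF m a j] .
  show "okl (push j a m) a b ((pos m)(a := 0))"
  proof (rule okl_intro)
    fix i :: nat assume i: "i < 3"
    have "a \<notin> set (m i)" using state_sub[OF m i] a by blast
    hence "map ((pos m)(a := 0)) (m i) = evenly (length (m i))"
      unfolding map_pos[OF m i, symmetric] by auto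
    hence "map ((pos m)(a := 0)) (push j a m i) = (if i = j then [0] else []) @ evenly (length (m i)) @ []"
      by (auto simp: push_def)
    thus "\<exists>e u v. map ((pos m)(a := 0)) (push j a m i) = u @ evenly e @ v \<and>
      (u = [] \<or> u = [0] \<and> hd (push j a m i) = a) \<and> (v = [] \<or> v = [1] \<and> last (push j a m i) = b)"
      by (rule_tac exI, rule_tac exI, rule_tac exI) (rule conjI, assumption, auto simp: push_def)
  qed
  show "okl (push j a m) a b (pos (push j a m))"
    by (rule okl_intro) (use map_pos[OF m1] in \<open>auto intro!: exI[of _ "[]"]\<close>)
qed

lemma okl_snoc:
  assumes m: "state M m" and b: "b \<notin> M" and j: "j < 3"
  shows "okl (snoc j b m) a b ((pos m)(b := 1))" "okl (snoc j b m) a b (pos (snoc j b m))"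
proof -
  have m1: "state (insert b M) (snoc j b m)" using state_snoc[OF m b j] .
  show "okl (snoc j b m) a b ((pos m)(b := 1))"
  proof (rule okl_intro)
    fix i :: nat assume i: "i < 3"
    have "b \<notin> set (m i)" using state_sub[OF m i] b by blast
    hence "map ((pos m)(b := 1)) (m i) = evenly (length (m i))"
      unfolding map_pos[OF m i, symmetric] by auto
    hence "map ((pos m)(b := 1)) (snoc j b m i) = [] @ evenly (length (m i)) @ (if i = j then [1] else [])"
      by (auto simp: snoc_def)
    thus "\<exists>e u v. map ((pos m)(b := 1)) (snoc j b m i) = u @ evenly e @ v \<and>
      (u = [] \<or> u = [0] \<and> hd (snoc j b m i) = a) \<and> (v = [] \<or> v = [1] \<and> last (snoc j b m i) = b)"
      by (rule_tac exI, rule_tac exI, rule_tac exI) (rule conjI, assumption, auto simp: snoc_def)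
  qed
  show "okl (snoc j b m) a b (pos (snoc j b m))"
    by (rule okl_intro) (use map_pos[OF m1] in \<open>auto intro!: exI[of _ "[]"]\<close>)
qed

text \<open>The four corners of the square in which \<open>a\<close> enters arc \<open>j\<close>
  from one vertex while \<open>b\<close> enters arc \<open>c\<close> from the other, all expressed
  as positions for one and the same state.\<close>

lemma okl_pos:
  assumes m: "state M m" and a: "a \<notin> M" and b: "b \<notin> M" and ab: "a \<noteq> b" and jc: "j < 3" "c < 3"
  shows "okl (snoc c b (push j a m)) a b ((pos m)(a := 0, b := 1))"
    "okl (snoc c b (push j a m)) a b ((pos (push j a m))(b := 1))"
    "okl (snoc c b (push j a m)) a b ((pos (snoc c b m))(a := 0))"
    "okl (snoc c b (push j a m)) a b (pos (snoc c b (push j a m)))"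
proof -
  have m1: "state (insert a M) (push j a m)" and m2: "state (insert b M) (snoc c b m)"
    using state_push[OF m a jc(1)] state_snoc[OF m b jc(2)] .
  have mi: "a \<notin> set (m i)" "b \<notin> set (m i)" if "i < 3" for i
    using state_sub[OF m that] a b by auto
  show "okl (snoc c b (push j a m)) a b ((pos m)(a := 0, b := 1))"
  proof (rule okl_intro)
    fix i :: nat assume i: "i < 3"
    have "map ((pos m)(a := 0, b := 1)) (m i) = evenly (length (m i))"
      unfolding map_pos[OF m i, symmetric] using mi[OF i] by auto
    hence "map ((pos m)(a := 0, b := 1)) (snoc c b (push j a m) i) =
      (if i = j then [0] else []) @ evenly (length (m i)) @ (if i = c then [1] else [])"
      using ab by (auto simp: snoc_def push_def)
    thus "\<exists>e u v. map ((pos m)(a := 0, b := 1)) (snoc c b (push j a m) i) = u @ evenly e @ v \<and>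
      (u = [] \<or> u = [0] \<and> hd (snoc c b (push j a m) i) = a) \<and> (v = [] \<or> v = [1] \<and> last (snoc c b (push j a m) i) = b)"
      by (rule_tac exI, rule_tac exI, rule_tac exI) (rule conjI, assumption, auto simp: snoc_def push_def)
  qed
  show "okl (snoc c b (push j a m)) a b ((pos (push j a m))(b := 1))" "okl (snoc c b (push j a m)) a b (pos (snoc c b (push j a m)))"
    using okl_snoc[OF m1 _ jc(2), of b a] ab b by blast+
  show "okl (snoc c b (push j a m)) a b ((pos (snoc c b m))(a := 0))"
    using okl_push[OF m2 _ jc(1), of a b] ab a unfolding push_snoc by blast
qed

section \<open>Motions on three arcs with common end points\<close>

locale theta =
  fixes X :: "'x topology" and n :: nat and \<gamma> :: "nat => real => 'x"
  assumes arcs: "i < 3 ==> pathin X (\<gamma> i)"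
    and ends: "i < 3 ==> j < 3 ==> \<gamma> i 0 = \<gamma> j 0" "i < 3 ==> j < 3 ==> \<gamma> i 1 = \<gamma> j 1"
    and inj: "i < 3 ==> j < 3 ==> s \<in> {0..1} ==> t \<in> {0..1} ==> \<gamma> i s = \<gamma> j t ==>
       i = j \<and> s = t \<or> s = 0 \<and> t = 0 \<or> s = 1 \<and> t = 1"
begin

definition qc :: "(nat => nat) => (nat => real) => nat => 'x" where
  "qc A q = (\<lambda>l\<in>{1..n}. \<gamma> (A l) (q l))"

definition lp :: "(nat => nat) => (nat => real) => (nat => real) => real => nat => 'x" where
  "lp A q q' = (\<lambda>t. qc A (\<lambda>l. lin (q l) (q' l) t))"

lemma qc_inj:
  assumes m: "state {1..n} m" and q: "okl m a b q"
  shows "inj_on (qc (arc_of m) q) {1..n}"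
proof (rule inj_onI)
  fix l l' assume l: "l \<in> {1..n}" "l' \<in> {1..n}" and e: "qc (arc_of m) q l = qc (arc_of m) q l'"
  note al = arc_mem[OF m l(1)] and al' = arc_mem[OF m l(2)]
  have r: "0 \<le> q l" "q l \<le> 1" "l \<noteq> a ==> 0 < q l" "l \<noteq> b ==> q l < 1"
    "0 \<le> q l'" "q l' \<le> 1" "l' \<noteq> a ==> 0 < q l'" "l' \<noteq> b ==> q l' < 1"
    using q al al' unfolding okl_def by blast+
  have "\<gamma> (arc_of m l) (q l) = \<gamma> (arc_of m l') (q l')" using e l by (simp add: qc_def)
  hence "arc_of m l = arc_of m l' \<and> q l = q l' \<or> q l = 0 \<and> q l' = 0 \<or> q l = 1 \<and> q l' = 1"
    using inj[of "arc_of m l" "arc_of m l'" "q l" "q l'"] al al' r by auto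
  thus "l = l'"
  proof (elim disjE conjE)
    assume 1: "arc_of m l = arc_of m l'" and 2: "q l = q l'"
    obtain k k' where k: "k < length (m (arc_of m l))" "m (arc_of m l) ! k = l"
      "k' < length (m (arc_of m l))" "m (arc_of m l) ! k' = l'"
      using al al' 1 by (metis in_set_conv_nth)
    have "sorted_wrt (<) (map q (m (arc_of m l)))" using q al unfolding okl_def by blast
    hence mn: "q (m (arc_of m l) ! x) < q (m (arc_of m l) ! y)" if "x < y" "y < length (m (arc_of m l))" for x y
      using that unfolding sorted_wrt_iff_nth_less by simp
    have "q l < q l'" if "k < k'" using mn[OF that k(3)] unfolding k .
    moreover have "q l' < q l" if "k' < k" using mn[OF that k(1)] unfolding k .
    ultimately have "k = k'" using 2 by (metis less_irrefl linorder_neqE_nat)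
    thus ?thesis using k by simp
  next
    assume "q l = 0" "q l' = 0"
    thus ?thesis using r(3,7) by fastforce
  next
    assume "q l = 1" "q l' = 1"
    thus ?thesis using r(4,8) by fastforce
  qed
qed

text \<open>Bilinear interpolation of four admissible corners is admissible everywhere, by convexity
  used once in each variable.\<close>

lemma qc_square:
  assumes m: "state {1..n} m"
    and q: "okl m a b q00" "okl m a b q10" "okl m a b q01" "okl m a b q11"
  shows "continuous_map (top_of_set ({0..1} \<times> {0..1})) (conf_space n X)
    (\<lambda>z. qc (arc_of m) (\<lambda>l. lin (lin (q00 l) (q10 l) (fst z)) (lin (q01 l) (q11 l) (fst z)) (snd z)))"
proof -
  define h where "h z = (\<lambda>l. lin (lin (q00 l) (q10 l) (fst z)) (lin (q01 l) (q11 l) (fst z)) (snd z))" for z :: "real \<times> real"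
  have h: "okl m a b (h z)" if "z \<in> {0..1} \<times> {0..1}" for z
    unfolding h_def by (intro okl_lin q) (use that in auto)
  have "continuous_map (top_of_set ({0..1} \<times> {0..1})) (conf_space n X) (\<lambda>z. qc (arc_of m) (h z))"
    unfolding continuous_map_conf_space
  proof (intro conjI ballI)
    fix z assume "z \<in> topspace (top_of_set ({0..1::real} \<times> {0..1::real}))"
    thus "inj_on (qc (arc_of m) (h z)) {1..n}" using qc_inj[OF m h] by simp
    show "qc (arc_of m) (h z) \<in> extensional {1..n}" by (simp add: qc_def)
  next
    fix l assume l: "l \<in> {1..n}"
    note al = arc_mem[OF m l]
    have "continuous_map (top_of_set ({0..1} \<times> {0..1})) X (\<gamma> (arc_of m l) \<circ> (\<lambda>z. h z l))"
    proof (rule continuous_map_compose)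
      show "continuous_map (top_of_set {0..1}) X (\<gamma> (arc_of m l))"
        using arcs[of "arc_of m l"] al by (simp add: pathin_def)
      have "h z l \<in> {0..1}" if "z \<in> {0..1} \<times> {0..1}" for z
        using h[OF that] al unfolding okl_def by auto
      moreover have "continuous_on ({0..1} \<times> {0..1}) (\<lambda>z. h z l)"
        unfolding h_def lin_def by (intro continuous_intros)
      ultimately show "continuous_map (top_of_set ({0..1} \<times> {0..1})) (top_of_set {0..1}) (\<lambda>z. h z l)"
        by auto
    qed
    thus "continuous_map (top_of_set ({0..1} \<times> {0..1})) X (\<lambda>z. qc (arc_of m) (h z) l)"
      using l by (simp add: qc_def o_def)
  qed
  thus ?thesis by (simp add: h_def)
qed

definition pq :: "(nat => nat) => (nat => real) => (nat => real) => real => (nat => 'x) set" where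
  "pq A q q' = perm_orbit n \<circ> lp A q q'"

lemma pathin_lp:
  assumes m: "state {1..n} m" and q: "okl m a b q" "okl m a b q'"
  shows "pathin (conf_space n X) (lp (arc_of m) q q')"
proof -
  have "pathin (conf_space n X) (\<lambda>t. (\<lambda>z. qc (arc_of m) (\<lambda>l. lin (lin (q l) (q' l) (fst z)) (lin (q l) (q' l) (fst z)) (snd z))) (t, 0))"
    by (rule pathin_compose_convex[OF qc_square[OF m q q]]) (auto intro!: continuous_intros)
  thus ?thesis by (simp add: lp_def)
qed

lemma pathin_pq:
  assumes "state {1..n} m" "okl m a b q" "okl m a b q'"
  shows "pathin (uconf_space n X) (pq (arc_of m) q q')"
  using pathin_lp[OF assms] continuous_map_perm_orbit unfolding pq_def pathin_def
  by (rule continuous_map_compose)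

lemma pq_ends: "pq A q q' 0 = perm_orbit n (qc A q)" "pq A q q' 1 = perm_orbit n (qc A q')"
  by (simp_all add: pq_def lp_def)

lemma functor_square:
  assumes F: "path_functor (uconf_space n X) F" and m: "state {1..n} m"
    and q: "okl m a b q00" "okl m a b q10" "okl m a b q01" "okl m a b q11"
  shows "F (pq (arc_of m) q00 q10) + F (pq (arc_of m) q10 q11) = F (pq (arc_of m) q00 q01) + F (pq (arc_of m) q01 q11)"
proof -
  let ?Y = "uconf_space n X"
  define h where "h = (\<lambda>z. perm_orbit n (qc (arc_of m) (\<lambda>l. lin (lin (q00 l) (q10 l) (fst z)) (lin (q01 l) (q11 l) (fst z)) (snd z))))"
  have h: "continuous_map (top_of_set ({0..1} \<times> {0..1})) ?Y h"
    unfolding h_def using continuous_map_compose[OF qc_square[OF m q] continuous_map_perm_orbit] by (simp add: o_def)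
  have e: "(\<lambda>t. h (t, 0)) = pq (arc_of m) q00 q10" "(\<lambda>t. h (1, t)) = pq (arc_of m) q10 q11"
     "(\<lambda>t. h (0, t)) = pq (arc_of m) q00 q01" "(\<lambda>t. h (t, 1)) = pq (arc_of m) q01 q11"
    by (simp_all add: h_def pq_def lp_def fun_eq_iff)
  note p = pathin_pq[OF m q(1,2)] pathin_pq[OF m q(2,4)] pathin_pq[OF m q(1,3)] pathin_pq[OF m q(3,4)]
  have "F (loop_concat (pq (arc_of m) q00 q10) (pq (arc_of m) q10 q11)) = F (loop_concat (pq (arc_of m) q00 q01) (pq (arc_of m) q01 q11))"
    using path_functor_hom[OF F path_hom_square[OF h]] unfolding e .
  thus ?thesis
    using path_functor_concat[OF F p(1,2)] path_functor_concat[OF F p(3,4)] by (simp add: pq_ends)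
qed

text \<open>A particle resting at a common end point may be booked on any of the arcs. This freedom
  is how particles pass from one arc to another.\<close>

lemma lp_cong:
  assumes "\<And>l. l \<in> {1..n} ==> q l = r l \<and> q' l = r' l \<and> (A l = B l \<or> A l < 3 \<and> B l < 3 \<and> q l = q' l \<and> (q l = 0 \<or> q l = 1))"
  shows "lp A q q' = lp B r r'"
proof
  fix t
  have "\<gamma> (A l) (lin (q l) (q' l) t) = \<gamma> (B l) (lin (r l) (r' l) t)" if "l \<in> {1..n}" for l
  proof (cases "A l = B l")
    case False
    hence "A l < 3" "B l < 3" "q l = q' l" "q l = 0 \<or> q l = 1" "q l = r l" "q' l = r' l"
      using assms[OF that] by auto
    moreover have "\<gamma> (A l) 0 = \<gamma> (B l) 0" "\<gamma> (A l) 1 = \<gamma> (B l) 1"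
      using ends[of "A l" "B l"] calculation(1,2) by blast+
    ultimately show ?thesis by (elim disjE) (simp_all only: lin_same)
  qed (use assms[OF that] in simp)
  thus "lp A q q' t = lp B r r' t" by (auto simp: lp_def qc_def)
qed

text \<open>The particle \<open>a\<close> moves from the vertex at parameter 0 (resp. \<open>b\<close> from the vertex at
  parameter 1) into the arc \<open>j\<close>; in the primed versions the other vertex is occupied.\<close>

definition xl :: "nat => nat => (nat => nat list) => real => nat => 'x" where
  "xl j a m = lp (arc_of (push j a m)) ((pos m)(a := 0)) (pos (push j a m))"
definition yl :: "nat => nat => (nat => nat list) => real => nat => 'x" where
  "yl j b m = lp (arc_of (snoc j b m)) ((pos m)(b := 1)) (pos (snoc j b m))"
definition xl' :: "nat => nat => nat => (nat => nat list) => real => nat => 'x" where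
  "xl' j a b m = lp ((arc_of (push j a m))(b := 0)) ((pos m)(a := 0, b := 1)) ((pos (push j a m))(b := 1))"
definition yl' :: "nat => nat => nat => (nat => nat list) => real => nat => 'x" where
  "yl' j a b m = lp ((arc_of (snoc j b m))(a := 0)) ((pos m)(a := 0, b := 1)) ((pos (snoc j b m))(a := 0))"

end

lemma push_commute: "i \<noteq> j ==> push i a (push j b m) = push j b (push i a m)"
  and snoc_commute: "i \<noteq> j ==> snoc i a (snoc j b m) = snoc j b (snoc i a m)"
  by (auto simp: push_def snoc_def fun_eq_iff)

section \<open>Relabelling of particles\<close>

lemma list_relabelling:
  assumes d: "distinct xs" "distinct ys" and l: "length xs = length ys" and e: "set xs = S" "set ys = S"
  obtains \<sigma> where "\<sigma> permutes S" "map \<sigma> xs = ys"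
proof -
  define \<sigma> where "\<sigma> k = (if k \<in> S then ys ! ix xs k else k)" for k
  have m: "map \<sigma> xs = ys"
  proof (rule nth_equalityI)
    fix r assume r: "r < length (map \<sigma> xs)"
    hence "xs ! r \<in> S" using e(1) nth_mem[of r xs] by simp
    thus "map \<sigma> xs ! r = ys ! r"
      using r ix_nth[OF d(1), of r] by (simp add: \<sigma>_def)
  qed (simp add: l)
  have s: "\<sigma> ` S = S" using arg_cong[OF m, of set] unfolding set_map e .
  have "finite S" using e by auto
  hence "inj_on \<sigma> S" using s by (simp add: finite_surj_inj)
  hence "bij_betw \<sigma> S S" using s by (simp add: bij_betw_def)
  hence "\<sigma> permutes S" by (rule bij_imp_permutes) (simp only: \<sigma>_def if_False)
  thus thesis using m by (rule that)
qed

text \<open>States with equally many particles on each arc differ by a permutation of labels. The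
  labels \<open>a\<close> and \<open>a'\<close> stand for a particle that is just about to enter an
  arc.\<close>

lemma state_relabelling:
  assumes m: "state ({1..n} - {a}) m" "a \<in> {1..n}" and m': "state ({1..n} - {a'}) m'" "a' \<in> {1..n}"
    and l: "\<And>i. i < 3 ==> length (m i) = length (m' i)"
  obtains \<sigma> where "\<sigma> permutes {1..n::nat}" "\<sigma> a = a'" "\<And>i. i < 3 ==> map \<sigma> (m i) = m' i"
proof -
  have d: "distinct (a # m 0 @ m 1 @ m 2)" "set (a # m 0 @ m 1 @ m 2) = {1..n}"
    using m unfolding state_def by auto
  have d': "distinct (a' # m' 0 @ m' 1 @ m' 2)" "set (a' # m' 0 @ m' 1 @ m' 2) = {1..n}"
    using m' unfolding state_def by auto
  have len: "length (a # m 0 @ m 1 @ m 2) = length (a' # m' 0 @ m' 1 @ m' 2)"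
    using l[of 0] l[of 1] l[of 2] by simp
  obtain \<sigma> where s: "\<sigma> permutes {1..n}" "map \<sigma> (a # m 0 @ m 1 @ m 2) = a' # m' 0 @ m' 1 @ m' 2"
    by (rule list_relabelling[OF d(1) d'(1) len d(2) d'(2)])
  hence "\<sigma> a = a'" "map \<sigma> (m 0) = m' 0" "map \<sigma> (m 1) = m' 1" "map \<sigma> (m 2) = m' 2"
    using l[of 0] l[of 1] l[of 2] by auto
  hence "map \<sigma> (m i) = m' i" if "i < 3" for i using that unfolding less3 by (elim disjE) (simp_all only:)
  thus thesis using that[OF s(1) \<open>\<sigma> a = a'\<close>] by blast
qed

lemma relabelled:
  assumes m: "state M m" and m': "state M' m'" and s: "\<And>i. i < 3 ==> map \<sigma> (m i) = m' i" and l: "l \<in> M"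
  shows "arc_of m' (\<sigma> l) = arc_of m l" "pos m' (\<sigma> l) = pos m l"
proof -
  let ?i = "arc_of m l"
  have i: "?i < 3" "l \<in> set (m ?i)" using arc_mem[OF m l] by auto
  then obtain r where r: "r < length (m ?i)" "m ?i ! r = l" by (metis in_set_conv_nth)
  have len: "length (m' ?i) = length (m ?i)" using arg_cong[OF s[OF i(1)], of length] by simp
  have sr: "m' ?i ! r = \<sigma> l" using s[OF i(1)] r by (metis nth_map)
  have "\<sigma> l \<in> set (m' ?i)" using r len sr by (metis nth_mem)
  thus "arc_of m' (\<sigma> l) = ?i" by (rule arc_eq[OF m' i(1)])
  show "pos m' (\<sigma> l) = pos m l"
    using pos_nth[OF m i(1) r(1)] pos_nth[OF m' i(1), of r] r len sr by simp
qed

lemma map_push: "map \<sigma> (m i) = m' i ==> \<sigma> a = a' ==> map \<sigma> (push j a m i) = push j a' m' i"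
  and map_snoc: "map \<sigma> (m i) = m' i ==> \<sigma> a = a' ==> map \<sigma> (snoc j a m i) = snoc j a' m' i"
  by (auto simp: push_def snoc_def)

lemma state_push_full: "state (S - {a}) m ==> a \<in> S ==> j < 3 ==> state S (push j a m)"
  using state_push[of "S - {a}" m a j] by (simp add: insert_absorb)

lemma state_snoc_full: "state (S - {a}) m ==> a \<in> S ==> j < 3 ==> state S (snoc j a m)"
  using state_snoc[of "S - {a}" m a j] by (simp add: insert_absorb)

lemma state_diff_pushI: "state (S - insert a T) m ==> a \<in> S ==> a \<notin> T ==> i < 3 ==> state (S - T) (push i a m)"
proof -
  assume a: "state (S - insert a T) m" "a \<in> S" "a \<notin> T" "i < 3"
  have "S - insert a T = (S - T) - {a}" by blast
  from a(1)[unfolded this] show ?thesis by (rule state_push_full) (use a in auto)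
qed

lemma state_diff_snocI: "state (S - insert a T) m ==> a \<in> S ==> a \<notin> T ==> i < 3 ==> state (S - T) (snoc i a m)"
proof -
  assume a: "state (S - insert a T) m" "a \<in> S" "a \<notin> T" "i < 3"
  have "S - insert a T = (S - T) - {a}" by blast
  from a(1)[unfolded this] show ?thesis by (rule state_snoc_full) (use a in auto)
qed

context theta
begin

definition Lc :: "(nat => nat list) => nat => 'x" where
  "Lc m = qc (arc_of m) (pos m)"
definition xc :: "nat => (nat => nat list) => nat => 'x" where
  "xc a m = qc ((arc_of m)(a := 0)) ((pos m)(a := 0))"
definition yc :: "nat => (nat => nat list) => nat => 'x" where
  "yc b m = qc ((arc_of m)(b := 0)) ((pos m)(b := 1))"

lemma pathin_xl:
  assumes "state ({1..n} - {a}) m" "a \<in> {1..n}" "j < 3"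
  shows "pathin (conf_space n X) (xl j a m)"
  unfolding xl_def by (rule pathin_lp[OF state_push_full okl_push]) (use assms in auto)

lemma pathin_yl:
  assumes "state ({1..n} - {b}) m" "b \<in> {1..n}" "j < 3"
  shows "pathin (conf_space n X) (yl j b m)"
  unfolding yl_def by (rule pathin_lp[OF state_snoc_full okl_snoc]) (use assms in auto)

lemma qc_cong:
  assumes "\<And>l. l \<in> {1..n} ==> q l = r l \<and> (A l = B l \<or> A l < 3 \<and> B l < 3 \<and> (q l = 0 \<or> q l = 1))"
  shows "qc A q = qc B r"
proof -
  have "lp A q q = lp B r r" by (rule lp_cong) (use assms in blast)
  from fun_cong[OF this, of 0] show ?thesis unfolding lp_def lin_0 .
qed

lemma xl_ends:
  assumes m: "state ({1..n} - {a}) m" "a \<in> {1..n}" "j < 3"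
  shows "xl j a m 0 = xc a m" "xl j a m 1 = Lc (push j a m)"
proof -
  have na: "a \<notin> {1..n} - {a}" by simp
  note A = arc_push[OF m(1) na m(3)]
  have "qc (arc_of (push j a m)) ((pos m)(a := 0)) = xc a m"
    unfolding xc_def
  proof (rule qc_cong)
    fix l assume "l \<in> {1..n}"
    thus "((pos m)(a := 0)) l = ((pos m)(a := 0)) l \<and> (arc_of (push j a m) l = ((arc_of m)(a := 0)) l \<or>
       arc_of (push j a m) l < 3 \<and> ((arc_of m)(a := 0)) l < 3 \<and> (((pos m)(a := 0)) l = 0 \<or> ((pos m)(a := 0)) l = 1))"
      using A(1)[of l] A(2) m(3) by (cases "l = a") simp_all
  qed
  thus "xl j a m 0 = xc a m" unfolding xl_def lp_def lin_0 .
  show "xl j a m 1 = Lc (push j a m)" by (simp add: xl_def lp_def Lc_def)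
qed

lemma yl_ends:
  assumes m: "state ({1..n} - {b}) m" "b \<in> {1..n}" "j < 3"
  shows "yl j b m 0 = yc b m" "yl j b m 1 = Lc (snoc j b m)"
proof -
  have na: "b \<notin> {1..n} - {b}" by simp
  note A = arc_snoc[OF m(1) na m(3)]
  have "qc (arc_of (snoc j b m)) ((pos m)(b := 1)) = yc b m"
    unfolding yc_def
  proof (rule qc_cong)
    fix l assume "l \<in> {1..n}"
    thus "((pos m)(b := 1)) l = ((pos m)(b := 1)) l \<and> (arc_of (snoc j b m) l = ((arc_of m)(b := 0)) l \<or>
       arc_of (snoc j b m) l < 3 \<and> ((arc_of m)(b := 0)) l < 3 \<and> (((pos m)(b := 1)) l = 0 \<or> ((pos m)(b := 1)) l = 1))"
      using A(1)[of l] A(2) m(3) by (cases "l = b") simp_all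
  qed
  thus "yl j b m 0 = yc b m" unfolding yl_def lp_def lin_0 .
  show "yl j b m 1 = Lc (snoc j b m)" by (simp add: yl_def lp_def Lc_def)
qed

text \<open>The entries of \<open>a\<close> and \<open>b\<close> take place at different vertices
  and can be performed simultaneously; \<open>functor_square\<close> is read off at the corners of
  \<open>okl_pos\<close>.\<close>

lemma square_law:
  assumes F: "path_functor (uconf_space n X) F" and m: "state ({1..n} - {a, b}) m"
    and ab: "a \<in> {1..n}" "b \<in> {1..n}" "a \<noteq> b" and jc: "j < 3" "c < 3"
  shows "F (perm_orbit n \<circ> xl' j a b m) + F (perm_orbit n \<circ> yl c b (push j a m)) =
     F (perm_orbit n \<circ> yl' c a b m) + F (perm_orbit n \<circ> xl j a (snoc c b m))"
proof -
  let ?M = "{1..n} - {a, b}" and ?k = "snoc c b (push j a m)"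
  have na: "a \<notin> ?M" "b \<notin> ?M" by auto
  have m': "state ({1..n} - {b, a}) m" using m by (simp only: insert_commute)
  have m1: "state ({1..n} - {b}) (push j a m)"
    by (rule state_diff_pushI[OF m]) (use ab jc in auto)
  have m2: "state ({1..n} - {a}) (snoc c b m)"
    by (rule state_diff_snocI[OF m']) (use ab jc in auto)
  have m3: "state {1..n} ?k" using state_snoc_full[OF m1 ab(2) jc(2)] .
  note ok = okl_pos[OF m na ab(3) jc]
  have A1: "arc_of ?k l = arc_of (push j a m) l" if "l \<in> {1..n}" "l \<noteq> b" for l
    using arc_snoc(1)[OF m1 _ jc(2), of b l] that by auto
  have A2: "arc_of ?k l = arc_of (snoc c b m) l" if "l \<in> {1..n}" "l \<noteq> a" for l
    using arc_push(1)[OF m2 _ jc(1), of a l] that unfolding push_snoc by auto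
  have lt: "arc_of ?k l < 3" if "l \<in> {1..n}" for l using arc_mem[OF m3 that] by simp
  have 1: "pq (arc_of ?k) ((pos m)(a := 0, b := 1)) ((pos (push j a m))(b := 1)) = perm_orbit n \<circ> xl' j a b m"
    unfolding pq_def xl'_def
    by (rule arg_cong[where f = "\<lambda>h. perm_orbit n \<circ> h"], rule lp_cong) (use A1 lt ab in auto)
  have 2: "pq (arc_of ?k) ((pos m)(a := 0, b := 1)) ((pos (snoc c b m))(a := 0)) = perm_orbit n \<circ> yl' c a b m"
    unfolding pq_def yl'_def
    by (rule arg_cong[where f = "\<lambda>h. perm_orbit n \<circ> h"], rule lp_cong) (use A2 lt ab in auto)
  show ?thesis
    using functor_square[OF F m3 ok] unfolding 1 2 unfolding pq_def yl_def xl_def push_snoc .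
qed

lemma orbit_relabel:
  assumes s: "\<sigma> permutes {1..n}" and e: "\<And>t. g t \<circ> \<sigma> = h t"
  shows "perm_orbit n \<circ> g = perm_orbit n \<circ> h"
proof
  fix t show "(perm_orbit n \<circ> g) t = (perm_orbit n \<circ> h) t"
    unfolding o_apply e[symmetric] perm_orbit_compose[OF s] ..
qed

lemma lp_relabel:
  assumes s: "\<sigma> permutes {1..n}"
    and e: "\<And>l. l \<in> {1..n} ==> A' (\<sigma> l) = A l \<and> q' (\<sigma> l) = q l \<and> r' (\<sigma> l) = r l"
  shows "lp A' q' r' t \<circ> \<sigma> = lp A q r t"
proof
  fix l
  show "(lp A' q' r' t \<circ> \<sigma>) l = lp A q r t l"
  proof (cases "l \<in> {1..n}")
    case True
    hence "\<sigma> l \<in> {1..n}" using permutes_in_image[OF s] by blast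
    with True show ?thesis using e[OF True] by (simp add: lp_def qc_def)
  next
    case False
    hence "\<sigma> l = l" using permutes_not_in[OF s] by blast
    thus ?thesis unfolding o_apply lp_def qc_def using False by (simp only: restrict_apply if_False)
  qed
qed

text \<open>In the unordered space a motion depends on the numbers of particles on the arcs and not
  on their names. Exchanges become closed loops through this.\<close>

lemma xl_relabel:
  assumes m: "state ({1..n} - {a}) m" "a \<in> {1..n}" and m': "state ({1..n} - {a'}) m'" "a' \<in> {1..n}"
    and l: "\<And>i. i < 3 ==> length (m i) = length (m' i)" and j: "j < 3"
  shows "perm_orbit n \<circ> xl j a' m' = perm_orbit n \<circ> xl j a m"
proof -
  obtain \<sigma> where s: "\<sigma> permutes {1..n}" "\<sigma> a = a'" "\<And>i. i < 3 ==> map \<sigma> (m i) = m' i"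
    using state_relabelling[OF m m' l] by blast
  have ne: "\<sigma> k \<noteq> a'" if "k \<noteq> a" for k
    using permutes_inj[OF s(1)] s(2) that by (metis injD)
  have p: "map \<sigma> (push j a m i) = push j a' m' i" if "i < 3" for i
    by (rule map_push) (use s that in auto)
  note r1 = relabelled[OF m(1) m'(1) s(3)]
  note r2 = relabelled[OF state_push_full[OF m j] state_push_full[OF m' j] p]
  show ?thesis
  proof (rule orbit_relabel[OF s(1)])
    fix t show "xl j a' m' t \<circ> \<sigma> = xl j a m t"
      unfolding xl_def by (rule lp_relabel[OF s(1)]) (use r1 r2 s(2) ne in auto)
  qed
qed

lemma yl_relabel:
  assumes m: "state ({1..n} - {a}) m" "a \<in> {1..n}" and m': "state ({1..n} - {a'}) m'" "a' \<in> {1..n}"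
    and l: "\<And>i. i < 3 ==> length (m i) = length (m' i)" and j: "j < 3"
  shows "perm_orbit n \<circ> yl j a' m' = perm_orbit n \<circ> yl j a m"
proof -
  obtain \<sigma> where s: "\<sigma> permutes {1..n}" "\<sigma> a = a'" "\<And>i. i < 3 ==> map \<sigma> (m i) = m' i"
    using state_relabelling[OF m m' l] by blast
  have ne: "\<sigma> k \<noteq> a'" if "k \<noteq> a" for k
    using permutes_inj[OF s(1)] s(2) that by (metis injD)
  have p: "map \<sigma> (snoc j a m i) = snoc j a' m' i" if "i < 3" for i
    by (rule map_snoc) (use s that in auto)
  note r1 = relabelled[OF m(1) m'(1) s(3)]
  note r2 = relabelled[OF state_snoc_full[OF m j] state_snoc_full[OF m' j] p]
  show ?thesis
  proof (rule orbit_relabel[OF s(1)])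
    fix t show "yl j a' m' t \<circ> \<sigma> = yl j a m t"
      unfolding yl_def by (rule lp_relabel[OF s(1)]) (use r1 r2 s(2) ne in auto)
  qed
qed

lemma Lc_transpose:
  assumes m: "state {1..n} m" and m': "state {1..n} m'" and ab: "a \<in> {1..n}" "b \<in> {1..n}"
    and s: "\<And>i. i < 3 ==> map (Transposition.transpose a b) (m i) = m' i"
  shows "Lc m' \<circ> Transposition.transpose a b = Lc m"
proof -
  have p: "Transposition.transpose a b permutes {1..n}" using ab by (intro permutes_swap_id)
  have "lp (arc_of m') (pos m') (pos m') 0 \<circ> Transposition.transpose a b = lp (arc_of m) (pos m) (pos m) 0"
    by (rule lp_relabel[OF p]) (use relabelled[OF m m' s] in auto)
  thus ?thesis unfolding lp_def Lc_def lin_0 .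
qed

end

section \<open>Exchanges at the two vertices\<close>

context theta
begin

definition xF :: "((real => (nat => 'x) set) => 'k::group_add) => nat => nat => nat => (nat => nat list) => 'k" where
  "xF F i j p m = - F (perm_orbit n \<circ> xl i p m) + F (perm_orbit n \<circ> xl j p m)"
definition yF :: "((real => (nat => 'x) set) => 'k::group_add) => nat => nat => nat => (nat => nat list) => 'k" where
  "yF F i j p m = - F (perm_orbit n \<circ> yl i p m) + F (perm_orbit n \<circ> yl j p m)"

text \<open>The exchange at the vertex 0: \<open>a\<close> waits on arc 0 and \<open>b\<close> on
  arc 1; then \<open>b\<close> steps aside to arc 2, \<open>a\<close> moves to arc 1, and
  \<open>b\<close> moves to arc 0. \<open>SW\<close> is the same manoeuvre at the other
  vertex.\<close>

definition SV where "SV F a b m = xF F 1 2 b (push 0 a m) + (xF F 0 1 a (push 2 b m) + xF F 2 0 b (push 1 a m))"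
definition SW where "SW F c d m = yF F 1 2 d (snoc 0 c m) + (yF F 0 1 c (snoc 2 d m) + yF F 2 0 d (snoc 1 c m))"

lemma state_push_eq: "state S m ==> a \<notin> S ==> i < 3 ==> insert a S = T ==> state T (push i a m)"
  and state_snoc_eq: "state S m ==> a \<notin> S ==> i < 3 ==> insert a S = T ==> state T (snoc i a m)"
  by ((frule (2) state_push, simp), (frule (2) state_snoc, simp))

text \<open>The witness \<open>g\<close> is the move of \<open>p\<close> from arc \<open>i\<close>
  to arc \<open>j\<close> while \<open>d\<close> waits at the other vertex, so it is the same for
  every arc \<open>c\<close> that \<open>d\<close> may enter afterwards. The relation consists of
  two instances of the square law.\<close>

lemma x_step:
  assumes F: "path_functor (uconf_space n X) F" and m: "state ({1..n} - {p, d}) m"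
    and pd: "p \<in> {1..n}" "d \<in> {1..n}" "p \<noteq> d" and ij: "i < 3" "j < 3"
  obtains g where "\<And>c. c < 3 ==> g + F (perm_orbit n \<circ> yl c d (push j p m)) =
     F (perm_orbit n \<circ> yl c d (push i p m)) + xF F i j p (snoc c d m)"
proof
  fix c :: nat assume c: "c < 3"
  let ?x = "\<lambda>k. F (perm_orbit n \<circ> xl' k p d m)"
  note 1 = square_law[OF F m pd ij(1) c] and 2 = square_law[OF F m pd ij(2) c]
  have "- ?x i + ?x j + F (perm_orbit n \<circ> yl c d (push j p m)) =
    - ?x i + F (perm_orbit n \<circ> yl' c p d m) + F (perm_orbit n \<circ> xl j p (snoc c d m))"
    using 2 by (simp only: add.assoc)
  also have "- ?x i + F (perm_orbit n \<circ> yl' c p d m) = F (perm_orbit n \<circ> yl c d (push i p m)) - F (perm_orbit n \<circ> xl i p (snoc c d m))"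
  proof -
    have "F (perm_orbit n \<circ> yl' c p d m) = ?x i + F (perm_orbit n \<circ> yl c d (push i p m)) - F (perm_orbit n \<circ> xl i p (snoc c d m))"
      unfolding 1 by simp
    thus ?thesis by (simp add: add.assoc[symmetric] diff_conv_add_uminus del: add_uminus_conv_diff)
  qed
  finally show "(- ?x i + ?x j) + F (perm_orbit n \<circ> yl c d (push j p m)) =
     F (perm_orbit n \<circ> yl c d (push i p m)) + xF F i j p (snoc c d m)"
    by (simp only: xF_def diff_conv_add_uminus add.assoc)
qed

text \<open>Let \<open>S\<close> be the exchange carried out while \<open>d\<close> waits at the
  other vertex. For every arc \<open>c\<close>, the exchange with \<open>d\<close> on
  \<open>c\<close> is the conjugate of \<open>S\<close> by the entry of \<open>d\<close> into
  \<open>c\<close>; comparing two arcs gives the commutation with the move of \<open>d\<close>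
  between them.\<close>

lemma SV_step:
  assumes F: "path_functor (uconf_space n X) F" and m: "state ({1..n} - {a, b, d}) m"
    and abd: "a \<in> {1..n}" "b \<in> {1..n}" "d \<in> {1..n}" "a \<noteq> b" "a \<noteq> d" "b \<noteq> d" and cc: "c < 3" "c' < 3"
  shows "SV F a b (snoc c d m) + yF F c c' d (push 1 b (push 0 a m)) =
     yF F c c' d (push 1 b (push 0 a m)) + SV F a b (snoc c' d m)"
proof -
  let ?Y = "\<lambda>c. F (perm_orbit n \<circ> yl c d (push 1 b (push 0 a m)))"
  have ma: "state ({1..n} - {b, d}) (push i a m)" and mb: "state ({1..n} - {a, d}) (push i b m)" if "i < 3" for i
    by (rule state_push_eq[OF m]; use abd that in blast)+
  obtain g1 where g1: "\<And>c. c < 3 ==> g1 + F (perm_orbit n \<circ> yl c d (push 2 b (push 0 a m))) =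
     F (perm_orbit n \<circ> yl c d (push 1 b (push 0 a m))) + xF F 1 2 b (snoc c d (push 0 a m))"
    by (rule x_step[OF F ma abd(2,3,6), of 0 1 2]) auto
  obtain g2 where g2: "\<And>c. c < 3 ==> g2 + F (perm_orbit n \<circ> yl c d (push 1 a (push 2 b m))) =
     F (perm_orbit n \<circ> yl c d (push 0 a (push 2 b m))) + xF F 0 1 a (snoc c d (push 2 b m))"
    by (rule x_step[OF F mb abd(1,3,5), of 2 0 1]) auto
  obtain g3 where g3: "\<And>c. c < 3 ==> g3 + F (perm_orbit n \<circ> yl c d (push 0 b (push 1 a m))) =
     F (perm_orbit n \<circ> yl c d (push 2 b (push 1 a m))) + xF F 2 0 b (snoc c d (push 1 a m))"
    by (rule x_step[OF F ma abd(2,3,6), of 1 2 0]) auto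
  have pc: "push 0 a (push 2 b m) = push 2 b (push 0 a m)" "push 2 b (push 1 a m) = push 1 a (push 2 b m)"
    by (rule push_commute; simp)+
  have main: "(g1 + (g2 + g3)) + ?Y c = ?Y c + SV F a b (snoc c d m)" if c: "c < 3" for c
  proof -
    have st: "state ({1..n} - {d}) (push i b (push j a m))" if "i < 3" "j < 3" for i j
      by (rule state_push_eq[OF ma[OF that(2)]]) (use abd that in blast)+
    \<comment> \<open>After the exchange \<open>a\<close> and \<open>b\<close> have traded places,
      which an unordered path does not notice.\<close>
    have "perm_orbit n \<circ> yl c d (push 0 b (push 1 a m)) = perm_orbit n \<circ> yl c d (push 1 b (push 0 a m))"
      by (rule yl_relabel) (use st abd c in \<open>auto simp: push_def\<close>)
    hence "g1 + (g2 + (g3 + ?Y c)) = g1 + (g2 + (F (perm_orbit n \<circ> yl c d (push 2 b (push 1 a m))) + xF F 2 0 b (snoc c d (push 1 a m))))"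
      using g3[OF c] by simp
    also have "\<dots> = g1 + (g2 + F (perm_orbit n \<circ> yl c d (push 1 a (push 2 b m)))) + xF F 2 0 b (snoc c d (push 1 a m))"
      by (simp only: add.assoc pc)
    also have "\<dots> = g1 + F (perm_orbit n \<circ> yl c d (push 2 b (push 0 a m))) + xF F 0 1 a (snoc c d (push 2 b m)) + xF F 2 0 b (snoc c d (push 1 a m))"
      unfolding g2[OF c] pc by (simp only: add.assoc)
    finally show ?thesis
      unfolding g1[OF c] SV_def push_snoc by (simp only: add.assoc)
  qed
  define S where "S = g1 + (g2 + g3)"
  have SV: "SV F a b (snoc c d m) = - ?Y c + (S + ?Y c)" if "c < 3" for c
    unfolding S_def main[OF that] by (simp only: minus_add_cancel)
  show ?thesis
    unfolding SV[OF cc(1)] SV[OF cc(2)] yF_def by (simp add: add.assoc)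
qed

lemma xF_relabel:
  assumes "state ({1..n} - {a}) m" "a \<in> {1..n}" "state ({1..n} - {a'}) m'" "a' \<in> {1..n}"
    "\<And>i. i < 3 ==> length (m i) = length (m' i)" "i < 3" "j < 3"
  shows "xF F i j a m = xF F i j a' m'"
  unfolding xF_def using xl_relabel[OF assms(1-5)] assms(6,7) by simp

text \<open>\<open>SW\<close> consists of three moves at the other vertex. Each carries the exchange
  at the first vertex to the same exchange over the next state, and after the third the state is the
  original one up to labels.\<close>

lemma SV_SW_commute:
  fixes F :: "(real => (nat => 'x) set) => 'a::group_add"
  assumes F: "path_functor (uconf_space n X) F" and m: "state ({1..n} - {a, b, c, d}) m"
    and l: "distinct [a, b, c, d]" "{a, b, c, d} \<subseteq> {1..n}"
  shows "SV F a b (snoc 1 d (snoc 0 c m)) + SW F c d (push 1 b (push 0 a m)) =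
     SW F c d (push 1 b (push 0 a m)) + SV F a b (snoc 1 d (snoc 0 c m))"
proof -
  let ?V = "push 1 b (push 0 a m)"
  have ld: "a \<in> {1..n}" "b \<in> {1..n}" "c \<in> {1..n}" "d \<in> {1..n}" "a \<noteq> b" "a \<noteq> c" "a \<noteq> d" "b \<noteq> c" "b \<noteq> d" "c \<noteq> d"
    using l by auto
  have mc: "state ({1..n} - {a, b, d}) (snoc i c m)" if "i < 3" for i
    by (rule state_snoc_eq[OF m]) (use ld that in blast)+
  have md: "state ({1..n} - {a, b, c}) (snoc i d m)" if "i < 3" for i
    by (rule state_snoc_eq[OF m]) (use ld that in blast)+
  have s1: "SV F a b (snoc 1 d (snoc 0 c m)) + yF F 1 2 d (snoc 0 c ?V) = yF F 1 2 d (snoc 0 c ?V) + SV F a b (snoc 2 d (snoc 0 c m))"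
    using SV_step[OF F mc[of 0] ld(1,2,4,5,7,9), of 1 2] by (simp add: push_snoc)
  have s2: "SV F a b (snoc 2 d (snoc 0 c m)) + yF F 0 1 c (snoc 2 d ?V) = yF F 0 1 c (snoc 2 d ?V) + SV F a b (snoc 2 d (snoc 1 c m))"
    using SV_step[OF F md[of 2] ld(1,2,3,5,6,8), of 0 1] snoc_commute[of 0 2 c d m] snoc_commute[of 1 2 c d m] by (simp add: push_snoc)
  have s3: "SV F a b (snoc 2 d (snoc 1 c m)) + yF F 2 0 d (snoc 1 c ?V) = yF F 2 0 d (snoc 1 c ?V) + SV F a b (snoc 0 d (snoc 1 c m))"
    using SV_step[OF F mc[of 1] ld(1,2,4,5,7,9), of 2 0] by (simp add: push_snoc)
  have st: "state ({1..n} - {a}) (push k b (snoc j d (snoc i c m)))" "state ({1..n} - {b}) (push k a (snoc j d (snoc i c m)))"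
    if "i < 3" "j < 3" "k < 3" for i j k
  proof -
    have *: "state ({1..n} - {a, b}) (snoc j d (snoc i c m))"
      by (rule state_snoc_eq[OF mc[OF that(1)]]) (use ld that in blast)+
    show "state ({1..n} - {a}) (push k b (snoc j d (snoc i c m)))" "state ({1..n} - {b}) (push k a (snoc j d (snoc i c m)))"
      by (rule state_push_eq[OF *]; use ld that in blast)+
  qed
  have "SV F a b (snoc 0 d (snoc 1 c m)) = SV F a b (snoc 1 d (snoc 0 c m))"
    unfolding SV_def
    by (intro arg_cong2[where f = "(+)"] xF_relabel st ld) (auto simp: push_def snoc_def)
  hence s3': "SV F a b (snoc 2 d (snoc 1 c m)) + yF F 2 0 d (snoc 1 c ?V) = yF F 2 0 d (snoc 1 c ?V) + SV F a b (snoc 1 d (snoc 0 c m))"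
    using s3 by simp
  have chain: "S1 + (y1 + (y2 + y3)) = (y1 + (y2 + y3)) + S1" if "S1 + y1 = y1 + S2" "S2 + y2 = y2 + S3" "S3 + y3 = y3 + S1"
    for S1 S2 S3 y1 y2 y3 :: 'a
  proof -
    have "S1 + (y1 + (y2 + y3)) = y1 + (S2 + y2) + y3" using that(1) by (metis add.assoc)
    also have "\<dots> = y1 + (y2 + (S3 + y3))" unfolding that(2) by (simp only: add.assoc)
    finally show ?thesis unfolding that(3) by (simp only: add.assoc)
  qed
  show ?thesis
    unfolding SW_def by (rule chain[OF s1 s2 s3'])
qed

text \<open>Commutativity reduces both exchanges to the same alternating sum over pairs of distinct
  arcs, of \<open>x j k\<close> and of \<open>y j k\<close> respectively. The square law expresses
  \<open>x j k\<close> by \<open>y k j\<close>. The remaining terms cancel, and transposing the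
  indices reverses the sign.\<close>

lemma SV_SW_opposite:
  fixes F :: "(real => (nat => 'x) set) => 'k::ab_group_add"
  assumes F: "path_functor (uconf_space n X) F" and m: "state ({1..n} - {a, b, c, d}) m"
    and l: "distinct [a, b, c, d]" "{a, b, c, d} \<subseteq> {1..n}"
  shows "SW F c d (push 1 b (push 0 a m)) = - SV F a b (snoc 1 d (snoc 0 c m))"
proof -
  let ?V = "push 1 b (push 0 a m)" and ?M = "snoc 1 d (snoc 0 c m)"
  have ld: "a \<in> {1..n}" "b \<in> {1..n}" "c \<in> {1..n}" "d \<in> {1..n}" "a \<noteq> b" "a \<noteq> c" "a \<noteq> d" "b \<noteq> c" "b \<noteq> d" "c \<noteq> d"
    using l by auto
  have M: "state ({1..n} - {a, b}) ?M"
    by (rule state_snoc_eq[OF state_snoc_eq[OF m _ _ refl]]) (use ld in auto)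
  have V: "state ({1..n} - {c, d}) ?V"
    by (rule state_push_eq[OF state_push_eq[OF m _ _ refl]]) (use ld in auto)
  \<comment> \<open>The entry into arc \<open>j\<close> at the vertex 0 with one more particle
    present on arc \<open>k\<close>; \<open>y\<close> is the same at the other vertex. By
    relabelling it is irrelevant at which end of arc \<open>k\<close>, and under which name, that
    particle was added.\<close>
  define x where "x j k = F (perm_orbit n \<circ> xl j a (snoc k b ?M))" for j k
  define y where "y j k = F (perm_orbit n \<circ> yl j b (push k a ?M))" for j k
  define p where "p j = F (perm_orbit n \<circ> xl' j a b ?M)" for j
  define q where "q k = F (perm_orbit n \<circ> yl' k a b ?M)" for k
  have xy: "x j k = p j + y k j - q k" if "j < 3" "k < 3" for j k
  proof -
    from square_law[OF F M ld(1,2,5) that] show ?thesis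
      by (simp add: x_def y_def p_def q_def algebra_simps)
  qed
  have sx: "state ({1..n} - {a}) (snoc k b ?M)" "state ({1..n} - {b}) (push k a ?M)" "state ({1..n} - {a}) (push k b ?M)"
    if "k < 3" for k
    by (rule state_snoc_eq[OF M] state_push_eq[OF M]; use that ld in blast)+
  have sy: "state ({1..n} - {c}) (snoc k d ?V)" "state ({1..n} - {d}) (snoc k c ?V)" if "k < 3" for k
    by (rule state_snoc_eq[OF V]; use that ld in blast)+
  have X1: "F (perm_orbit n \<circ> xl j b (push k a ?M)) = x j k" "F (perm_orbit n \<circ> xl j a (push k b ?M)) = x j k"
    if "j < 3" "k < 3" for j k
    unfolding x_def
    using xl_relabel[OF sx(1)[OF that(2)] ld(1) sx(2)[OF that(2)] ld(2) _ that(1)]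
      xl_relabel[OF sx(1)[OF that(2)] ld(1) sx(3)[OF that(2)] ld(1) _ that(1)]
    by (simp_all add: push_def snoc_def)
  have Y1: "F (perm_orbit n \<circ> yl j c (snoc k d ?V)) = y j k" "F (perm_orbit n \<circ> yl j d (snoc k c ?V)) = y j k"
    if "j < 3" "k < 3" for j k
    unfolding y_def
    using yl_relabel[OF sx(2)[OF that(2)] ld(2) sy(1)[OF that(2)] ld(3) _ that(1)]
      yl_relabel[OF sx(2)[OF that(2)] ld(2) sy(2)[OF that(2)] ld(4) _ that(1)]
    by (simp_all add: push_def snoc_def)
  have SVe: "SV F a b ?M = - x 1 0 + x 2 0 + (- x 0 2 + x 1 2 + (- x 2 1 + x 0 1))"
    unfolding SV_def xF_def using X1 by simp
  have SWe: "SW F c d ?V = - y 1 0 + y 2 0 + (- y 0 2 + y 1 2 + (- y 2 1 + y 0 1))"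
    unfolding SW_def yF_def using Y1 by simp
  show ?thesis unfolding SVe SWe by (simp add: xy algebra_simps)
qed

end

text \<open>Functors need values in a type of class \<open>group_add\<close>. The Artin group enters
  through its left regular representation, extended by the identity outside its carrier. Evaluation
  at the unit shows that this representation is faithful, so commuting values mean commuting
  words.\<close>

lemma raag_left_action:
  fixes P :: "('c, 'd) pre_digraph"
  assumes w: "raag_words Y s P l w"
  obtains \<Lambda> :: "(real => 'y) => 'c word set sym" where "path_functor Y \<Lambda>"
    "\<And>p q. pathin Y p ==> pathin Y q ==> \<Lambda> p + \<Lambda> q = \<Lambda> q + \<Lambda> p ==>
       (w p @ w q, w q @ w p) \<in> pres_eq (verts P) (raag_rel P)"
proof -
  let ?G = "presented_group (verts P) (raag_rel P)"
  interpret G: group ?G by (rule group_presented_group)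
  define k where "k u = pres_eq (verts P) (raag_rel P) `` {u}" for u
  have kc: "k u \<in> carrier ?G" if "u \<in> words (verts P)" for u
    using that by (auto simp: k_def presented_group_def quotient_def)
  have km: "k (u @ v) = k u \<otimes>\<^bsub>?G\<^esub> k v" if "u \<in> words (verts P)" "v \<in> words (verts P)" for u v
    unfolding k_def using mult_presented_group[OF that] by simp
  have keq: "k u = k v" if "(u, v) \<in> pres_eq (verts P) (raag_rel P)" for u v
    unfolding k_def by (rule equiv_class_eq[OF equiv_pres_eq that])
  define act where "act x Z = (if Z \<in> carrier ?G then x \<otimes>\<^bsub>?G\<^esub> Z else Z)" for x Z
  have comp: "act (x \<otimes>\<^bsub>?G\<^esub> y) = act x \<circ> act y" if "x \<in> carrier ?G" "y \<in> carrier ?G" for x y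
    using that by (auto simp: act_def G.m_assoc fun_eq_iff)
  have one: "act \<one>\<^bsub>?G\<^esub> = id" by (auto simp: act_def fun_eq_iff)
  have bij: "bij (act x)" if "x \<in> carrier ?G" for x
  proof (rule o_bij)
    show "act (inv\<^bsub>?G\<^esub> x) \<circ> act x = id" "act x \<circ> act (inv\<^bsub>?G\<^esub> x) = id"
      using comp[symmetric] that one by simp_all
  qed
  define \<Lambda> where "\<Lambda> p = Abs_sym (act (k (w p)))" for p
  have wp: "w p \<in> words (verts P)" if "pathin Y p" for p
    using w that by (auto simp: raag_words_def)
  have Rep: "Rep_sym (\<Lambda> p) = act (k (w p))" if "pathin Y p" for p
    unfolding \<Lambda>_def using bij[OF kc[OF wp[OF that]]] by (intro Abs_sym_inverse) simp
  have mult: "act (k (w p @ w q)) = Rep_sym (\<Lambda> p + \<Lambda> q)" if "pathin Y p" "pathin Y q" for p q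
    unfolding Rep_sym_simps Rep[OF that(1)] Rep[OF that(2)] km[OF wp wp, OF that]
    by (rule comp[OF kc kc, OF wp wp, OF that])
  have "path_functor Y \<Lambda>"
    unfolding path_functor_def
  proof (intro conjI allI impI)
    fix p q assume pq: "pathin Y p" "pathin Y q" "p 1 = q 0"
    have "k (w (loop_concat p q)) = k (w p @ w q)"
      by (rule keq) (use w pq in \<open>auto simp: raag_words_def\<close>)
    hence "Rep_sym (\<Lambda> (loop_concat p q)) = Rep_sym (\<Lambda> p + \<Lambda> q)"
      using Rep[OF pathin_loop_concat[OF pq]] mult[OF pq(1,2)] by simp
    thus "\<Lambda> (loop_concat p q) = \<Lambda> p + \<Lambda> q" by (simp only: Rep_sym_inject)
  next
    fix p q assume "path_hom Y p q"
    hence "k (w p) = k (w q)" by (intro keq) (use w in \<open>auto simp: raag_words_def\<close>)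
    thus "\<Lambda> p = \<Lambda> q" by (simp add: \<Lambda>_def)
  qed
  moreover have "(w p @ w q, w q @ w p) \<in> pres_eq (verts P) (raag_rel P)"
    if "pathin Y p" "pathin Y q" "\<Lambda> p + \<Lambda> q = \<Lambda> q + \<Lambda> p" for p q
  proof -
    have ws: "w p @ w q \<in> words (verts P)" "w q @ w p \<in> words (verts P)" using wp that by auto
    have "act (k (w p @ w q)) \<one>\<^bsub>?G\<^esub> = act (k (w q @ w p)) \<one>\<^bsub>?G\<^esub>"
      unfolding mult[OF that(1,2)] mult[OF that(2,1)] that(3) ..
    hence "k (w p @ w q) = k (w q @ w p)" using kc[OF ws(1)] kc[OF ws(2)] by (simp add: act_def)
    thus ?thesis unfolding k_def by (rule eq_equiv_class[OF _ equiv_pres_eq ws(2)])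
  qed
  ultimately show thesis by (rule that)
qed

lemma Rep_sym_conj:
  assumes "Rep_sym t = Transposition.transpose a b"
  shows "Rep_sym (g + t - g) = Transposition.transpose (Rep_sym g a) (Rep_sym g b)"
proof -
  have g: "bij (Rep_sym g)" using Rep_sym[of g] by simp
  have "Rep_sym g \<circ> Transposition.transpose a b = Transposition.transpose (Rep_sym g a) (Rep_sym g b) \<circ> Rep_sym g"
    using bij_is_inj[OF g] by (auto simp: fun_eq_iff Transposition.transpose_def inj_eq)
  hence "Rep_sym g \<circ> Transposition.transpose a b \<circ> inv_into UNIV (Rep_sym g) =
     Transposition.transpose (Rep_sym g a) (Rep_sym g b) \<circ> (Rep_sym g \<circ> inv_into UNIV (Rep_sym g))"
    by (simp only: o_assoc)
  also have "Rep_sym g \<circ> inv_into UNIV (Rep_sym g) = id"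
    using bij_is_surj[OF g] surj_iff by blast
  finally show ?thesis
    unfolding minus_sym_def Rep_sym_simps assms by (simp only: comp_id)
qed

section \<open>Exchange loops and the contradiction\<close>

context theta
begin

definition x_path :: "nat => nat => nat => (nat => nat list) => real => (nat => 'x) set" where
  "x_path i j p m = loop_concat (rev_path (perm_orbit n \<circ> xl i p m)) (perm_orbit n \<circ> xl j p m)"
definition y_path :: "nat => nat => nat => (nat => nat list) => real => (nat => 'x) set" where
  "y_path i j p m = loop_concat (rev_path (perm_orbit n \<circ> yl i p m)) (perm_orbit n \<circ> yl j p m)"

lemma pathin_orbit: "pathin (conf_space n X) x ==> pathin (uconf_space n X) (perm_orbit n \<circ> x)"
  unfolding pathin_def by (rule continuous_map_compose[OF _ continuous_map_perm_orbit])

lemma x_path: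
  assumes m: "state ({1..n} - {p}) m" "p \<in> {1..n}" and ij: "i < 3" "j < 3"
  shows "pathin (uconf_space n X) (x_path i j p m)"
    "x_path i j p m 0 = perm_orbit n (Lc (push i p m))" "x_path i j p m 1 = perm_orbit n (Lc (push j p m))"
    "path_functor (uconf_space n X) F ==> F (x_path i j p m) = xF F i j p m"
proof -
  note i = pathin_orbit[OF pathin_xl[OF m ij(1)]] xl_ends[OF m ij(1)]
  note j = pathin_orbit[OF pathin_xl[OF m ij(2)]] xl_ends[OF m ij(2)]
  have e: "rev_path (perm_orbit n \<circ> xl i p m) 1 = (perm_orbit n \<circ> xl j p m) 0" by (simp add: i j)
  show "pathin (uconf_space n X) (x_path i j p m)"
    unfolding x_path_def by (rule pathin_loop_concat[OF pathin_rev_path[OF i(1)] j(1) e])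
  show "x_path i j p m 0 = perm_orbit n (Lc (push i p m))" "x_path i j p m 1 = perm_orbit n (Lc (push j p m))"
    by (simp_all add: x_path_def i j)
  assume F: "path_functor (uconf_space n X) F"
  show "F (x_path i j p m) = xF F i j p m"
    unfolding x_path_def path_functor_concat[OF F pathin_rev_path[OF i(1)] j(1) e] path_functor_rev[OF F i(1)] xF_def ..
qed

lemma y_path:
  assumes m: "state ({1..n} - {p}) m" "p \<in> {1..n}" and ij: "i < 3" "j < 3"
  shows "pathin (uconf_space n X) (y_path i j p m)"
    "y_path i j p m 0 = perm_orbit n (Lc (snoc i p m))" "y_path i j p m 1 = perm_orbit n (Lc (snoc j p m))"
    "path_functor (uconf_space n X) F ==> F (y_path i j p m) = yF F i j p m"
proof -
  note i = pathin_orbit[OF pathin_yl[OF m ij(1)]] yl_ends[OF m ij(1)]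
  note j = pathin_orbit[OF pathin_yl[OF m ij(2)]] yl_ends[OF m ij(2)]
  have e: "rev_path (perm_orbit n \<circ> yl i p m) 1 = (perm_orbit n \<circ> yl j p m) 0" by (simp add: i j)
  show "pathin (uconf_space n X) (y_path i j p m)"
    unfolding y_path_def by (rule pathin_loop_concat[OF pathin_rev_path[OF i(1)] j(1) e])
  show "y_path i j p m 0 = perm_orbit n (Lc (snoc i p m))" "y_path i j p m 1 = perm_orbit n (Lc (snoc j p m))"
    by (simp_all add: y_path_def i j)
  assume F: "path_functor (uconf_space n X) F"
  show "F (y_path i j p m) = yF F i j p m"
    unfolding y_path_def path_functor_concat[OF F pathin_rev_path[OF i(1)] j(1) e] path_functor_rev[OF F i(1)] yF_def ..
qed

definition sv where
  "sv a b m = loop_concat (x_path 1 2 b (push 0 a m)) (loop_concat (x_path 0 1 a (push 2 b m)) (x_path 2 0 b (push 1 a m)))"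
definition sw where
  "sw a b m = loop_concat (y_path 1 2 b (snoc 0 a m)) (loop_concat (y_path 0 1 a (snoc 2 b m)) (y_path 2 0 b (snoc 1 a m)))"

lemma Lc_conf:
  assumes m: "state {1..n} m" shows "Lc m \<in> topspace (conf_space n X)"
proof -
  have ok: "okl m 0 0 (pos m)"
    by (rule okl_intro) (use map_pos[OF m] in \<open>auto intro!: exI[of _ "[]"]\<close>)
  from pathin_topspace[OF pathin_lp[OF m ok ok], of 0] show ?thesis by (simp add: lp_def Lc_def)
qed

text \<open>The monodromy of an exchange is the transposition conjugated by the label of the
  starting configuration; two exchanges at one configuration share the same conjugating
  permutation.\<close>

lemma swap_label:
  assumes m: "state {1..n} m" and m': "state {1..n} m'" and ab: "a \<in> {1..n}" "b \<in> {1..n}"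
    and s: "\<And>i. i < 3 ==> map (Transposition.transpose a b) (m i) = m' i"
  shows "perm_orbit n (Lc m') = perm_orbit n (Lc m)"
    "\<exists>t. Rep_sym t = Transposition.transpose a b \<and> slabel n (Lc m) - slabel n (Lc m') = slabel n (Lc m) + t - slabel n (Lc m)"
proof -
  have e: "Lc m' \<circ> Transposition.transpose a b = Lc m"
    by (rule Lc_transpose[OF m m' ab s])
  have p: "Transposition.transpose a b permutes {1..n}" using ab by (intro permutes_swap_id)
  show "perm_orbit n (Lc m') = perm_orbit n (Lc m)"
    using perm_orbit_compose[OF p, of "Lc m'"] arg_cong[OF e, of "perm_orbit n"] by (rule trans[OF sym])
  define t where "t = Abs_sym (Transposition.transpose a b)"
  have t: "Rep_sym t = Transposition.transpose a b"
    unfolding t_def by (rule Abs_sym_inverse) simp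
  have "slabel n (Lc m) = slabel n (Lc m') + t"
    using slabel_compose[OF Lc_conf[OF m'], of t] p unfolding t e by simp
  hence "slabel n (Lc m') = slabel n (Lc m) - t" by simp
  hence "slabel n (Lc m) - slabel n (Lc m') = slabel n (Lc m) + t - slabel n (Lc m)"
    by (simp only: diff_conv_add_uminus minus_add minus_minus add.assoc)
  with t show "\<exists>t. Rep_sym t = Transposition.transpose a b \<and> slabel n (Lc m) - slabel n (Lc m') = slabel n (Lc m) + t - slabel n (Lc m)"
    by blast
qed

lemma transpose_map: "a \<notin> set xs ==> b \<notin> set xs ==> map (Transposition.transpose a b) xs = xs"
  by (induction xs) (auto simp: Transposition.transpose_def)

lemma sv:
  assumes m: "state ({1..n} - {a, b}) m" and ab: "a \<in> {1..n}" "b \<in> {1..n}" "a \<noteq> b"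
  shows "pathin (uconf_space n X) (sv a b m)"
    "sv a b m 0 = perm_orbit n (Lc (push 1 b (push 0 a m)))" "sv a b m 1 = perm_orbit n (Lc (push 1 b (push 0 a m)))"
    "path_functor (uconf_space n X) F ==> F (sv a b m) = SV F a b m"
    "path_functor (uconf_space n X) \<Phi> ==>
     (\<And>x. pathin (conf_space n X) x ==> \<Phi> (perm_orbit n \<circ> x) = slabel n (x 0) - slabel n (x 1)) ==>
     \<exists>t. Rep_sym t = Transposition.transpose a b \<and>
       \<Phi> (sv a b m) = slabel n (Lc (push 1 b (push 0 a m))) + t - slabel n (Lc (push 1 b (push 0 a m)))"
proof -
  let ?Y = "uconf_space n X"
  have m': "state ({1..n} - {b, a}) m" using m by (simp only: insert_commute)
  have ma: "state ({1..n} - {b}) (push i a m)" if "i < 3" for i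
    by (rule state_diff_pushI[OF m]) (use ab that in auto)
  have mb: "state ({1..n} - {a}) (push i b m)" if "i < 3" for i
    by (rule state_diff_pushI[OF m']) (use ab that in auto)
  have lt: "(0::nat) < 3" "(1::nat) < 3" "(2::nat) < 3" by auto
  note p1 = x_path[OF ma[OF lt(1)] ab(2) lt(2,3)] and p2 = x_path[OF mb[OF lt(3)] ab(1) lt(1,2)]
    and p3 = x_path[OF ma[OF lt(2)] ab(2) lt(3,1)]
  have pc: "push 0 a (push 2 b m) = push 2 b (push 0 a m)" "push 1 a (push 2 b m) = push 2 b (push 1 a m)"
    by (rule push_commute; simp)+
  have e: "x_path 0 1 a (push 2 b m) 1 = x_path 2 0 b (push 1 a m) 0"
    "x_path 1 2 b (push 0 a m) 1 = x_path 0 1 a (push 2 b m) 0"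
    unfolding p1 p2 p3 pc by (rule refl)+
  have p23: "pathin ?Y (loop_concat (x_path 0 1 a (push 2 b m)) (x_path 2 0 b (push 1 a m)))"
    by (rule pathin_loop_concat[OF p2(1) p3(1) e(1)])
  have e': "x_path 1 2 b (push 0 a m) 1 = loop_concat (x_path 0 1 a (push 2 b m)) (x_path 2 0 b (push 1 a m)) 0"
    unfolding loop_concat_0 by (rule e(2))
  show "pathin ?Y (sv a b m)"
    unfolding sv_def by (rule pathin_loop_concat[OF p1(1) p23 e'])
  show "sv a b m 0 = perm_orbit n (Lc (push 1 b (push 0 a m)))"
    unfolding sv_def loop_concat_0 by (rule p1(2))
  show "F (sv a b m) = SV F a b m" if "path_functor ?Y F" for F :: "_ => 'k::group_add"
    unfolding sv_def path_functor_concat[OF that p1(1) p23 e'] path_functor_concat[OF that p2(1) p3(1) e(1)]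
      p1(4)[OF that] p2(4)[OF that] p3(4)[OF that] SV_def ..
  let ?m = "push 1 b (push 0 a m)" and ?m' = "push 0 b (push 1 a m)"
  have st: "state {1..n} ?m" "state {1..n} ?m'"
    using state_push_full[OF ma[OF lt(1)] ab(2) lt(2)] state_push_full[OF ma[OF lt(2)] ab(2) lt(1)] .
  have s: "map (Transposition.transpose a b) (?m i) = ?m' i" if "i < 3" for i
    using transpose_map[of a "m i" b] state_sub[OF m that] ab by (auto simp: push_def)
  note sl = swap_label[OF st ab(1,2) s]
  show "sv a b m 1 = perm_orbit n (Lc ?m)"
    unfolding sv_def loop_concat_1 p3(3) by (rule sl(1))
  assume F: "path_functor ?Y \<Phi>" and mono: "\<And>x. pathin (conf_space n X) x ==> \<Phi> (perm_orbit n \<circ> x) = slabel n (x 0) - slabel n (x 1)"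
  have xF: "xF \<Phi> i j p k = slabel n (Lc (push i p k)) - slabel n (Lc (push j p k))"
    if k: "state ({1..n} - {p}) k" "p \<in> {1..n}" "i < 3" "j < 3" for i j p k
    unfolding xF_def mono[OF pathin_xl[OF k(1,2,3)]] mono[OF pathin_xl[OF k(1,2,4)]]
      xl_ends[OF k(1,2,3)] xl_ends[OF k(1,2,4)] by (simp add: diff_conv_add_uminus add.assoc minus_add del: add_uminus_conv_diff)
  have "\<Phi> (sv a b m) = slabel n (Lc ?m) - slabel n (Lc ?m')"
    unfolding sv_def path_functor_concat[OF F p1(1) p23 e'] path_functor_concat[OF F p2(1) p3(1) e(1)]
      p1(4)[OF F] p2(4)[OF F] p3(4)[OF F]
      xF[OF ma[OF lt(1)] ab(2) lt(2,3)] xF[OF mb[OF lt(3)] ab(1) lt(1,2)] xF[OF ma[OF lt(2)] ab(2) lt(3,1)] pc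
    by (simp add: diff_conv_add_uminus add.assoc del: add_uminus_conv_diff)
  with sl(2) show "\<exists>t. Rep_sym t = Transposition.transpose a b \<and> \<Phi> (sv a b m) = slabel n (Lc ?m) + t - slabel n (Lc ?m)"
    by simp
qed

lemma sw:
  assumes m: "state ({1..n} - {a, b}) m" and ab: "a \<in> {1..n}" "b \<in> {1..n}" "a \<noteq> b"
  shows "pathin (uconf_space n X) (sw a b m)"
    "sw a b m 0 = perm_orbit n (Lc (snoc 1 b (snoc 0 a m)))" "sw a b m 1 = perm_orbit n (Lc (snoc 1 b (snoc 0 a m)))"
    "path_functor (uconf_space n X) F ==> F (sw a b m) = SW F a b m"
    "path_functor (uconf_space n X) \<Phi> ==>
     (\<And>x. pathin (conf_space n X) x ==> \<Phi> (perm_orbit n \<circ> x) = slabel n (x 0) - slabel n (x 1)) ==>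
     \<exists>t. Rep_sym t = Transposition.transpose a b \<and>
       \<Phi> (sw a b m) = slabel n (Lc (snoc 1 b (snoc 0 a m))) + t - slabel n (Lc (snoc 1 b (snoc 0 a m)))"
proof -
  let ?Y = "uconf_space n X"
  have m': "state ({1..n} - {b, a}) m" using m by (simp only: insert_commute)
  have ma: "state ({1..n} - {b}) (snoc i a m)" if "i < 3" for i
    by (rule state_diff_snocI[OF m]) (use ab that in auto)
  have mb: "state ({1..n} - {a}) (snoc i b m)" if "i < 3" for i
    by (rule state_diff_snocI[OF m']) (use ab that in auto)
  have lt: "(0::nat) < 3" "(1::nat) < 3" "(2::nat) < 3" by auto
  note p1 = y_path[OF ma[OF lt(1)] ab(2) lt(2,3)] and p2 = y_path[OF mb[OF lt(3)] ab(1) lt(1,2)]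
    and p3 = y_path[OF ma[OF lt(2)] ab(2) lt(3,1)]
  have pc: "snoc 0 a (snoc 2 b m) = snoc 2 b (snoc 0 a m)" "snoc 1 a (snoc 2 b m) = snoc 2 b (snoc 1 a m)"
    by (rule snoc_commute; simp)+
  have e: "y_path 0 1 a (snoc 2 b m) 1 = y_path 2 0 b (snoc 1 a m) 0"
    "y_path 1 2 b (snoc 0 a m) 1 = y_path 0 1 a (snoc 2 b m) 0"
    unfolding p1 p2 p3 pc by (rule refl)+
  have p23: "pathin ?Y (loop_concat (y_path 0 1 a (snoc 2 b m)) (y_path 2 0 b (snoc 1 a m)))"
    by (rule pathin_loop_concat[OF p2(1) p3(1) e(1)])
  have e': "y_path 1 2 b (snoc 0 a m) 1 = loop_concat (y_path 0 1 a (snoc 2 b m)) (y_path 2 0 b (snoc 1 a m)) 0"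
    unfolding loop_concat_0 by (rule e(2))
  show "pathin ?Y (sw a b m)"
    unfolding sw_def by (rule pathin_loop_concat[OF p1(1) p23 e'])
  show "sw a b m 0 = perm_orbit n (Lc (snoc 1 b (snoc 0 a m)))"
    unfolding sw_def loop_concat_0 by (rule p1(2))
  show "F (sw a b m) = SW F a b m" if "path_functor ?Y F" for F :: "_ => 'k::group_add"
    unfolding sw_def path_functor_concat[OF that p1(1) p23 e'] path_functor_concat[OF that p2(1) p3(1) e(1)]
      p1(4)[OF that] p2(4)[OF that] p3(4)[OF that] SW_def ..
  let ?m = "snoc 1 b (snoc 0 a m)" and ?m' = "snoc 0 b (snoc 1 a m)"
  have st: "state {1..n} ?m" "state {1..n} ?m'"
    using state_snoc_full[OF ma[OF lt(1)] ab(2) lt(2)] state_snoc_full[OF ma[OF lt(2)] ab(2) lt(1)] .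
  have s: "map (Transposition.transpose a b) (?m i) = ?m' i" if "i < 3" for i
    using transpose_map[of a "m i" b] state_sub[OF m that] ab by (auto simp: snoc_def)
  note sl = swap_label[OF st ab(1,2) s]
  show "sw a b m 1 = perm_orbit n (Lc ?m)"
    unfolding sw_def loop_concat_1 p3(3) by (rule sl(1))
  assume F: "path_functor ?Y \<Phi>" and mono: "\<And>x. pathin (conf_space n X) x ==> \<Phi> (perm_orbit n \<circ> x) = slabel n (x 0) - slabel n (x 1)"
  have yF: "yF \<Phi> i j p k = slabel n (Lc (snoc i p k)) - slabel n (Lc (snoc j p k))"
    if k: "state ({1..n} - {p}) k" "p \<in> {1..n}" "i < 3" "j < 3" for i j p k
    unfolding yF_def mono[OF pathin_yl[OF k(1,2,3)]] mono[OF pathin_yl[OF k(1,2,4)]]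
      yl_ends[OF k(1,2,3)] yl_ends[OF k(1,2,4)] by (simp add: diff_conv_add_uminus add.assoc minus_add del: add_uminus_conv_diff)
  have "\<Phi> (sw a b m) = slabel n (Lc ?m) - slabel n (Lc ?m')"
    unfolding sw_def path_functor_concat[OF F p1(1) p23 e'] path_functor_concat[OF F p2(1) p3(1) e(1)]
      p1(4)[OF F] p2(4)[OF F] p3(4)[OF F]
      yF[OF ma[OF lt(1)] ab(2) lt(2,3)] yF[OF mb[OF lt(3)] ab(1) lt(1,2)] yF[OF ma[OF lt(2)] ab(2) lt(3,1)] pc
    by (simp add: diff_conv_add_uminus add.assoc del: add_uminus_conv_diff)
  with sl(2) show "\<exists>t. Rep_sym t = Transposition.transpose a b \<and> \<Phi> (sw a b m) = slabel n (Lc ?m) + t - slabel n (Lc ?m)"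
    by simp
qed

theorem theta_not_raag:
  fixes P :: "('c, 'd) pre_digraph"
  assumes P: "graph P" and H: "Hausdorff_space X" and n: "n \<ge> 4"
    and Y: "path_connected_space (uconf_space n X)" "s \<in> topspace (uconf_space n X)"
  shows "\<not> fundamental_group (uconf_space n X) s \<cong> raag P"
proof
  let ?Y = "uconf_space n X"
  assume iso: "fundamental_group ?Y s \<cong> raag P"
  interpret P: graph P by fact
  obtain c where c: "base_paths ?Y s c" using base_paths_exist[OF Y] .
  obtain l w where w: "raag_words ?Y s P l w"
    using raag_words_exist[OF iso Y(2) c P.wf_digraph_axioms] .
  have l: "l x \<in> loops ?Y s" if "x \<in> verts P" for x
    using w that by (auto simp: raag_words_def)
  obtain \<Phi> :: "(real => (nat => 'x) set) => nat sym" where \<Phi>: "path_functor ?Y \<Phi>"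
    "\<And>x. pathin (conf_space n X) x ==> \<Phi> (perm_orbit n \<circ> x) = slabel n (x 0) - slabel n (x 1)"
    "\<And>p. pathin ?Y p ==> Rep_sym (\<Phi> p) permutes {1..n}"
    using monodromy[OF H, of n] by metis
  obtain \<Lambda> :: "(real => (nat => 'x) set) => 'c word set sym" where \<Lambda>: "path_functor ?Y \<Lambda>"
    "\<And>p q. pathin ?Y p ==> pathin ?Y q ==> \<Lambda> p + \<Lambda> q = \<Lambda> q + \<Lambda> p ==>
       (w p @ w q, w q @ w p) \<in> pres_eq (verts P) (raag_rel P)"
    using raag_left_action[OF w] by metis
  \<comment> \<open>The particles other than 1, 2, 3 and 4 are parked on the third arc.\<close>
  define m where "m = tri [] [] [5..<Suc n]"
  have m: "state ({1..n} - {1, 2, 3, 4}) m" using n by (auto simp: state_def m_def)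
  have ld: "distinct [1, 2, 3, 4::nat]" "{1, 2, 3, 4} \<subseteq> {1..n}" using n by auto
  \<comment> \<open>The surroundings of the exchange of 1 and 2; \<open>V\<close> is that of the
    exchange of 3 and 4. Completing either of them gives the same configuration \<open>L\<close>, as
    \<open>push\<close> and \<open>snoc\<close> commute.\<close>
  define M where "M = snoc 1 4 (snoc 0 3 m)"
  define V where "V = push 1 2 (push 0 1 m)"
  have M: "state ({1..n} - {1, 2}) M"
    unfolding M_def by (rule state_snoc_eq[OF state_snoc_eq[OF m _ _ refl]]) (use n in auto)
  have V: "state ({1..n} - {3, 4}) V"
    unfolding V_def by (rule state_push_eq[OF state_push_eq[OF m _ _ refl]]) (use n in auto)
  have n4: "1 \<in> {1..n}" "2 \<in> {1..n}" "3 \<in> {1..n}" "4 \<in> {1..n}" "(1::nat) \<noteq> 2" "(3::nat) \<noteq> 4" using n by auto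
  define p where "p = sv 1 2 M"
  define q where "q = sw 3 4 V"
  define L where "L = Lc (push 1 2 (push 0 1 M))"
  have L': "Lc (snoc 1 4 (snoc 0 3 V)) = L" by (simp add: L_def M_def V_def push_snoc)
  note p = sv[OF M n4(1,2,5), folded p_def L_def] and q = sw[OF V n4(3,4,6), unfolded L', folded q_def]
  \<comment> \<open>Both loops are closed up through the same path \<open>c y\<close>. Hence they
    still commute, their classes stay opposite, and both transpositions are conjugated by one
    permutation, which keeps them disjoint.\<close>
  define p' where "p' = conj_loop c p"
  define q' where "q' = conj_loop c q"
  have p': "p' \<in> loops ?Y s" "pathin ?Y p'" and q': "q' \<in> loops ?Y s" "pathin ?Y q'"
    using conj_loop_loop[OF c p(1)] conj_loop_loop[OF c q(1)] by (auto simp: p'_def q'_def loops_def)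
  define y where "y = perm_orbit n L"
  define A where "A p = ab (w p)" for p
  have A: "path_functor ?Y A" unfolding A_def[abs_def] by (rule path_functor_ab[OF w])
  have "A q = - A p"
    unfolding p(4)[OF A] q(4)[OF A] using SV_SW_opposite[OF A m ld] by (simp add: M_def V_def)
  moreover have "A p' = A (c y) + A p - A (c y)" "A q' = A (c y) + A q - A (c y)"
    unfolding p'_def q'_def using path_functor_conj_loop[OF c A p(1)] path_functor_conj_loop[OF c A q(1)]
    by (simp_all add: p(2,3) q(2,3) y_def)
  ultimately have opp: "ab (w q') = - ab (w p')" by (simp add: A_def)
  have "\<Lambda> p + \<Lambda> q = \<Lambda> q + \<Lambda> p"
    unfolding p(4)[OF \<Lambda>(1)] q(4)[OF \<Lambda>(1)] using SV_SW_commute[OF \<Lambda>(1) m ld] by (simp add: M_def V_def)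
  moreover have "\<Lambda> p' = \<Lambda> (c y) + \<Lambda> p - \<Lambda> (c y)" "\<Lambda> q' = \<Lambda> (c y) + \<Lambda> q - \<Lambda> (c y)"
    unfolding p'_def q'_def using path_functor_conj_loop[OF c \<Lambda>(1) p(1)] path_functor_conj_loop[OF c \<Lambda>(1) q(1)]
    by (simp_all add: p(2,3) q(2,3) y_def)
  ultimately have "\<Lambda> p' + \<Lambda> q' = \<Lambda> q' + \<Lambda> p'"
    by (metis (no_types, lifting) add.assoc diff_add_cancel add_diff_eq)
  from \<Lambda>(2)[OF p'(2) q'(2) this]
  have commuting: "(w p' @ w q', w q' @ w p') \<in> pres_eq (verts P) (raag_rel P)" .
  define \<rho> where "\<rho> x = \<Phi> (l x)" for x
  have ev: "\<Phi> r = ev \<rho> (w r)" "w r \<in> words (verts P)" if r: "r \<in> loops ?Y s" for r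
  proof -
    show wr: "w r \<in> words (verts P)" using w r by (auto simp: raag_words_def loops_def)
    have "\<Phi> r = \<Phi> (word_loop s l (w r))"
      using path_functor_hom[OF \<Phi>(1)] w r by (auto simp: raag_words_def)
    also have "\<dots> = ev \<rho> (w r)"
      unfolding \<rho>_def[abs_def] by (rule path_functor_word_loop[OF \<Phi>(1) l wr Y(2)])
    finally show "\<Phi> r = ev \<rho> (w r)" .
  qed
  interpret spin P n \<rho>
  proof
    show "finite (verts P)" by simp
    show "Rep_sym (\<rho> x) permutes {1..n}" if "x \<in> verts P" for x
      unfolding \<rho>_def using \<Phi>(3) l[OF that] by (auto simp: loops_def)
    fix x y assume xy: "(x, y) \<in> arcs_ends P" "x \<in> verts P" "y \<in> verts P"
    have "path_hom ?Y (loop_concat (l x) (l y)) (loop_concat (l y) (l x))"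
      using w xy(1) by (auto simp: raag_words_def)
    from path_functor_hom[OF \<Phi>(1) this] have "\<rho> x + \<rho> y = \<rho> y + \<rho> x"
      using path_functor_concat[OF \<Phi>(1)] l[OF xy(2)] l[OF xy(3)] by (simp add: \<rho>_def loops_def)
    moreover have "x \<noteq> y"
      using xy(1) P.no_loops by (auto simp: arcs_ends_def arc_to_ends_def)
    ultimately show "x \<noteq> y \<and> \<rho> x + \<rho> y = \<rho> y + \<rho> x" by blast
  qed
  let ?g = "\<Phi> (c y) + slabel n L"
  have conj: "\<Phi> (c y) + (slabel n L + t - slabel n L) - \<Phi> (c y) = ?g + t - ?g" for t
    by (simp only: diff_conv_add_uminus minus_add add.assoc)
  obtain t where t: "Rep_sym t = Transposition.transpose 1 2" "\<Phi> p = slabel n L + t - slabel n L"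
    using p(5)[OF \<Phi>(1,2)] by blast
  obtain u where u: "Rep_sym u = Transposition.transpose 3 4" "\<Phi> q = slabel n L + u - slabel n L"
    using q(5)[OF \<Phi>(1,2)] by blast
  have "\<Phi> p' = ?g + t - ?g" "\<Phi> q' = ?g + u - ?g"
    unfolding p'_def q'_def using path_functor_conj_loop[OF c \<Phi>(1) p(1)] path_functor_conj_loop[OF c \<Phi>(1) q(1)] conj
    by (simp_all only: p(2,3) q(2,3) y_def t u)
  hence R: "Rep_sym (ev \<rho> (w p')) = Transposition.transpose (Rep_sym ?g 1) (Rep_sym ?g 2)"
    "Rep_sym (ev \<rho> (w q')) = Transposition.transpose (Rep_sym ?g 3) (Rep_sym ?g 4)"
    using ev(1)[OF p'(1)] ev(1)[OF q'(1)] Rep_sym_conj[OF t(1), of ?g] Rep_sym_conj[OF u(1), of ?g] by (simp_all only:)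
  have cy: "pathin ?Y (c y)" using base_path(1)[OF c p(1), of 0] by (simp add: p(2) y_def)
  have gp: "Rep_sym ?g permutes {1..n}"
    unfolding Rep_sym_simps Rep_slabel by (rule permutes_compose[OF label(1) \<Phi>(3)[OF cy]])
  have d: "distinct [Rep_sym ?g 1, Rep_sym ?g 2, Rep_sym ?g 3, Rep_sym ?g 4]"
    using permutes_inj[OF gp] by (simp add: inj_eq)
  have sub: "{Rep_sym ?g 1, Rep_sym ?g 2, Rep_sym ?g 3, Rep_sym ?g 4} \<subseteq> {1..n}"
    using permutes_in_image[OF gp] n4 by blast
  show False
    by (rule no_opposite_commuting_transpositions[OF ev(2)[OF p'(1)] R(1) ev(2)[OF q'(1)] R(2) d sub commuting opp])
qed

end

section \<open>Connectedness of configuration spaces\<close>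

text \<open>The images of closed subsets of the finitely many compact pieces are compact, hence
  closed in the Hausdorff space; so a map that is continuous on each piece is continuous.\<close>

lemma continuous_map_glue_compact:
  assumes fin: "finite J" and Z: "Hausdorff_space Z"
    and K: "\<And>e. e \<in> J ==> compact_space (K e) \<and> continuous_map (K e) Z (g e)"
    and cov: "topspace Z \<subseteq> (\<Union>e\<in>J. g e ` topspace (K e))"
    and f: "\<And>e. e \<in> J ==> continuous_map (K e) W (f \<circ> g e)"
  shows "continuous_map Z W f"
  unfolding continuous_map_closedin
proof (intro conjI allI impI funcsetI)
  fix z assume "z \<in> topspace Z"
  then obtain e x where "e \<in> J" "x \<in> topspace (K e)" "z = g e x" using cov by blast
  thus "f z \<in> topspace W" using f[of e] by (auto simp: continuous_map_def)
next
  fix C assume C: "closedin W C"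
  have "{z \<in> topspace Z. f z \<in> C} = (\<Union>e\<in>J. g e ` {x \<in> topspace (K e). (f \<circ> g e) x \<in> C})"
  proof (intro equalityI subsetI)
    fix z assume "z \<in> {z \<in> topspace Z. f z \<in> C}"
    hence z: "z \<in> topspace Z" "f z \<in> C" by auto
    from z(1) cov obtain e x where "e \<in> J" "x \<in> topspace (K e)" "z = g e x" by blast
    with z(2) show "z \<in> (\<Union>e\<in>J. g e ` {x \<in> topspace (K e). (f \<circ> g e) x \<in> C})" by auto
  next
    fix z assume "z \<in> (\<Union>e\<in>J. g e ` {x \<in> topspace (K e). (f \<circ> g e) x \<in> C})"
    then obtain e x where e: "e \<in> J" "x \<in> topspace (K e)" "z = g e x" "f z \<in> C" by auto
    thus "z \<in> {z \<in> topspace Z. f z \<in> C}" using K[OF e(1)] by (auto simp: continuous_map_def)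
  qed
  moreover have "closedin Z (g e ` {x \<in> topspace (K e). (f \<circ> g e) x \<in> C})" if e: "e \<in> J" for e
  proof -
    have "closedin (K e) {x \<in> topspace (K e). (f \<circ> g e) x \<in> C}"
      by (rule closedin_continuous_map_preimage[OF f[OF e] C])
    hence "compactin (K e) {x \<in> topspace (K e). (f \<circ> g e) x \<in> C}"
      using K[OF e] closedin_compact_space by blast
    hence "compactin Z (g e ` {x \<in> topspace (K e). (f \<circ> g e) x \<in> C})"
      using K[OF e] image_compactin by blast
    thus ?thesis using Z compactin_imp_closedin by blast
  qed
  ultimately show "closedin Z {z \<in> topspace Z. f z \<in> C}"
    using fin by (auto intro!: closedin_Union)
qed

lemma pathin_conf:
  assumes "\<And>i. i \<in> {1..n} ==> pathin X (f i)" "\<And>t. t \<in> {0..1} ==> inj_on (\<lambda>i. f i t) {1..n}"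
  shows "pathin (conf_space n X) (\<lambda>t. \<lambda>i\<in>{1..n}. f i t)"
  unfolding pathin_def continuous_map_conf_space
proof (intro conjI ballI)
  fix t assume "t \<in> topspace (top_of_set {0..1::real})"
  hence "inj_on (\<lambda>i. f i t) {1..n}" using assms(2) by simp
  thus "inj_on (\<lambda>i\<in>{1..n}. f i t) {1..n}" by (rule inj_on_cong[THEN iffD1, rotated]) simp
  show "(\<lambda>i\<in>{1..n}. f i t) \<in> extensional {1..n}" by simp
next
  fix i assume i: "i \<in> {1..n}"
  show "continuous_map (top_of_set {0..1}) X (\<lambda>t. (\<lambda>i\<in>{1..n}. f i t) i)"
    using assms(1)[OF i] i by (simp add: pathin_def)
qed

lemma path_component_orbit:
  assumes "pathin (conf_space n X) g" "g 0 = x" "g 1 = y"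
  shows "path_component_of (uconf_space n X) (perm_orbit n x) (perm_orbit n y)"
  unfolding path_component_of_def
proof (intro exI[of _ "perm_orbit n \<circ> g"] conjI)
  show "pathin (uconf_space n X) (perm_orbit n \<circ> g)"
    using assms(1) unfolding pathin_def by (rule continuous_map_compose[OF _ continuous_map_perm_orbit])
qed (simp_all add: assms)

lemma conf_restrict: "x \<in> topspace (conf_space n X) ==> (\<lambda>i\<in>{1..n}. x i) = x"
  by (auto simp: topspace_conf_space PiE_iff intro!: extensional_restrict[unfolded restrict_def[symmetric]])

text \<open>Sorts the particles by their key, with \<open>i0\<close> put first whatever its key may
  be. Near a wall, \<open>i0\<close> is the particle that crosses.\<close>

lemma sort_config:
  fixes k :: "nat => real"
  assumes i0: "i0 \<in> {1..n}" and k: "inj_on k ({1..n} - {i0})"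
  obtains \<sigma> where "\<sigma> permutes {1..n}" "\<sigma> 1 = i0" "\<And>i j. i \<in> {2..n} ==> j \<in> {2..n} ==> i < j ==> k (\<sigma> i) < k (\<sigma> j)"
    "\<And>i. i \<in> {2..n} ==> \<sigma> i \<in> {1..n} - {i0}"
proof -
  define ys where "ys = sort_key k (sorted_list_of_set ({1..n} - {i0}))"
  have ys: "set ys = {1..n} - {i0}" "distinct ys" by (simp_all add: ys_def)
  have "length ys = card ({1..n} - {i0})" using ys by (metis distinct_card)
  hence len: "length ys = n - 1" using i0 by simp
  have srt: "sorted (map k ys)" "distinct (map k ys)"
    using ys k by (simp_all add: ys_def distinct_map)
  hence "sorted_wrt (<) (map k ys)" by (simp only: strict_sorted_iff)
  hence lt: "k (ys ! r) < k (ys ! r')" if "r < r'" "r' < length ys" for r r'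
    using sorted_wrt_nth_less[of "(<)" "map k ys" r r'] that by simp
  have n: "n \<ge> 1" using i0 by simp
  define xs where "xs = [1..<Suc n]"
  have xs: "distinct xs" "set xs = {1..n}" "length xs = n"
    unfolding xs_def by (rule distinct_upt, simp_all only: set_upt atLeastLessThanSuc_atLeastAtMost length_upt diff_Suc_1)
  have d: "distinct (i0 # ys)" "set (i0 # ys) = {1..n}"
    using ys insert_Diff[OF i0] by simp_all
  have l: "length xs = length (i0 # ys)" using xs len n by simp
  obtain \<sigma> where s: "\<sigma> permutes {1..n}" "map \<sigma> xs = i0 # ys"
    by (rule list_relabelling[OF xs(1) d(1) l xs(2) d(2)])
  have nth: "\<sigma> i = (i0 # ys) ! (i - 1)" if "i \<in> {1..n}" for i
  proof -
    have "i - 1 < length xs" using that xs(3) by auto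
    moreover have "xs ! (i - 1) = i" using that nth_upt[of 1 "i - 1" "Suc n"] by (simp add: xs_def del: upt_Suc)
    ultimately have "xs ! (i - 1) = i" "i - 1 < length xs" by simp_all
    thus ?thesis using s(2) by (metis nth_map)
  qed
  have nth2: "\<sigma> i = ys ! (i - 2)" "i - 2 < length ys" if "i \<in> {2..n}" for i
  proof -
    have "i - 1 = Suc (i - 2)" "i \<in> {1..n}" using that by auto
    thus "\<sigma> i = ys ! (i - 2)" using nth by simp
    show "i - 2 < length ys" using that len by auto
  qed
  show thesis
  proof (rule that[OF s(1)])
    show "\<sigma> 1 = i0" using nth[of 1] n by simp
    show "k (\<sigma> i) < k (\<sigma> j)" if "i \<in> {2..n}" "j \<in> {2..n}" "i < j" for i j
      using lt[of "i - 2" "j - 2"] nth2[OF that(1)] nth2[OF that(2)] that by auto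
    show "\<sigma> i \<in> {1..n} - {i0}" if "i \<in> {2..n}" for i
      using nth2[OF that] ys(1) by (metis nth_mem)
  qed
qed

locale open_arc =
  fixes X :: "'x topology" and n :: nat and \<kappa> :: "real => 'x"
  assumes Haus: "Hausdorff_space X" and pc: "path_connected_space X"
    and cont: "continuous_map (top_of_set {0<..<1}) X \<kappa>"
    and inj: "inj_on \<kappa> {0<..<1}"
    and opn: "\<And>U. open U ==> U \<subseteq> {0<..<1} ==> openin X (\<kappa> ` U)"
begin

abbreviation "E \<equiv> \<kappa> ` {0<..<1}"

lemma pathin_kappa:
  assumes "continuous_on {0..1} q" "\<And>t. t \<in> {0..1} ==> q t \<in> {0<..<1}"
  shows "pathin X (\<lambda>t. \<kappa> (q t))"
  by (rule pathin_compose_convex[OF cont assms(1)]) (use assms(2) in blast)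

text \<open>The particles on the open arc are squeezed into its middle half, t going to 1/4 + t/2.
  Differences of parameters are multiplied by 1 - s/2, so none of them collide, and the rest of the
  arc becomes empty.\<close>

lemma shrink:
  assumes x: "x \<in> topspace (conf_space n X)"
  obtains y where "y \<in> topspace (conf_space n X)" "path_component_of (uconf_space n X) (perm_orbit n x) (perm_orbit n y)"
    "\<And>i. i \<in> {1..n} ==> x i \<in> E ==> y i \<in> \<kappa> ` {1/4<..<3/4}" "\<And>i. i \<in> {1..n} ==> x i \<notin> E ==> y i = x i"
proof -
  have xi: "inj_on x {1..n}" and xX: "x i \<in> topspace X" if "i \<in> {1..n}" for i
    using x that by (auto simp: topspace_conf_space)
  define t where "t i = inv_into {0<..<1} \<kappa> (x i)" for i
  have t: "t i \<in> {0<..<1}" "\<kappa> (t i) = x i" if "x i \<in> E" for i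
    unfolding t_def using inv_into_into[OF that] f_inv_into_f[OF that] by blast+
  define f where "f i s = (if x i \<in> E then \<kappa> (lin (t i) (1/4 + t i / 2) s) else x i)" for i s
  have r: "lin (t i) (1/4 + t i / 2) s \<in> {0<..<1}" if "x i \<in> E" "s \<in> {0..1}" for i s
    by (rule lin_in_convex) (use t(1)[OF that(1)] that in auto)
  have p: "pathin (conf_space n X) (\<lambda>s. \<lambda>i\<in>{1..n}. f i s)"
  proof (rule pathin_conf)
    fix i assume i: "i \<in> {1..n}"
    show "pathin X (f i)"
    proof (cases "x i \<in> E")
      case True
      have "pathin X (\<lambda>s. \<kappa> (lin (t i) (1/4 + t i / 2) s))"
        by (rule pathin_kappa[OF continuous_on_lin r[OF True]])
      thus ?thesis using True by (simp add: f_def[abs_def])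
    qed (use xX[OF i] in \<open>simp add: f_def[abs_def]\<close>)
  next
    fix s :: real assume s: "s \<in> {0..1}"
    show "inj_on (\<lambda>i. f i s) {1..n}"
    proof (rule inj_onI)
      fix i j assume ij: "i \<in> {1..n}" "j \<in> {1..n}" "f i s = f j s"
      have fE: "f k s \<in> E \<longleftrightarrow> x k \<in> E" for k using r[OF _ s] by (auto simp: f_def)
      show "i = j"
      proof (cases "x i \<in> E")
        case True
        hence j: "x j \<in> E" using fE ij(3) by metis
        have "lin (t i) (1/4 + t i / 2) s = lin (t j) (1/4 + t j / 2) s"
          using ij(3) True j inj_onD[OF inj _ r[OF True s] r[OF j s]] by (simp add: f_def)
        hence "(t i - t j) * (1 - s / 2) = 0" unfolding lin_def real_scaleR_def by argo
        hence "t i = t j" using s by simp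
        hence "x i = x j" using t(2) True j by metis
        thus ?thesis using inj_onD[OF xi _ ij(1,2)] ij by blast
      next
        case False
        hence "x j \<notin> E" using fE ij(3) by metis
        hence "x i = x j" using False ij(3) by (simp add: f_def)
        thus ?thesis using inj_onD[OF xi _ ij(1,2)] ij by blast
      qed
    qed
  qed
  have 0: "(\<lambda>i\<in>{1..n}. f i 0) = x"
  proof -
    have "f i 0 = x i" for i using t(2) by (simp add: f_def)
    thus ?thesis using conf_restrict[OF x] by simp
  qed
  define y where "y = (\<lambda>i\<in>{1..n}. f i 1)"
  have "y \<in> topspace (conf_space n X)" unfolding y_def using pathin_topspace[OF p, of 1] by simp
  moreover have "path_component_of (uconf_space n X) (perm_orbit n x) (perm_orbit n y)"
    by (rule path_component_orbit[OF p]) (simp_all only: 0 y_def)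
  moreover have "y i \<in> \<kappa> ` {1/4<..<3/4}" if "i \<in> {1..n}" "x i \<in> E" for i
    using t(1)[OF that(2)] that by (auto simp: y_def f_def)
  moreover have "y i = x i" if "i \<in> {1..n}" "x i \<notin> E" for i
    using that by (auto simp: y_def f_def)
  ultimately show thesis by (rule that)
qed

text \<open>Follow a path into the middle of the arc from its last visit to an outside particle
  until it first touches the middle half. The outside particle found at that last visit can be moved
  along this piece, and the number of outside particles drops.\<close>

lemma pull_in:
  assumes x: "x \<in> topspace (conf_space n X)" and out: "i0 \<in> {1..n}" "x i0 \<notin> E"
  obtains z where "z \<in> topspace (conf_space n X)" "path_component_of (uconf_space n X) (perm_orbit n x) (perm_orbit n z)"
    "{i \<in> {1..n}. z i \<notin> E} \<subset> {i \<in> {1..n}. x i \<notin> E}"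
proof -
  obtain y where y: "y \<in> topspace (conf_space n X)" "path_component_of (uconf_space n X) (perm_orbit n x) (perm_orbit n y)"
    "\<And>i. i \<in> {1..n} ==> x i \<in> E ==> y i \<in> \<kappa> ` {1/4<..<3/4}" "\<And>i. i \<in> {1..n} ==> x i \<notin> E ==> y i = x i"
    using shrink[OF x] by blast
  have yi: "inj_on y {1..n}" and yX: "\<And>i. i \<in> {1..n} ==> y i \<in> topspace X"
    using y(1) by (auto simp: topspace_conf_space)
  let ?J = "{i \<in> {1..n}. x i \<notin> E}"
  have kX: "\<kappa> u \<in> topspace X" if "u \<in> {0<..<1}" for u using cont that by (auto simp: continuous_map_def)
  obtain g where g: "pathin X g" "g 0 = y i0" "g 1 = \<kappa> (1/2)"
    using pc yX[OF out(1)] kX[of "1/2"] unfolding path_connected_space_def by fastforce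
  let ?I = "top_of_set {0..1::real}"
  have gc: "continuous_map ?I X g" using g(1) by (simp add: pathin_def)
  \<comment> \<open>The times at which \<open>g\<close> visits a particle lying outside the open
    arc. The last one is \<open>ts\<close>, where the particle is called \<open>k\<close>; it need
    not be \<open>i0\<close>.\<close>
  define T where "T = {t \<in> {0..1}. g t \<in> y ` ?J}"
  have "closedin X (y ` ?J)"
    using yX Haus by (intro closedin_Hausdorff_finite) auto
  from closedin_continuous_map_preimage[OF gc this]
  have cT: "closed T" unfolding T_def by (simp add: closedin_closed_trans[of "{0..1}"] closedin_closed_eq)
  have "i0 \<in> ?J" using out by blast
  hence "g 0 \<in> y ` ?J" unfolding g(2) by (rule imageI)
  hence T0: "0 \<in> T" by (simp add: T_def)
  define ts where "ts = Sup T"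
  have bT: "bdd_above T" "T \<noteq> {}" using T0 by (rule_tac bdd_aboveI[of _ 1], simp add: T_def, blast)
  have ts: "ts \<in> T" unfolding ts_def by (rule closed_contains_Sup[OF bT(2,1) cT])
  have ts_max: "t \<notin> T" if "ts < t" for t
    using that cSup_upper[OF _ bT(1), of t] unfolding ts_def by auto
  obtain k where k: "k \<in> {1..n}" "x k \<notin> E" "g ts = y k" using ts by (auto simp: T_def)
  have gts: "g ts \<notin> E" using k y(4) by simp
  have sub: "{1/4..3/4} \<subseteq> {0<..<1::real}" by auto
  have "compactin X (\<kappa> ` {1/4..3/4})"
    by (rule image_compactin[OF _ cont]) (use sub in \<open>auto simp: compactin_subtopology\<close>)
  hence clK: "closedin X (\<kappa> ` {1/4..3/4})" by (rule compactin_imp_closedin[OF Haus])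
  define T1 where "T1 = {t \<in> {0..1}. g t \<in> \<kappa> ` {1/4..3/4}} \<inter> {ts..}"
  from closedin_continuous_map_preimage[OF gc clK]
  have cT1: "closed T1" unfolding T1_def by (intro closed_Int) (simp_all add: closedin_closed_eq)
  have ts01: "ts \<in> {0..1}" using ts by (simp add: T_def)
  have T11: "1 \<in> T1" using g(3) ts01 by (auto simp: T1_def)
  define t1 where "t1 = Inf T1"
  have bT1: "bdd_below T1" "T1 \<noteq> {}" using T11 by (rule_tac bdd_belowI[of _ 0], simp add: T1_def, blast)
  have t1: "t1 \<in> T1" unfolding t1_def by (rule closed_contains_Inf[OF bT1(2,1) cT1])
  have t1_min: "t \<notin> T1" if "t < t1" for t
    using that cInf_lower[OF _ bT1(1), of t] unfolding t1_def by auto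
  have t1E: "g t1 \<in> E" "t1 \<in> {0..1}" "ts \<le> t1" using t1 sub by (auto simp: T1_def)
  hence lt: "ts < t1" using gts by (metis order_le_less)
  \<comment> \<open>At the moment of first contact the path is at the boundary of the middle half.
    The particles on the arc are strictly inside it after \<open>shrink\<close>, so they are avoided
    up to and including this moment.\<close>
  have g1: "g t1 \<notin> \<kappa> ` {1/4<..<3/4}"
  proof
    assume a: "g t1 \<in> \<kappa> ` {1/4<..<3/4}"
    have "openin X (\<kappa> ` {1/4<..<3/4})" by (rule opn) auto
    from openin_continuous_map_preimage[OF gc this]
    obtain O' where O': "open O'" "{t \<in> {0..1}. g t \<in> \<kappa> ` {1/4<..<3/4}} = {0..1} \<inter> O'"
      by (auto simp: openin_open)
    hence "t1 \<in> O'" using a t1E by blast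
    then obtain e where e: "e > 0" "ball t1 e \<subseteq> O'" using O'(1) openE by blast
    define u where "u = max ts (t1 - e / 2)"
    have u: "u < t1" "ts \<le> u" "u \<in> ball t1 e" "u \<in> {0..1}"
      using e(1) lt ts01 t1E by (auto simp: u_def dist_real_def max_def)
    hence "g u \<in> \<kappa> ` {1/4<..<3/4}" using e(2) O'(2) by blast
    hence "g u \<in> \<kappa> ` {1/4..3/4}" by auto
    hence "u \<in> T1" using u by (auto simp: T1_def)
    thus False using t1_min u by blast
  qed
  define f where "f i s = (if i = k then g (lin ts t1 s) else y i)" for i s
  have r: "lin ts t1 s \<in> {ts..t1}" if "s \<in> {0..1}" for s
    by (rule lin_in_convex) (use that lt in auto)
  have avoid: "g u \<noteq> y i" if u: "u \<in> {ts..t1}" and i: "i \<in> {1..n}" "i \<noteq> k" for u i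
  proof (cases "x i \<in> E")
    case True
    hence yi': "y i \<in> \<kappa> ` {1/4<..<3/4}" using y(3) i by blast
    show ?thesis
    proof (cases "u = t1")
      case True
      thus ?thesis using g1 yi' by auto
    next
      case False
      hence "u \<notin> T1" using u t1_min by simp
      hence "g u \<notin> \<kappa> ` {1/4..3/4}" using u ts01 t1E by (auto simp: T1_def)
      thus ?thesis using yi' by auto
    qed
  next
    case False
    show ?thesis
    proof (cases "u = ts")
      case True
      thus ?thesis using k inj_onD[OF yi _ i(1) k(1)] i(2) by metis
    next
      case False': False
      hence "u \<notin> T" using u ts_max by simp
      thus ?thesis using u ts01 t1E False i by (auto simp: T_def)
    qed
  qed
  have p: "pathin (conf_space n X) (\<lambda>s. \<lambda>i\<in>{1..n}. f i s)"
  proof (rule pathin_conf)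
    fix i assume i: "i \<in> {1..n}"
    have "pathin X (\<lambda>s. g (lin ts t1 s))"
      by (rule pathin_compose_convex[OF gc continuous_on_lin]) (use r ts01 t1E in fastforce)
    thus "pathin X (f i)" using yX[OF i] by (cases "i = k") (simp_all add: f_def[abs_def])
  next
    fix s :: real assume s: "s \<in> {0..1}"
    show "inj_on (\<lambda>i. f i s) {1..n}"
    proof (rule inj_onI)
      fix i j assume ij: "i \<in> {1..n}" "j \<in> {1..n}" "f i s = f j s"
      show "i = j"
        using avoid[OF r[OF s] ij(1)] avoid[OF r[OF s] ij(2)] ij(3) inj_onD[OF yi _ ij(1,2)]
        by (cases "i = k"; cases "j = k") (auto simp: f_def)
    qed
  qed
  define z where "z = (\<lambda>i\<in>{1..n}. f i 1)"
  have 0: "(\<lambda>i\<in>{1..n}. f i 0) = y"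
  proof -
    have "f i 0 = y i" for i using k(3) by (simp add: f_def)
    thus ?thesis using conf_restrict[OF y(1)] by simp
  qed
  have "z \<in> topspace (conf_space n X)" unfolding z_def using pathin_topspace[OF p, of 1] by simp
  moreover have "path_component_of (uconf_space n X) (perm_orbit n y) (perm_orbit n z)"
    by (rule path_component_orbit[OF p]) (simp_all only: 0 z_def)
  hence "path_component_of (uconf_space n X) (perm_orbit n x) (perm_orbit n z)"
    using y(2) path_component_of_trans by metis
  moreover have "{i \<in> {1..n}. z i \<notin> E} \<subset> {i \<in> {1..n}. x i \<notin> E}"
  proof
    show "{i \<in> {1..n}. z i \<notin> E} \<subseteq> {i \<in> {1..n}. x i \<notin> E}"
    proof safe
      fix i u assume i: "i \<in> {1..n}" "z i \<notin> E" "x i = \<kappa> u" "u \<in> {0<..<1}"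
      hence "x i \<in> E" by blast
      hence "i \<noteq> k" "y i \<in> \<kappa> ` {1/4<..<3/4}" using k y(3) i by auto
      hence "z i \<in> E" using i(1) by (auto simp: z_def f_def)
      thus False using i by blast
    qed
    show "{i \<in> {1..n}. z i \<notin> E} \<noteq> {i \<in> {1..n}. x i \<notin> E}"
    proof -
      have "z k \<in> E" using k(1) t1E by (simp add: z_def f_def)
      thus ?thesis using k by blast
    qed
  qed
  ultimately show thesis by (rule that)
qed

lemma all_in:
  assumes "x \<in> topspace (conf_space n X)"
  shows "\<exists>z. z \<in> topspace (conf_space n X) \<and> path_component_of (uconf_space n X) (perm_orbit n x) (perm_orbit n z) \<and>
    (\<forall>i\<in>{1..n}. z i \<in> E)"
  using assms
proof (induction "card {i \<in> {1..n}. x i \<notin> E}" arbitrary: x rule: less_induct)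
  case less
  show ?case
  proof (cases "\<forall>i\<in>{1..n}. x i \<in> E")
    case True
    have "perm_orbit n x \<in> topspace (uconf_space n X)" using less.prems by (simp add: topspace_uconf_space)
    thus ?thesis using True less.prems by (intro exI[of _ x]) (simp add: path_component_of_refl)
  next
    case False
    then obtain i0 where i0: "i0 \<in> {1..n}" "x i0 \<notin> E" by blast
    obtain z where z: "z \<in> topspace (conf_space n X)" "path_component_of (uconf_space n X) (perm_orbit n x) (perm_orbit n z)"
      "{i \<in> {1..n}. z i \<notin> E} \<subset> {i \<in> {1..n}. x i \<notin> E}"
      using pull_in[OF less.prems i0] by blast
    have "card {i \<in> {1..n}. z i \<notin> E} < card {i \<in> {1..n}. x i \<notin> E}"
      by (rule psubset_card_mono[OF _ z(3)]) simp
    from less.hyps[OF this z(1)] obtain z' where "z' \<in> topspace (conf_space n X)"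
      "path_component_of (uconf_space n X) (perm_orbit n z) (perm_orbit n z')" "\<forall>i\<in>{1..n}. z' i \<in> E" by blast
    thus ?thesis using path_component_of_trans[OF z(2)] by blast
  qed
qed

lemma increasing_path:
  assumes q: "\<And>i. i \<in> {1..n} ==> q i \<in> {0<..<1} \<and> r i \<in> {0<..<1}"
    and mono: "\<And>i j. i \<in> {1..n} ==> j \<in> {1..n} ==> i < j ==> q i < q j \<and> r i < r j"
  shows "pathin (conf_space n X) (\<lambda>s. \<lambda>i\<in>{1..n}. \<kappa> (lin (q i) (r i) s))"
proof (rule pathin_conf)
  have m: "lin (q i) (r i) s \<in> {0<..<1}" if "i \<in> {1..n}" "s \<in> {0..1}" for i s
    by (rule lin_in_convex) (use q[OF that(1)] that in auto)
  thus "pathin X (\<lambda>s. \<kappa> (lin (q i) (r i) s))" if "i \<in> {1..n}" for i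
    by (intro pathin_kappa continuous_on_lin) (use that in auto)
  fix s :: real assume s: "s \<in> {0..1}"
  have lt: "lin (q i) (r i) s < lin (q j) (r j) s" if "i \<in> {1..n}" "j \<in> {1..n}" "i < j" for i j
  proof -
    have "(1 - s) * q i + s * r i < (1 - s) * q j + s * r j"
    proof (cases "s = 1")
      case False
      hence "(1 - s) * q i < (1 - s) * q j" "s * r i \<le> s * r j"
        using mono[OF that] s by (auto intro!: mult_left_mono)
      thus ?thesis by linarith
    qed (use mono[OF that] in simp)
    thus ?thesis by (simp add: lin_def algebra_simps)
  qed
  show "inj_on (\<lambda>i. \<kappa> (lin (q i) (r i) s)) {1..n}"
  proof (rule inj_onI)
    fix i j assume ij: "i \<in> {1..n}" "j \<in> {1..n}" "\<kappa> (lin (q i) (r i) s) = \<kappa> (lin (q j) (r j) s)"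
    have "lin (q i) (r i) s = lin (q j) (r j) s"
      by (rule inj_onD[OF inj ij(3) m[OF ij(1) s] m[OF ij(2) s]])
    thus "i = j" using lt[OF ij(1,2)] lt[OF ij(2,1)] by (metis less_irrefl linorder_neqE_nat)
  qed
qed

text \<open>Once all particles are on one open arc they can be renamed in increasing order, since
  the configuration is unordered, and then slide monotonically to the evenly spaced positions
  \<open>c i\<close>.\<close>

theorem uconf_path_connected: "path_connected_space (uconf_space n X)"
proof (cases "n = 0")
  case True
  have "path_component_of (uconf_space n X) a b" if "a \<in> topspace (uconf_space n X)" "b \<in> topspace (uconf_space n X)" for a b
  proof -
    have "a = b" using that True by (auto simp: topspace_uconf_space topspace_conf_space)
    thus ?thesis using that by (simp add: path_component_of_refl)
  qed
  thus ?thesis by (auto simp: path_connected_space_iff_path_component)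
next
  case False
  hence n: "1 \<in> {1..n}" by simp
  define c where "c i = real i / real (n + 1)" for i
  define cc where "cc = (\<lambda>i\<in>{1..n}. \<kappa> (c i))"
  have to_cc: "path_component_of (uconf_space n X) y (perm_orbit n cc)" if y: "y \<in> topspace (uconf_space n X)" for y
  proof -
    obtain x where x: "x \<in> topspace (conf_space n X)" "y = perm_orbit n x" using y by (auto simp: topspace_uconf_space)
    obtain z where z: "z \<in> topspace (conf_space n X)" "path_component_of (uconf_space n X) y (perm_orbit n z)"
      "\<forall>i\<in>{1..n}. z i \<in> E" using all_in[OF x(1)] x(2) by blast
    define t where "t i = inv_into {0<..<1} \<kappa> (z i)" for i
    have t: "t i \<in> {0<..<1}" "\<kappa> (t i) = z i" if "i \<in> {1..n}" for i
      unfolding t_def using inv_into_into[of "z i" \<kappa>] f_inv_into_f[of "z i" \<kappa>] z(3) that by blast+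
    have zi: "inj_on z {1..n}" using z(1) by (auto simp: topspace_conf_space)
    have ti: "inj_on t {1..n}"
    proof (rule inj_onI)
      fix i j assume ij: "i \<in> {1..n}" "j \<in> {1..n}" "t i = t j"
      hence "z i = z j" using t(2) by metis
      thus "i = j" using inj_onD[OF zi _ ij(1,2)] by blast
    qed
    \<comment> \<open>\<open>sort_config\<close> puts the chosen index first; choosing the smallest
      parameter makes the whole order increasing.\<close>
    define i0 where "i0 = arg_min_on t {1..n}"
    have i0: "i0 \<in> {1..n}" unfolding i0_def using n by (intro arg_min_if_finite) auto
    have i0m: "t i0 \<le> t i" if "i \<in> {1..n}" for i
      unfolding i0_def using that by (intro arg_min_least) auto
    have ti': "inj_on t ({1..n} - {i0})" using ti by (rule inj_on_subset) blast
    obtain \<sigma> where s: "\<sigma> permutes {1..n}" "\<sigma> 1 = i0"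
      "\<And>i j. i \<in> {2..n} ==> j \<in> {2..n} ==> i < j ==> t (\<sigma> i) < t (\<sigma> j)"
      "\<And>i. i \<in> {2..n} ==> \<sigma> i \<in> {1..n} - {i0}"
      using sort_config[OF i0 ti'] by metis
    have si: "\<sigma> i \<in> {1..n}" if "i \<in> {1..n}" for i using permutes_in_image[OF s(1)] that by blast
    have mono: "t (\<sigma> i) < t (\<sigma> j)" if ij: "i \<in> {1..n}" "j \<in> {1..n}" "i < j" for i j
    proof (cases "i = 1")
      case True
      have j: "j \<in> {2..n}" using that True by auto
      have "t i0 \<noteq> t (\<sigma> j)" using s(4)[OF j] inj_onD[OF ti _ i0 si[OF ij(2)]] by auto
      thus ?thesis using True s(2) i0m[OF si[OF ij(2)]] by simp
    qed (use that in \<open>auto intro: s(3)\<close>)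
    define g where "g = (\<lambda>u. \<lambda>i\<in>{1..n}. \<kappa> (lin (t (\<sigma> i)) (c i) u))"
    have g: "pathin (conf_space n X) g"
      unfolding g_def
    proof (rule increasing_path)
      show "t (\<sigma> i) \<in> {0<..<1} \<and> c i \<in> {0<..<1}" if "i \<in> {1..n}" for i
        using t(1)[OF si[OF that]] that by (auto simp: c_def)
      show "t (\<sigma> i) < t (\<sigma> j) \<and> c i < c j" if "i \<in> {1..n}" "j \<in> {1..n}" "i < j" for i j
        using mono[OF that] that by (auto simp: c_def divide_strict_right_mono)
    qed
    have "g 0 = z \<circ> \<sigma>"
    proof
      fix i
      show "g 0 i = (z \<circ> \<sigma>) i"
      proof (cases "i \<in> {1..n}")
        case True
        thus ?thesis using t(2)[OF si[OF True]] by (simp add: g_def)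
      next
        case i: False
        hence "\<sigma> i = i" using permutes_not_in[OF s(1)] by blast
        moreover have "z i = undefined" using z(1) i by (auto simp: topspace_conf_space PiE_iff extensional_def)
        ultimately show ?thesis using i by (simp only: g_def restrict_apply o_apply if_False)
      qed
    qed
    moreover have "g 1 = cc" by (simp add: g_def cc_def)
    ultimately have "path_component_of (uconf_space n X) (perm_orbit n (z \<circ> \<sigma>)) (perm_orbit n cc)"
      using path_component_orbit[OF g] by metis
    thus ?thesis unfolding perm_orbit_compose[OF s(1)] using path_component_of_trans[OF z(2)] by blast
  qed
  show ?thesis
    unfolding path_connected_space_iff_path_component
  proof (intro ballI)
    fix a b assume "a \<in> topspace (uconf_space n X)" "b \<in> topspace (uconf_space n X)"
    from to_cc[OF this(1)] to_cc[OF this(2)]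
    show "path_component_of (uconf_space n X) a b"
      using path_component_of_sym path_component_of_trans by metis
  qed
qed

end

section \<open>Collars and walls\<close>

lemma openin_finite_ball:
  assumes "finite S" "openin Z T" "\<And>i. i \<in> S ==> openin Z {x \<in> T. P i x}"
  shows "openin Z {x \<in> T. \<forall>i\<in>S. P i x}"
  using assms(1,3)
proof (induction S rule: finite_induct)
  case empty
  thus ?case using assms(2) by simp
next
  case (insert i S)
  have "{x \<in> T. \<forall>j\<in>insert i S. P j x} = {x \<in> T. P i x} \<inter> {x \<in> T. \<forall>j\<in>S. P j x}" by blast
  thus ?case using insert by (simp add: openin_Int)
qed

lemma continuous_map_conf_component: "i \<in> {1..n} ==> continuous_map (conf_space n X) X (\<lambda>x. x i)"
  using continuous_map_conf_space[of "conf_space n X" n X id] by auto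

lemma permutation_increasing_id:
  assumes s: "\<sigma> permutes {1..n::nat}" and m: "\<And>i. i \<in> {1..n} ==> Suc i \<in> {1..n} ==> \<sigma> i < \<sigma> (Suc i)"
  shows "\<sigma> = id"
proof (rule permutes_natset_ge[OF s], rule ballI)
  fix i assume "i \<in> {1..n}"
  thus "i \<le> \<sigma> i"
  proof (induction i)
    case (Suc i)
    show ?case
    proof (cases "i = 0")
      case True
      have "\<sigma> (Suc i) \<in> {1..n}" using permutes_in_image[OF s] Suc.prems by blast
      thus ?thesis using True by simp
    next
      case False
      hence "i \<in> {1..n}" using Suc.prems by simp
      thus ?thesis using Suc.IH m[OF _ Suc.prems] by fastforce
    qed
  qed simp
qed

text \<open>One particle ranges over a star \<open>N\<close> with rays \<omega> from
  \<open>v\<close>, the others over an edge parametrised by \<kappa> on \<open>I\<close>. The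
  function \<delta> measures depth in that edge, is concave along it, and shrinks linearly when the
  star is contracted. The cases are \<open>I\<close> half open with \<open>d t = t\<close> for a
  leaf edge or an interval, and \<open>I\<close> open with a tent function for a loop.\<close>

locale collar =
  fixes X :: "'x topology" and n :: nat and I :: "real set" and \<kappa> :: "real => 'x" and d :: "real => real"
    and \<delta> :: "'x => real" and D :: "'j set" and \<omega> :: "'j => real => 'x" and \<rho> :: real and N :: "'x set" and v :: 'x
  assumes Haus: "Hausdorff_space X" and n1: "n \<ge> 1"
    and I: "convex I" "{0<..<1} \<subseteq> I"
    and cont: "continuous_map (top_of_set I) X \<kappa>" and inj: "inj_on \<kappa> I"
    and opn: "\<And>U. openin (top_of_set I) U ==> openin X (\<kappa> ` U)"
    and conc: "\<And>a b s. a \<in> I ==> b \<in> I ==> s \<in> {0..1} ==> (1 - s) * d a + s * d b \<le> d (lin a b s)"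
    and dpos: "\<And>t. t \<in> I ==> d t > 0"
    and dcont: "continuous_map X euclideanreal \<delta>" and dk: "\<And>t. t \<in> I ==> \<delta> (\<kappa> t) = d t"
    and finD: "finite D" and \<rho>: "\<rho> \<ge> 0"
    and \<omega>: "\<And>j. j \<in> D ==> continuous_map (top_of_set {0..\<rho>}) X (\<omega> j)" "\<And>j. j \<in> D ==> \<omega> j 0 = v"
    and \<omega>_inj: "\<And>j k s t. j \<in> D ==> k \<in> D ==> s \<in> {0..\<rho>} ==> t \<in> {0..\<rho>} ==> \<omega> j s = \<omega> k t ==> j = k \<and> s = t \<or> s = 0 \<and> t = 0"
    and N: "openin X N" "N \<subseteq> (\<Union>j\<in>D. \<omega> j ` {0..\<rho>})"
    and star: "\<And>j s t. j \<in> D ==> t \<in> {0..\<rho>} ==> \<omega> j t \<in> N ==> s \<in> {0..1} ==>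
       \<omega> j ((1 - s) * t) \<in> N \<and> \<delta> (\<omega> j ((1 - s) * t)) = (1 - s) * \<delta> (\<omega> j t)"
begin

abbreviation "E \<equiv> \<kappa> ` I"

definition \<tau> :: "'x => real" where "\<tau> = inv_into I \<kappa>"

lemma tau_kappa: "t \<in> I ==> \<tau> (\<kappa> t) = t"
  unfolding \<tau>_def by (rule inv_into_f_f[OF inj])

lemma tau: "x \<in> E ==> \<tau> x \<in> I" "x \<in> E ==> \<kappa> (\<tau> x) = x"
  unfolding \<tau>_def by (rule inv_into_into, assumption) (rule f_inv_into_f)

lemma open_E: "openin X E"
  by (rule opn) simp

lemma cont_tau: "continuous_map (subtopology X E) (top_of_set I) \<tau>"
  unfolding continuous_map_def
proof (intro conjI allI impI funcsetI)
  fix x assume "x \<in> topspace (subtopology X E)"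
  thus "\<tau> x \<in> topspace (top_of_set I)" using tau(1) by auto
next
  fix U assume U: "openin (top_of_set I) U"
  hence UI: "U \<subseteq> I" using openin_subset by fastforce
  have "{x \<in> topspace (subtopology X E). \<tau> x \<in> U} = \<kappa> ` U"
  proof (intro equalityI subsetI)
    fix x assume "x \<in> {x \<in> topspace (subtopology X E). \<tau> x \<in> U}"
    hence "x \<in> E" "\<tau> x \<in> U" by auto
    thus "x \<in> \<kappa> ` U" using tau(2) by (metis imageI)
  next
    fix x assume "x \<in> \<kappa> ` U"
    then obtain t where t: "t \<in> U" "x = \<kappa> t" by blast
    have "x \<in> topspace X" using openin_subset[OF opn[OF U]] t by blast
    thus "x \<in> {x \<in> topspace (subtopology X E). \<tau> x \<in> U}"
      using t UI tau_kappa[of t] by auto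
  qed
  moreover have "openin (subtopology X E) (\<kappa> ` U)"
    using opn[OF U] UI by (intro openin_subset_topspace_eq[THEN iffD2] openin_subtopology[THEN iffD2] exI[of _ "\<kappa> ` U"]) auto
  ultimately show "openin (subtopology X E) {x \<in> topspace (subtopology X E). \<tau> x \<in> U}" by simp
qed

text \<open>The contraction of the star to \<open>v\<close> along its rays. The choice is harmless
  because distinct rays meet only in their common start.\<close>

definition h :: "'x => real => 'x" where
  "h x s = (SOME y. \<exists>j\<in>D. \<exists>t\<in>{0..\<rho>}. x = \<omega> j t \<and> y = \<omega> j ((1 - s) * t))"

lemma h:
  assumes "j \<in> D" "t \<in> {0..\<rho>}" shows "h (\<omega> j t) s = \<omega> j ((1 - s) * t)"
  unfolding h_def
proof (rule some_equality)
  show "\<exists>k\<in>D. \<exists>u\<in>{0..\<rho>}. \<omega> j t = \<omega> k u \<and> \<omega> j ((1 - s) * t) = \<omega> k ((1 - s) * u)" using assms by blast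
  fix y assume "\<exists>k\<in>D. \<exists>u\<in>{0..\<rho>}. \<omega> j t = \<omega> k u \<and> y = \<omega> k ((1 - s) * u)"
  then obtain k u where k: "k \<in> D" "u \<in> {0..\<rho>}" "\<omega> j t = \<omega> k u" "y = \<omega> k ((1 - s) * u)" by blast
  from \<omega>_inj[OF assms(1) k(1) assms(2) k(2,3)] show "y = \<omega> j ((1 - s) * t)"
    using k(4) \<omega>(2)[OF k(1)] \<omega>(2)[OF assms(1)] by auto
qed

lemma cont_h:
  "continuous_map (prod_topology (subtopology X (\<Union>j\<in>D. \<omega> j ` {0..\<rho>})) (top_of_set {0..1})) X (\<lambda>p. h (fst p) (snd p))"
proof (rule continuous_map_glue_compact[OF finD, where K = "\<lambda>_. top_of_set ({0..\<rho>} \<times> {0..1})"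
      and g = "\<lambda>j p. (\<omega> j (fst p), snd p)"])
  let ?Z = "prod_topology (subtopology X (\<Union>j\<in>D. \<omega> j ` {0..\<rho>})) (top_of_set {0..1::real})"
  show "Hausdorff_space ?Z"
    by (auto simp: Hausdorff_space_prod_topology Hausdorff_space_subtopology Haus)
  show "topspace ?Z \<subseteq> (\<Union>j\<in>D. (\<lambda>p. (\<omega> j (fst p), snd p)) ` topspace (top_of_set ({0..\<rho>} \<times> {0..1})))"
  proof
    fix z assume "z \<in> topspace ?Z"
    then obtain j t s where "j \<in> D" "t \<in> {0..\<rho>}" "s \<in> {0..1}" "z = (\<omega> j t, s)" by auto
    thus "z \<in> (\<Union>j\<in>D. (\<lambda>p. (\<omega> j (fst p), snd p)) ` topspace (top_of_set ({0..\<rho>} \<times> {0..1})))" by force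
  qed
  fix j assume j: "j \<in> D"
  have c: "continuous_map (top_of_set ({0..\<rho>} \<times> {0..1})) X (\<omega> j \<circ> (\<lambda>p. fst p))"
    by (rule continuous_map_compose[OF _ \<omega>(1)[OF j]]) (auto intro!: continuous_intros)
  have "compact ({0..\<rho>} \<times> {0..1::real})" by (intro compact_Times) auto
  hence "compact_space (top_of_set ({0..\<rho>} \<times> {0..1::real}))"
    by (simp add: compact_space_subtopology compactin_euclidean_iff)
  moreover have "continuous_map (top_of_set ({0..\<rho>} \<times> {0..1::real})) ?Z (\<lambda>p. (\<omega> j (fst p), snd p))"
    using c j by (auto simp: continuous_map_pairwise continuous_map_in_subtopology o_def intro!: continuous_intros)
  ultimately show "compact_space (top_of_set ({0..\<rho>} \<times> {0..1::real})) \<and>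
      continuous_map (top_of_set ({0..\<rho>} \<times> {0..1::real})) ?Z (\<lambda>p. (\<omega> j (fst p), snd p))" ..
  have m: "(1 - s) * t \<in> {0..\<rho>}" if "t \<in> {0..\<rho>}" "s \<in> {0..1}" for s t
    using that mult_left_le_one_le[of t "1 - s"] by auto
  have "continuous_map (top_of_set ({0..\<rho>} \<times> {0..1})) X (\<omega> j \<circ> (\<lambda>p. (1 - snd p) * fst p))"
    by (rule continuous_map_compose[OF _ \<omega>(1)[OF j]]) (use m in \<open>auto intro!: continuous_intros\<close>)
  thus "continuous_map (top_of_set ({0..\<rho>} \<times> {0..1::real})) X ((\<lambda>p. h (fst p) (snd p)) \<circ> (\<lambda>p. (\<omega> j (fst p), snd p)))"
    by (rule continuous_map_eq) (use h[OF j] in auto)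
qed

lemma h_N:
  assumes "x \<in> N" "s \<in> {0..1}"
  shows "h x s \<in> N" "\<delta> (h x s) = (1 - s) * \<delta> x" "h x 0 = x" "h x 1 = v"
proof -
  obtain j t where j: "j \<in> D" "t \<in> {0..\<rho>}" "x = \<omega> j t" using N(2) assms(1) by blast
  show "h x s \<in> N" "\<delta> (h x s) = (1 - s) * \<delta> x"
    using star[OF j(1,2) _ assms(2)] assms(1) h[OF j(1,2)] j(3) by auto
  show "h x 0 = x" "h x 1 = v" using h[OF j(1,2)] j \<omega>(2) by auto
qed

text \<open>Ordered representatives near the wall: the crossing particle has index 1 and is less
  deep than all the others, which are numbered along the edge. \<open>N\<close> and the edge
  overlap, so the comparison of depths is what identifies particle 1.\<close>

definition Good :: "(nat => 'x) set" where
  "Good = {x \<in> topspace (conf_space n X). x 1 \<in> N \<and> (\<forall>i\<in>{2..n}. x i \<in> E \<and> \<delta> (x 1) < \<delta> (x i)) \<and>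
     (\<forall>i\<in>{2..n}. \<forall>j\<in>{2..n}. i < j \<longrightarrow> \<tau> (x i) < \<tau> (x j))}"

lemma open_Good: "openin (conf_space n X) Good"
proof -
  let ?C = "conf_space n X"
  define B where "B = {x \<in> topspace ?C. \<forall>i\<in>{1..n}. x i \<in> (if i = 1 then N else E)}"
  have B: "openin ?C B" unfolding B_def by (rule open_box) (simp add: N open_E)
  have one: "1 \<in> {1..n}" using n1 by simp
  have sub: "i \<in> {1..n}" if "i \<in> {2..n}" for i using that by simp
  have 1: "openin ?C {x \<in> B. \<delta> (x 1) < \<delta> (x i)}" if i: "i \<in> {2..n}" for i
  proof -
    have "continuous_map ?C euclideanreal (\<lambda>x. \<delta> (x i) - \<delta> (x 1))"
      using continuous_map_compose[OF continuous_map_conf_component[OF sub[OF i]] dcont]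
        continuous_map_compose[OF continuous_map_conf_component[OF one] dcont]
      by (intro continuous_map_diff) (simp_all add: o_def)
    from openin_continuous_map_preimage[OF this, of "{0<..}"]
    have "openin ?C {x \<in> topspace ?C. \<delta> (x i) - \<delta> (x 1) \<in> {0<..}}" by (simp only: open_openin[symmetric] open_greaterThan)
    hence "openin ?C (B \<inter> {x \<in> topspace ?C. \<delta> (x i) - \<delta> (x 1) \<in> {0<..}})" using B by (intro openin_Int)
    moreover have "B \<inter> {x \<in> topspace ?C. \<delta> (x i) - \<delta> (x 1) \<in> {0<..}} = {x \<in> B. \<delta> (x 1) < \<delta> (x i)}"
      by (auto simp: B_def)
    ultimately show ?thesis by simp
  qed
  have comp: "continuous_map (subtopology ?C B) euclideanreal (\<lambda>x. \<tau> (x i))" if i: "i \<in> {2..n}" for i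
  proof -
    have "continuous_map (subtopology ?C B) (subtopology X E) (\<lambda>x. x i)"
      unfolding continuous_map_in_subtopology
      using continuous_map_from_subtopology[OF continuous_map_conf_component[OF sub[OF i]]] i by (auto simp: B_def)
    from continuous_map_compose[OF this cont_tau] show ?thesis
      by (simp add: o_def continuous_map_in_subtopology)
  qed
  have 2: "openin ?C {x \<in> B. \<tau> (x i) < \<tau> (x j)}" if i: "i \<in> {2..n}" and j: "j \<in> {2..n}" for i j
  proof -
    have "continuous_map (subtopology ?C B) euclideanreal (\<lambda>x. \<tau> (x j) - \<tau> (x i))"
      by (intro continuous_map_diff comp i j)
    from openin_continuous_map_preimage[OF this, of "{0<..}"]
    have "openin (subtopology ?C B) {x \<in> topspace (subtopology ?C B). \<tau> (x j) - \<tau> (x i) \<in> {0<..}}"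
      by (simp only: open_openin[symmetric] open_greaterThan)
    hence "openin ?C {x \<in> topspace (subtopology ?C B). \<tau> (x j) - \<tau> (x i) \<in> {0<..}}"
      using B openin_trans_full by blast
    moreover have "{x \<in> topspace (subtopology ?C B). \<tau> (x j) - \<tau> (x i) \<in> {0<..}} = {x \<in> B. \<tau> (x i) < \<tau> (x j)}"
      using openin_subset[OF B] by auto
    ultimately show ?thesis by simp
  qed
  have A1: "openin ?C {x \<in> B. \<forall>i\<in>{2..n}. \<delta> (x 1) < \<delta> (x i)}"
    by (rule openin_finite_ball[OF _ B 1]) simp
  have A2: "openin ?C {x \<in> B. \<forall>i\<in>{2..n}. \<forall>j\<in>{2..n}. i < j \<longrightarrow> \<tau> (x i) < \<tau> (x j)}"
  proof (intro openin_finite_ball B finite_atLeastAtMost)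
    fix i j assume "i \<in> {2..n}" "j \<in> {2..n}"
    thus "openin ?C {x \<in> B. i < j \<longrightarrow> \<tau> (x i) < \<tau> (x j)}" using 2[of i j] B by (cases "i < j") simp_all
  qed
  have "Good = {x \<in> B. \<forall>i\<in>{2..n}. \<delta> (x 1) < \<delta> (x i)} \<inter> {x \<in> B. \<forall>i\<in>{2..n}. \<forall>j\<in>{2..n}. i < j \<longrightarrow> \<tau> (x i) < \<tau> (x j)}"
  proof -
    have "x \<in> B \<longleftrightarrow> x \<in> topspace ?C \<and> x 1 \<in> N \<and> (\<forall>i\<in>{2..n}. x i \<in> E)" for x
    proof -
      have "{1..n} = insert 1 {2..n}" using n1 by auto
      thus ?thesis unfolding B_def by auto
    qed
    thus ?thesis unfolding Good_def by blast
  qed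
  thus ?thesis using openin_Int[OF A1 A2] by simp
qed

text \<open>Particle 1 is recognised as the one of least depth and the others by their order on the
  edge, so no nontrivial permutation stays in \<open>Good\<close>.\<close>

lemma inj_Good: "inj_on (perm_orbit n) Good"
proof (rule inj_onI)
  fix a b assume a: "a \<in> Good" and b: "b \<in> Good" and e: "perm_orbit n a = perm_orbit n b"
  obtain \<sigma> where s: "\<sigma> permutes {1..n}" "b = a \<circ> \<sigma>" using perm_orbit_eqE[OF e] .
  have one: "1 \<in> {1..n}" using n1 by simp
  have si: "\<sigma> i \<in> {1..n}" if "i \<in> {1..n}" for i using permutes_in_image[OF s(1)] that by blast
  have inj\<sigma>: "\<sigma> i \<noteq> \<sigma> j" if "i \<noteq> j" for i j using permutes_inj[OF s(1)] that by (metis injD)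
  have s1: "\<sigma> 1 = 1"
  proof (rule ccontr)
    assume n: "\<sigma> 1 \<noteq> 1"
    hence k: "\<sigma> 1 \<in> {2..n}" using si[OF one] by auto
    obtain j where j: "\<sigma> j = 1" using permutes_surj[OF s(1)] by (metis surjD)
    have "j \<in> {1..n}" using permutes_in_image[OF s(1), of j] j one by simp
    moreover have "j \<noteq> 1" using n j by auto
    ultimately have "j \<in> {2..n}" by auto
    hence "\<delta> (b 1) < \<delta> (b j)" using b unfolding Good_def by blast
    moreover have "\<delta> (a 1) < \<delta> (a (\<sigma> 1))" using a k unfolding Good_def by blast
    ultimately show False using j s(2) by simp
  qed
  have "\<sigma> = id"
  proof (rule permutation_increasing_id[OF s(1)])
    fix i assume i: "i \<in> {1..n}" "Suc i \<in> {1..n}"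
    show "\<sigma> i < \<sigma> (Suc i)"
    proof (cases "i = 1")
      case True
      thus ?thesis using s1 si[OF i(2)] inj\<sigma>[of i "Suc i"] by auto
    next
      case False
      hence i2: "i \<in> {2..n}" "Suc i \<in> {2..n}" using i by auto
      have s2: "\<sigma> i \<in> {2..n}" "\<sigma> (Suc i) \<in> {2..n}"
        using si[OF i(1)] si[OF i(2)] inj\<sigma>[of i 1] inj\<sigma>[of "Suc i" 1] s1 False i by auto
      have "\<tau> (b i) < \<tau> (b (Suc i))" using b i2 unfolding Good_def by blast
      hence lt: "\<tau> (a (\<sigma> i)) < \<tau> (a (\<sigma> (Suc i)))" using s(2) by simp
      show ?thesis
      proof (rule ccontr)
        assume "\<not> \<sigma> i < \<sigma> (Suc i)"
        hence "\<sigma> (Suc i) < \<sigma> i" using inj\<sigma>[of i "Suc i"] by auto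
        hence "\<tau> (a (\<sigma> (Suc i))) < \<tau> (a (\<sigma> i))" using a s2 unfolding Good_def by blast
        thus False using lt by simp
      qed
    qed
  qed
  thus "a = b" using s(2) by simp
qed

lemma Good_cover:
  assumes x: "x \<in> topspace (conf_space n X)" and i0: "i0 \<in> {1..n}" "x i0 \<in> N"
    and o: "\<And>i. i \<in> {1..n} - {i0} ==> x i \<in> E \<and> \<delta> (x i0) < \<delta> (x i)"
  shows "perm_orbit n x \<in> perm_orbit n ` Good"
proof -
  have xi: "inj_on x {1..n}" using x by (simp add: topspace_conf_space)
  have "inj_on (\<lambda>i. \<tau> (x i)) ({1..n} - {i0})"
  proof (rule inj_onI)
    fix i j assume ij: "i \<in> {1..n} - {i0}" "j \<in> {1..n} - {i0}" "\<tau> (x i) = \<tau> (x j)"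
    hence "x i = x j" using tau(2) o by metis
    thus "i = j" using inj_onD[OF xi] ij by blast
  qed
  then obtain \<sigma> where s: "\<sigma> permutes {1..n}" "\<sigma> 1 = i0"
    "\<And>i j. i \<in> {2..n} ==> j \<in> {2..n} ==> i < j ==> \<tau> (x (\<sigma> i)) < \<tau> (x (\<sigma> j))"
    "\<And>i. i \<in> {2..n} ==> \<sigma> i \<in> {1..n} - {i0}"
    using sort_config[OF i0(1)] by metis
  have "x \<circ> \<sigma> \<in> Good"
    unfolding Good_def using conf_compose_mem[OF s(1) x] i0 o s by auto
  hence "perm_orbit n (x \<circ> \<sigma>) \<in> perm_orbit n ` Good" by (rule imageI)
  thus ?thesis unfolding perm_orbit_compose[OF s(1)] .
qed

definition cpos :: "nat => real" where "cpos i = real i / real (n + 1)"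

lemma cpos_I: "i \<in> {1..n} ==> cpos i \<in> I"
  using I(2) by (auto simp: cpos_def)

text \<open>A contraction to one configuration: particle 1 retreats to \<open>v\<close>, the others
  slide to evenly spaced positions on the edge.\<close>

definition H :: "(nat => 'x) => real => nat => 'x" where
  "H x s = (\<lambda>i\<in>{1..n}. if i = 1 then h (x 1) s else \<kappa> (lin (\<tau> (x i)) (cpos i) s))"

lemma H_0: assumes x: "x \<in> Good" shows "H x 0 = x"
proof -
  have "H x 0 i = x i" for i
  proof (cases "i \<in> {1..n}")
    case True
    show ?thesis
    proof (cases "i = 1")
      case False
      hence "i \<in> {2..n}" using True by auto
      hence "x i \<in> E" using x unfolding Good_def by blast
      thus ?thesis using True False tau(2) by (simp add: H_def)
    qed (use True x h_N(3)[of "x 1" 0] in \<open>simp add: H_def Good_def\<close>)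
  next
    case False
    have "x i = undefined" using x False unfolding Good_def topspace_conf_space by (auto simp: PiE_iff extensional_def)
    thus ?thesis using False by (simp only: H_def restrict_apply if_False)
  qed
  thus ?thesis by (rule ext)
qed

lemma H_1: "x \<in> Good ==> H x 1 = (\<lambda>i\<in>{1..n}. if i = 1 then v else \<kappa> (cpos i))"
  using h_N(4)[of "x 1" 0] unfolding H_def Good_def by (intro restrict_ext) auto

text \<open>The depth of particle 1 shrinks by the factor 1 - s, while by concavity each other depth
  is at least (1 - s) times its initial value plus s times a positive number. So particle 1 remains
  strictly shallowest, and the others keep their order.\<close>

lemma H_inj:
  assumes x: "x \<in> Good" and s: "s \<in> {0..1}" shows "inj_on (H x s) {1..n}"
proof -
  have x1: "x 1 \<in> N" using x unfolding Good_def by blast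
  define q where "q i = lin (\<tau> (x i)) (cpos i) s" for i
  have xE: "x i \<in> E" "\<delta> (x 1) < \<delta> (x i)" if "i \<in> {2..n}" for i using x that unfolding Good_def by blast+
  have qI: "q i \<in> I" if i: "i \<in> {2..n}" for i
    unfolding q_def by (rule lin_in_convex[OF I(1) tau(1)[OF xE(1)[OF i]] cpos_I s]) (use i in auto)
  have lt: "\<delta> (h (x 1) s) < \<delta> (\<kappa> (q i))" if i: "i \<in> {2..n}" for i
  proof -
    have c: "cpos i \<in> I" using cpos_I[of i] i by auto
    have dx: "\<delta> (x i) = d (\<tau> (x i))" using dk[OF tau(1)[OF xE(1)[OF i]]] tau(2)[OF xE(1)[OF i]] by simp
    have "(1 - s) * \<delta> (x 1) < (1 - s) * d (\<tau> (x i)) + s * d (cpos i)"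
    proof (cases "s = 1")
      case False
      hence "(1 - s) * \<delta> (x 1) < (1 - s) * d (\<tau> (x i))" "0 \<le> s * d (cpos i)"
        using xE(2)[OF i] dx s dpos[OF c] by auto
      thus ?thesis by linarith
    qed (use dpos[OF c] in simp)
    also have "\<dots> \<le> d (q i)" unfolding q_def by (rule conc[OF tau(1)[OF xE(1)[OF i]] c s])
    also have "\<dots> = \<delta> (\<kappa> (q i))" using dk[OF qI[OF i]] by simp
    finally show ?thesis using h_N(2)[OF x1 s] by simp
  qed
  have mono: "q i < q j" if ij: "i \<in> {2..n}" "j \<in> {2..n}" "i < j" for i j
  proof -
    have t: "\<tau> (x i) < \<tau> (x j)" using x ij unfolding Good_def by blast
    have c: "cpos i < cpos j" using ij by (simp add: cpos_def divide_strict_right_mono)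
    have "(1 - s) * \<tau> (x i) + s * cpos i < (1 - s) * \<tau> (x j) + s * cpos j"
    proof (cases "s = 1")
      case False
      hence "(1 - s) * \<tau> (x i) < (1 - s) * \<tau> (x j)" "s * cpos i \<le> s * cpos j"
        using t c s by (auto intro!: mult_left_mono)
      thus ?thesis by linarith
    qed (use c in simp)
    thus ?thesis by (simp add: q_def lin_def algebra_simps)
  qed
  have H1: "H x s 1 = h (x 1) s" and H2: "\<And>i. i \<in> {2..n} ==> H x s i = \<kappa> (q i)"
    using n1 by (auto simp: H_def q_def)
  have ne: "h (x 1) s \<noteq> \<kappa> (q i)" if "i \<in> {2..n}" for i using lt[OF that] by force
  have ne2: "\<kappa> (q i) \<noteq> \<kappa> (q j)" if ij: "i \<in> {2..n}" "j \<in> {2..n}" "i \<noteq> j" for i j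
  proof
    assume "\<kappa> (q i) = \<kappa> (q j)"
    from inj_onD[OF inj this qI[OF ij(1)] qI[OF ij(2)]] have "q i = q j" .
    thus False using mono[OF ij(1,2)] mono[OF ij(2,1)] ij(3) by (metis less_irrefl linorder_neqE_nat)
  qed
  show ?thesis
  proof (rule inj_onI)
    fix i j assume ij: "i \<in> {1..n}" "j \<in> {1..n}" "H x s i = H x s j"
    consider "i = j" | "i \<noteq> j" "i = 1" "j \<in> {2..n}" | "i \<noteq> j" "j = 1" "i \<in> {2..n}" | "i \<noteq> j" "i \<in> {2..n}" "j \<in> {2..n}"
      using ij(1,2) by force
    thus "i = j"
    proof cases
      case 2
      thus ?thesis using ij(3) H1 H2[of j] ne[of j] by simp
    next
      case 3
      thus ?thesis using ij(3) H1 H2[of i] ne[of i] by simp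
    next
      case 4
      thus ?thesis using ij(3) H2[of i] H2[of j] ne2[of i j] by simp
    qed
  qed
qed

text \<open>The contraction spreads a path out to a square whose far side is constant. The potential
  of a configuration is the value of the functor on its track under the contraction.\<close>

theorem potential:
  assumes F: "path_functor (uconf_space n X) (F :: (real => (nat => 'x) set) => 'k::group_add)"
  shows "\<exists>g. \<forall>p. pathin (subtopology (uconf_space n X) (perm_orbit n ` Good)) p \<longrightarrow> F p = g (p 0) - g (p 1)"
proof -
  let ?Y = "uconf_space n X" and ?C = "conf_space n X" and ?U = "perm_orbit n ` Good"
  obtain r where r: "continuous_map (subtopology ?Y ?U) ?C r" "\<forall>x\<in>Good. r (perm_orbit n x) = x"
    using perm_orbit_section[OF open_Good inj_Good] by (elim exE conjE)
  define g where "g y = F (\<lambda>s. perm_orbit n (H (r y) s))" for y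
  have "F p = g (p 0) - g (p 1)" if p: "pathin (subtopology ?Y ?U) p" for p
  proof -
    have pU: "p t \<in> ?U" and rp: "r (p t) \<in> Good" "perm_orbit n (r (p t)) = p t" if "t \<in> {0..1}" for t
    proof -
      show "p t \<in> ?U" using pathin_topspace[OF p that] by simp
      then obtain x where "x \<in> Good" "p t = perm_orbit n x" by blast
      thus "r (p t) \<in> Good" "perm_orbit n (r (p t)) = p t" using r(2) by auto
    qed
    let ?Q = "top_of_set ({0..1::real} \<times> {0..1::real})"
    have rc: "continuous_map (top_of_set {0..1}) ?C (\<lambda>t. r (p t))"
      using continuous_map_compose[OF p[unfolded pathin_def] r(1)] by (simp add: o_def)
    have comp: "continuous_map (top_of_set {0..1}) X (\<lambda>t. r (p t) i)" if "i \<in> {1..n}" for i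
      using continuous_map_compose[OF rc continuous_map_conf_component[OF that]] by (simp add: o_def)
    have fst: "continuous_map ?Q (top_of_set {0..1}) fst" and snd: "continuous_map ?Q (top_of_set {0..1}) snd"
      by (auto intro!: continuous_intros)
    have "continuous_map ?Q ?C (\<lambda>z. H (r (p (fst z))) (snd z))"
      unfolding continuous_map_conf_space
    proof (intro conjI ballI)
      fix z assume "z \<in> topspace ?Q"
      thus "inj_on (H (r (p (fst z))) (snd z)) {1..n}" using H_inj[OF rp(1)] by auto
      show "H (r (p (fst z))) (snd z) \<in> extensional {1..n}" by (simp add: H_def)
    next
      fix i assume i: "i \<in> {1..n}"
      show "continuous_map ?Q X (\<lambda>z. H (r (p (fst z))) (snd z) i)"
      proof (cases "i = 1")
        case True
        have "continuous_map ?Q (subtopology X (\<Union>j\<in>D. \<omega> j ` {0..\<rho>})) (\<lambda>z. r (p (fst z)) 1)"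
          unfolding continuous_map_in_subtopology
        proof
          show "continuous_map ?Q X (\<lambda>z. r (p (fst z)) 1)"
            using continuous_map_compose[OF fst comp[of 1]] n1 by (simp add: o_def)
          show "(\<lambda>z. r (p (fst z)) 1) \<in> topspace ?Q \<rightarrow> (\<Union>j\<in>D. \<omega> j ` {0..\<rho>})"
            using rp(1) N(2) unfolding Good_def by fastforce
        qed
        hence "continuous_map ?Q (prod_topology (subtopology X (\<Union>j\<in>D. \<omega> j ` {0..\<rho>})) (top_of_set {0..1})) (\<lambda>z. (r (p (fst z)) 1, snd z))"
          using snd by (simp add: continuous_map_pairwise o_def)
        from continuous_map_compose[OF this cont_h] show ?thesis
          using True i by (simp add: H_def o_def)
      next
        case False
        hence i2: "i \<in> {2..n}" using i by auto
        have "continuous_map ?Q (subtopology X E) (\<lambda>z. r (p (fst z)) i)"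
          unfolding continuous_map_in_subtopology
        proof
          show "continuous_map ?Q X (\<lambda>z. r (p (fst z)) i)"
            using continuous_map_compose[OF fst comp[OF i]] by (simp add: o_def)
          show "(\<lambda>z. r (p (fst z)) i) \<in> topspace ?Q \<rightarrow> E"
            using rp(1) i2 unfolding Good_def by fastforce
        qed
        from continuous_map_compose[OF this cont_tau]
        have tc: "continuous_map ?Q (top_of_set I) (\<lambda>z. \<tau> (r (p (fst z)) i))" by (simp add: o_def)
        have "continuous_map ?Q (top_of_set I) (\<lambda>z. lin (\<tau> (r (p (fst z)) i)) (cpos i) (snd z))"
          unfolding continuous_map_in_subtopology
        proof
          have "continuous_on ({0..1::real} \<times> {0..1::real}) (\<lambda>z. \<tau> (r (p (fst z)) i))"
            using tc by (simp add: continuous_map_in_subtopology)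
          hence "continuous_on ({0..1::real} \<times> {0..1::real}) (\<lambda>z. lin (\<tau> (r (p (fst z)) i)) (cpos i) (snd z))"
            unfolding lin_def by (intro continuous_intros)
          thus "continuous_map ?Q euclideanreal (\<lambda>z. lin (\<tau> (r (p (fst z)) i)) (cpos i) (snd z))" by simp
          show "(\<lambda>z. lin (\<tau> (r (p (fst z)) i)) (cpos i) (snd z)) \<in> topspace ?Q \<rightarrow> I"
          proof
            fix z assume z: "z \<in> topspace ?Q"
            hence "\<tau> (r (p (fst z)) i) \<in> I" using tc by (auto simp: continuous_map_def)
            thus "lin (\<tau> (r (p (fst z)) i)) (cpos i) (snd z) \<in> I"
              by (rule lin_in_convex[OF I(1) _ cpos_I[OF i]]) (use z in auto)
          qed
        qed
        from continuous_map_compose[OF this cont] show ?thesis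
          using False i by (simp add: H_def o_def)
      qed
    qed
    from continuous_map_compose[OF this continuous_map_perm_orbit]
    have hc: "continuous_map ?Q ?Y (\<lambda>z. perm_orbit n (H (r (p (fst z))) (snd z)))" by (simp add: o_def)
    define h' where "h' = (\<lambda>z. perm_orbit n (H (r (p (fst z))) (snd z)))"
    define y1 where "y1 = perm_orbit n (\<lambda>i\<in>{1..n}. if i = 1 then v else \<kappa> (cpos i))"
    have sides: "pathin ?Y (\<lambda>t. h' (t, 0))" "pathin ?Y (\<lambda>t. h' (1, t))" "pathin ?Y (\<lambda>t. h' (0, t))" "pathin ?Y (\<lambda>t. h' (t, 1))"
      unfolding h'_def by (rule pathin_compose_convex[OF hc]; auto intro!: continuous_intros)+
    have b: "h' (t, 0) = p t" "h' (t, 1) = y1" if "t \<in> {0..1}" for t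
      using H_0[OF rp(1)[OF that]] H_1[OF rp(1)[OF that]] rp(2)[OF that] by (simp_all add: h'_def y1_def)
    have "F (\<lambda>t. h' (t, 0)) + F (\<lambda>t. h' (1, t)) = F (\<lambda>t. h' (0, t)) + F (\<lambda>t. h' (t, 1))"
      using path_functor_hom[OF F path_hom_square[OF hc]]
        path_functor_concat[OF F sides(1,2)] path_functor_concat[OF F sides(3,4)] unfolding h'_def by simp
    moreover have "F (\<lambda>t. h' (t, 0)) = F p" by (rule path_functor_cong[OF F sides(1)]) (rule b(1))
    moreover have "F (\<lambda>t. h' (t, 1)) = F (\<lambda>_. y1)" by (rule path_functor_cong[OF F sides(4)]) (rule b(2))
    moreover have "F (\<lambda>_. y1) = 0"
      by (rule path_functor_const[OF F]) (use pathin_topspace[OF sides(4), of 0] b(2)[of 0] in simp)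
    moreover have "F (\<lambda>t. h' (1, t)) = g (p 1)" "F (\<lambda>t. h' (0, t)) = g (p 0)" by (simp_all add: h'_def g_def)
    ultimately have "F p + g (p 1) = g (p 0)" by simp
    thus ?thesis by (simp add: eq_diff_eq)
  qed
  thus ?thesis by (intro exI[of _ g] allI impI)
qed

theorem not_raag:
  fixes P :: "('c, 'd) pre_digraph"
  assumes P: "graph P" "card (verts P) \<ge> 2"
    and Y: "path_connected_space (uconf_space n X)" "s \<in> topspace (uconf_space n X)"
    and cov: "topspace (uconf_space n X) \<subseteq> perm_orbit n ` Good"
  shows "\<not> fundamental_group (uconf_space n X) s \<cong> raag P"
proof (rule contractible_not_raag[OF P Y])
  fix F :: "(real => (nat => 'x) set) => 'c => int"
  assume "path_functor (uconf_space n X) F"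
  moreover have "subtopology (uconf_space n X) (perm_orbit n ` Good) = uconf_space n X"
    using cov by (rule subtopology_superset)
  ultimately show "\<exists>g. \<forall>p. pathin (uconf_space n X) p \<longrightarrow> F p = g (p 0) - g (p 1)"
    using potential[of F] by simp
qed

end

text \<open>The set \<open>B\<close> marks one side: inside \<open>N\<close> without
  \<open>v\<close> it is open and so is its complement, hence a particle cannot change sides without
  passing through \<open>v\<close>.\<close>

locale wall = collar X n I \<kappa> d \<delta> D \<omega> \<rho> N v
  for X :: "'x topology" and n I \<kappa> d \<delta> and D :: "'j set" and \<omega> \<rho> N v +
  fixes B :: "'x set"
  assumes clos: "closedin X (insert v E)" and vE: "v \<notin> E" and vN: "v \<in> N"
    and B: "openin X B" "openin X (N - {v} - B)" "v \<notin> B"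
begin

text \<open>The complement of the wall, the wall being one particle at \<open>v\<close> and all
  others in the edge. Both alternatives are open because \<open>v\<close> and the closed edge are
  closed.\<close>

definition off :: "(nat => 'x) set" where
  "off = {x \<in> topspace (conf_space n X). (\<forall>i\<in>{1..n}. x i \<noteq> v) \<or> (\<exists>i\<in>{1..n}. x i \<notin> insert v E)}"

lemma vX: "v \<in> topspace X"
  using openin_subset[OF N(1)] vN by blast

lemma open_off: "openin (conf_space n X) off"
proof -
  let ?C = "conf_space n X"
  have "closedin X {v}" using Haus vX by (simp add: closedin_Hausdorff_singleton)
  hence 1: "openin X (topspace X - {v})" by (rule openin_diff[OF openin_topspace])
  have 2: "openin X (topspace X - insert v E)" using clos by (rule openin_diff[OF openin_topspace])
  have xX: "x i \<in> topspace X" if "x \<in> topspace ?C" "i \<in> {1..n}" for x i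
    using that unfolding topspace_conf_space by (auto simp: PiE_iff)
  have "openin ?C {x \<in> topspace ?C. \<forall>i\<in>{1..n}. x i \<in> topspace X - {v}}"
    by (rule open_box) (rule 1)
  moreover have "openin ?C {x \<in> topspace ?C. x i \<in> topspace X - insert v E}" if "i \<in> {1..n}" for i
    by (rule openin_continuous_map_preimage[OF continuous_map_conf_component[OF that] 2])
  hence "openin ?C (\<Union>i\<in>{1..n}. {x \<in> topspace ?C. x i \<in> topspace X - insert v E})" by blast
  ultimately have "openin ?C ({x \<in> topspace ?C. \<forall>i\<in>{1..n}. x i \<in> topspace X - {v}} \<union>
      (\<Union>i\<in>{1..n}. {x \<in> topspace ?C. x i \<in> topspace X - insert v E}))" by (rule openin_Un)
  moreover have "{x \<in> topspace ?C. \<forall>i\<in>{1..n}. x i \<in> topspace X - {v}} \<union>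
      (\<Union>i\<in>{1..n}. {x \<in> topspace ?C. x i \<in> topspace X - insert v E}) = off"
    unfolding off_def using xX by blast
  ultimately show ?thesis by simp
qed

lemma off_perm:
  assumes s: "\<sigma> permutes {1..n}" and x: "x \<in> off" shows "x \<circ> \<sigma> \<in> off"
proof -
  have xC: "x \<circ> \<sigma> \<in> topspace (conf_space n X)" using conf_compose_mem[OF s] x unfolding off_def by blast
  have si: "\<sigma> i \<in> {1..n}" if "i \<in> {1..n}" for i using permutes_in_image[OF s] that by blast
  from x consider "\<forall>i\<in>{1..n}. x i \<noteq> v" | i where "i \<in> {1..n}" "x i \<notin> insert v E" unfolding off_def by blast
  thus ?thesis
  proof cases
    case 1
    thus ?thesis using xC si unfolding off_def by auto
  next
    case 2
    obtain j where j: "j \<in> {1..n}" "\<sigma> j = i" using permutes_image[OF s] 2(1) by (metis imageE)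
    hence "(x \<circ> \<sigma>) j \<notin> insert v E" using 2(2) by simp
    thus ?thesis using xC j(1) unfolding off_def by blast
  qed
qed

text \<open>The side function \<open>f\<close> is read off from particle 1 of the representative in
  \<open>Good\<close>. A configuration outside \<open>off\<close> has a particle at \<open>v\<close>
  of depth 0 and all others at positive depth, so it lies in the good part.\<close>

theorem wall_obstruction:
  fixes P :: "('c, 'd) pre_digraph"
  assumes P: "graph P" "Digraph_Component.connected P" "card (verts P) \<ge> 2"
    and Y: "path_connected_space (uconf_space n X)" "s \<in> topspace (uconf_space n X)"
    and a: "pathin (conf_space n X) a" "\<And>t. t \<in> {0..1} ==> a t \<in> Good" "a 0 1 \<notin> B" "a 1 1 \<in> B"
    and b: "pathin (conf_space n X) b" "\<And>t. t \<in> {0..1} ==> b t \<in> off"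
    and ab: "perm_orbit n (a 1) = perm_orbit n (b 0)" "perm_orbit n (b 1) = perm_orbit n (a 0)"
  shows "\<not> fundamental_group (uconf_space n X) s \<cong> raag P"
proof -
  let ?Y = "uconf_space n X" and ?C = "conf_space n X"
  let ?U = "perm_orbit n ` Good" and ?W = "perm_orbit n ` off"
  obtain r where r: "continuous_map (subtopology ?Y ?U) ?C r" "\<forall>x\<in>Good. r (perm_orbit n x) = x"
    using perm_orbit_section[OF open_Good inj_Good] by (elim exE conjE)
  define f :: "(nat => 'x) set => int" where "f y = (if r y 1 \<in> B then 1 else 0)" for y
  have lift: "pathin (subtopology ?Y (perm_orbit n ` S)) (perm_orbit n \<circ> g)"
    if "pathin ?C g" "\<And>t. t \<in> {0..1} ==> g t \<in> S" for g S
    using continuous_map_compose[OF that(1)[unfolded pathin_def] continuous_map_perm_orbit] that(2)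
    unfolding pathin_def continuous_map_in_subtopology by auto
  show ?thesis
  proof (rule wall_not_raag[OF P Y open_perm_orbit[OF open_Good] open_perm_orbit[OF open_off], where f = f
        and a = "perm_orbit n \<circ> a" and b = "perm_orbit n \<circ> b"])
    show "topspace ?Y \<subseteq> ?U \<union> ?W"
    proof
      fix y assume "y \<in> topspace ?Y"
      then obtain x where x: "x \<in> topspace ?C" "y = perm_orbit n x" by (auto simp: topspace_uconf_space)
      show "y \<in> ?U \<union> ?W"
      proof (cases "x \<in> off")
        case False
        then obtain i0 where i0: "i0 \<in> {1..n}" "x i0 = v" "\<And>i. i \<in> {1..n} ==> x i \<in> insert v E"
          using x(1) unfolding off_def by blast
        have d0: "\<delta> v = 0"
        proof -
          obtain j t where j: "j \<in> D" "t \<in> {0..\<rho>}" "v = \<omega> j t" using N(2) vN by blast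
          thus ?thesis using star[OF j(1,2), of 1] vN \<omega>(2)[OF j(1)] by simp
        qed
        have "perm_orbit n x \<in> ?U"
        proof (rule Good_cover[OF x(1) i0(1)])
          show "x i0 \<in> N" using i0(2) vN by simp
          fix i assume i: "i \<in> {1..n} - {i0}"
          have "inj_on x {1..n}" using x(1) by (simp add: topspace_conf_space)
          hence "x i \<noteq> v" using i i0(1,2) inj_onD by fastforce
          hence "x i \<in> E" using i0(3) i by blast
          thus "x i \<in> E \<and> \<delta> (x i0) < \<delta> (x i)" using i0(2) d0 dk dpos by auto
        qed
        thus ?thesis using x(2) by blast
      qed (use x(2) in blast)
    qed
    show "\<exists>g. \<forall>p. pathin (subtopology ?Y ?U) p \<longrightarrow> F p = g (p 0) - g (p 1)"
      if "path_functor ?Y F" for F :: "(real => (nat => 'x) set) => 'c => int"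
      by (rule potential[OF that])
    show "pathin (subtopology ?Y ?U) (perm_orbit n \<circ> a)" by (rule lift[OF a(1,2)])
    show "pathin (subtopology ?Y ?W) (perm_orbit n \<circ> b)" by (rule lift[OF b])
    show "(perm_orbit n \<circ> a) 1 = (perm_orbit n \<circ> b) 0" "(perm_orbit n \<circ> b) 1 = (perm_orbit n \<circ> a) 0"
      using ab by simp_all
    have "r (perm_orbit n (a 0)) = a 0" "r (perm_orbit n (a 1)) = a 1" using r(2) a(2)[of 0] a(2)[of 1] by auto
    thus "f ((perm_orbit n \<circ> a) 0) \<noteq> f ((perm_orbit n \<circ> a) 1)" using a(3,4) by (simp add: f_def)
    fix p assume p: "pathin (subtopology ?Y (?U \<inter> ?W)) p"
    have pW: "p t \<in> ?U \<inter> ?W" if "t \<in> {0..1}" for t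
      using pathin_topspace[OF p that] by simp
    have pc: "continuous_map (top_of_set {0..1}) (subtopology ?Y ?U) p"
      using p pW unfolding pathin_def continuous_map_in_subtopology by auto
    have one: "1 \<in> {1..n}" using n1 by simp
    have rc: "continuous_map (top_of_set {0..1}) X (\<lambda>t. r (p t) 1)"
      using continuous_map_compose[OF continuous_map_compose[OF pc r(1)] continuous_map_conf_component[OF one]] by (simp add: o_def)
    \<comment> \<open>In the good part only particle 1 may be at \<open>v\<close>, and the others
      lie in the edge. So being off the wall says that particle 1 is not at \<open>v\<close>; by
      connectedness of the interval it then stays on one side.\<close>
    have rv: "r (p t) 1 \<in> N - {v}" if t: "t \<in> {0..1}" for t
    proof -
      obtain x where x: "x \<in> Good" "p t = perm_orbit n x" using pW[OF t] by blast
      obtain x' where x': "x' \<in> off" "p t = perm_orbit n x'" using pW[OF t] by blast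
      obtain \<sigma> where "\<sigma> permutes {1..n}" "x = x' \<circ> \<sigma>" using x(2) x'(2) perm_orbit_eqE by metis
      hence xo: "x \<in> off" using off_perm x'(1) by blast
      have x1: "x 1 \<in> N" and xE: "\<And>i. i \<in> {2..n} ==> x i \<in> E" using x(1) unfolding Good_def by blast+
      have "x 1 \<noteq> v"
      proof
        assume xv: "x 1 = v"
        have "x i \<in> insert v E" if "i \<in> {1..n}" for i using xE[of i] xv that by (cases "i = 1") auto
        thus False using xo xv one unfolding off_def by blast
      qed
      thus ?thesis using x x1 r(2) by auto
    qed
    let ?I = "top_of_set {0..1::real}"
    have o1: "openin ?I {t \<in> topspace ?I. r (p t) 1 \<in> B}" by (rule openin_continuous_map_preimage[OF rc B(1)])
    have o2: "openin ?I {t \<in> topspace ?I. r (p t) 1 \<in> N - {v} - B}" by (rule openin_continuous_map_preimage[OF rc B(2)])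
    have "connected_space ?I" by (simp add: connected_space_subtopology)
    moreover have "topspace ?I \<subseteq> {t \<in> topspace ?I. r (p t) 1 \<in> B} \<union> {t \<in> topspace ?I. r (p t) 1 \<in> N - {v} - B}"
    proof
      fix t assume t: "t \<in> topspace ?I"
      hence "r (p t) 1 \<in> N - {v}" by (intro rv) simp
      thus "t \<in> {t \<in> topspace ?I. r (p t) 1 \<in> B} \<union> {t \<in> topspace ?I. r (p t) 1 \<in> N - {v} - B}" using t by blast
    qed
    moreover have "{t \<in> topspace ?I. r (p t) 1 \<in> B} \<inter> {t \<in> topspace ?I. r (p t) 1 \<in> N - {v} - B} = {}" by blast
    ultimately have "{t \<in> topspace ?I. r (p t) 1 \<in> B} = {} \<or> {t \<in> topspace ?I. r (p t) 1 \<in> N - {v} - B} = {}"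
      using o1 o2 unfolding connected_space_def by meson
    thus "f (p 0) = f (p 1)"
    proof
      assume "{t \<in> topspace ?I. r (p t) 1 \<in> B} = {}"
      hence "r (p t) 1 \<notin> B" if "t \<in> {0..1}" for t using that by auto
      from this[of 0] this[of 1] show ?thesis by (simp add: f_def)
    next
      assume "{t \<in> topspace ?I. r (p t) 1 \<in> N - {v} - B} = {}"
      hence "r (p t) 1 \<in> B" if "t \<in> {0..1}" for t using that rv[OF that] by auto
      from this[of 0] this[of 1] show ?thesis by (simp add: f_def)
    qed
  qed
qed

end

section \<open>Graphs as unions of arcs\<close>

context collar
begin

definition sp :: "'x => nat => 'x" where
  "sp z = (\<lambda>i\<in>{1..n}. if i = 1 then z else \<kappa> (cpos i))"

lemma special_path:
  assumes \<alpha>: "pathin X \<alpha>" "\<And>t i. t \<in> {0..1} ==> i \<in> {2..n} ==> \<delta> (\<alpha> t) < d (cpos i)"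
    and \<alpha>N: "\<And>t. t \<in> {0..1} ==> \<alpha> t \<in> N"
  shows "pathin (conf_space n X) (\<lambda>t. sp (\<alpha> t))" "\<And>t. t \<in> {0..1} ==> sp (\<alpha> t) \<in> Good"
proof -
  have cI: "cpos i \<in> I" if "i \<in> {2..n}" for i using cpos_I[of i] that by simp
  have kX: "\<kappa> (cpos i) \<in> topspace X" if "i \<in> {2..n}" for i using cont cI[OF that] by (auto simp: continuous_map_def)
  have dk': "\<delta> (\<kappa> (cpos i)) = d (cpos i)" if "i \<in> {2..n}" for i by (rule dk[OF cI[OF that]])
  have lt: "cpos i < cpos j" if "i < j" for i j using that by (simp add: cpos_def divide_strict_right_mono)
  have p: "pathin (conf_space n X) (\<lambda>t. \<lambda>i\<in>{1..n}. if i = 1 then \<alpha> t else \<kappa> (cpos i))"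
  proof (rule pathin_conf)
    fix i assume i: "i \<in> {1..n}"
    show "pathin X (\<lambda>t. if i = 1 then \<alpha> t else \<kappa> (cpos i))"
      using \<alpha>(1) kX[of i] i by (cases "i = 1") auto
  next
    fix t :: real assume t: "t \<in> {0..1}"
    have ne: "\<alpha> t \<noteq> \<kappa> (cpos i)" if "i \<in> {2..n}" for i using \<alpha>(2)[OF t that] dk'[OF that] by force
    have ne2: "\<kappa> (cpos i) \<noteq> \<kappa> (cpos j)" if "i \<in> {2..n}" "j \<in> {2..n}" "i \<noteq> j" for i j
      using inj_onD[OF inj _ cI[OF that(1)] cI[OF that(2)]] lt[of i j] lt[of j i] that(3) by (metis less_irrefl linorder_neqE_nat)
    show "inj_on (\<lambda>i. if i = 1 then \<alpha> t else \<kappa> (cpos i)) {1..n}"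
    proof (rule inj_onI)
      fix i j assume ij: "i \<in> {1..n}" "j \<in> {1..n}" "(if i = 1 then \<alpha> t else \<kappa> (cpos i)) = (if j = 1 then \<alpha> t else \<kappa> (cpos j))"
      have "k = 1 \<or> k \<in> {2..n}" if "k \<in> {1..n}" for k using that by auto
      from this[OF ij(1)] this[OF ij(2)] ij(3) show "i = j"
        using ne[of i] ne[of j] ne2[of i j] by (cases "i = 1"; cases "j = 1") auto
    qed
  qed
  thus pa: "pathin (conf_space n X) (\<lambda>t. sp (\<alpha> t))" by (simp only: sp_def)
  fix t :: real assume t: "t \<in> {0..1}"
  have s1: "sp (\<alpha> t) 1 = \<alpha> t" and s2: "\<And>i. i \<in> {2..n} ==> sp (\<alpha> t) i = \<kappa> (cpos i)" using n1 by (auto simp: sp_def)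
  show "sp (\<alpha> t) \<in> Good"
    unfolding Good_def
  proof (intro CollectI conjI ballI impI)
    show "sp (\<alpha> t) \<in> topspace (conf_space n X)" by (rule pathin_topspace[OF pa t])
    show "sp (\<alpha> t) 1 \<in> N" using \<alpha>N[OF t] s1 by simp
    fix i assume i: "i \<in> {2..n}"
    show "sp (\<alpha> t) i \<in> E" using s2[OF i] cI[OF i] by simp
    show "\<delta> (sp (\<alpha> t) 1) < \<delta> (sp (\<alpha> t) i)" using s1 s2[OF i] dk'[OF i] \<alpha>(2)[OF t i] by simp
    fix j assume j: "j \<in> {2..n}" "i < j"
    show "\<tau> (sp (\<alpha> t) i) < \<tau> (sp (\<alpha> t) j)"
      using s2[OF i] s2[OF j(1)] tau_kappa[OF cI[OF i]] tau_kappa[OF cI[OF j(1)]] lt[OF j(2)] by simp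
  qed
qed

end

text \<open>A finite graph as a space together with a decomposition into parametrised edges. The
  space and the decomposition are kept apart so that edges can be reversed or merged while the
  configuration space stays the same.\<close>

locale tgraph =
  fixes X :: "'x topology" and Ed :: "'e set" and c :: "'e => real => 'x"
  assumes Haus: "Hausdorff_space X" and fin: "finite Ed" and ne: "Ed \<noteq> {}"
    and pth: "\<And>e. e \<in> Ed ==> pathin X (c e)"
    and cov: "topspace X = (\<Union>e\<in>Ed. c e ` {0..1})"
    and inner: "\<And>e e' s t. e \<in> Ed ==> e' \<in> Ed ==> 0 < t ==> t < 1 ==> s \<in> {0..1} ==> c e t = c e' s ==> e = e' \<and> s = t"
    and pc: "path_connected_space X"
begin

text \<open>A dart is an edge with a direction, \<open>True\<close> being that of the
  parametrisation; \<open>dp\<close> is the edge traversed in this direction.\<close>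

definition dp :: "'e \<times> bool => real => 'x" where
  "dp d t = c (fst d) (if snd d then t else 1 - t)"

abbreviation "Dt \<equiv> Ed \<times> (UNIV :: bool set)"

lemma pathin_dp: "d \<in> Dt ==> pathin X (dp d)"
  using pth[of "fst d"] pathin_rev_path[OF pth[of "fst d"]] unfolding dp_def rev_path_def
  by (cases "snd d") (auto simp: rev_path_def[abs_def])

lemma dp_inner:
  assumes "d \<in> Dt" "d' \<in> Dt" "0 < s" "s < 1" "t \<in> {0..1}" "dp d s = dp d' t"
  shows "fst d = fst d' \<and> (if snd d = snd d' then t = s else t = 1 - s)"
proof -
  have "c (fst d) (if snd d then s else 1 - s) = c (fst d') (if snd d' then t else 1 - t)"
    using assms(6) by (simp add: dp_def)
  moreover have "0 < (if snd d then s else 1 - s)" "(if snd d then s else 1 - s) < 1"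
    "(if snd d' then t else 1 - t) \<in> {0..1}" using assms by auto
  ultimately have "fst d = fst d' \<and> (if snd d' then t else 1 - t) = (if snd d then s else 1 - s)"
    using inner[of "fst d" "fst d'" "if snd d then s else 1 - s" "if snd d' then t else 1 - t"] assms(1,2) by auto
  thus ?thesis by (auto split: if_splits)
qed

lemma dp_star_inj:
  assumes d: "d \<in> Dt" "d' \<in> Dt" and st: "s \<in> {0..1/3}" "t \<in> {0..1/3}" "dp d s = dp d' t"
  shows "d = d' \<and> s = t \<or> s = 0 \<and> t = 0"
proof -
  have *: "d = d' \<and> s = t" if "d \<in> Dt" "d' \<in> Dt" "s \<in> {0..1/3}" "t \<in> {0..1/3}" "dp d s = dp d' t" "0 < s" for d d' s t
    using dp_inner[of d d' s t] that by (auto split: if_splits intro: prod_eqI)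
  show ?thesis
  proof (cases "0 < s")
    case False
    thus ?thesis using *[OF d(2,1) st(2,1) st(3)[symmetric]] st by force
  qed (use *[OF d st] in blast)
qed

text \<open>The complement is a finite union of images of compact sets, hence closed. The topology
  is thereby seen to be the weak one with respect to the edges.\<close>

lemma open_criterion:
  assumes U: "U \<subseteq> topspace X" and o: "\<And>e. e \<in> Ed ==> openin (top_of_set {0..1}) {t \<in> {0..1}. c e t \<in> U}"
  shows "openin X U"
proof -
  have cl: "closedin X (c e ` {t \<in> {0..1}. c e t \<notin> U})" if e: "e \<in> Ed" for e
  proof -
    have "closedin (top_of_set {0..1}) ({0..1} - {t \<in> {0..1}. c e t \<in> U})"
      using closedin_diff[OF closedin_topspace o[OF e]] by simp
    moreover have "{0..1} - {t \<in> {0..1}. c e t \<in> U} = {t \<in> {0..1}. c e t \<notin> U}" by blast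
    ultimately have "compactin (top_of_set {0..1}) {t \<in> {0..1}. c e t \<notin> U}"
      using closedin_compact_space[of "top_of_set {0..1::real}"] by (simp add: compact_space_subtopology)
    from image_compactin[OF this pth[OF e, unfolded pathin_def]] show ?thesis
      by (rule compactin_imp_closedin[OF Haus])
  qed
  have "closedin X (\<Union>e\<in>Ed. c e ` {t \<in> {0..1}. c e t \<notin> U})"
    by (rule closedin_Union) (use fin cl in auto)
  moreover have "(\<Union>e\<in>Ed. c e ` {t \<in> {0..1}. c e t \<notin> U}) = topspace X - U" unfolding cov by blast
  ultimately show ?thesis using U by (simp add: openin_closedin)
qed

lemma continuous_criterion:
  assumes "\<And>e. e \<in> Ed ==> continuous_map (top_of_set {0..1}) W (\<lambda>t. f (c e t))"
  shows "continuous_map X W f"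
  by (rule continuous_map_glue_compact[OF fin Haus, where K = "\<lambda>_. top_of_set {0..1}" and g = c])
     (use pth cov assms in \<open>auto simp: pathin_def o_def compact_space_subtopology\<close>)

lemma open_inner:
  assumes d: "d \<in> Dt" and U: "open U" "U \<subseteq> {0<..<1}"
  shows "openin X (dp d ` U)"
proof (rule open_criterion)
  show "dp d ` U \<subseteq> topspace X" using pathin_topspace[OF pathin_dp[OF d]] U(2) by fastforce
  fix e assume e: "e \<in> Ed"
  define U' where "U' = (if snd d then U else (\<lambda>t. 1 - t) ` U)"
  have "open ((\<lambda>t. 1 - t) ` U)"
  proof -
    have "(\<lambda>t. 1 - t) ` U = (\<lambda>t. 1 - t) -` U" by (force simp: image_iff)
    moreover have "open ((\<lambda>t. 1 - t) -` U)" by (intro open_vimage U(1) continuous_intros)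
    ultimately show ?thesis by simp
  qed
  hence oU: "open U'" using U(1) by (simp add: U'_def)
  have "{t \<in> {0..1}. c e t \<in> dp d ` U} = (if e = fst d then U' else {})"
  proof (intro equalityI subsetI)
    fix t assume "t \<in> {t \<in> {0..1}. c e t \<in> dp d ` U}"
    then obtain u where t: "t \<in> {0..1}" and u: "u \<in> U" "c e t = dp d u" by blast
    have u01: "0 < u" "u < 1" using u(1) U(2) by auto
    have "dp d u = dp (e, True) t" using u(2) by (simp add: dp_def)
    from dp_inner[OF d _ u01 t this] e have "fst d = e" "if snd d then t = u else t = 1 - u" by auto
    thus "t \<in> (if e = fst d then U' else {})" using u(1) by (auto simp: U'_def)
  next
    fix t assume "t \<in> (if e = fst d then U' else {})"
    hence ed: "e = fst d" and t: "t \<in> U'" by (auto split: if_splits)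
    obtain u where u: "u \<in> U" "t = (if snd d then u else 1 - u)" using t by (auto simp: U'_def split: if_splits)
    have "c e t = dp d u" using ed u(2) by (simp add: dp_def)
    moreover have "t \<in> {0..1}" using u U(2) by fastforce
    ultimately show "t \<in> {t \<in> {0..1}. c e t \<in> dp d ` U}" using u(1) by blast
  qed
  moreover have "openin (top_of_set {0..1}) U'"
    using oU U(2) by (auto simp: openin_open U'_def intro!: exI[of _ U'])
  ultimately show "openin (top_of_set {0..1}) {t \<in> {0..1}. c e t \<in> dp d ` U}" by simp
qed

text \<open>A loop contributes both of its darts, so the cardinality is the degree of
  \<open>v\<close>.\<close>

definition Dv :: "'x => ('e \<times> bool) set" where "Dv v = {d \<in> Dt. dp d 0 = v}"

text \<open>The open star. The radius 1/3 is less than one half, so that the stars of the two ends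
  of an edge, or of a loop, do not meet inside it.\<close>

definition St :: "'x => 'x set" where "St v = (\<Union>d\<in>Dv v. dp d ` {0..<1/3})"

lemma finite_Dv: "finite (Dv v)"
  unfolding Dv_def using fin by auto

lemma open_St: "openin X (St v)"
proof (rule open_criterion)
  show "St v \<subseteq> topspace X"
    unfolding St_def Dv_def using pathin_topspace[OF pathin_dp] by fastforce
  fix e assume e: "e \<in> Ed"
  have "{t \<in> {0..1}. c e t \<in> St v} = (if c e 0 = v then {0..<1/3} else {}) \<union> (if c e 1 = v then {2/3<..1} else {})"
  proof (intro equalityI subsetI)
    fix t assume "t \<in> {t \<in> {0..1}. c e t \<in> St v}"
    then obtain d s where t: "t \<in> {0..1}" and d: "d \<in> Dt" "dp d 0 = v" "s \<in> {0..<1/3}" "c e t = dp d s"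
      unfolding St_def Dv_def by blast
    have ct: "dp d s = dp (e, True) t" using d(4) by (simp add: dp_def)
    show "t \<in> (if c e 0 = v then {0..<1/3} else {}) \<union> (if c e 1 = v then {2/3<..1} else {})"
    proof (cases "0 < s")
      case True
      from dp_inner[OF d(1) _ True _ t ct] d(3) e
      have ed: "fst d = e" "if snd d then t = s else t = 1 - s" by auto
      thus ?thesis using d(2,3) by (auto simp: dp_def split: if_splits)
    next
      case False
      hence s: "s = 0" using d(3) by simp
      hence cv: "c e t = v" using d(2,4) by simp
      have "t = 0 \<or> t = 1"
      proof (rule ccontr)
        assume "\<not> (t = 0 \<or> t = 1)"
        hence t': "0 < t" "t < 1" using t by auto
        from dp_inner[OF _ d(1) t' _ ct[symmetric]] e s show False using t' by (auto split: if_splits)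
      qed
      thus ?thesis using cv by auto
    qed
  next
    fix t :: real assume t: "t \<in> (if c e 0 = v then {0..<1/3} else {}) \<union> (if c e 1 = v then {2/3<..1} else {})"
    show "t \<in> {t \<in> {0..1}. c e t \<in> St v}"
    proof (cases "c e 0 = v \<and> t \<in> {0..<1/3}")
      case True
      hence "(e, True) \<in> Dv v" "c e t = dp (e, True) t" using e by (auto simp: Dv_def dp_def)
      hence "c e t \<in> St v" using True unfolding St_def by blast
      moreover have "t \<in> {0..1}" using True by auto
      ultimately show ?thesis by blast
    next
      case False
      hence f: "c e 1 = v" "t \<in> {2/3<..1}" using t by (auto split: if_splits)
      hence "(e, False) \<in> Dv v" "c e t = dp (e, False) (1 - t)" "1 - t \<in> {0..<1/3}" using e by (auto simp: Dv_def dp_def)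
      hence "c e t \<in> St v" unfolding St_def by blast
      moreover have "t \<in> {0..1}" using f by auto
      ultimately show ?thesis by blast
    qed
  qed
  moreover have "openin (top_of_set {0..1}) {0..<1/3::real}" "openin (top_of_set {0..1}) {2/3<..1::real}"
    unfolding openin_open by (rule exI[of _ "{..<1/3}"], fastforce) (rule exI[of _ "{2/3<..}"], fastforce)
  ultimately show "openin (top_of_set {0..1}) {t \<in> {0..1}. c e t \<in> St v}" by auto
qed

lemma St_radius:
  assumes d: "d \<in> Dv v" and t: "t \<in> {0..1/3}" and m: "dp d t \<in> St v"
  shows "t < 1/3"
proof -
  obtain d' s where d': "d' \<in> Dv v" "s \<in> {0..<1/3}" "dp d t = dp d' s" using m unfolding St_def by blast
  have "d \<in> Dt" "d' \<in> Dt" using d d' by (auto simp: Dv_def)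
  from dp_star_inj[OF this t _ d'(3)] d'(2) show ?thesis by auto
qed

lemma St_contract:
  assumes d: "d \<in> Dv v" and t: "t \<in> {0..1/3}" and m: "dp d t \<in> St v" and s: "s \<in> {0..1}"
  shows "dp d ((1 - s) * t) \<in> St v"
proof -
  have "(1 - s) * t \<le> t" using s t by (intro mult_left_le_one_le) auto
  hence "(1 - s) * t \<in> {0..<1/3}" using St_radius[OF d t m] s t by auto
  thus ?thesis using d unfolding St_def by blast
qed

lemma uconf_connected: "path_connected_space (uconf_space n X)"
proof -
  obtain e where e: "e \<in> Ed" using ne by blast
  have dp: "dp (e, True) = c e" by (simp add: dp_def fun_eq_iff)
  interpret open_arc X n "c e"
  proof
    show "Hausdorff_space X" "path_connected_space X" by (rule Haus, rule pc)
    show "continuous_map (top_of_set {0<..<1}) X (c e)"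
      by (rule continuous_map_from_subtopology_mono[OF pth[OF e, unfolded pathin_def]]) auto
    show "inj_on (c e) {0<..<1}"
      using inner[OF e e] by (auto intro!: inj_onI)
    show "openin X (c e ` U)" if "open U" "U \<subseteq> {0<..<1}" for U
      using open_inner[of "(e, True)" U] e that unfolding dp by simp
  qed
  show ?thesis by (rule uconf_path_connected)
qed

text \<open>Away from \<open>v\<close> the star is the disjoint union of its open branches, so any
  one branch can serve as the side \<open>B\<close> of a wall.\<close>

lemma branch_sets:
  assumes d1: "d1 \<in> Dv v"
  shows "openin X (dp d1 ` {0<..<1/3})" "openin X (St v - {v} - dp d1 ` {0<..<1/3})" "v \<notin> dp d1 ` {0<..<1/3}" "v \<in> St v"
proof -
  have dt: "d1 \<in> Dt" "dp d1 0 = v" using d1 by (auto simp: Dv_def)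
  show "openin X (dp d1 ` {0<..<1/3})" by (rule open_inner[OF dt(1)]) auto
  have v: "v \<notin> dp d ` {0<..<1/3}" if "d \<in> Dt" for d
  proof
    assume "v \<in> dp d ` {0<..<1/3}"
    then obtain t where t: "t \<in> {0<..<1/3}" "dp d t = dp d1 0" using dt by auto
    from dp_star_inj[OF that dt(1) _ _ t(2)] t(1) show False by auto
  qed
  show "v \<notin> dp d1 ` {0<..<1/3}" by (rule v[OF dt(1)])
  have "dp d1 0 \<in> dp d1 ` {0..<1/3}" by (rule imageI) simp
  thus "v \<in> St v" unfolding St_def using d1 dt(2) by auto
  have "St v - {v} - dp d1 ` {0<..<1/3} = (\<Union>d\<in>Dv v - {d1}. dp d ` {0<..<1/3})"
  proof (intro equalityI subsetI)
    fix x assume x: "x \<in> St v - {v} - dp d1 ` {0<..<1/3}"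
    then obtain d t where d: "d \<in> Dv v" "t \<in> {0..<1/3}" "x = dp d t" unfolding St_def by blast
    have "t \<noteq> 0" using x d by (auto simp: Dv_def)
    hence "t \<in> {0<..<1/3}" using d(2) by auto
    thus "x \<in> (\<Union>d\<in>Dv v - {d1}. dp d ` {0<..<1/3})" using d x by blast
  next
    fix x assume "x \<in> (\<Union>d\<in>Dv v - {d1}. dp d ` {0<..<1/3})"
    then obtain d t where d: "d \<in> Dv v" "d \<noteq> d1" "t \<in> {0<..<1/3}" "x = dp d t" by blast
    have dD: "d \<in> Dt" using d(1) by (simp add: Dv_def)
    have "t \<in> {0..<1/3}" using d(3) by simp
    hence "x \<in> St v" using d(1,4) unfolding St_def by blast
    moreover have "x \<noteq> v" using v[OF dD] d by blast
    moreover have "x \<notin> dp d1 ` {0<..<1/3}"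
    proof
      assume "x \<in> dp d1 ` {0<..<1/3}"
      then obtain s where s: "s \<in> {0<..<1/3}" "dp d t = dp d1 s" using d(4) by auto
      from dp_star_inj[OF dD dt(1) _ _ s(2)] s(1) d(2,3) show False by auto
    qed
    ultimately show "x \<in> St v - {v} - dp d1 ` {0<..<1/3}" by blast
  qed
  moreover have "openin X (\<Union>d\<in>Dv v - {d1}. dp d ` {0<..<1/3})"
    by (intro openin_Union ballI) (auto intro!: open_inner simp: Dv_def)
  ultimately show "openin X (St v - {v} - dp d1 ` {0<..<1/3})" by simp
qed

lemma closed_edge: "e \<in> Ed ==> closedin X (c e ` {0..1})"
  by (rule compactin_imp_closedin[OF Haus image_compactin[OF _ pth[unfolded pathin_def]]])
     (auto simp: compactin_subtopology)

end

section \<open>Intervals, leaf edges and loops as collars and walls\<close>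

context tgraph
begin

text \<open>The free end is at parameter 1, so that the depth of a point of the edge is its
  parameter.\<close>

definition leaf_edge :: "'e => bool" where
  "leaf_edge e0 \<longleftrightarrow> e0 \<in> Ed \<and> (\<forall>e\<in>Ed. \<forall>t\<in>{0..1}. c e t = c e0 1 \<longrightarrow> e = e0 \<and> t = 1)"

definition ht :: "'e => 'x => real" where
  "ht e0 x = (if x \<in> c e0 ` {0..1} then inv_into {0..1} (c e0) x else 0)"

lemma leaf_inj:
  assumes l: "leaf_edge e0" shows "inj_on (c e0) {0..1}"
proof (rule inj_onI)
  fix s t assume s: "s \<in> {0..1}" and t: "t \<in> {0..1}" and e: "c e0 s = c e0 t"
  have e0: "e0 \<in> Ed" and lf: "\<And>u. u \<in> {0..1} ==> c e0 u = c e0 1 ==> u = 1" using l unfolding leaf_edge_def by blast+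
  consider "0 < s \<and> s < 1" | "0 < t \<and> t < 1" | "s = 1" | "t = 1" | "s = 0 \<and> t = 0" using s t by fastforce
  thus "s = t"
  proof cases
    case 1
    thus ?thesis using inner[OF e0 e0 _ _ t e] by simp
  next
    case 2
    thus ?thesis using inner[OF e0 e0 _ _ s e[symmetric]] by simp
  next
    case 3
    thus ?thesis using lf[OF t] e by simp
  next
    case 4
    thus ?thesis using lf[OF s] e by simp
  qed simp
qed

lemma ht_edge: "leaf_edge e0 ==> t \<in> {0..1} ==> ht e0 (c e0 t) = t"
  unfolding ht_def using inv_into_f_f[OF leaf_inj, of e0 t] by auto

lemma ht_other:
  assumes l: "leaf_edge e0" and e: "e \<in> Ed" "e \<noteq> e0" and t: "t \<in> {0..1}" shows "ht e0 (c e t) = 0"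
proof (cases "c e t \<in> c e0 ` {0..1}")
  case True
  then obtain u where u: "u \<in> {0..1}" "c e t = c e0 u" by blast
  have e0: "e0 \<in> Ed" using l by (simp add: leaf_edge_def)
  have "\<not> (0 < u \<and> u < 1)" using inner[OF e0 e(1) _ _ t u(2)[symmetric]] e(2) by blast
  moreover have "u \<noteq> 1" using l u e t unfolding leaf_edge_def by blast
  ultimately have "u = 0" using u(1) by auto
  thus ?thesis using u ht_edge[OF l, of 0] by simp
qed (simp add: ht_def)

lemma leaf_facts:
  assumes l: "leaf_edge e0"
  shows "continuous_map (top_of_set {0<..1}) X (c e0)" "inj_on (c e0) {0<..1}"
    "\<And>U. openin (top_of_set {0<..1}) U ==> openin X (c e0 ` U)"
    "continuous_map X euclideanreal (ht e0)"
proof -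
  have e0: "e0 \<in> Ed" using l by (simp add: leaf_edge_def)
  show "continuous_map (top_of_set {0<..1}) X (c e0)"
    by (rule continuous_map_from_subtopology_mono[OF pth[OF e0, unfolded pathin_def]]) auto
  show "inj_on (c e0) {0<..1}" by (rule inj_on_subset[OF leaf_inj[OF l]]) auto
  show "continuous_map X euclideanreal (ht e0)"
  proof (rule continuous_criterion)
    fix e assume e: "e \<in> Ed"
    show "continuous_map (top_of_set {0..1}) euclideanreal (\<lambda>t. ht e0 (c e t))"
    proof (cases "e = e0")
      case True
      have "continuous_map (top_of_set {0..1}) euclideanreal (\<lambda>t::real. t)" by simp
      thus ?thesis by (rule continuous_map_eq) (use ht_edge[OF l] True in simp)
    next
      case False
      have "continuous_map (top_of_set {0..1::real}) euclideanreal (\<lambda>t. 0)" by simp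
      thus ?thesis by (rule continuous_map_eq) (use ht_other[OF l e False] in simp)
    qed
  qed
  fix U assume U: "openin (top_of_set {0<..1::real}) U"
  hence UI: "U \<subseteq> {0<..1}" using openin_subset by fastforce
  show "openin X (c e0 ` U)"
  proof (rule open_criterion)
    show "c e0 ` U \<subseteq> topspace X" using pathin_topspace[OF pth[OF e0]] UI by fastforce
    fix e assume e: "e \<in> Ed"
    have "{t \<in> {0..1}. c e t \<in> c e0 ` U} = (if e = e0 then U else {})"
    proof (cases "e = e0")
      case True
      have "{t \<in> {0..1}. c e0 t \<in> c e0 ` U} = U"
      proof (intro equalityI subsetI)
        fix t assume "t \<in> {t \<in> {0..1}. c e0 t \<in> c e0 ` U}"
        then obtain u where t: "t \<in> {0..1}" "u \<in> U" "c e0 t = c e0 u" by blast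
        hence "t = u" using inj_onD[OF leaf_inj[OF l] t(3,1)] UI by fastforce
        thus "t \<in> U" using t by simp
      next
        fix t assume "t \<in> U"
        thus "t \<in> {t \<in> {0..1}. c e0 t \<in> c e0 ` U}" using UI by fastforce
      qed
      thus ?thesis using True by simp
    next
      case False
      have "c e t \<notin> c e0 ` U" if t: "t \<in> {0..1}" for t
      proof
        assume "c e t \<in> c e0 ` U"
        then obtain u where "u \<in> U" "c e t = c e0 u" by blast
        thus False using ht_other[OF l e False t] ht_edge[OF l, of u] UI by force
      qed
      thus ?thesis using False by auto
    qed
    moreover have "openin (top_of_set {0..1}) U"
    proof -
      obtain T where T: "open T" "U = {0<..1} \<inter> T" using U unfolding openin_open by blast
      have "open ({0<..} \<inter> T)" using T(1) by (intro open_Int open_greaterThan)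
      moreover have "U = {0..1} \<inter> ({0<..} \<inter> T)" unfolding T(2) by auto
      ultimately show ?thesis unfolding openin_open by blast
    qed
    ultimately show "openin (top_of_set {0..1}) {t \<in> {0..1}. c e t \<in> c e0 ` U}" by simp
  qed
qed

text \<open>On a loop both ends are the vertex, so the depth must vanish at 0 and at 1; the minimum
  of two affine functions does so and is concave.\<close>

definition tent :: "real => real" where "tent t = min t (1 - t)"

definition lh :: "'e => 'x => real" where
  "lh e0 x = (if x \<in> c e0 ` {0<..<1} then tent (inv_into {0<..<1} (c e0) x) else 0)"

lemma loop_facts:
  assumes e0: "e0 \<in> Ed" and lp: "c e0 0 = c e0 1"
  shows "continuous_map (top_of_set {0<..<1}) X (c e0)" "inj_on (c e0) {0<..<1}"
    "\<And>U. openin (top_of_set {0<..<1}) U ==> openin X (c e0 ` U)"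
    "continuous_map X euclideanreal (lh e0)" "\<And>t. t \<in> {0..1} ==> lh e0 (c e0 t) = tent t"
    "\<And>e t. e \<in> Ed ==> e \<noteq> e0 ==> t \<in> {0..1} ==> lh e0 (c e t) = 0"
    "c e0 0 \<notin> c e0 ` {0<..<1}"
proof -
  show "continuous_map (top_of_set {0<..<1}) X (c e0)"
    by (rule continuous_map_from_subtopology_mono[OF pth[OF e0, unfolded pathin_def]]) auto
  show i: "inj_on (c e0) {0<..<1}" using inner[OF e0 e0] by (auto intro!: inj_onI)
  show n0: "c e0 0 \<notin> c e0 ` {0<..<1}"
  proof
    assume "c e0 0 \<in> c e0 ` {0<..<1}"
    then obtain u where "0 < u" "u < 1" "c e0 u = c e0 0" by auto
    thus False using inner[OF e0 e0, of u 0] by auto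
  qed
  show "openin X (c e0 ` U)" if U: "openin (top_of_set {0<..<1}) U" for U
  proof -
    have "open U" using U open_greaterThanLessThan openin_open_trans by blast
    moreover have "U \<subseteq> {0<..<1}" using openin_subset[OF U] by simp
    moreover have "dp (e0, True) = c e0" by (simp add: dp_def fun_eq_iff)
    ultimately show ?thesis using open_inner[of "(e0, True)" U] e0 by simp
  qed
  show D0: "lh e0 (c e0 t) = tent t" if t: "t \<in> {0..1}" for t
  proof (cases "0 < t \<and> t < 1")
    case True
    thus ?thesis using inv_into_f_f[OF i, of t] by (auto simp: lh_def)
  next
    case False
    hence "t = 0 \<or> t = 1" using t by auto
    hence "c e0 t = c e0 0" "tent t = 0" using lp by (auto simp: tent_def[abs_def])
    thus ?thesis using n0 by (simp only: lh_def if_False)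
  qed
  show D1: "lh e0 (c e t) = 0" if "e \<in> Ed" "e \<noteq> e0" "t \<in> {0..1}" for e t
  proof -
    have "c e t \<notin> c e0 ` {0<..<1}"
    proof
      assume "c e t \<in> c e0 ` {0<..<1}"
      then obtain u where "0 < u" "u < 1" "c e0 u = c e t" by auto
      thus False using inner[OF e0 that(1), of u t] that by auto
    qed
    thus ?thesis by (simp add: lh_def)
  qed
  show "continuous_map X euclideanreal (lh e0)"
  proof (rule continuous_criterion)
    fix e assume e: "e \<in> Ed"
    show "continuous_map (top_of_set {0..1}) euclideanreal (\<lambda>t. lh e0 (c e t))"
    proof (cases "e = e0")
      case True
      have "continuous_map (top_of_set {0..1}) euclideanreal tent"
        unfolding tent_def[abs_def] by (auto intro!: continuous_intros)
      thus ?thesis by (rule continuous_map_eq) (use D0 True in simp)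
    next
      case False
      have "continuous_map (top_of_set {0..1::real}) euclideanreal (\<lambda>t. 0)" by simp
      thus ?thesis by (rule continuous_map_eq) (use D1[OF e False] in simp)
    qed
  qed
qed

text \<open>Here the star is the whole interval with a single ray. The particle of least height
  takes the part of particle 1, so the contractible set \<open>Good\<close> represents every
  configuration.\<close>

theorem interval_not_raag:
  fixes P :: "('c, 'd) pre_digraph"
  assumes P: "graph P" "card (verts P) \<ge> 2" and n: "n \<ge> 1"
    and s: "s \<in> topspace (uconf_space n X)" and l: "leaf_edge e0" and Ed: "Ed = {e0}"
  shows "\<not> fundamental_group (uconf_space n X) s \<cong> raag P"
proof -
  note f = leaf_facts[OF l]
  have e0: "e0 \<in> Ed" using Ed by simp
  interpret collar X n "{0<..1}" "c e0" "\<lambda>t. t" "ht e0" "{()}" "\<lambda>_. c e0" 1 "topspace X" "c e0 0"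
  proof
    show "Hausdorff_space X" by (rule Haus)
    show "openin X (c e0 ` U)" if "openin (top_of_set {0<..1}) U" for U by (rule f(3)[OF that])
    show "(1 - s) * a + s * b \<le> lin a b s" for a b s :: real by (simp add: lin_def algebra_simps)
    show "j = k \<and> s = t \<or> s = 0 \<and> t = 0" if "s \<in> {0..1}" "t \<in> {0..1}" "c e0 s = c e0 t" for j k :: unit and s t
      using inj_onD[OF leaf_inj[OF l] that(3,1,2)] by simp
    show "topspace X \<subseteq> (\<Union>j\<in>{()}. c e0 ` {0..1})" using cov Ed by simp
    fix s t :: real assume t: "t \<in> {0..1}" and s: "s \<in> {0..1}"
    have "(1 - s) * t \<in> {0..1}" using s t mult_left_le_one_le[of t "1 - s"] by auto
    thus "c e0 ((1 - s) * t) \<in> topspace X \<and> ht e0 (c e0 ((1 - s) * t)) = (1 - s) * ht e0 (c e0 t)"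
      using pathin_topspace[OF pth[OF e0]] ht_edge[OF l] t by auto
  qed (use n f e0 pth[OF e0] ht_edge[OF l] in \<open>auto simp: pathin_def\<close>)
  show ?thesis
  proof (rule not_raag[OF P uconf_connected s], rule subsetI)
    fix y assume "y \<in> topspace (uconf_space n X)"
    then obtain x where x: "x \<in> topspace (conf_space n X)" "y = perm_orbit n x" by (auto simp: topspace_uconf_space)
    have xX: "x i \<in> topspace X" if "i \<in> {1..n}" for i using x(1) that unfolding topspace_conf_space by (auto simp: PiE_iff)
    have xi: "inj_on x {1..n}" using x(1) by (simp add: topspace_conf_space)
    define i0 where "i0 = arg_min_on (\<lambda>i. ht e0 (x i)) {1..n}"
    have i0: "i0 \<in> {1..n}" unfolding i0_def using n by (intro arg_min_if_finite) auto
    have i0m: "ht e0 (x i0) \<le> ht e0 (x i)" if "i \<in> {1..n}" for i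
      unfolding i0_def using that by (intro arg_min_least) auto
    have "perm_orbit n x \<in> perm_orbit n ` Good"
    proof (rule Good_cover[OF x(1) i0 xX[OF i0]])
      fix i assume i: "i \<in> {1..n} - {i0}"
      obtain t where t: "t \<in> {0..1}" "x i = c e0 t" using xX[of i] i cov Ed by auto
      obtain u where u: "u \<in> {0..1}" "x i0 = c e0 u" using xX[OF i0] cov Ed by auto
      have "x i \<noteq> x i0" using inj_onD[OF xi] i i0 by blast
      hence "t \<noteq> u" using t u by auto
      moreover have "u \<le> t" using i0m[of i] i ht_edge[OF l t(1)] ht_edge[OF l u(1)] t u by simp
      ultimately have "u < t" by simp
      thus "x i \<in> c e0 ` {0<..1} \<and> ht e0 (x i0) < ht e0 (x i)"
        using ht_edge[OF l t(1)] ht_edge[OF l u(1)] t u by auto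
    qed
    thus "y \<in> perm_orbit n ` Good" using x(2) by simp
  qed
qed

lemma dart_path:
  assumes d: "d \<in> Dt" and r: "r \<in> {0..1}"
  shows "pathin X (\<lambda>t. dp d (t * r))"
  by (rule pathin_compose_convex[OF pathin_dp[OF d, unfolded pathin_def]])
     (use r in \<open>auto intro!: continuous_intros mult_le_one\<close>)

lemma through_vertex:
  assumes d1: "d1 \<in> Dv v" and d2: "d2 \<in> Dv v" and r: "r1 \<in> {0..1}" "r2 \<in> {0..1}"
  obtains \<alpha> where "pathin X \<alpha>" "\<alpha> 0 = dp d2 r2" "\<alpha> 1 = dp d1 r1"
    "\<And>t. t \<in> {0..1} ==> \<exists>u. u \<in> {0..r1} \<and> \<alpha> t = dp d1 u \<or> u \<in> {0..r2} \<and> \<alpha> t = dp d2 u"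
proof
  let ?a = "loop_concat (rev_path (\<lambda>t. dp d2 (t * r2))) (\<lambda>t. dp d1 (t * r1))"
  have D: "d1 \<in> Dt" "d2 \<in> Dt" "dp d1 0 = v" "dp d2 0 = v" using d1 d2 by (auto simp: Dv_def)
  show "pathin X ?a"
    by (rule pathin_loop_concat[OF pathin_rev_path[OF dart_path[OF D(2) r(2)]] dart_path[OF D(1) r(1)]]) (simp add: D)
  show "?a 0 = dp d2 r2" "?a 1 = dp d1 r1" by simp_all
  fix t :: real assume t: "t \<in> {0..1}"
  show "\<exists>u. u \<in> {0..r1} \<and> ?a t = dp d1 u \<or> u \<in> {0..r2} \<and> ?a t = dp d2 u"
  proof (cases "t \<le> 1/2")
    case True
    have "(1 - 2 * t) * r2 \<in> {0..r2}" using True t r mult_left_le_one_le[of r2 "1 - 2 * t"] by auto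
    thus ?thesis using True by (auto simp: loop_concat_def rev_path_def)
  next
    case False
    have "(2 * t - 1) * r1 \<in> {0..r1}" using False t r mult_left_le_one_le[of r1 "2 * t - 1"] by auto
    thus ?thesis using False by (auto simp: loop_concat_def)
  qed
qed

end

context tgraph
begin

lemma star_collar:
  assumes v: "Dv v \<noteq> {}"
  shows "finite (Dv v)" "(0::real) \<le> 1/3"
    "\<And>j. j \<in> Dv v ==> continuous_map (top_of_set {0..1/3}) X (dp j)" "\<And>j. j \<in> Dv v ==> dp j 0 = v"
    "\<And>j k s t. j \<in> Dv v ==> k \<in> Dv v ==> s \<in> {0..1/3} ==> t \<in> {0..1/3} ==> dp j s = dp k t ==> j = k \<and> s = t \<or> s = 0 \<and> t = 0"
    "openin X (St v)" "St v \<subseteq> (\<Union>j\<in>Dv v. dp j ` {0..1/3})"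
proof -
  show "continuous_map (top_of_set {0..1/3}) X (dp j)" if "j \<in> Dv v" for j
    by (rule continuous_map_from_subtopology_mono[OF pathin_dp[unfolded pathin_def]]) (use that in \<open>auto simp: Dv_def\<close>)
  show "j = k \<and> s = t \<or> s = 0 \<and> t = 0" if "j \<in> Dv v" "k \<in> Dv v" "s \<in> {0..1/3}" "t \<in> {0..1/3}" "dp j s = dp k t" for j k s t
    using dp_star_inj[OF _ _ that(3-5)] that(1,2) by (auto simp: Dv_def)
  show "St v \<subseteq> (\<Union>j\<in>Dv v. dp j ` {0..1/3})" unfolding St_def by (intro UN_mono image_mono) auto
  show "dp j 0 = v" if "j \<in> Dv v" for j using that by (simp add: Dv_def)
qed (simp_all add: finite_Dv open_St)

lemma transpose_config:
  assumes n: "n \<ge> 2"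
  shows "(\<lambda>i\<in>{1..n}. if i = 1 then a else if i = 2 then b else g i) \<circ> Transposition.transpose 1 (2::nat) =
    (\<lambda>i\<in>{1..n}. if i = 1 then b else if i = 2 then a else g i)"
  using n by (auto simp: fun_eq_iff Transposition.transpose_def)

text \<open>Particle 1 crosses \<open>v\<close> from the branch of \<open>d2\<close> to that of
  \<open>d1\<close>. On the way back it stays parked on \<open>d1\<close> while particle 2, the
  outermost in the leaf edge, comes out to \<open>d2\<close>; then particle 1 takes its place in the
  edge. During either step the parked particle lies outside the closed edge, so the wall is
  avoided.\<close>

theorem leaf_not_raag:
  fixes P :: "('c, 'd) pre_digraph"
  assumes P: "graph P" "Digraph_Component.connected P" "card (verts P) \<ge> 2" and n: "n \<ge> 2"
    and s: "s \<in> topspace (uconf_space n X)" and l: "leaf_edge e0"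
    and d1: "d1 \<in> Dv (c e0 0)" "d1 \<noteq> (e0, True)" and d2: "d2 \<in> Dv (c e0 0)" "d2 \<noteq> (e0, True)" and d12: "d1 \<noteq> d2"
  shows "\<not> fundamental_group (uconf_space n X) s \<cong> raag P"
proof -
  note f = leaf_facts[OF l]
  define v where "v = c e0 0"
  have e0: "e0 \<in> Ed" using l by (simp add: leaf_edge_def)
  have e0t: "(e0, True) \<in> Dv v" using e0 by (simp add: Dv_def dp_def v_def)
  have dpe: "dp (e0, True) = c e0" by (simp add: dp_def fun_eq_iff)
  have nF: "(e0, False) \<notin> Dv v"
  proof
    assume "(e0, False) \<in> Dv v"
    hence "c e0 1 = c e0 0" by (simp add: Dv_def dp_def v_def)
    thus False using inj_onD[OF leaf_inj[OF l], of 1 0] by simp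
  qed
  have ht0: "ht e0 (dp d t) = 0" if "d \<in> Dv v" "d \<noteq> (e0, True)" "t \<in> {0..1}" for d t
  proof -
    have "fst d \<noteq> e0"
    proof
      assume "fst d = e0"
      hence "d = (e0, True) \<or> d = (e0, False)" by (cases d) auto
      thus False using that(1,2) nF by blast
    qed
    moreover have "fst d \<in> Ed" "(if snd d then t else 1 - t) \<in> {0..1}" using that by (auto simp: Dv_def)
    ultimately show ?thesis using ht_other[OF l, of "fst d" "if snd d then t else 1 - t"] unfolding dp_def by blast
  qed
  have ht1: "ht e0 (dp (e0, True) t) = t" if "t \<in> {0..1}" for t using ht_edge[OF l that] dpe by simp
  note sc = star_collar[of v]
  have ne: "Dv v \<noteq> {}" using e0t by blast
  have eE: "insert v (c e0 ` {0<..1}) = c e0 ` {0..1}"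
  proof -
    have "{0..1::real} = insert 0 {0<..1}" by auto
    thus ?thesis by (simp add: v_def)
  qed
  have star': "dp j ((1 - s) * t) \<in> St v \<and> ht e0 (dp j ((1 - s) * t)) = (1 - s) * ht e0 (dp j t)"
    if j: "j \<in> Dv v" "t \<in> {0..1/3}" "dp j t \<in> St v" "s \<in> {0..1}" for j s t
  proof
    show "dp j ((1 - s) * t) \<in> St v" by (rule St_contract[OF j])
    have m: "(1 - s) * t \<in> {0..1}" "t \<in> {0..1}" using j mult_left_le_one_le[of t "1 - s"] by auto
    show "ht e0 (dp j ((1 - s) * t)) = (1 - s) * ht e0 (dp j t)"
      using ht0[OF j(1)] ht1 m by (cases "j = (e0, True)") auto
  qed
  interpret wall X n "{0<..1}" "c e0" "\<lambda>t. t" "ht e0" "Dv v" dp "1/3" "St v" v "dp d1 ` {0<..<1/3}"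
  proof
    show "Hausdorff_space X" by (rule Haus)
    show "openin X (c e0 ` U)" if "openin (top_of_set {0<..1}) U" for U by (rule f(3)[OF that])
    show "(1 - s) * a + s * b \<le> lin a b s" for a b s :: real by (simp add: lin_def algebra_simps)
    show "closedin X (insert v (c e0 ` {0<..1}))" unfolding eE by (rule closed_edge[OF e0])
    show "v \<notin> c e0 ` {0<..1}"
    proof
      assume "v \<in> c e0 ` {0<..1}"
      then obtain u where "u \<in> {0<..1}" "c e0 0 = c e0 u" by (auto simp: v_def)
      thus False using inj_onD[OF leaf_inj[OF l], of 0 u] by auto
    qed
    show "openin X (dp d1 ` {0<..<1/3})" "openin X (St v - {v} - dp d1 ` {0<..<1/3})" "v \<notin> dp d1 ` {0<..<1/3}" "v \<in> St v"
      using branch_sets[of d1 v] d1(1) unfolding v_def by auto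
    show "dp j ((1 - s) * t) \<in> St v \<and> ht e0 (dp j ((1 - s) * t)) = (1 - s) * ht e0 (dp j t)"
      if j: "j \<in> Dv v" "t \<in> {0..1/3}" "dp j t \<in> St v" "s \<in> {0..1}" for j s t by (rule star'[OF j])
    show "j = k \<and> s = t \<or> s = 0 \<and> t = 0" if "j \<in> Dv v" "k \<in> Dv v" "s \<in> {0..1/3}" "t \<in> {0..1/3}" "dp j s = dp k t" for j k s t
      by (rule sc(5)[OF ne that])
    show "dp j 0 = v" if "j \<in> Dv v" for j by (rule sc(4)[OF ne that])
    show "continuous_map (top_of_set {0..1/3}) X (dp j)" if "j \<in> Dv v" for j by (rule sc(3)[OF ne that])
  qed (use n f ht_edge[OF l] sc(1,2,6,7)[OF ne] in auto)
  have d1v: "d1 \<in> Dv v" "d2 \<in> Dv v" using d1 d2 by (simp_all add: v_def)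
  have Dt12: "d1 \<in> Dt" "d2 \<in> Dt" using d1v by (auto simp: Dv_def)
  \<comment> \<open>The parking position 1/4 is inside the star of radius 1/3, as the crossing path
    has to stay in the star.\<close>
  define b1 where "b1 = dp d1 (1/4)"
  define b2 where "b2 = dp d2 (1/4)"
  have q4: "(1/4::real) \<in> {0..1}" by simp
  obtain \<alpha> where \<alpha>: "pathin X \<alpha>" "\<alpha> 0 = b2" "\<alpha> 1 = b1"
    "\<And>t. t \<in> {0..1} ==> \<exists>u. u \<in> {0..1/4} \<and> \<alpha> t = dp d1 u \<or> u \<in> {0..1/4} \<and> \<alpha> t = dp d2 u"
    using through_vertex[OF d1v q4 q4] unfolding b1_def b2_def by metis
  have \<alpha>2: "\<alpha> t \<in> St v" "ht e0 (\<alpha> t) = 0" if t: "t \<in> {0..1}" for t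
  proof -
    obtain u d where u: "u \<in> {0..1/4}" "\<alpha> t = dp d u" "d = d1 \<or> d = d2" using \<alpha>(4)[OF t] by blast
    hence "u \<in> {0..<1/3}" "u \<in> {0..1}" "d \<in> Dv v" "d \<noteq> (e0, True)" using d1v d1 d2 by auto
    thus "\<alpha> t \<in> St v" "ht e0 (\<alpha> t) = 0" using ht0[of d u] unfolding St_def u(2) by blast+
  qed
  have cp: "0 < cpos i" "cpos i < 1" if "i \<in> {2..n}" for i using that by (auto simp: cpos_def)
  have a: "pathin (conf_space n X) (\<lambda>t. sp (\<alpha> t))" "\<And>t. t \<in> {0..1} ==> sp (\<alpha> t) \<in> Good"
    using special_path[OF \<alpha>(1) _ \<alpha>2(1)] \<alpha>2(2) cp by auto
  have sp1: "sp z 1 = z" for z using n by (simp add: sp_def)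
  have b1B: "b1 \<in> dp d1 ` {0<..<1/3}" unfolding b1_def by (rule imageI) simp
  have b2B: "b2 \<notin> dp d1 ` {0<..<1/3}"
  proof
    assume "b2 \<in> dp d1 ` {0<..<1/3}"
    then obtain u where u: "u \<in> {0<..<1/3}" "dp d1 u = dp d2 (1/4)" by (auto simp: b2_def)
    from dp_star_inj[OF Dt12 _ _ u(2)] u(1) d12 show False by auto
  qed
  have c2: "cpos 2 \<in> {0..1}" and c20: "0 < cpos 2" using cp[of 2] n by auto
  obtain \<mu> where \<mu>: "pathin X \<mu>" "\<mu> 0 = c e0 (cpos 2)" "\<mu> 1 = b2"
    "\<And>t. t \<in> {0..1} ==> \<exists>u. u \<in> {0..1/4} \<and> \<mu> t = dp d2 u \<or> u \<in> {0..cpos 2} \<and> \<mu> t = c e0 u"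
    using through_vertex[OF d1v(2) e0t q4 c2] unfolding b2_def dpe by metis
  obtain \<nu> where \<nu>: "pathin X \<nu>" "\<nu> 0 = b1" "\<nu> 1 = c e0 (cpos 2)"
    "\<And>t. t \<in> {0..1} ==> \<exists>u. u \<in> {0..cpos 2} \<and> \<nu> t = c e0 u \<or> u \<in> {0..1/4} \<and> \<nu> t = dp d1 u"
    using through_vertex[OF e0t d1v(1) c2 q4] unfolding b1_def dpe by metis
  have bX: "b1 \<in> topspace X" "b2 \<in> topspace X"
    using \<nu>(1,2) \<mu>(1,3) pathin_topspace[of X \<nu> 0] pathin_topspace[of X \<mu> 1] by auto
  have kX: "c e0 (cpos i) \<in> topspace X" if "i \<in> {2..n}" for i
    using pathin_topspace[OF pth[OF e0], of "cpos i"] cp[OF that] by simp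
  have htb: "ht e0 b1 = 0" "ht e0 b2 = 0" using \<alpha>2(2)[of 1] \<alpha>2(2)[of 0] \<alpha>(2,3) by simp_all
  have bv: "b1 \<noteq> v" "b2 \<noteq> v"
  proof -
    show "b1 \<noteq> v" using b1B branch_sets(3)[of d1 v] d1v by blast
    show "b2 \<noteq> v"
    proof
      assume "b2 = v"
      hence "dp d2 (1/4) = dp d2 0" using d1v(2) by (simp add: b2_def Dv_def)
      from dp_star_inj[OF Dt12(2) Dt12(2) _ _ this] show False by simp
    qed
  qed
  have bE: "b \<notin> insert v (c e0 ` {0<..1})" if "b \<noteq> v" "ht e0 b = 0" for b
    using that ht_edge[OF l] by fastforce
  have clt: "cpos 2 < cpos i" if "i \<in> {3..n}" for i using that by (simp add: cpos_def divide_strict_right_mono)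
  have kinj: "c e0 u \<noteq> c e0 w" if "u \<in> {0..1}" "w \<in> {0..1}" "u \<noteq> w" for u w
    using inj_onD[OF leaf_inj[OF l] _ that(1,2)] that(3) by blast
  have move: "z \<noteq> c e0 (cpos i)" if z: "\<exists>u. u \<in> {0..1/4} \<and> z = dp d u \<or> u \<in> {0..cpos 2} \<and> z = c e0 u"
    and d: "d = d1 \<or> d = d2" and i: "i \<in> {3..n}" for z d i
  proof -
    have i2: "i \<in> {2..n}" using i by auto
    obtain u where "u \<in> {0..1/4} \<and> z = dp d u \<or> u \<in> {0..cpos 2} \<and> z = c e0 u" using z by blast
    thus ?thesis
    proof (elim disjE conjE)
      assume "u \<in> {0..1/4}" "z = dp d u"
      hence "ht e0 z = 0" using ht0[of d u] d d1v d1 d2 by auto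
      thus ?thesis using ht_edge[OF l, of "cpos i"] cp[OF i2] by auto
    next
      assume "u \<in> {0..cpos 2}" "z = c e0 u"
      thus ?thesis using kinj[of u "cpos i"] clt[OF i] cp[OF i2] by auto
    qed
  qed
  have off_d: "z \<noteq> dp d' (1/4)" if z: "\<exists>u. u \<in> {0..1/4} \<and> z = dp d u \<or> u \<in> {0..cpos 2} \<and> z = c e0 u"
    and d: "d \<in> Dv v" "d' \<in> Dv v" "d \<noteq> d'" "d' \<noteq> (e0, True)" "dp d' (1/4) \<noteq> v" for z d d'
  proof -
    obtain u where "u \<in> {0..1/4} \<and> z = dp d u \<or> u \<in> {0..cpos 2} \<and> z = c e0 u" using z by blast
    thus ?thesis
    proof (elim disjE conjE)
      assume "u \<in> {0..1/4}" "z = dp d u"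
      thus ?thesis using dp_star_inj[of d d' u "1/4"] d by (auto simp: Dv_def)
    next
      assume u: "u \<in> {0..cpos 2}" "z = c e0 u"
      show ?thesis
      proof
        assume "z = dp d' (1/4)"
        hence "ht e0 (c e0 u) = 0" using ht0[OF d(2,4)] u by simp
        moreover have "u \<in> {0..1}" using u(1) c2 by auto
        ultimately have "u = 0" using ht_edge[OF l] by simp
        thus False using \<open>z = dp d' (1/4)\<close> u(2) d(5) by (simp add: v_def)
      qed
    qed
  qed
  define g where "g i = c e0 (cpos i)" for i
  have conf: "pathin (conf_space n X) (\<lambda>t. \<lambda>i\<in>{1..n}. if i = 1 then p t else if i = 2 then q t else g i)"
    if p: "pathin X p" "pathin X q" and pq: "\<And>t. t \<in> {0..1} ==> p t \<noteq> q t"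
      "\<And>t i. t \<in> {0..1} ==> i \<in> {3..n} ==> p t \<noteq> g i \<and> q t \<noteq> g i" for p q
  proof (rule pathin_conf)
    fix i assume "i \<in> {1..n}"
    hence "i = 1 \<or> i = 2 \<or> i \<noteq> 1 \<and> i \<noteq> 2 \<and> i \<in> {2..n}" by auto
    thus "pathin X (\<lambda>t. if i = 1 then p t else if i = 2 then q t else g i)" using p kX[of i] by (auto simp: g_def)
  next
    fix t :: real assume t: "t \<in> {0..1}"
    have gi: "g i \<noteq> g j" if "i \<in> {3..n}" "j \<in> {3..n}" "i \<noteq> j" for i j
      unfolding g_def by (rule kinj) (use that cp[of i] cp[of j] in \<open>auto simp: cpos_def\<close>)
    show "inj_on (\<lambda>i. if i = 1 then p t else if i = 2 then q t else g i) {1..n}"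
    proof (rule inj_onI)
      fix i j assume ij: "i \<in> {1..n}" "j \<in> {1..n}"
        "(if i = 1 then p t else if i = 2 then q t else g i) = (if j = 1 then p t else if j = 2 then q t else g j)"
      have 3: "k = 1 \<or> k = 2 \<or> k \<noteq> 1 \<and> k \<noteq> 2 \<and> k \<in> {3..n}" if "k \<in> {1..n}" for k using that by auto
      from 3[OF ij(1)] 3[OF ij(2)] show "i = j"
        using ij(3) pq(1)[OF t] pq(2)[OF t, of i] pq(2)[OF t, of j] gi[of i j] by (elim disjE conjE) auto
    qed
  qed
  \<comment> \<open>The two halves of the way back: particle 2 leaves the edge along \<mu>, then
    particle 1 enters it along \<nu>. At the end particles 1 and 2 have traded roles, which the
    transposition below undoes.\<close>
  define B1 where "B1 = (\<lambda>t. \<lambda>i\<in>{1..n}. if i = 1 then b1 else if i = 2 then \<mu> t else g i)"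
  define B2 where "B2 = (\<lambda>t. \<lambda>i\<in>{1..n}. if i = 1 then \<nu> t else if i = 2 then b2 else g i)"
  have z1: "\<exists>u. u \<in> {0..1/4} \<and> b1 = dp d1 u \<or> u \<in> {0..cpos 2} \<and> b1 = c e0 u"
    and z2: "\<exists>u. u \<in> {0..1/4} \<and> b2 = dp d2 u \<or> u \<in> {0..cpos 2} \<and> b2 = c e0 u"
    unfolding b1_def b2_def by (rule exI[of _ "1/4"], simp)+
  have pB1: "pathin (conf_space n X) B1"
    unfolding B1_def
  proof (rule conf)
    show "pathin X (\<lambda>t. b1)" using bX by simp
    show "b1 \<noteq> \<mu> t" if "t \<in> {0..1}" for t
      using off_d[of "\<mu> t" d2 d1] \<mu>(4)[OF that] d1v d12 d1(2) bv(1) unfolding b1_def by metis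
    show "b1 \<noteq> g i \<and> \<mu> t \<noteq> g i" if "t \<in> {0..1}" "i \<in> {3..n}" for t i
      using move[OF z1 _ that(2)] move[of "\<mu> t" d2 i] \<mu>(4)[OF that(1)] that(2) unfolding g_def by blast
  qed (rule \<mu>(1))
  have pB2: "pathin (conf_space n X) B2"
    unfolding B2_def
  proof (rule conf)
    show "pathin X (\<lambda>t. b2)" using bX by simp
    have nz: "\<exists>u. u \<in> {0..1/4} \<and> \<nu> t = dp d1 u \<or> u \<in> {0..cpos 2} \<and> \<nu> t = c e0 u" if "t \<in> {0..1}" for t
      using \<nu>(4)[OF that] by blast
    show "\<nu> t \<noteq> b2" if "t \<in> {0..1}" for t
      using off_d[OF nz[OF that], of d2] d1v d12 d2(2) bv(2) unfolding b2_def by blast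
    show "\<nu> t \<noteq> g i \<and> b2 \<noteq> g i" if "t \<in> {0..1}" "i \<in> {3..n}" for t i
      using move[OF z2 _ that(2)] move[OF nz[OF that(1)] _ that(2)] unfolding g_def by blast
  qed (rule \<nu>(1))
  have B12: "B1 1 = B2 0" unfolding B1_def B2_def \<mu>(3) \<nu>(2) ..
  have n12: "1 \<in> {1..n}" "2 \<in> {1..n}" using n by auto
  have offB: "B1 t \<in> off" "B2 t \<in> off" if t: "t \<in> {0..1}" for t
  proof -
    have "B1 t 1 = b1" "B2 t 2 = b2" using n12 by (simp_all add: B1_def B2_def)
    thus "B1 t \<in> off" "B2 t \<in> off"
      using pathin_topspace[OF pB1 t] pathin_topspace[OF pB2 t] bE[OF bv(1) htb(1)] bE[OF bv(2) htb(2)] n12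
      unfolding off_def by blast+
  qed
  show ?thesis
  proof (rule wall_obstruction[OF P uconf_connected s a])
    show "sp (\<alpha> 0) 1 \<notin> dp d1 ` {0<..<1/3}" "sp (\<alpha> 1) 1 \<in> dp d1 ` {0<..<1/3}"
      using sp1 \<alpha>(2,3) b1B b2B by simp_all
    show "pathin (conf_space n X) (loop_concat B1 B2)" by (rule pathin_loop_concat[OF pB1 pB2 B12])
    show "loop_concat B1 B2 t \<in> off" if "t \<in> {0..1}" for t
      using offB[of "2 * t"] offB[of "2 * t - 1"] that by (auto simp: loop_concat_def)
    have "sp (\<alpha> 1) = B1 0" unfolding sp_def B1_def \<alpha>(3) \<mu>(2) g_def by (rule restrict_ext) simp
    thus "perm_orbit n (sp (\<alpha> 1)) = perm_orbit n (loop_concat B1 B2 0)" by simp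
    have "sp (\<alpha> 0) = (\<lambda>i\<in>{1..n}. if i = 1 then b2 else if i = 2 then c e0 (cpos 2) else g i)"
      unfolding sp_def \<alpha>(2) g_def by (rule restrict_ext) simp
    also have "\<dots> = B2 1 \<circ> Transposition.transpose 1 2"
      unfolding B2_def \<nu>(3) by (rule transpose_config[OF n, symmetric])
    finally have e: "sp (\<alpha> 0) = B2 1 \<circ> Transposition.transpose 1 2" .
    have "Transposition.transpose 1 2 permutes {1..n}" using n12 by (intro permutes_swap_id)
    from perm_orbit_compose[OF this, of "B2 1"] e
    show "perm_orbit n (loop_concat B1 B2 1) = perm_orbit n (sp (\<alpha> 0))" by (simp only: loop_concat_1)
  qed
qed

text \<open>One particle crosses \<open>v\<close> from the end of the loop to its beginning.
  Afterwards all particles are pushed forward inside the open loop, each to the place of the next,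
  and the last one arrives where the crossing began.\<close>

theorem loop_not_raag:
  fixes P :: "('c, 'd) pre_digraph"
  assumes P: "graph P" "Digraph_Component.connected P" "card (verts P) \<ge> 2" and n: "n \<ge> 1"
    and s: "s \<in> topspace (uconf_space n X)" and e0: "e0 \<in> Ed" and lp: "c e0 0 = c e0 1"
  shows "\<not> fundamental_group (uconf_space n X) s \<cong> raag P"
proof -
  define v where "v = c e0 0"
  define d where "d = tent"
  define D where "D = lh e0"
  note f = loop_facts[OF e0 lp, folded d_def D_def]
  have e0t: "(e0, True) \<in> Dv v" "(e0, False) \<in> Dv v" using e0 lp by (simp_all add: Dv_def dp_def v_def)
  have dpe: "dp (e0, True) = c e0" "dp (e0, False) = (\<lambda>t. c e0 (1 - t))" by (simp_all add: dp_def fun_eq_iff)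
  have ne: "Dv v \<noteq> {}" using e0t by blast
  note sc = star_collar[OF ne]
  have Dd: "D (dp j t) = (if fst j = e0 then t else 0)" if j: "j \<in> Dv v" and t: "t \<in> {0..1/3}" for j t
  proof -
    have u: "(if snd j then t else 1 - t) \<in> {0..1}" and jE: "fst j \<in> Ed" using t j by (auto simp: Dv_def)
    show ?thesis
    proof (cases "fst j = e0")
      case True
      hence "D (dp j t) = d (if snd j then t else 1 - t)" using f(5)[OF u] by (simp add: dp_def)
      thus ?thesis using True t by (auto simp: d_def tent_def)
    next
      case False
      thus ?thesis using f(6)[OF jE False u] by (simp add: dp_def)
    qed
  qed
  have eE: "insert v (c e0 ` {0<..<1}) = c e0 ` {0..1}"
  proof -
    have "{0..1::real} = insert 0 (insert 1 {0<..<1})" by auto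
    thus ?thesis using lp by (simp add: v_def)
  qed
  interpret wall X n "{0<..<1}" "c e0" d D "Dv v" dp "1/3" "St v" v "dp (e0, True) ` {0<..<1/3}"
  proof
    show "Hausdorff_space X" by (rule Haus)
    show "openin X (c e0 ` U)" if "openin (top_of_set {0<..<1}) U" for U by (rule f(3)[OF that])
    show "(1 - s) * d a + s * d b \<le> d (lin a b s)" if "s \<in> {0..1}" for a b s :: real
    proof -
      have "(1 - s) * d a \<le> (1 - s) * a" "(1 - s) * d a \<le> (1 - s) * (1 - a)"
        "s * d b \<le> s * b" "s * d b \<le> s * (1 - b)"
        using that by (auto simp: d_def tent_def intro!: mult_left_mono)
      moreover have "lin a b s = (1 - s) * a + s * b" "1 - lin a b s = (1 - s) * (1 - a) + s * (1 - b)"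
        by (simp_all add: lin_def algebra_simps)
      ultimately show ?thesis unfolding d_def tent_def min_def by auto
    qed
    show "closedin X (insert v (c e0 ` {0<..<1}))" unfolding eE by (rule closed_edge[OF e0])
    show "v \<notin> c e0 ` {0<..<1}" using f(7) by (simp add: v_def)
    show "openin X (dp (e0, True) ` {0<..<1/3})" "openin X (St v - {v} - dp (e0, True) ` {0<..<1/3})" "v \<notin> dp (e0, True) ` {0<..<1/3}" "v \<in> St v"
      using branch_sets[OF e0t(1)] by auto
    show "dp j ((1 - s) * t) \<in> St v \<and> D (dp j ((1 - s) * t)) = (1 - s) * D (dp j t)"
      if j: "j \<in> Dv v" "t \<in> {0..1/3}" "dp j t \<in> St v" "s \<in> {0..1}" for j s t
    proof
      show "dp j ((1 - s) * t) \<in> St v" by (rule St_contract[OF j])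
      have "(1 - s) * t \<in> {0..1/3}" using j mult_left_le_one_le[of t "1 - s"] by auto
      thus "D (dp j ((1 - s) * t)) = (1 - s) * D (dp j t)" using Dd[OF j(1)] j(2) by simp
    qed
    show "j = k \<and> s = t \<or> s = 0 \<and> t = 0" if "j \<in> Dv v" "k \<in> Dv v" "s \<in> {0..1/3}" "t \<in> {0..1/3}" "dp j s = dp k t" for j k s t
      by (rule sc(5)[OF that])
    show "dp j 0 = v" if "j \<in> Dv v" for j by (rule sc(4)[OF that])
    show "continuous_map (top_of_set {0..1/3}) X (dp j)" if "j \<in> Dv v" for j by (rule sc(3)[OF that])
    show "d t > 0" if "t \<in> {0<..<1}" for t using that by (simp add: d_def tent_def)
  qed (use n f(1,2,4,5) sc(1,2,6,7) in auto)
  \<comment> \<open>Half the spacing of the positions \<open>cpos\<close>, so that the crossing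
    particle is less deep than all others; the bound 1/4 keeps it in the star.\<close>
  define \<epsilon> where "\<epsilon> = 1 / (2 * real (n + 1))"
  have \<epsilon>: "0 < \<epsilon>" "\<epsilon> \<le> 1/4" using n by (auto simp: \<epsilon>_def field_simps)
  have \<epsilon>1: "\<epsilon> \<in> {0..1}" using \<epsilon> by simp
  have ed: "\<epsilon> < d (cpos i)" if "i \<in> {2..n}" for i
  proof -
    have e: "\<epsilon> = (1/2) / real (n + 1)" by (simp add: \<epsilon>_def)
    have "(1/2) / real (n + 1) < real i / real (n + 1)" "(1/2) / real (n + 1) < (real (n + 1) - real i) / real (n + 1)"
      by (rule divide_strict_right_mono; use that in simp)+
    moreover have "1 - cpos i = (real (n + 1) - real i) / real (n + 1)"
      by (simp add: cpos_def diff_divide_distrib)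
    ultimately show ?thesis unfolding e d_def tent_def cpos_def by simp
  qed
  obtain \<alpha> where \<alpha>: "pathin X \<alpha>" "\<alpha> 0 = c e0 (1 - \<epsilon>)" "\<alpha> 1 = c e0 \<epsilon>"
    "\<And>t. t \<in> {0..1} ==> \<exists>u. u \<in> {0..\<epsilon>} \<and> \<alpha> t = dp (e0, True) u \<or> u \<in> {0..\<epsilon>} \<and> \<alpha> t = dp (e0, False) u"
    using through_vertex[OF e0t \<epsilon>1 \<epsilon>1] unfolding dpe by metis
  have \<alpha>2: "\<alpha> t \<in> St v" "D (\<alpha> t) \<le> \<epsilon>" if t: "t \<in> {0..1}" for t
  proof -
    obtain u b where u: "u \<in> {0..\<epsilon>}" "\<alpha> t = dp (e0, b) u" using \<alpha>(4)[OF t] by blast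
    have eb: "(e0, b) \<in> Dv v" using e0t by (cases b) auto
    have u3: "u \<in> {0..<1/3}" "u \<in> {0..1/3}" using u(1) \<epsilon> by auto
    show "\<alpha> t \<in> St v" using eb u3(1) u(2) unfolding St_def by blast
    show "D (\<alpha> t) \<le> \<epsilon>" using Dd[OF eb u3(2)] u by simp
  qed
  have a: "pathin (conf_space n X) (\<lambda>t. sp (\<alpha> t))" "\<And>t. t \<in> {0..1} ==> sp (\<alpha> t) \<in> Good"
    using special_path[OF \<alpha>(1) _ \<alpha>2(1)] \<alpha>2(2) ed by (meson le_less_trans)+
  interpret oa: open_arc X n "c e0"
  proof
    show "Hausdorff_space X" "path_connected_space X" by (rule Haus, rule pc)
    show "openin X (c e0 ` U)" if "open U" "U \<subseteq> {0<..<1}" for U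
      using open_inner[of "(e0, True)" U] e0 that unfolding dpe by simp
  qed (use f(1,2) in auto)
  \<comment> \<open>Positions at the start and the end of the rotation. Indices shift by one, so
    that the final configuration agrees with the initial one of the crossing only as a set.\<close>
  define q where "q i = (if i = 1 then \<epsilon> else cpos i)" for i :: nat
  define r where "r i = (if i = n then 1 - \<epsilon> else cpos (Suc i))" for i :: nat
  have qr: "q i \<in> {0<..<1} \<and> r i \<in> {0<..<1}" if "i \<in> {1..n}" for i
    using that \<epsilon> by (auto simp: q_def r_def cpos_def)
  have cl: "cpos i < cpos j" if "i < j" for i j using that by (simp add: cpos_def divide_strict_right_mono)
  have mono: "q i < q j \<and> r i < r j" if ij: "i \<in> {1..n}" "j \<in> {1..n}" "i < j" for i j
  proof
    have "\<epsilon> < cpos j" if "j \<in> {2..n}" for j using ed[OF that] by (simp add: d_def tent_def)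
    thus "q i < q j" using ij cl[of i j] by (auto simp: q_def)
    have "cpos k < 1 - \<epsilon>" if "k \<in> {2..n}" for k using ed[OF that] by (simp add: d_def tent_def)
    thus "r i < r j" using ij cl[of "Suc i" "Suc j"] by (auto simp: r_def)
  qed
  define b where "b = (\<lambda>s. \<lambda>i\<in>{1..n}. c e0 (lin (q i) (r i) s))"
  have pb: "pathin (conf_space n X) b" unfolding b_def by (rule oa.increasing_path[OF qr mono])
  show ?thesis
  proof (rule wall_obstruction[OF P uconf_connected s a])
    have sp1: "sp z 1 = z" for z using n by (simp add: sp_def)
    show "sp (\<alpha> 1) 1 \<in> dp (e0, True) ` {0<..<1/3}"
      unfolding sp1 \<alpha>(3) dpe by (rule imageI) (use \<epsilon> in auto)
    show "sp (\<alpha> 0) 1 \<notin> dp (e0, True) ` {0<..<1/3}"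
    proof
      assume "sp (\<alpha> 0) 1 \<in> dp (e0, True) ` {0<..<1/3}"
      then obtain u where "u \<in> {0<..<1/3}" "c e0 u = c e0 (1 - \<epsilon>)" unfolding sp1 \<alpha>(2) dpe by auto
      thus False using inj_onD[OF f(2), of u "1 - \<epsilon>"] \<epsilon> by auto
    qed
    show "pathin (conf_space n X) b" by (rule pb)
    show "b t \<in> off" if t: "t \<in> {0..1}" for t
    proof -
      have "b t i \<noteq> v" if i: "i \<in> {1..n}" for i
      proof -
        have "lin (q i) (r i) t \<in> {0<..<1}" by (rule lin_in_convex) (use qr[OF i] t in auto)
        hence "c e0 (lin (q i) (r i) t) \<in> c e0 ` {0<..<1}" by (rule imageI)
        moreover have "b t i = c e0 (lin (q i) (r i) t)" using i by (simp add: b_def)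
        ultimately show ?thesis using f(7) unfolding v_def by metis
      qed
      thus ?thesis using pathin_topspace[OF pb t] unfolding off_def by blast
    qed
    have "sp (\<alpha> 1) = b 0" unfolding sp_def b_def \<alpha>(3) lin_0 q_def by (rule restrict_ext) simp
    thus "perm_orbit n (sp (\<alpha> 1)) = perm_orbit n (b 0)" by simp
    show "perm_orbit n (b 1) = perm_orbit n (sp (\<alpha> 0))"
    proof (rule perm_orbit_eq_iff_image)
      show "b 1 \<in> topspace (conf_space n X)" using pathin_topspace[OF pb, of 1] by simp
      show "sp (\<alpha> 0) \<in> topspace (conf_space n X)" using pathin_topspace[OF a(1), of 0] by simp
      have "b 1 ` {1..n} = (\<lambda>i. c e0 (r i)) ` {1..n}" by (simp add: b_def)
      also have "\<dots> = insert (c e0 (1 - \<epsilon>)) ((\<lambda>i. c e0 (cpos (Suc i))) ` {1..<n})"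
      proof -
        have "{1..n} = insert n {1..<n}" using n by auto
        thus ?thesis by (auto simp: r_def)
      qed
      also have "(\<lambda>i. c e0 (cpos (Suc i))) ` {1..<n} = (\<lambda>i. c e0 (cpos i)) ` Suc ` {1..<n}" unfolding image_image ..
      also have "Suc ` {1..<n} = {2..n}" by (simp add: image_Suc_atLeastLessThan atLeastLessThanSuc_atLeastAtMost numeral_2_eq_2)
      also have "insert (c e0 (1 - \<epsilon>)) ((\<lambda>i. c e0 (cpos i)) ` {2..n}) = sp (\<alpha> 0) ` {1..n}"
      proof -
        have "{1..n} = insert 1 {2..n}" using n by auto
        thus ?thesis using n by (auto simp: sp_def \<alpha>(2))
      qed
      finally show "b 1 ` {1..n} = sp (\<alpha> 0) ` {1..n}" .
    qed
  qed
qed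

end

section \<open>Smoothing and longest paths\<close>

text \<open>\<open>leaf_edge\<close> demands the free end at parameter 1; reversing all edges treats
  leaves at parameter 0 without a second argument.\<close>

lemma (in tgraph) tgraph_reverse: "tgraph X Ed (\<lambda>e t. c e (1 - t))"
proof
  show "pathin X (\<lambda>t. c e (1 - t))" if "e \<in> Ed" for e
    using pathin_rev_path[OF pth[OF that]] by (simp add: rev_path_def[abs_def])
  have "(\<lambda>t. c e (1 - t)) ` {0..1} = c e ` {0..1}" for e
  proof -
    have "(\<lambda>t::real. 1 - t) ` {0..1} = {0..1}" by (auto intro!: image_eqI[of _ _ "1 - x" for x])
    thus ?thesis by (metis image_image)
  qed
  thus "topspace X = (\<Union>e\<in>Ed. (\<lambda>t. c e (1 - t)) ` {0..1})" using cov by simp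
  show "e = e' \<and> s = t" if "e \<in> Ed" "e' \<in> Ed" "0 < t" "t < 1" "s \<in> {0..1}" "c e (1 - t) = c e' (1 - s)" for e e' s t
    using inner[of e e' "1 - t" "1 - s"] that by auto
qed (rule Haus fin ne pc)+

context tgraph
begin

lemma dp_end: "dp (e, \<not> b) 0 = dp (e, b) 1" "dp (e, \<not> b) 1 = dp (e, b) 0"
  by (auto simp: dp_def)

lemma inner_not_vertex:
  assumes "d \<in> Dt" "d' \<in> Dt" "0 < u" "u < 1" shows "dp d u \<noteq> dp d' 0" "dp d u \<noteq> dp d' 1"
  using dp_inner[OF assms(1,2,3,4), of 0] dp_inner[OF assms(1,2,3,4), of 1] assms(3,4) by (auto split: if_splits)

lemma edge_vertex:
  assumes e: "e \<in> Ed" and d: "d \<in> Dt" and t: "t \<in> {0..1}" and ev: "c e t = dp d 0"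
  shows "(t = 0 \<and> (e, True) \<in> Dv (dp d 0)) \<or> (t = 1 \<and> (e, False) \<in> Dv (dp d 0))"
proof -
  have "\<not> (0 < t \<and> t < 1)" using inner_not_vertex(1)[of "(e, True)" d t] e d ev by (auto simp: dp_def)
  hence "t = 0 \<or> t = 1" using t by auto
  thus ?thesis using e ev by (auto simp: Dv_def dp_def)
qed

text \<open>The edge \<open>e1\<close> is redefined to run through \<open>v\<close> and along
  \<open>e2\<close>, which is then dropped. Only the darts given meet \<open>v\<close>, so no other
  edge notices that \<open>v\<close> has become an interior point.\<close>

lemma merge:
  assumes e12: "e1 \<noteq> e2" and D: "Dv v = {(e1, b1), (e2, b2)}"
  shows "\<exists>c'. tgraph X (Ed - {e2}) c'"
proof -
  define d1 where "d1 = (e1, b1)"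
  define d2 where "d2 = (e2, b2)"
  have d1: "d1 \<in> Dt" "dp d1 0 = v" and d2: "d2 \<in> Dt" "dp d2 0 = v" using D by (auto simp: Dv_def d1_def d2_def)
  have fs: "fst d1 = e1" "fst d2 = e2" by (simp_all add: d1_def d2_def)
  have E: "e1 \<in> Ed" "e2 \<in> Ed" using d1 d2 by (auto simp: d1_def d2_def)
  define m where "m = loop_concat (rev_path (dp d1)) (dp d2)"
  have m: "pathin X m"
    unfolding m_def by (rule pathin_loop_concat[OF pathin_rev_path[OF pathin_dp[OF d1(1)]] pathin_dp[OF d2(1)]]) (simp add: d1 d2)
  have m1: "m t = dp d1 (1 - 2 * t)" if "t \<le> 1/2" for t using that by (simp add: m_def loop_concat_def rev_path_def)
  have m2: "m t = dp d2 (2 * t - 1)" if "1/2 \<le> t" for t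
    unfolding m_def by (rule loop_concat_right[OF that]) (simp add: d1 d2)
  have img: "m ` {0..1} = c e1 ` {0..1} \<union> c e2 ` {0..1}"
  proof -
    have dimg: "dp d ` {0..1} = c (fst d) ` {0..1}" for d
    proof -
      have "(\<lambda>t::real. 1 - t) ` {0..1} = {0..1}" by (auto intro!: image_eqI[of _ _ "1 - x" for x])
      thus ?thesis unfolding dp_def by (cases "snd d") (auto simp: image_image[symmetric, of "c (fst d)" "\<lambda>t. 1 - t"])
    qed
    have "m ` {0..1} = dp d1 ` {0..1} \<union> dp d2 ` {0..1}"
    proof (intro equalityI subsetI)
      fix x assume "x \<in> m ` {0..1}"
      then obtain t where t: "t \<in> {0..1}" "x = m t" by blast
      have "t \<le> 1/2 \<and> 1 - 2 * t \<in> {0..1} \<or> 1/2 \<le> t \<and> 2 * t - 1 \<in> {0..1}" using t(1) by auto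
      thus "x \<in> dp d1 ` {0..1} \<union> dp d2 ` {0..1}" using m1[of t] m2[of t] t(2) by auto
    next
      fix x assume "x \<in> dp d1 ` {0..1} \<union> dp d2 ` {0..1}"
      then obtain u where u: "u \<in> {0..1}" "x = dp d1 u \<or> x = dp d2 u" by blast
      have a: "(1 - u) / 2 \<le> 1/2" "(1 - u) / 2 \<in> {0..1}" "1/2 \<le> (1 + u) / 2" "(1 + u) / 2 \<in> {0..1}" using u(1) by auto
      have "m ((1 - u) / 2) = dp d1 u" "m ((1 + u) / 2) = dp d2 u" using m1[OF a(1)] m2[OF a(3)] by (simp_all add: field_simps)
      thus "x \<in> m ` {0..1}" using u(2) a by (metis imageI)
    qed
    thus ?thesis by (simp add: dimg fs)
  qed
  define c' where "c' = c(e1 := m)"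
  have other: "c e s \<noteq> v" if "e \<in> Ed" "e \<noteq> e1" "e \<noteq> e2" "s \<in> {0..1}" for e s
  proof
    assume "c e s = v"
    hence "c e s = dp d1 0" using d1(2) by simp
    from edge_vertex[OF that(1) d1(1) that(4) this] show False using D that(2,3) d1(2) by auto
  qed
  have end1: "dp d1 1 \<noteq> v" "dp d2 1 \<noteq> v"
  proof -
    have "(e1, \<not> b1) \<notin> Dv v" "(e2, \<not> b2) \<notin> Dv v" using D e12 by auto
    thus "dp d1 1 \<noteq> v" "dp d2 1 \<noteq> v" using E dp_end(1)[of e1 b1] dp_end(1)[of e2 b2] by (auto simp: Dv_def d1_def d2_def)
  qed
  have notv: "dp d u \<noteq> v" if "d = d1 \<or> d = d2" "0 < u" "u \<le> 1" for d u
  proof (cases "u = 1")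
    case False
    thus ?thesis using inner_not_vertex(1)[of d d1 u] that d1 d2 by auto
  qed (use that end1 in auto)
  have mv: "s = 1/2" if s: "s \<in> {0..1}" and e: "m s = v" for s
  proof (rule ccontr)
    assume "s \<noteq> 1/2"
    then consider "s < 1/2" | "1/2 < s" by linarith
    thus False
    proof cases
      case 1
      thus False using notv[of d1 "1 - 2 * s"] m1[of s] e s by auto
    next
      case 2
      thus False using notv[of d2 "2 * s - 1"] m2[of s] e s by auto
    qed
  qed
  have half: "m (1/2) = v" using m1[of "1/2"] d1 by simp
  have lift: "\<exists>e d u. (e = e1 \<or> e = e2) \<and> d \<in> Dt \<and> fst d = e \<and> 0 < u \<and> u < 1 \<and> m t = dp d u \<and>
     (t < 1/2 \<and> d = d1 \<and> u = 1 - 2 * t \<or> 1/2 < t \<and> d = d2 \<and> u = 2 * t - 1)" if "0 < t" "t < 1" "t \<noteq> 1/2" for t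
  proof (cases "t < 1/2")
    case True
    thus ?thesis using that m1[of t] d1(1) fs by (intro exI[of _ e1] exI[of _ d1] exI[of _ "1 - 2 * t"]) auto
  next
    case False
    thus ?thesis using that m2[of t] d2(1) fs by (intro exI[of _ e2] exI[of _ d2] exI[of _ "2 * t - 1"]) auto
  qed
  have inm: "e = e1 \<and> s = t" if t: "0 < t" "t < 1" and e: "e \<in> Ed - {e2}" "s \<in> {0..1}" "m t = c' e s" for e s t
  proof (cases "t = 1/2")
    case True
    from e(3) have "c' e s = m (1/2)" unfolding True by (rule sym)
    hence v: "c' e s = v" unfolding half .
    hence "e = e1" using other[of e s] e by (auto simp: c'_def split: if_splits)
    thus ?thesis using v mv[of s] e True by (simp add: c'_def)
  next
    case False
    obtain f d u where d: "f = e1 \<or> f = e2" "d \<in> Dt" "fst d = f" "0 < u" "u < 1" "m t = dp d u"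
      "t < 1/2 \<and> d = d1 \<and> u = 1 - 2 * t \<or> 1/2 < t \<and> d = d2 \<and> u = 2 * t - 1"
      using lift[OF t False] by blast
    show ?thesis
    proof (cases "e = e1")
      case False
      hence "dp d u = dp (e, True) s" using d(6) e(3) by (simp add: c'_def dp_def)
      from dp_inner[OF d(2) _ d(4,5) e(2) this] have "f = e" using d(3) e(1) by auto
      thus ?thesis using d(1) False e(1) by auto
    next
      case True
      hence ms: "m s = dp d u" using e(3) d(6) by (simp add: c'_def)
      show ?thesis
      proof (cases "s \<le> 1/2")
        case True
        hence "dp d u = dp d1 (1 - 2 * s)" "1 - 2 * s \<in> {0..1}" using ms m1 e(2) by auto
        from dp_inner[OF d(2) d1(1) d(4,5) this(2,1)] show ?thesis
          using d(7) fs e12 \<open>e = e1\<close> by (elim disjE conjE) (auto split: if_splits)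
      next
        case False
        hence "dp d u = dp d2 (2 * s - 1)" "2 * s - 1 \<in> {0..1}" using ms m2 e(2) by auto
        from dp_inner[OF d(2) d2(1) d(4,5) this(2,1)] show ?thesis
          using d(7) fs e12 \<open>e = e1\<close> by (elim disjE conjE) (auto split: if_splits)
      qed
    qed
  qed
  have "tgraph X (Ed - {e2}) c'"
  proof
    show "pathin X (c' e)" if "e \<in> Ed - {e2}" for e using that m pth by (auto simp: c'_def)
    show "Ed - {e2} \<noteq> {}" using E e12 by auto
    have "(\<Union>e\<in>Ed - {e2}. c' e ` {0..1}) = (\<Union>e\<in>Ed. c e ` {0..1})"
    proof -
      have 1: "Ed - {e2} = insert e1 (Ed - {e1, e2})" "Ed = insert e1 (insert e2 (Ed - {e1, e2}))" using E e12 by auto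
      have "(\<Union>e\<in>Ed - {e2}. c' e ` {0..1}) = m ` {0..1} \<union> (\<Union>e\<in>Ed - {e1, e2}. c' e ` {0..1})"
        unfolding 1(1) by (simp add: c'_def)
      also have "(\<Union>e\<in>Ed - {e1, e2}. c' e ` {0..1}) = (\<Union>e\<in>Ed - {e1, e2}. c e ` {0..1})"
        by (rule SUP_cong) (auto simp: c'_def)
      finally show ?thesis unfolding img using 1(2) by (metis UN_insert Un_assoc)
    qed
    thus "topspace X = (\<Union>e\<in>Ed - {e2}. c' e ` {0..1})" using cov by simp
    fix e e' s t assume h: "e \<in> Ed - {e2}" "e' \<in> Ed - {e2}" "0 < t" "t < 1" "s \<in> {0..1}" "c' e t = c' e' s"
    show "e = e' \<and> s = t"
    proof (cases "e = e1")
      case True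
      hence "m t = c' e' s" using h(6) by (simp add: c'_def)
      from inm[OF h(3,4,2,5) this] True show ?thesis by simp
    next
      case False
      hence ce: "c e t = c' e' s" using h(6) by (simp add: c'_def)
      show ?thesis
      proof (cases "e' = e1")
        case e': False
        thus ?thesis using ce inner[of e e' t s] h by (auto simp: c'_def)
      next
        case True
        hence "c e t = m s" using ce by (simp add: c'_def)
        hence "c e t \<in> c e1 ` {0..1} \<union> c e2 ` {0..1}" using img h(5) by blast
        thus ?thesis using inner[of e _ t] h False E by blast
      qed
    qed
  qed (rule Haus pc finite_Diff[OF fin])+
  thus ?thesis by blast
qed

section \<open>Walks and the arcs they trace\<close>

fun wk :: "'x => ('e \<times> bool) list => bool" where
  "wk v [] \<longleftrightarrow> True"
| "wk v (d # ds) \<longleftrightarrow> d \<in> Dt \<and> dp d 0 = v \<and> wk (dp d 1) ds"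

fun en :: "'x => ('e \<times> bool) list => 'x" where
  "en v [] = v"
| "en v (d # ds) = en (dp d 1) ds"

definition vl :: "'x => ('e \<times> bool) list => 'x list" where
  "vl v ds = v # map (\<lambda>d. dp d 1) ds"

definition flip_dart :: "'e \<times> bool => 'e \<times> bool" where "flip_dart d = (fst d, \<not> snd d)"

lemma flip_dart: "dp (flip_dart d) 0 = dp d 1" "dp (flip_dart d) 1 = dp d 0" "d \<in> Dt ==> flip_dart d \<in> Dt" "fst (flip_dart d) = fst d"
  by (auto simp: flip_dart_def dp_def)

lemma wk_append: "wk v (as @ bs) \<longleftrightarrow> wk v as \<and> wk (en v as) bs" and en_append: "en v (as @ bs) = en (en v as) bs"
  by (induction as arbitrary: v) auto

lemma en_mem: "en v ds \<in> set (vl v ds)"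
  by (induction ds arbitrary: v) (auto simp: vl_def)

lemma wk_rev:
  assumes "wk v ds"
  shows "wk (en v ds) (map flip_dart (rev ds))" "en (en v ds) (map flip_dart (rev ds)) = v"
    "vl (en v ds) (map flip_dart (rev ds)) = rev (vl v ds)"
proof -
  have "wk (en v ds) (map flip_dart (rev ds)) \<and> en (en v ds) (map flip_dart (rev ds)) = v \<and>
    vl (en v ds) (map flip_dart (rev ds)) = rev (vl v ds)"
    using assms
  proof (induction ds arbitrary: v)
    case (Cons d ds)
    thus ?case using Cons.IH[of "dp d 1"] by (auto simp: wk_append en_append flip_dart vl_def)
  qed (simp add: vl_def)
  thus "wk (en v ds) (map flip_dart (rev ds))" "en (en v ds) (map flip_dart (rev ds)) = v"
    "vl (en v ds) (map flip_dart (rev ds)) = rev (vl v ds)" by blast+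
qed

lemma wk_darts: "wk v ds ==> d \<in> set ds ==> d \<in> Dt \<and> dp d 0 \<in> set (vl v ds) \<and> dp d 1 \<in> set (vl v ds)"
  by (induction ds arbitrary: v) (auto simp: vl_def)

text \<open>The empty walk has no constant path to offer, as its base point is not recorded; the
  lemmas on \<open>pl\<close> speak of nonempty walks.\<close>

fun pl :: "('e \<times> bool) list => real => 'x" where
  "pl [] = undefined"
| "pl [d] = dp d"
| "pl (d # d' # ds) = loop_concat (dp d) (pl (d' # ds))"

definition inn :: "('e \<times> bool) list => 'x set" where
  "inn ds = (\<Union>d\<in>set ds. dp d ` {0<..<1})"

lemma dp_inj_on:
  assumes d: "d \<in> Dt" "dp d 0 \<noteq> dp d 1" shows "inj_on (dp d) {0..1}"
proof (rule inj_onI)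
  fix s t assume s: "s \<in> {0..1}" and t: "t \<in> {0..1}" and e: "dp d s = dp d t"
  consider "0 < s \<and> s < 1" | "0 < t \<and> t < 1" | "s \<in> {0, 1}" "t \<in> {0, 1}" using s t by fastforce
  thus "s = t"
  proof cases
    case 1
    thus ?thesis using dp_inner[OF d(1) d(1) _ _ t e] by simp
  next
    case 2
    thus ?thesis using dp_inner[OF d(1) d(1) _ _ s e[symmetric]] by simp
  next
    case 3
    thus ?thesis using e d(2) by auto
  qed
qed

lemma dp_where: "t \<in> {0..1} ==> dp d t = dp d 0 \<and> t = 0 \<or> dp d t = dp d 1 \<and> t = 1 \<or> dp d t \<in> dp d ` {0<..<1} \<and> 0 < t \<and> t < 1"
  by (cases "t = 0"; cases "t = 1") auto

text \<open>Injectivity of the concatenation reduces to the claim that the first edge meets the rest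
  only in its end. A common interior point would identify the first edge with a later one, and then
  the starting vertex would occur twice.\<close>

lemma pl_path:
  assumes "wk v ds" "ds \<noteq> []" "distinct (vl v ds)"
  shows "pathin X (pl ds) \<and> pl ds 0 = v \<and> pl ds 1 = en v ds \<and> inj_on (pl ds) {0..1} \<and>
    (\<forall>t\<in>{0..1}. pl ds t \<in> set (vl v ds) \<union> inn ds)"
  using assms
proof (induction ds arbitrary: v rule: pl.induct)
  case (2 d)
  hence d: "d \<in> Dt" "dp d 0 = v" "dp d 0 \<noteq> dp d 1" by (auto simp: vl_def)
  have "dp d t \<in> set (vl v [d]) \<union> inn [d]" if "t \<in> {0..1}" for t
    using dp_where[OF that, of d] d by (auto simp: vl_def inn_def)
  thus ?case using d pathin_dp[OF d(1)] dp_inj_on[OF d(1,3)] by simp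
next
  case (3 d d' ds)
  let ?r = "d' # ds" and ?w = "dp d 1"
  have d: "d \<in> Dt" "dp d 0 = v" "v \<noteq> ?w" and r: "wk ?w ?r" "distinct (vl ?w ?r)" and vn: "v \<notin> set (vl ?w ?r)"
    using "3.prems" by (auto simp: vl_def)
  have IH: "pathin X (pl ?r)" "pl ?r 0 = ?w" "pl ?r 1 = en ?w ?r" "inj_on (pl ?r) {0..1}"
    "\<And>t. t \<in> {0..1} ==> pl ?r t \<in> set (vl ?w ?r) \<union> inn ?r"
    using "3.IH"[OF r(1) _ r(2)] by auto
  have cross: "s = 1 \<and> t = 0" if s: "s \<in> {0..1}" and t: "t \<in> {0..1}" and e: "dp d s = pl ?r t" for s t
  proof -
    have vert: "\<exists>g\<in>Dt. x = dp g 0 \<or> x = dp g 1" if "x \<in> set (vl ?w ?r)" for x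
    proof -
      have "x = ?w \<or> (\<exists>g\<in>set ?r. x = dp g 1)" using that by (auto simp: vl_def)
      thus ?thesis using d(1) wk_darts[OF r(1)] by blast
    qed
    have "dp d s = dp d 0 \<and> s = 0 \<or> dp d s = ?w \<and> s = 1 \<or> dp d s \<in> dp d ` {0<..<1} \<and> 0 < s \<and> s < 1" by (rule dp_where[OF s])
    thus ?thesis
    proof (elim disjE conjE)
      assume "dp d s = dp d 0"
      hence v: "pl ?r t = v" using e d(2) by simp
      hence "v \<in> inn ?r" using IH(5)[OF t] vn by auto
      then obtain g u where g: "g \<in> set ?r" "u \<in> {0<..<1}" "v = dp g u" unfolding inn_def by blast
      have "g \<in> Dt" using wk_darts[OF r(1) g(1)] by blast
      thus ?thesis using inner_not_vertex(1)[of g d u] g(2,3) d by auto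
    next
      assume "dp d s = ?w" "s = 1"
      hence "pl ?r t = pl ?r 0" using e IH(2) by simp
      from inj_onD[OF IH(4) this t] \<open>s = 1\<close> show ?thesis by simp
    next
      assume s': "0 < s" "s < 1"
      have "pl ?r t \<notin> set (vl ?w ?r)"
      proof
        assume "pl ?r t \<in> set (vl ?w ?r)"
        from vert[OF this] obtain g where "g \<in> Dt" "dp d s = dp g 0 \<or> dp d s = dp g 1" using e by auto
        thus False using inner_not_vertex[OF d(1) _ s', of g] by blast
      qed
      hence "pl ?r t \<in> inn ?r" using IH(5)[OF t] by blast
      then obtain g u where g': "g \<in> set ?r" "u \<in> {0<..<1}" "pl ?r t = dp g u" unfolding inn_def by blast
      hence g: "g \<in> set ?r" "0 < u" "u < 1" "dp d s = dp g u" using e by auto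
      have gD: "g \<in> Dt" "dp g 0 \<in> set (vl ?w ?r)" "dp g 1 \<in> set (vl ?w ?r)" using wk_darts[OF r(1) g(1)] by auto
      from dp_inner[OF d(1) gD(1) s' _ g(4)] g(2,3) have "fst d = fst g" by auto
      hence "v = dp g 0 \<or> v = dp g 1" using d(2) by (cases "snd d"; cases "snd g") (auto simp: dp_def)
      thus ?thesis using gD(2,3) vn by auto
    qed
  qed
  let ?p = "loop_concat (dp d) (pl ?r)"
  have p: "pathin X ?p" by (rule pathin_loop_concat[OF pathin_dp[OF d(1)] IH(1)]) (simp add: IH)
  have dinj: "inj_on (dp d) {0..1}" using dp_inj_on[OF d(1)] d by simp
  have inj: "inj_on ?p {0..1}"
  proof -
    have ne: "?p s \<noteq> ?p t" if st: "s \<in> {0..1}" "t \<in> {0..1}" "s < t" for s t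
    proof (cases "t \<le> 1/2")
      case True
      have "2 * s \<in> {0..1}" "2 * t \<in> {0..1}" using st True by auto
      thus ?thesis using inj_onD[OF dinj, of "2 * s" "2 * t"] st True by (auto simp: loop_concat_def)
    next
      case t2: False
      show ?thesis
      proof (cases "s \<le> 1/2")
        case True
        have "2 * s \<in> {0..1}" "2 * t - 1 \<in> {0..1}" using st True t2 by auto
        thus ?thesis using cross[of "2 * s" "2 * t - 1"] True t2 by (auto simp: loop_concat_def)
      next
        case False
        have "2 * s - 1 \<in> {0..1}" "2 * t - 1 \<in> {0..1}" using st False t2 by auto
        thus ?thesis using inj_onD[OF IH(4), of "2 * s - 1" "2 * t - 1"] st False t2 by (auto simp: loop_concat_def)
      qed
    qed
    show ?thesis
      by (rule inj_onI) (use ne in \<open>metis linorder_less_linear\<close>)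
  qed
  have "?p t \<in> set (vl v (d # ?r)) \<union> inn (d # ?r)" if t: "t \<in> {0..1}" for t
  proof (cases "t \<le> 1/2")
    case True
    have "2 * t \<in> {0..1}" using t True by auto
    thus ?thesis using dp_where[of "2 * t" d] True d(2) by (auto simp: loop_concat_def vl_def inn_def)
  next
    case False
    have "2 * t - 1 \<in> {0..1}" using t False by auto
    from IH(5)[OF this] show ?thesis using False by (auto simp: loop_concat_def vl_def inn_def)
  qed
  thus ?case using p inj d(2) IH(3) by (simp del: pl.simps(1,2))
qed simp

end

lemma ix_mem: "l \<in> set xs ==> ix xs l < length xs \<and> xs ! ix xs l = l"
  by (induction xs) (auto simp: ix_def)

context tgraph
begin

text \<open>A common point of two of the arcs is either interior to edges of both walks, hence to a
  shared edge, or a vertex of both; vertices are never interior points.\<close>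

lemma theta_of_walks:
  assumes w: "\<And>i. i < (3::nat) ==> wk v (A i) \<and> A i \<noteq> [] \<and> distinct (vl v (A i)) \<and> en v (A i) = w"
    and vv: "\<And>i j. i < 3 ==> j < 3 ==> i \<noteq> j ==> set (vl v (A i)) \<inter> set (vl v (A j)) \<subseteq> {v, w}"
    and ee: "\<And>i j. i < 3 ==> j < 3 ==> i \<noteq> j ==> fst ` set (A i) \<inter> fst ` set (A j) = {}"
  shows "theta X (\<lambda>i. pl (A i))"
proof -
  have p: "pathin X (pl (A i))" "pl (A i) 0 = v" "pl (A i) 1 = w" "inj_on (pl (A i)) {0..1}"
    "\<And>t. t \<in> {0..1} ==> pl (A i) t \<in> set (vl v (A i)) \<union> inn (A i)" if "i < 3" for i
    using pl_path[of v "A i"] w[OF that] by auto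
  have vert: "\<exists>g\<in>Dt. x = dp g 0 \<or> x = dp g 1" if i: "i < 3" and x: "x \<in> set (vl v (A i))" for i x
  proof -
    obtain d ds where d: "A i = d # ds" using w[OF i] by (cases "A i") auto
    have "x = v \<or> (\<exists>g\<in>set (A i). x = dp g 1)" using x by (auto simp: vl_def)
    moreover have "d \<in> Dt" "dp d 0 = v" using w[OF i] d by auto
    moreover have "g \<in> Dt" if "g \<in> set (A i)" for g using wk_darts[of v "A i" g] w[OF i] that by blast
    ultimately show ?thesis by blast
  qed
  have mixed: False if i: "i < 3" "j < 3" and x: "x \<in> set (vl v (A i))" "x \<in> inn (A j)" for i j x
  proof -
    obtain g where g: "g \<in> Dt" "x = dp g 0 \<or> x = dp g 1" using vert[OF i(1) x(1)] by blast
    obtain h u where h: "h \<in> set (A j)" "u \<in> {0<..<1}" "x = dp h u" using x(2) unfolding inn_def by blast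
    have "h \<in> Dt" using wk_darts[of v "A j" h] w[OF i(2)] h(1) by blast
    thus False using inner_not_vertex[OF _ g(1), of h u] h g by auto
  qed
  show ?thesis
  proof
    show "pathin X (pl (A i))" if "i < 3" for i by (rule p(1)[OF that])
    show "pl (A i) 0 = pl (A j) 0" "pl (A i) 1 = pl (A j) 1" if "i < 3" "j < 3" for i j using p(2,3) that by auto
    fix i j :: nat and s t :: real
    assume ij: "i < 3" "j < 3" and st: "s \<in> {0..1}" "t \<in> {0..1}" and e: "pl (A i) s = pl (A j) t"
    show "i = j \<and> s = t \<or> s = 0 \<and> t = 0 \<or> s = 1 \<and> t = 1"
    proof (cases "i = j")
      case True
      thus ?thesis using inj_onD[OF p(4)[OF ij(1)] _ st] e by simp
    next
      case False
      let ?x = "pl (A i) s"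
      have x: "?x \<in> set (vl v (A i)) \<union> inn (A i)" "?x \<in> set (vl v (A j)) \<union> inn (A j)"
        using p(5)[OF ij(1) st(1)] p(5)[OF ij(2) st(2)] e by auto
      have "\<not> (?x \<in> inn (A i) \<and> ?x \<in> inn (A j))"
      proof
        assume a: "?x \<in> inn (A i) \<and> ?x \<in> inn (A j)"
        obtain g u where g: "g \<in> set (A i)" "u \<in> {0<..<1}" "?x = dp g u" using a unfolding inn_def by blast
        obtain h r where h: "h \<in> set (A j)" "r \<in> {0<..<1}" "?x = dp h r" using a unfolding inn_def by blast
        have D: "g \<in> Dt" "h \<in> Dt" using wk_darts[of v "A i" g] wk_darts[of v "A j" h] w[OF ij(1)] w[OF ij(2)] g(1) h(1) by blast+
        have "dp g u = dp h r" using g(3) h(3) by simp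
        from dp_inner[OF D _ _ _ this] g(2) h(2) have "fst g = fst h" by auto
        thus False using ee[OF ij False] g(1) h(1) by blast
      qed
      hence "?x \<in> set (vl v (A i))" "?x \<in> set (vl v (A j))"
        using x mixed[OF ij, of ?x] mixed[OF ij(2,1), of ?x] by blast+
      hence "?x \<in> {v, w}" using vv[OF ij False] by blast
      then consider "?x = pl (A i) 0" "pl (A j) t = pl (A j) 0" | "?x = pl (A i) 1" "pl (A j) t = pl (A j) 1"
        using p(2,3)[OF ij(1)] p(2,3)[OF ij(2)] e by auto
      thus ?thesis
      proof cases
        case 1
        thus ?thesis using inj_onD[OF p(4)[OF ij(1)] 1(1) st(1)] inj_onD[OF p(4)[OF ij(2)] 1(2) st(2)] by simp
      next
        case 2
        thus ?thesis using inj_onD[OF p(4)[OF ij(1)] 2(1) st(1)] inj_onD[OF p(4)[OF ij(2)] 2(2) st(2)] by simp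
      qed
    qed
  qed
qed

lemma en_take: "i < length ds ==> en v (take (Suc i) ds) = dp (ds ! i) 1"
proof (induction ds arbitrary: v i)
  case (Cons d ds)
  thus ?case by (cases i) auto
qed simp

text \<open>All neighbours of the start \<open>v\<close> of a longest path lie on it. Three darts at
  \<open>v\<close> hit the path at three places, in order: the first continues along the path to the
  place of the second, and the third runs back along the path to it, which gives three arcs from
  \<open>v\<close> to \<open>w\<close>.\<close>

lemma walk_theta:
  assumes noloop: "\<And>e. e \<in> Ed ==> c e 0 \<noteq> c e 1"
    and deg: "\<And>d. d \<in> Dt ==> card (Dv (dp d 0)) \<ge> 3"
  shows "\<exists>\<gamma>. theta X \<gamma>"
proof -
  let ?e = "\<lambda>d. dp d 1"
  define V where "V = (\<lambda>d. dp d 0) ` Dt"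
  have fV: "finite V" unfolding V_def using fin by auto
  have noloop': "dp d 0 \<noteq> dp d 1" if "d \<in> Dt" for d
    using noloop[of "fst d"] that by (cases "snd d") (auto simp: dp_def)
  have V1: "dp d 1 \<in> V" if "d \<in> Dt" for d
    unfolding V_def using flip_dart(1)[of d] flip_dart(3)[OF that] by (metis imageI)
  define S where "S p \<longleftrightarrow> wk (fst p) (snd p) \<and> distinct (vl (fst p) (snd p))" for p :: "'x \<times> ('e \<times> bool) list"
  \<comment> \<open>A walk without repeated vertices has at most as many vertices as the graph, so a
    longest one exists.\<close>
  have bound: "length (snd p) < Suc (card V)" if p: "S p" for p
  proof (cases "snd p = []")
    case False
    then obtain d ds where d: "snd p = d # ds" by (cases "snd p") auto
    have "set (vl (fst p) (snd p)) \<subseteq> V"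
    proof
      fix x assume "x \<in> set (vl (fst p) (snd p))"
      hence "x = fst p \<or> (\<exists>g\<in>set (snd p). x = dp g 1)" by (auto simp: vl_def)
      thus "x \<in> V"
      proof
        assume "x = fst p"
        moreover have "d \<in> Dt" "dp d 0 = fst p" using p d by (auto simp: S_def)
        ultimately show ?thesis unfolding V_def by (metis imageI)
      next
        assume "\<exists>g\<in>set (snd p). x = dp g 1"
        then obtain g where "g \<in> set (snd p)" "x = dp g 1" by blast
        thus ?thesis using V1 wk_darts[of "fst p" "snd p" g] p by (auto simp: S_def)
      qed
    qed
    from card_mono[OF fV this] have "length (vl (fst p) (snd p)) \<le> card V"
      using p distinct_card unfolding S_def by metis
    thus ?thesis by (simp add: vl_def)
  qed simp
  obtain e where e: "e \<in> Ed" using ne by blast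
  have S0: "S (dp (e, True) 0, [(e, True)])"
    using noloop'[of "(e, True)"] e by (auto simp: S_def vl_def)
  have "\<exists>p. S p \<and> (\<forall>q. S q \<longrightarrow> length (snd q) \<le> length (snd p))"
    using ex_has_greatest_nat[of S "(dp (e, True) 0, [(e, True)])" "\<lambda>p. length (snd p)" "Suc (card V)"] S0 bound by blast
  then obtain p where p: "S p" "\<And>q. S q ==> length (snd q) \<le> length (snd p)" by blast
  define v where "v = fst p"
  define ds where "ds = snd p"
  have wkd: "wk v ds" "distinct (vl v ds)" using p(1) by (auto simp: S_def v_def ds_def)
  have max: "length ds' \<le> length ds" if "wk v' ds'" "distinct (vl v' ds')" for v' ds'
    using p(2)[of "(v', ds')"] that by (simp add: S_def ds_def)
  have "length ds \<ge> 1" using p(2)[OF S0] by (simp add: ds_def)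
  then obtain d0 ds0 where d0: "ds = d0 # ds0" by (cases ds) auto
  have v0: "d0 \<in> Dt" "dp d0 0 = v" using wkd(1) d0 by auto
  \<comment> \<open>Otherwise the reversed dart could be put in front of the path, making it
    longer.\<close>
  have nb: "dp x 1 \<in> set (map ?e ds)" if x: "x \<in> Dv v" for x
  proof (rule ccontr)
    assume n: "dp x 1 \<notin> set (map ?e ds)"
    have xD: "x \<in> Dt" "dp x 0 = v" using x by (auto simp: Dv_def)
    have "wk (dp x 1) (flip_dart x # ds)" using xD wkd(1) flip_dart[of x] by simp
    moreover have "distinct (vl (dp x 1) (flip_dart x # ds))"
      using n wkd(2) noloop'[OF xD(1)] xD(2) flip_dart(2)[of x] by (auto simp: vl_def)
    ultimately have "length (flip_dart x # ds) \<le> length ds" by (rule max)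
    thus False by simp
  qed
  define idx where "idx x = ix (map ?e ds) (dp x 1)" for x
  have idx: "idx x < length ds" "dp (ds ! idx x) 1 = dp x 1" if "x \<in> Dv v" for x
    using ix_mem[OF nb[OF that]] by (auto simp: idx_def)
  have "card (Dv v) \<ge> 3" using deg[OF v0(1)] v0(2) by simp
  then obtain T where T: "T \<subseteq> Dv v" "card T = 3" by (metis obtain_subset_with_card_n)
  have fT: "finite T" using T(2) by (metis card.infinite zero_neq_numeral)
  obtain ts where ts: "set ts = T" "distinct ts" using finite_distinct_list[OF fT] by blast
  \<comment> \<open>Sorting by the place of arrival; parallel edges arrive at equal places, so the
    indices are ordered only weakly and the segments \<open>B\<close> and \<open>C\<close> may be
    empty.\<close>
  define xs where "xs = sort_key idx ts"
  have xs: "set xs = T" "distinct xs" "sorted (map idx xs)" using ts by (auto simp: xs_def)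
  have "length xs = 3" using xs T(2) distinct_card by metis
  then obtain x1 x2 x3 where x: "xs = [x1, x2, x3]"
    by (auto simp: numeral_3_eq_3 length_Suc_conv)
  have xD: "x1 \<in> Dv v" "x2 \<in> Dv v" "x3 \<in> Dv v" "x1 \<noteq> x2" "x1 \<noteq> x3" "x2 \<noteq> x3" using x xs T(1) by auto
  define i1 where "i1 = idx x1"
  define i2 where "i2 = idx x2"
  define i3 where "i3 = idx x3"
  have le: "i1 \<le> i2" "i2 \<le> i3" "i3 < length ds" using xs(3) x idx(1)[OF xD(3)] by (auto simp: i1_def i2_def i3_def)
  define A where "A = take (Suc i1) ds"
  define B where "B = drop (Suc i1) (take (Suc i2) ds)"
  define C where "C = drop (Suc i2) (take (Suc i3) ds)"
  define R where "R = drop (Suc i3) ds"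
  have AB: "A @ B = take (Suc i2) ds"
    using append_take_drop_id[of "Suc i1" "take (Suc i2) ds"] le by (simp add: A_def B_def take_take min_def)
  have ABC: "(A @ B) @ C = take (Suc i3) ds"
    using append_take_drop_id[of "Suc i2" "take (Suc i3) ds"] le unfolding AB by (simp add: C_def take_take min_def)
  have dsE: "ds = A @ B @ C @ R"
    using append_take_drop_id[of "Suc i3" ds, folded ABC R_def] by simp
  define w where "w = dp x2 1"
  have enA: "en v A = dp x1 1" and enAB: "en (dp x1 1) B = w" and enC: "en w C = dp x3 1"
  proof -
    show 1: "en v A = dp x1 1" using en_take[of i1 ds v] idx(2)[OF xD(1)] le by (simp add: A_def i1_def)
    have 2: "en v (A @ B) = w" unfolding AB using en_take[of i2 ds v] idx(2)[OF xD(2)] le by (simp add: w_def i2_def)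
    thus "en (dp x1 1) B = w" using 1 by (simp add: en_append)
    have "en v ((A @ B) @ C) = dp x3 1" unfolding ABC using en_take[of i3 ds v] idx(2)[OF xD(3)] le by (simp add: i3_def)
    thus "en w C = dp x3 1" using 2 by (simp only: en_append)
  qed
  have wk: "wk (dp x1 1) B" "wk w C"
    using wkd(1) enA enAB unfolding dsE wk_append by (auto simp: en_append)
  have dist: "distinct (v # map ?e A @ map ?e B @ map ?e C)" using wkd(2) unfolding dsE vl_def by auto
  have eA: "dp x1 1 \<in> set (map ?e A)"
  proof -
    have "A = d0 # take i1 ds0" by (simp add: A_def d0)
    thus ?thesis using en_mem[of "dp d0 1" "take i1 ds0"] enA by (auto simp: vl_def)
  qed
  have wAB: "w \<in> set (map ?e A) \<union> set (map ?e B)"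
    using en_mem[of "dp x1 1" B] enAB eA by (auto simp: vl_def)
  have x3C: "dp x3 1 \<in> insert w (set (map ?e C))" using en_mem[of w C] enC by (auto simp: vl_def)
  define L where "L = tri (x1 # B) [x2] (x3 # map flip_dart (rev C))"
  note rv = wk_rev[OF wk(2), unfolded enC]
  have vs0: "vl v (x1 # B) = v # dp x1 1 # map ?e B" and vs1: "vl v [x2] = [v, w]"
    and vs2: "vl v (x3 # map flip_dart (rev C)) = v # rev (vl w C)"
    using rv(3) by (auto simp: vl_def w_def)
  have xx: "x \<in> Dt" "dp x 0 = v" if "x \<in> Dv v" for x using that by (auto simp: Dv_def)
  have Bd: "d \<in> Dt \<and> dp d 0 \<in> insert (dp x1 1) (set (map ?e B)) \<and> dp d 1 \<in> set (map ?e B)" if "d \<in> set B" for d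
    using wk_darts[OF wk(1) that] that by (auto simp: vl_def)
  have Cd: "d \<in> Dt \<and> dp d 0 \<in> insert w (set (map ?e C)) \<and> dp d 1 \<in> set (map ?e C)" if "d \<in> set C" for d
    using wk_darts[OF wk(2) that] that by (auto simp: vl_def)
  have same: "dp d 0 = dp g 0 \<and> dp d 1 = dp g 1 \<or> dp d 0 = dp g 1 \<and> dp d 1 = dp g 0" if "fst d = fst g" for d g
    using that by (cases "snd d"; cases "snd g") (auto simp: dp_def)
  have nB: "v \<notin> set (map ?e A)" "v \<notin> set (map ?e B)" "v \<notin> set (map ?e C)"
    "set (map ?e A) \<inter> set (map ?e B) = {}" "set (map ?e A) \<inter> set (map ?e C) = {}" "set (map ?e B) \<inter> set (map ?e C) = {}"
    using dist by auto
  have wv: "w \<noteq> v" "dp x1 1 \<noteq> v" using wAB nB eA by auto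
  have wC: "w \<notin> set (map ?e C)" using wAB nB by blast
  have fx: "fst x \<noteq> fst y" if "x \<in> Dv v" "y \<in> Dv v" "x \<noteq> y" for x y
  proof
    assume f: "fst x = fst y"
    hence "snd x \<noteq> snd y" using that(3) by (cases x; cases y) auto
    hence "dp x 0 = dp y 1" using f by (cases "snd x"; cases "snd y") (auto simp: dp_def)
    thus False using xx[OF that(1)] xx[OF that(2)] noloop'[of y] by simp
  qed
  have fB: "fst x \<noteq> fst d" if "x \<in> Dv v" "d \<in> set B \<union> set C" for x d
  proof
    assume "fst x = fst d"
    hence "v = dp d 0 \<or> v = dp d 1" using same[of x d] xx[OF that(1)] by auto
    thus False using that(2) Bd[of d] Cd[of d] nB wv by auto
  qed
  have fBC: "fst d \<noteq> fst g" if d: "d \<in> set B" "g \<in> set C" for d g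
  proof
    assume "fst d = fst g"
    hence "dp d 1 \<in> insert w (set (map ?e C))" "dp d 0 \<in> insert w (set (map ?e C))" using same[of d g] Cd[OF d(2)] by auto
    moreover have "y \<notin> set (map ?e C)" if "y \<in> insert (dp x1 1) (set (map ?e B))" for y
      using that eA nB(5,6) by (metis disjoint_iff insert_iff)
    hence "dp d 0 \<notin> set (map ?e C)" "dp d 1 \<notin> set (map ?e C)" using Bd[OF d(1)] by blast+
    ultimately have "dp d 0 = dp d 1" by auto
    thus False using noloop' Bd[OF d(1)] by blast
  qed
  have ff: "fst ` set (map flip_dart (rev C)) = fst ` set C" by (simp add: image_image flip_dart(4))
  have setL2: "set (vl v (L 2)) = {v, w} \<union> set (map ?e C)" unfolding L_def tri_simps vs2 by (auto simp: vl_def)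
  have setL0: "set (vl v (L 0)) = {v, dp x1 1} \<union> set (map ?e B)" unfolding L_def tri_simps vs0 by auto
  have setL1: "set (vl v (L 1)) = {v, w}" unfolding L_def One_nat_def tri_simps vs1 by auto
  have "theta X (\<lambda>i. pl (L i))"
  proof (rule theta_of_walks[where v = v and w = w])
    fix i :: nat assume "i < 3"
    then consider "i = 0" | "i = 1" | "i = 2" by linarith
    thus "wk v (L i) \<and> L i \<noteq> [] \<and> distinct (vl v (L i)) \<and> en v (L i) = w"
    proof cases
      case 1
      have "distinct (vl v (x1 # B))" unfolding vs0 using dist nB eA wv by auto
      thus ?thesis using 1 xx[OF xD(1)] wk enAB by (simp add: L_def)
    next
      case 2
      have "distinct (vl v [x2])" unfolding vs1 using wv by simp
      thus ?thesis using 2 xx[OF xD(2)] by (simp add: L_def w_def)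
    next
      case 3
      have "distinct (vl v (x3 # map flip_dart (rev C)))" unfolding vs2 using dist nB wC wv by (auto simp: vl_def)
      thus ?thesis using 3 xx[OF xD(3)] rv(1,2) by (simp add: L_def)
    qed
  next
    have 01: "set (vl v (L 0)) \<inter> set (vl v (L 1)) \<subseteq> {v, w}" and 12: "set (vl v (L 1)) \<inter> set (vl v (L 2)) \<subseteq> {v, w}"
      unfolding setL1 by auto
    have 02: "set (vl v (L 0)) \<inter> set (vl v (L 2)) \<subseteq> {v, w}" unfolding setL0 setL2 using nB eA by blast
    fix i j :: nat assume ij: "i < 3" "j < 3" "i \<noteq> j"
    thus "set (vl v (L i)) \<inter> set (vl v (L j)) \<subseteq> {v, w}"
      using 01 12 02 unfolding less3 by (elim disjE; hypsubst; blast)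
  next
    have 01: "fst ` set (L 0) \<inter> fst ` set (L 1) = {}"
      using fx[OF xD(1,2,4)] fB[OF xD(2)] unfolding L_def One_nat_def tri_simps by auto
    have 12: "fst ` set (L 1) \<inter> fst ` set (L 2) = {}"
      using fx[OF xD(2,3,6)] fB[OF xD(2)] unfolding L_def One_nat_def tri_simps list.set image_insert ff by auto
    have 02: "fst ` set (L 0) \<inter> fst ` set (L 2) = {}"
      using fx[OF xD(1,3,5)] fB[OF xD(1)] fB[OF xD(3)] fBC unfolding L_def tri_simps list.set image_insert ff by fastforce
    fix i j :: nat assume ij: "i < 3" "j < 3" "i \<noteq> j"
    thus "fst ` set (L i) \<inter> fst ` set (L j) = {}"
      using 01 12 02 unfolding less3 by (elim disjE; hypsubst; blast)
  qed
  thus ?thesis by blast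
qed

text \<open>If the other end of the leaf edge also has degree 1, the graph is an interval. Otherwise
  its degree is at least 3, as degree 2 is excluded, and two further darts are available for the
  wall.\<close>

lemma leaf_case:
  fixes P :: "('c, 'd) pre_digraph"
  assumes P: "graph P" "Digraph_Component.connected P" "card (verts P) \<ge> 2" and n: "n \<ge> 2"
    and s: "s \<in> topspace (uconf_space n X)"
    and e0: "e0 \<in> Ed" and D: "Dv (c e0 1) = {(e0, False)}"
    and nl: "\<And>e. e \<in> Ed ==> c e 0 \<noteq> c e 1" and two: "\<And>v. card (Dv v) \<noteq> 2"
  shows "\<not> fundamental_group (uconf_space n X) s \<cong> raag P"
proof -
  have dF: "(e0, False) \<in> Dt" "dp (e0, False) 0 = c e0 1" using e0 by (auto simp: dp_def)
  have l: "leaf_edge e0"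
    unfolding leaf_edge_def
  proof (intro conjI ballI impI e0)
    fix e t assume e: "e \<in> Ed" "t \<in> {0..1}" "c e t = c e0 1"
    have "c e t = dp (e0, False) 0" using e(3) dF(2) by simp
    from edge_vertex[OF e(1) dF(1) e(2) this] show "e = e0" "t = 1" using D dF(2) by auto
  qed
  let ?v = "c e0 0"
  have eT: "(e0, True) \<in> Dv ?v" using e0 by (simp add: Dv_def dp_def)
  show ?thesis
  proof (cases "Dv ?v = {(e0, True)}")
    case True
    \<comment> \<open>No other edge touches this one, so it is open as well as closed, and
      connectedness makes it the whole graph.\<close>
    have "openin X (c e0 ` {0..1})"
    proof (rule open_criterion)
      show "c e0 ` {0..1} \<subseteq> topspace X" using cov e0 by blast
      fix e assume e: "e \<in> Ed"
      have "{t \<in> {0..1}. c e t \<in> c e0 ` {0..1}} = (if e = e0 then {0..1} else {})"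
      proof (cases "e = e0")
        case False
        have "c e t \<notin> c e0 ` {0..1}" if t: "t \<in> {0..1}" for t
        proof
          assume "c e t \<in> c e0 ` {0..1}"
          then obtain u where u: "u \<in> {0..1}" "c e t = c e0 u" by blast
          have "\<not> (0 < u \<and> u < 1)" using inner[OF e0 e _ _ t u(2)[symmetric]] False by blast
          moreover have "u \<noteq> 1" using l u e t False unfolding leaf_edge_def by blast
          ultimately have "u = 0" using u(1) by auto
          hence "c e t = dp (e0, True) 0" using u(2) by (simp add: dp_def)
          from edge_vertex[OF e _ t this] e0 True False show False by (auto simp: dp_def)
        qed
        thus ?thesis using False by auto
      qed auto
      thus "openin (top_of_set {0..1}) {t \<in> {0..1}. c e t \<in> c e0 ` {0..1}}" by simp
    qed
    moreover have "closedin X (c e0 ` {0..1})" by (rule closed_edge[OF e0])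
    moreover have "connected_space X" using pc path_connected_imp_connected_space by blast
    moreover have "c e0 ` {0..1} \<noteq> {}" by simp
    ultimately have full: "c e0 ` {0..1} = topspace X" unfolding connected_space_clopen_in by blast
    have "Ed = {e0}"
    proof -
      have "e = e0" if e: "e \<in> Ed" for e
      proof -
        have "c e (1/2) \<in> c e0 ` {0..1}" unfolding full using pathin_topspace[OF pth[OF e], of "1/2"] by simp
        then obtain u where "u \<in> {0..1}" "c e (1/2) = c e0 u" by blast
        thus ?thesis using inner[OF e e0, of "1/2" u] by simp
      qed
      thus ?thesis using e0 by blast
    qed
    thus ?thesis using interval_not_raag[OF P(1,3) _ s l] n by simp
  next
    case False
    have "card (Dv ?v) \<noteq> 1" using False eT by (metis card_1_singletonE singletonD)
    moreover have "card (Dv ?v) \<noteq> 0" using eT finite_Dv by (metis card_0_eq empty_iff)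
    ultimately have "card (Dv ?v) \<ge> 3" using two[of ?v] by linarith
    hence "card (Dv ?v - {(e0, True)}) \<ge> 2" using eT finite_Dv by simp
    then obtain T where T: "T \<subseteq> Dv ?v - {(e0, True)}" "card T = 2" by (metis obtain_subset_with_card_n)
    then obtain d1 d2 where "T = {d1, d2}" "d1 \<noteq> d2" by (auto simp: card_2_iff)
    thus ?thesis using leaf_not_raag[OF P n s l, of d1 d2] T(1) by blast
  qed
qed

text \<open>Minimality is over all decompositions of the same space. A vertex of degree 2 could be
  smoothed by \<open>merge\<close>; its two darts belong to different edges because loops have been
  dealt with before.\<close>

theorem minimal_not_raag:
  fixes P :: "('c, 'd) pre_digraph"
  assumes P: "graph P" "Digraph_Component.connected P" "card (verts P) \<ge> 2" and n: "n \<ge> 4"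
    and s: "s \<in> topspace (uconf_space n X)"
    and min: "\<And>Ed' c'. tgraph X Ed' c' ==> card Ed \<le> card (Ed' :: 'e set)"
  shows "\<not> fundamental_group (uconf_space n X) s \<cong> raag P"
proof (cases "\<exists>e\<in>Ed. c e 0 = c e 1")
  case True
  thus ?thesis using loop_not_raag[OF P _ s] n by auto
next
  case False
  hence nl: "c e 0 \<noteq> c e 1" if "e \<in> Ed" for e using that by blast
  have two: "card (Dv v) \<noteq> 2" for v
  proof
    assume "card (Dv v) = 2"
    then obtain d1 d2 where d: "Dv v = {d1, d2}" "d1 \<noteq> d2" by (auto simp: card_2_iff)
    have D: "d1 \<in> Dt" "d2 \<in> Dt" "dp d1 0 = v" "dp d2 0 = v" using d(1) by (auto simp: Dv_def)
    have "fst d1 \<noteq> fst d2"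
    proof
      assume f: "fst d1 = fst d2"
      hence "snd d1 \<noteq> snd d2" using d(2) by (cases d1; cases d2) auto
      hence "c (fst d2) 0 = c (fst d2) 1" using f D by (cases "snd d1"; cases "snd d2") (auto simp: dp_def)
      thus False using nl[of "fst d2"] D by auto
    qed
    moreover have "Dv v = {(fst d1, snd d1), (fst d2, snd d2)}" using d by simp
    ultimately obtain c' where "tgraph X (Ed - {fst d2}) c'" using merge by blast
    from min[OF this] have "card Ed \<le> card (Ed - {fst d2})" .
    moreover have "fst d2 \<in> Ed" using D by auto
    ultimately show False using fin card_Diff1_less by (metis not_less)
  qed
  show ?thesis
  proof (cases "\<exists>d\<in>Dt. card (Dv (dp d 0)) < 3")
    case False
    hence "card (Dv (dp d 0)) \<ge> 3" if "d \<in> Dt" for d using that by (meson not_less)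
    from walk_theta[OF nl this] obtain \<gamma> where "theta X \<gamma>" by blast
    then interpret theta X n \<gamma> .
    show ?thesis by (rule theta_not_raag[OF P(1) Haus n uconf_connected s])
  next
    case True
    then obtain d where d: "d \<in> Dt" "card (Dv (dp d 0)) < 3" by blast
    have "d \<in> Dv (dp d 0)" using d(1) by (simp add: Dv_def)
    hence "card (Dv (dp d 0)) > 0" using finite_Dv card_gt_0_iff by blast
    hence "card (Dv (dp d 0)) = 1" using d(2) two[of "dp d 0"] by linarith
    hence Dd: "Dv (dp d 0) = {d}" using \<open>d \<in> Dv (dp d 0)\<close> by (metis card_1_singletonE singletonD)
    show ?thesis
    proof (cases "snd d")
      case False
      hence "Dv (c (fst d) 1) = {(fst d, False)}" using Dd by (cases d) (simp add: dp_def)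
      moreover have "fst d \<in> Ed" "2 \<le> n" using d(1) n by auto
      ultimately show ?thesis using leaf_case[OF P _ s, of "fst d"] nl two by blast
    next
      case True
      have dE: "fst d \<in> Ed" using d(1) by auto
      \<comment> \<open>Here the vertex of degree 1 is at parameter 0 of its edge, so the reversed
        decomposition is used; its darts are the old ones with the direction negated.\<close>
      interpret r: tgraph X Ed "\<lambda>e t. c e (1 - t)" by (rule tgraph_reverse)
      have dp: "r.dp g t = dp (fst g, \<not> snd g) t" for g t by (simp add: r.dp_def dp_def)
      have Dv: "r.Dv v = (\<lambda>g. (fst g, \<not> snd g)) ` Dv v" for v
      proof (intro equalityI subsetI)
        fix g assume "g \<in> r.Dv v"
        hence "(fst g, \<not> snd g) \<in> Dv v" by (auto simp: r.Dv_def Dv_def dp)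
        thus "g \<in> (\<lambda>g. (fst g, \<not> snd g)) ` Dv v" by (rule image_eqI[rotated]) simp
      next
        fix g assume "g \<in> (\<lambda>g. (fst g, \<not> snd g)) ` Dv v"
        thus "g \<in> r.Dv v" by (auto simp: r.Dv_def Dv_def dp)
      qed
      have "inj_on (\<lambda>g. (fst g, \<not> snd g)) (Dv v)" for v by (rule inj_onI) (auto simp: prod_eq_iff)
      from card_image[OF this] have two': "card (r.Dv v) \<noteq> 2" for v using two[of v] unfolding Dv by simp
      have "r.Dv (dp d 0) = {(fst d, False)}" unfolding Dv Dd using True by simp
      moreover have "dp d 0 = c (fst d) (1 - 1)" using True by (simp add: dp_def)
      ultimately have D1: "r.Dv (c (fst d) (1 - 1)) = {(fst d, False)}" by simp
      have nl': "c e (1 - 0) \<noteq> c e (1 - 1)" if "e \<in> Ed" for e using nl[OF that] by simp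
      have "2 \<le> n" using n by simp
      from r.leaf_case[OF P this s dE D1 nl' two'] show ?thesis by blast
    qed
  qed
qed

end

lemma Hausdorff_space_real_functions:
  assumes "\<And>x y. x \<in> topspace X ==> y \<in> topspace X ==> x \<noteq> y ==>
    \<exists>f. continuous_map X euclideanreal f \<and> f x \<noteq> f y"
  shows "Hausdorff_space X"
  unfolding Hausdorff_space_def
proof (intro allI impI)
  fix x y assume xy: "x \<in> topspace X \<and> y \<in> topspace X \<and> x \<noteq> y"
  then obtain f where f: "continuous_map X euclideanreal f" "f x \<noteq> f y" using assms by blast
  obtain U V where UV: "open U" "open V" "f x \<in> U" "f y \<in> V" "U \<inter> V = {}"
    using hausdorff[OF f(2)] by blast
  have "openin X {z \<in> topspace X. f z \<in> U}" "openin X {z \<in> topspace X. f z \<in> V}"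
    using f(1) UV(1,2) by (auto intro: openin_continuous_map_preimage)
  moreover have "disjnt {z \<in> topspace X. f z \<in> U} {z \<in> topspace X. f z \<in> V}"
    using UV(5) by (auto simp: disjnt_def)
  ultimately show "\<exists>U V. openin X U \<and> openin X V \<and> x \<in> U \<and> y \<in> V \<and> disjnt U V"
    using UV(3,4) xy by (intro exI[of _ "{z \<in> topspace X. f z \<in> U}"] exI[of _ "{z \<in> topspace X. f z \<in> V}"]) simp
qed

section \<open>The realization as a topological graph\<close>

context wf_digraph
begin

lemma continuous_map_realization:
  fixes f :: "'a + 'b \<times> real => real"
  assumes "\<And>e. e \<in> arcs G ==> continuous_on {0..1} (\<lambda>t. f (char_map G e t))"
  shows "continuous_map (realization G) euclideanreal f"
  unfolding continuous_map_def
proof (intro conjI allI impI)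
  fix U :: "real set" assume "openin euclideanreal U"
  hence U: "open U" by simp
  have pts: "char_map G e t \<in> realization_points G" if "e \<in> arcs G" for e t
    using that by (auto simp: char_map_def realization_points_def)
  have "openin (top_of_set {0..1}) {t \<in> {0..1}. char_map G e t \<in> {x \<in> realization_points G. f x \<in> U}}"
    if e: "e \<in> arcs G" for e
  proof -
    have "{t \<in> {0..1}. char_map G e t \<in> {x \<in> realization_points G. f x \<in> U}} =
        {0..1} \<inter> (\<lambda>t. f (char_map G e t)) -` U"
      using pts[OF e] by auto
    thus ?thesis using assms[OF e] U continuous_openin_preimage_gen by metis
  qed
  thus "openin (realization G) {x \<in> topspace (realization G). f x \<in> U}"
    unfolding openin_realization topspace_realization[OF wf_digraph_axioms] by blast
qed simp

text \<open>Vanishes at both ends of \<open>e\<close>, hence is continuous. The exponent 1 separates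
  interior points of \<open>e\<close> from all points off \<open>e\<close> and, together with the
  exponent 2, from each other.\<close>

definition bump :: "'b => nat => 'a + 'b \<times> real => real" where
  "bump e k x = (case x of Inl v => 0 | Inr (e', t) => if e' = e then t ^ k * (1 - t) else 0)"

definition tent :: "'a => 'a + 'b \<times> real => real" where
  "tent u x = (case x of Inl v => if v = u then 1 else 0 | Inr (e, t) =>
     (1 - t) * (if tail G e = u then 1 else 0) + t * (if head G e = u then 1 else 0))"

lemma continuous_bump: "k > 0 ==> continuous_map (realization G) euclideanreal (bump e k)"
proof (rule continuous_map_realization)
  fix e' assume k: "k > 0"
  have "continuous_on {0..1} (\<lambda>t::real. if e' = e then t ^ k * (1 - t) else 0)"
    by (cases "e' = e") (auto intro!: continuous_intros)
  thus "continuous_on {0..1} (\<lambda>t. bump e k (char_map G e' t))"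
    by (rule continuous_on_eq) (use k in \<open>auto simp: bump_def char_map_def\<close>)
qed

lemma continuous_tent: "continuous_map (realization G) euclideanreal (tent u)"
proof (rule continuous_map_realization)
  fix e
  have "continuous_on {0..1} (\<lambda>t::real. (1 - t) * (if tail G e = u then 1 else 0) + t * (if head G e = u then 1 else 0))"
    by (intro continuous_intros)
  thus "continuous_on {0..1} (\<lambda>t. tent u (char_map G e t))"
    by (rule continuous_on_eq) (auto simp: tent_def char_map_def)
qed

lemma Hausdorff_realization: "Hausdorff_space (realization G)"
proof (rule Hausdorff_space_real_functions)
  have *: "\<exists>f. continuous_map (realization G) euclideanreal f \<and> f (Inr (e, t)) \<noteq> f y"
    if t: "0 < t" "t < 1" and y: "y \<noteq> Inr (e, t)" for e t y
  proof (cases "bump e 1 y = bump e 1 (Inr (e, t))")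
    case True
    have p: "t * (1 - t) > 0" using t by simp
    then obtain s where s: "y = Inr (e, s)"
      using True by (auto simp: bump_def split: sum.splits prod.splits if_splits)
    hence "s * (1 - s) = t * (1 - t)" "s \<noteq> t" using True y by (auto simp: bump_def)
    \<comment> \<open>The values with exponent 1 agree and are positive, so the extra factor
      distinguishes s from t.\<close>
    hence "s * (s * (1 - s)) \<noteq> t * (t * (1 - t))" using t by simp
    hence "bump e 2 (Inr (e, t)) \<noteq> bump e 2 y" by (simp add: s bump_def power2_eq_square mult.assoc)
    thus ?thesis using continuous_bump[of 2 e] by auto
  next
    case False
    thus ?thesis using continuous_bump[of 1 e] by (metis zero_less_one)
  qed
  fix x y assume xy: "x \<in> topspace (realization G)" "y \<in> topspace (realization G)" "x \<noteq> y"
  hence pts: "x \<in> realization_points G" "y \<in> realization_points G"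
    by (auto simp: topspace_realization[OF wf_digraph_axioms])
  show "\<exists>f. continuous_map (realization G) euclideanreal f \<and> f x \<noteq> f y"
  proof (cases x)
    case (Inr p)
    thus ?thesis using *[of "snd p" y "fst p"] pts(1) xy(3) by (auto simp: realization_points_def)
  next
    case x: (Inl u)
    show ?thesis
    proof (cases y)
      case (Inr p)
      hence "\<exists>f. continuous_map (realization G) euclideanreal f \<and> f (Inr (fst p, snd p)) \<noteq> f x"
        using pts(2) x by (intro *) (auto simp: realization_points_def)
      then obtain f where "continuous_map (realization G) euclideanreal f" "f y \<noteq> f x" using Inr by auto
      thus ?thesis by (intro exI[of _ f]) simp
    next
      case (Inl v)
      hence "tent u x \<noteq> tent u y" using x xy(3) by (simp add: tent_def)
      thus ?thesis using continuous_tent by blast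
    qed
  qed
qed

lemma pathin_char_map:
  assumes "e \<in> arcs G"
  shows "pathin (realization G) (char_map G e)"
  unfolding pathin_def continuous_map_def
proof (intro conjI allI impI)
  show "char_map G e \<in> topspace (top_of_set {0..1}) \<rightarrow> topspace (realization G)"
    unfolding topspace_realization[OF wf_digraph_axioms] using assms
    by (auto simp: char_map_def realization_points_def)
  fix U assume "openin (realization G) U"
  thus "openin (top_of_set {0..1}) {x \<in> topspace (top_of_set {0..1}). char_map G e x \<in> U}"
    using assms by (simp add: openin_realization)
qed

lemma tgraph_realization:
  assumes f: "finite (arcs G)" and conn: "Digraph_Component.connected G" and two: "card (verts G) \<ge> 2"
  shows "tgraph (realization G) (arcs G) (char_map G)"
proof -
  let ?X = "realization G"
  note tops = topspace_realization[OF wf_digraph_axioms]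
  have reach: "(u, v) \<in> rtrancl_on (verts G) (parcs (mk_symmetric G))" if "u \<in> verts G" "v \<in> verts G" for u v
    using conn that by (auto simp: Digraph_Component.connected_def strongly_connected_def reachable_def)
  \<comment> \<open>Connectedness with at least two vertices rules out isolated vertices, so the
    closed edges cover the space.\<close>
  have vert: "\<exists>e\<in>arcs G. x = tail G e \<or> x = head G e" if x: "x \<in> verts G" for x
  proof -
    have "card {x} < card (verts G)" using two by simp
    hence "\<not> verts G \<subseteq> {x}" by (meson card_mono finite.emptyI finite_insert not_less)
    then obtain z where z: "z \<in> verts G" "z \<noteq> x" by blast
    from reach[OF z(1) x] show ?thesis
    proof (cases rule: rtrancl_on.cases)
      case rtrancl_on_refl
      thus ?thesis using z by simp
    next
      case (rtrancl_on_into_rtrancl_on y)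
      thus ?thesis by (auto simp: parcs_mk_symmetric)
    qed
  qed
  have cm: "char_map G e 0 = Inl (tail G e)" "char_map G e 1 = Inl (head G e)" for e by (auto simp: char_map_def)
  have ends: "path_component_of ?X (char_map G e s) (char_map G e t)"
    if e: "e \<in> arcs G" and st: "s \<in> {0..1}" "t \<in> {0..1}" for e s t
  proof -
    have "path_connectedin ?X (char_map G e ` {0..1})"
      using path_connectedin_path_image[OF pathin_char_map[OF e]] .
    from path_component_of_maximal[OF this, of "char_map G e s"] st show ?thesis by blast
  qed
  have pv: "path_component_of ?X (Inl u) (Inl v)" if "u \<in> verts G" "v \<in> verts G" for u v
    using reach[OF that]
  proof (induction rule: rtrancl_on.induct)
    case rtrancl_on_refl
    thus ?case by (simp add: path_component_of_refl tops realization_points_def)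
  next
    case (rtrancl_on_into_rtrancl_on a w z)
    then obtain e where e: "e \<in> arcs G" "(w, z) = (tail G e, head G e) \<or> (w, z) = (head G e, tail G e)"
      by (auto simp: parcs_mk_symmetric)
    have "path_component_of ?X (Inl w) (Inl z)"
      using ends[OF e(1), of 0 1] ends[OF e(1), of 1 0] e(2) by (auto simp: cm)
    thus ?case using rtrancl_on_into_rtrancl_on.IH path_component_of_trans by fast
  qed
  have cov: "topspace ?X = (\<Union>e\<in>arcs G. char_map G e ` {0..1})"
  proof (intro equalityI subsetI)
    fix x assume "x \<in> topspace ?X"
    then consider v where "v \<in> verts G" "x = Inl v" | e t where "e \<in> arcs G" "0 < t" "t < 1" "x = Inr (e, t)"
      by (auto simp: tops realization_points_def)
    thus "x \<in> (\<Union>e\<in>arcs G. char_map G e ` {0..1})"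
    proof cases
      case 1
      then obtain e where e: "e \<in> arcs G" "x = char_map G e 0 \<or> x = char_map G e 1" using vert[of v] cm by force
      hence "x \<in> char_map G e ` {0..1}" by auto
      thus ?thesis using e(1) by blast
    next
      case 2
      hence "x = char_map G e t" "t \<in> {0..1}" by (auto simp: char_map_def)
      thus ?thesis using 2(1) by blast
    qed
  next
    fix x assume "x \<in> (\<Union>e\<in>arcs G. char_map G e ` {0..1})"
    thus "x \<in> topspace ?X" by (auto simp: tops char_map_def realization_points_def)
  qed
  have to_vert: "\<exists>v\<in>verts G. path_component_of ?X x (Inl v)" if x: "x \<in> topspace ?X" for x
  proof -
    obtain e t where e: "e \<in> arcs G" "t \<in> {0..1}" "x = char_map G e t" using x unfolding cov by blast
    hence "path_component_of ?X x (Inl (tail G e))" using ends[OF e(1,2), of 0] by (simp add: cm)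
    thus ?thesis using e(1) tail_in_verts by blast
  qed
  show ?thesis
  proof
    show "Hausdorff_space ?X" by (rule Hausdorff_realization)
    show "finite (arcs G)" by (rule f)
    show "arcs G \<noteq> {}" using vert two by fastforce
    show "pathin ?X (char_map G e)" if "e \<in> arcs G" for e by (rule pathin_char_map[OF that])
    show "topspace ?X = (\<Union>e\<in>arcs G. char_map G e ` {0..1})" by (rule cov)
    show "e = e' \<and> s = t" if "e \<in> arcs G" "e' \<in> arcs G" "0 < t" "t < 1" "s \<in> {0..1}"
      "char_map G e t = char_map G e' s" for e e' t s
      using that by (auto simp: char_map_def split: if_splits)
    show "path_connected_space ?X"
      unfolding path_connected_space_iff_path_component
    proof (intro ballI)
      fix x y assume "x \<in> topspace ?X" "y \<in> topspace ?X"
      then obtain u v where "u \<in> verts G" "path_component_of ?X x (Inl u)" "v \<in> verts G" "path_component_of ?X y (Inl v)"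
        using to_vert by blast
      thus "path_component_of ?X x y"
        using path_component_of_trans[OF _ path_component_of_trans[OF pv[of u v]]] path_component_of_sym[of ?X y] by blast
    qed
  qed
qed

end

theorem theorem1:
  fixes G :: "('a, 'b) pre_digraph" and P :: "('c, 'd) pre_digraph" and n :: nat
    and S :: "(nat \<Rightarrow> 'a + 'b \<times> real) set"
  assumes "fin_digraph G" and "Digraph_Component.connected G" and "card (verts G) \<ge> 2"
    and "graph P" and "Digraph_Component.connected P" and "card (verts P) \<ge> 2"
    and "n \<ge> 5"
    and "S \<in> topspace (uconf_space n (realization G))"
  shows "\<not> graph_braid_group n G S \<cong> raag P"
proof -
  interpret fin_digraph G by fact
  let ?X = "realization G"
  let ?T = "\<lambda>q :: 'b set \<times> ('b \<Rightarrow> real \<Rightarrow> 'a + 'b \<times> real). tgraph ?X (fst q) (snd q)"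
  have "tgraph ?X (arcs G) (char_map G)" by (rule tgraph_realization) (use assms in auto)
  hence "?T (arcs G, char_map G)" by simp
  \<comment> \<open>The edge paths are varied along with the edge set, while the space is fixed, so
    that merging edges stays within the family over which the number of edges is minimised.\<close>
  from ex_has_least_nat[of ?T, OF this, of "\<lambda>q. card (fst q)"]
  obtain p where p: "?T p" "\<And>q. ?T q \<Longrightarrow> card (fst p) \<le> card (fst q)" by blast
  have "\<not> fundamental_group (uconf_space n ?X) S \<cong> raag P"
  proof (rule tgraph.minimal_not_raag[OF p(1)])
    fix Ed' and c' :: "'b \<Rightarrow> real \<Rightarrow> 'a + 'b \<times> real"
    assume "tgraph ?X Ed' c'"
    thus "card (fst p) \<le> card Ed'" using p(2)[of "(Ed', c')"] by simp
  qed (use assms in auto)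
  thus ?thesis by (simp add: graph_braid_group_def)
qed

end
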